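(* Suppose that there exist constants $R_\infty\ge1$, $\upsilon\in(0,1)$ and a function $\varPhi$ such that the conditions $\mathrm{VRD}^{R_\infty}(\upsilon)$, $\mathrm{ULS}^{R_\infty}(\varPhi)$, $\mathrm{Tail}^{R_\infty}(\varPhi,\upsilon,\le)$, $\mathrm{NDL}^{R_\infty}(\varPhi,\upsilon)$ and $\mathrm{NDU}^{R_\infty}(\varPhi,\upsilon)$ (defined in the context) hold, and let $\varphi(r)=\int_1^rs^{-1}\varPhi(s)\,ds$ for $r>1$. Suppose also that there are constants $C_U\ge1$ and $\beta_2<d_1$, where $d_1$ is the constant in $\mathrm{VRD}^{R_\infty}(\upsilon)$, such that $\varPhi(r)/\varPhi(s)\le C_U(r/s)^{\beta_2}$ for all $r\ge s>R_\infty$. Let $f_\infty:(0,\infty)\to(0,1]$ be the deterministic function such that for every $x\in M$ and $\kappa>0$, $$\limsup_{r\to\infty}\frac{\mathcal U\big(B(x,r),\,\kappa\varphi(r)\log\log\varphi(r)\big)}{\kappa\varphi(r)\log\log\varphi(r)}=f_\infty(\kappa),\qquad\mathbb P^z\text{-a.s., for all }z\in M$$ (such a function exists under these assumptions). Then the limit $\kappa_1:=\lim_{\kappa\to\infty}\kappa f_\infty(\kappa)$ exists in $(0,\infty)$, and for every $x\in M$, $$\limsup_{r\to\infty}\frac{\mathcal U\big(B(x,r),\infty\big)}{\varphi(r)\log\log\varphi(r)}=\kappa_1,\qquad\mathbb P^z\text{-a.s., for all }z\in M.$$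
   Context: $(M,d)$ is a locally compact separable metric space with a base point $o\in M$, $\mu$ is a positive Radon measure on $M$ with full support, $B(x,r)$ is the open ball, $V(x,r)=\mu(B(x,r))$, and $\mathsf d(x)=d(x,o)+1$. $\partial$ is a cemetery point, $M_\partial=M\cup\{\partial\}$; functions on $M$ are extended by $0$ at $\partial$. $X=(\Omega,\mathcal F_t,X_t,t\ge0;\mathbb P^x,x\in M_\partial)$ is a Borel standard Markov process on $M_\partial$ with a Lévy system of the form $(J(x,\cdot),ds)$: $(J(x,dy):x\in M)$ are Borel measures on $M_\partial$ such that for all $z\in M$, $t>0$ and all non-negative Borel $F$ on $M\times M_\partial$ vanishing on the diagonal, $\mathbb E^z[\sum_{s\le t}F(X_{s-},X_s)]=\mathbb E^z[\int_0^t\int_{M_\partial}F(X_s,y)J(X_s,dy)ds]$. For a Borel set $D\subset M$ and $t\in[0,\infty]$, $\tau_D=\inf\{t>0:X_t\in M_\partial\setminus D\}$, $\mathcal U(D,t)=\int_0^t\mathbf 1_D(X_s)ds$, and $X^D$ is the part process of $X$ killed upon leaving $D$. The heat kernel of $X^D$ is a Borel function $p^D:(0,\infty)\times D\times D\to[0,\infty]$ with $\mathbb E^x[f(X^D_t)]=\int_Dp^D(t,x,y)f(y)\mu(dy)$ for all $f\in L^\infty(D;\mu)$, $t>0$, $x\in D$, and $p^D(t+s,x,y)=\int_Dp^D(t,x,z)p^D(s,z,y)\mu(dz)$ for all $t,s>0$, $x,y\in D$; $p=p^M$. $a\wedge b=\min\{a,b\}$, $a\vee b=\max\{a,b\}$.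 $\varPhi:(0,\infty)\to(0,\infty)$ is increasing and continuous, with inverse $\varPhi^{-1}$. Conditions: $\mathrm{VRD}^{R_\infty}(\upsilon)$: there are $d_1,d_2,c_\mu,C_\mu>0$ with $c_\mu(r/s)^{d_1}\le V(x,r)/V(x,s)\le C_\mu(r/s)^{d_2}$ for all $x\in M$ and $r\ge s>R_\infty\mathsf d(x)^\upsilon$. $\mathrm{ULS}^{R_\infty}(\varPhi)$: there are $\ell>1$, $C_2>0$ with $2\varPhi(s/\ell)\le\varPhi(s)\le C_2\varPhi(s/2)$ for all $s>R_\infty$. $\mathrm{Tail}^{R_\infty}(\varPhi,\upsilon,\le)$: there is $C_3>0$ with $J(x,M_\partial\setminus B(x,r))\le C_3/\varPhi(r)$ for all $x\in M$, $r>R_\infty\mathsf d(x)^\upsilon$. $\mathrm{NDL}^{R_\infty}(\varPhi,\upsilon)$: there are $\eta\in(0,1)$, $c_l>0$ such that for all $x\in M$ and $r>R_\infty\mathsf d(x)^\upsilon$, the heat kernel $p^{B(x,r)}$ of $X^{B(x,r)}$ exists and $p^{B(x,r)}(\varPhi(\eta r),y,z)\ge c_l/V(x,r)$ for all $y,z\in B(x,\eta^2r)$. $\mathrm{NDU}^{R_\infty}(\varPhi,\upsilon)$: the heat kernel $p(t,x,y)$ of $X$ exists and there is $c_u>0$ with $p(t,x,y)\le c_u/\big(V(x,\varPhi^{-1}(t))\wedge V(y,\varPhi^{-1}(t))\big)$ for all $x,y\in M$ and $t\ge\varPhi\big(R_\infty(\mathsf d(x)\vee\mathsf d(y))^\upsilon\big)$.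 *)

theory Defs
  imports "HOL-Probability.Probability"
begin

section \<open>State space\<close>

text \<open>
  The metric space \<open>M\<close> is the type \<open>'a\<close>; for a metric space, separability is the class
  second_countable_topology. The space \<open>M \<union> {cemetery}\<close> is \<^typ>\<open>'a option\<close> with \<^term>\<open>None\<close>
  as cemetery, carrying the one-point compactification topology used for standard processes
  (the cemetery is isolated if \<open>M\<close> is compact).
\<close>

abbreviation cem_top :: "'a::topological_space option topology" where
  "cem_top \<equiv> Alexandroff_compactification euclidean"

definition cem_borel :: "'a::topological_space option measure" where
  "cem_borel = sigma UNIV {U. openin cem_top U}"

definition radon_measure :: "'a::metric_space measure \<Rightarrow> bool" where
  "radon_measure \<mu> \<longleftrightarrow> sets \<mu> = sets borel \<and>
     (\<forall>K. compact K \<longrightarrow> emeasure \<mu> K < \<infinity>) \<and>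
     (\<forall>A\<in>sets borel. emeasure \<mu> A = (SUP K\<in>{K. compact K \<and> K \<subseteq> A}. emeasure \<mu> K))"

definition full_support :: "'a::metric_space measure \<Rightarrow> bool" where
  "full_support \<mu> \<longleftrightarrow> (\<forall>U. open U \<and> U \<noteq> {} \<longrightarrow> 0 < emeasure \<mu> U)"

definition dd :: "'a::metric_space \<Rightarrow> 'a \<Rightarrow> real" where
  "dd x0 x = dist x x0 + 1"

text \<open>Real-valued, hence \<open>0\<close> for a ball of infinite measure.\<close>

definition vol :: "'a::metric_space measure \<Rightarrow> 'a \<Rightarrow> real \<Rightarrow> real" where
  "vol \<mu> x r = measure \<mu> (ball x r)"

section \<open>Borel standard processes\<close>

text \<open>Time runs through \<open>[0,\<infinity>]\<close>, with \<open>X\<^sub>\<infinity>\<close> the cemetery.\<close>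

definition lifetime :: "(ennreal \<Rightarrow> 'w \<Rightarrow> 'a option) \<Rightarrow> 'w \<Rightarrow> ennreal" where
  "lifetime X \<omega> = Inf {t. X t \<omega> = None}"

text \<open>
  Strong Markov property and quasi-left-continuity are required for the given right-continuous
  filtration \<open>F\<close>; \<open>F \<infinity>\<close> is the ambient \<open>\<sigma>\<close>-algebra on \<open>\<Omega>\<close>. The process being Borel is
  the measurability of the transition function with respect to the Borel (rather than the
  universally measurable) sets. The simple Markov property is the case of constant \<open>T\<close>.
\<close>

locale borel_standard_process = filtration \<Omega> F
  for \<Omega> :: "'w set" and F :: "ennreal \<Rightarrow> 'w measure" +
  fixes X :: "ennreal \<Rightarrow> 'w \<Rightarrow> 'a::{metric_space, second_countable_topology} option"
    and P :: "'a option \<Rightarrow> 'w measure"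
  assumes prob_space_P: "prob_space (P z)"
    and sets_P: "sets (P z) = sets (F \<infinity>)"
    and right_continuous_F: "t < \<infinity> \<Longrightarrow> sets (F t) = (\<Inter>u\<in>{t<..}. sets (F u))"
    and adapted: "X t \<in> measurable (F t) cem_borel"
    and borel_transition:
      "B \<in> sets cem_borel \<Longrightarrow>
        (\<lambda>z. emeasure (P z) {\<omega>\<in>\<Omega>. X t \<omega> \<in> B}) \<in> borel_measurable cem_borel"
    and normal: "AE \<omega> in P z. X 0 \<omega> = z"
    and at_infinity: "\<omega> \<in> \<Omega> \<Longrightarrow> X \<infinity> \<omega> = None"
    and absorbing: "\<omega> \<in> \<Omega> \<Longrightarrow> s \<le> t \<Longrightarrow> X s \<omega> = None \<Longrightarrow> X t \<omega> = None"
    and right_continuous_paths: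
      "\<omega> \<in> \<Omega> \<Longrightarrow> limitin cem_top (\<lambda>s. X s \<omega>) (X t \<omega>) (at_right t)"
    and left_limits:
      "AE \<omega> in P z. \<forall>t. 0 < t \<and> t < lifetime X \<omega> \<longrightarrow>
        (\<exists>y. limitin cem_top (\<lambda>s. X s \<omega>) (Some y) (at_left t))"
    and strong_markov:
      "stopping_time F T \<Longrightarrow> B \<in> sets cem_borel \<Longrightarrow>
        AE \<omega> in P z.
          real_cond_exp (P z) (pre_sigma T) (indicator {\<omega>\<in>\<Omega>. X (T \<omega> + s) \<omega> \<in> B}) \<omega>
            = measure (P (X (T \<omega>) \<omega>)) {\<omega>'\<in>\<Omega>. X s \<omega>' \<in> B}"
    and quasi_left_continuous:
      "(\<And>n. stopping_time F (S n)) \<Longrightarrow> (\<And>n \<omega>. \<omega> \<in> \<Omega> \<Longrightarrow> S n \<omega> \<le> S (Suc n) \<omega>) \<Longrightarrow>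
        AE \<omega> in P z. (SUP n. S n \<omega>) < lifetime X \<omega> \<longrightarrow>
          limitin cem_top (\<lambda>n. X (S n \<omega>) \<omega>) (X (SUP n. S n \<omega>) \<omega>) sequentially"

text \<open>
  The sum over jumps is indexed by pairs \<open>(s, y)\<close> with \<open>X\<^sub>s\<^sub>- = y \<in> M\<close>; there is at most one such
  \<open>y\<close> for each \<open>s\<close>. Times at which the left limit is the cemetery or does not exist (possible only
  from the lifetime on) do not contribute, as \<open>G\<close> lives on \<open>M \<times> (M \<union> {cemetery})\<close>.
  Measurability of the inner integral is part of \<open>J\<close> being the kernel of a Levy system.
\<close>

definition levy_system ::
  "(ennreal \<Rightarrow> 'w \<Rightarrow> 'a::{metric_space, second_countable_topology} option) \<Rightarrow>
   ('a option \<Rightarrow> 'w measure) \<Rightarrow> ('a \<Rightarrow> 'a option measure) \<Rightarrow> bool" where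
  "levy_system X P J \<longleftrightarrow>
     (\<forall>x. sets (J x) = sets cem_borel) \<and>
     (\<forall>G :: 'a \<Rightarrow> 'a option \<Rightarrow> ennreal.
        (\<lambda>(x, y). G x y) \<in> borel_measurable (borel \<Otimes>\<^sub>M cem_borel) \<and> (\<forall>x. G x (Some x) = 0) \<longrightarrow>
        (\<lambda>x. \<integral>\<^sup>+ y. G x y \<partial>J x) \<in> borel_measurable borel \<and>
        (\<forall>z. \<forall>t>0::real.
          (\<integral>\<^sup>+ \<omega>. (\<Sum>\<^sub>\<infinity>(s, y) \<in> {(s, y). 0 < s \<and> s \<le> ennreal t \<and>
                       limitin cem_top (\<lambda>u. X u \<omega>) (Some y) (at_left s)}. G y (X s \<omega>)) \<partial>P (Some z))
          = (\<integral>\<^sup>+ \<omega>. (\<integral>\<^sup>+ s \<in> {0..t}. case_option 0 (\<lambda>x. \<integral>\<^sup>+ y. G x y \<partial>J x) (X (ennreal s) \<omega>) \<partial>lborel)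
               \<partial>P (Some z))))"

definition exit_time ::
  "(ennreal \<Rightarrow> 'w \<Rightarrow> 'a option) \<Rightarrow> 'a set \<Rightarrow> 'w \<Rightarrow> ennreal" where
  "exit_time X D \<omega> = Inf {t. 0 < t \<and> X t \<omega> \<notin> Some ` D}"

definition part_process ::
  "(ennreal \<Rightarrow> 'w \<Rightarrow> 'a option) \<Rightarrow> 'a set \<Rightarrow> ennreal \<Rightarrow> 'w \<Rightarrow> 'a option" where
  "part_process X D t \<omega> = (if t < exit_time X D \<omega> then X t \<omega> else None)"

definition occupation_time ::
  "(ennreal \<Rightarrow> 'w \<Rightarrow> 'a option) \<Rightarrow> 'a set \<Rightarrow> ennreal \<Rightarrow> 'w \<Rightarrow> ennreal" where
  "occupation_time X D t \<omega> =
     (\<integral>\<^sup>+ s \<in> {s. 0 \<le> s \<and> ennreal s \<le> t}. indicator (Some ` D) (X (ennreal s) \<omega>) \<partial>lborel)"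

text \<open>
  Since \<open>p\<close> may take the value \<open>\<infinity>\<close>, the integral identity is stated for the nonnegative
  \<open>f\<close> in \<open>L\<^sup>\<infinity>(D; \<mu>)\<close>, where it is an identity of Lebesgue integrals in \<open>[0,\<infinity>)\<close>; the identity
  for signed \<open>f\<close> is its linear extension.
\<close>

definition is_heat_kernel ::
  "(ennreal \<Rightarrow> 'w \<Rightarrow> 'a::{metric_space, second_countable_topology} option) \<Rightarrow>
   ('a option \<Rightarrow> 'w measure) \<Rightarrow> 'a measure \<Rightarrow> 'a set \<Rightarrow>
   (real \<Rightarrow> 'a \<Rightarrow> 'a \<Rightarrow> ennreal) \<Rightarrow> bool" where
  "is_heat_kernel X P \<mu> D p \<longleftrightarrow>
     (\<lambda>(t, x, y). p t x y) \<in> borel_measurable (restrict_space borel ({0<..} \<times> D \<times> D)) \<and>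
     (\<forall>t>0. \<forall>x\<in>D. \<forall>f :: 'a \<Rightarrow> ennreal.
        f \<in> borel_measurable borel \<and> (\<exists>C<\<infinity>. AE y in \<mu>. y \<in> D \<longrightarrow> f y \<le> C) \<longrightarrow>
        (\<integral>\<^sup>+ \<omega>. case_option 0 f (part_process X D (ennreal t) \<omega>) \<partial>P (Some x))
          = (\<integral>\<^sup>+ y \<in> D. p t x y * f y \<partial>\<mu>)) \<and>
     (\<forall>t>0. \<forall>s>0. \<forall>x\<in>D. \<forall>y\<in>D. p (t + s) x y = (\<integral>\<^sup>+ z \<in> D. p t x z * p s z y \<partial>\<mu>))"

section \<open>The conditions\<close>

text \<open>
  A ball of infinite measure would make the volume ratio \<open>0\<close> (see \<^const>\<open>vol\<close>) and violate the
  lower bound, so \<open>VRD\<close> includes finiteness of the volumes.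
\<close>

definition VRD :: "'a::metric_space measure \<Rightarrow> 'a \<Rightarrow> real \<Rightarrow> real \<Rightarrow> real \<Rightarrow> bool" where
  "VRD \<mu> x0 R \<upsilon> d1 \<longleftrightarrow> d1 > 0 \<and>
     (\<exists>d2>0. \<exists>c>0. \<exists>C>0. \<forall>x r s. r \<ge> s \<and> s > R * dd x0 x powr \<upsilon> \<longrightarrow>
        c * (r / s) powr d1 \<le> vol \<mu> x r / vol \<mu> x s \<and>
        vol \<mu> x r / vol \<mu> x s \<le> C * (r / s) powr d2)"

definition ULS :: "real \<Rightarrow> (real \<Rightarrow> real) \<Rightarrow> bool" where
  "ULS R \<Phi> \<longleftrightarrow>
     (\<exists>l>1. \<exists>C>0. \<forall>s>R. 2 * \<Phi> (s / l) \<le> \<Phi> s \<and> \<Phi> s \<le> C * \<Phi> (s / 2))"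

definition Tail_le ::
  "('a::metric_space \<Rightarrow> 'a option measure) \<Rightarrow> 'a \<Rightarrow> real \<Rightarrow> (real \<Rightarrow> real) \<Rightarrow> real \<Rightarrow> bool" where
  "Tail_le J x0 R \<Phi> \<upsilon> \<longleftrightarrow>
     (\<exists>C>0. \<forall>x r. r > R * dd x0 x powr \<upsilon> \<longrightarrow>
        emeasure (J x) (UNIV - Some ` ball x r) \<le> ennreal (C / \<Phi> r))"

definition NDL ::
  "(ennreal \<Rightarrow> 'w \<Rightarrow> 'a::{metric_space, second_countable_topology} option) \<Rightarrow>
   ('a option \<Rightarrow> 'w measure) \<Rightarrow> 'a measure \<Rightarrow> 'a \<Rightarrow> real \<Rightarrow> (real \<Rightarrow> real) \<Rightarrow> real \<Rightarrow> bool" where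
  "NDL X P \<mu> x0 R \<Phi> \<upsilon> \<longleftrightarrow>
     (\<exists>\<eta>\<in>{0<..<1}. \<exists>c>0. \<forall>x r. r > R * dd x0 x powr \<upsilon> \<longrightarrow>
        (\<exists>p. is_heat_kernel X P \<mu> (ball x r) p \<and>
           (\<forall>y\<in>ball x (\<eta>\<^sup>2 * r). \<forall>z\<in>ball x (\<eta>\<^sup>2 * r).
              p (\<Phi> (\<eta> * r)) y z \<ge> ennreal (c / vol \<mu> x r))))"

text \<open>
  \<open>\<Phi>\<close> is not required to be onto \<open>(0,\<infinity>)\<close>; for the times \<open>t\<close> occurring here its inverse is defined
  because \<open>ULS\<close> makes \<open>\<Phi>\<close> unbounded.
\<close>

definition NDU ::
  "(ennreal \<Rightarrow> 'w \<Rightarrow> 'a::{metric_space, second_countable_topology} option) \<Rightarrow>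
   ('a option \<Rightarrow> 'w measure) \<Rightarrow> 'a measure \<Rightarrow> 'a \<Rightarrow> real \<Rightarrow> (real \<Rightarrow> real) \<Rightarrow> real \<Rightarrow> bool" where
  "NDU X P \<mu> x0 R \<Phi> \<upsilon> \<longleftrightarrow>
     (\<exists>p. is_heat_kernel X P \<mu> UNIV p \<and>
       (\<exists>c>0. \<forall>x y t. t \<ge> \<Phi> (R * (max (dd x0 x) (dd x0 y)) powr \<upsilon>) \<longrightarrow>
          p t x y \<le> ennreal (c / min (vol \<mu> x (inv_into {0<..} \<Phi> t))
                                      (vol \<mu> y (inv_into {0<..} \<Phi> t)))))"

definition phi :: "(real \<Rightarrow> real) \<Rightarrow> real \<Rightarrow> real" where
  "phi \<Phi> r = integral {1..r} (\<lambda>s. \<Phi> s / s)"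

end

theory Submission
  imports Defs "HOL-Real_Asymp.Real_Asymp"
begin

text \<open>
  The limit \<open>\<kappa>\<^sub>1\<close> is the supremum of \<open>\<kappa> f(\<kappa>)\<close>, which is increasing because occupation times are
  increasing in time; only the upper bound for the total occupation time \<open>U\<close> needs an argument. The key is
  a comparison, on the spatial scale \<open>r\<close> with time unit \<open>u = \<Phi>(r / \<eta>\<^sup>3)\<close>: the supremum over all starting
  points of \<open>P(U > (b + 8) u)\<close> is at most a constant times the infimum, over the starting points in a
  concentric ball \<open>D\<close>, of the probability that the occupation exceeds \<open>b u\<close> by the time of some visit to \<open>D\<close>. The
  constant is uniform in \<open>b\<close> and \<open>r\<close>: returns to \<open>D\<close> are summable because \<open>\<beta> < d\<^sub>1\<close>, and what happens away
  from \<open>D\<close> is absorbed by sampling the process on a fine time grid. Iterating over \<open>j\<close> blocks gives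
  matching geometric tails \<open>S\<^sup>j\<close> and \<open>(S / K)\<^sup>j\<close>; enlarging the level by a fixed multiple of \<open>g = \<phi> log log \<phi>\<close>
  turns the factors \<open>K\<^sup>j\<close> into a negative power of \<open>n\<close> on the scale \<open>r = q\<^sup>n\<close>. Hence, if the tails at level
  \<open>\<xi> g\<close> were not summable, sparse scales taken from a single dyadic block of indices would, with a probability
  bounded below, infinitely often produce occupation times above \<open>\<zeta> g\<close> (\<open>\<zeta> < \<xi>\<close>) already before a
  time \<open>\<kappa> g\<close>, which forces \<open>\<zeta> \<le> \<kappa> f(\<kappa>)\<close>. For \<open>\<zeta> > \<kappa>\<^sub>1\<close> this is impossible, and the Borel--Cantelli
  lemma together with \<open>q \<rightarrow> 1\<close> yields the bound. Only the Markov property at deterministic times is used.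
\<close>

section \<open>The Markov property on path space\<close>

text \<open>Occupation times on different scales are dependent, and the upper tail is a supremum
  over all starting points, whereas a lower bound has to be restarted from a known region. The
  comparison constant \<open>K\<close> is paid once per block. With blocks of length
  \<open>b\<close> the logarithm of this cost at level \<open>\<zeta> * g\<close> is of order
  \<open>\<zeta> * ln K / b\<close> times log log phi. The tail of one block decays exponentially in
  \<open>b\<close>, so raising the level from \<open>\<zeta> * g\<close> to \<open>\<xi> * g\<close>
  gains an exponent, again times log log phi, that does not vanish as \<open>b\<close> grows.
  Because the constant is free of \<open>b\<close>, large blocks let the gain win for every
  \<open>\<zeta> < \<xi>\<close>, however close. The surviving power of \<open>n\<close> is what
  permits thinning the scales: in the dyadic block of order \<open>k\<close>, keeping one index out
  of \<open>k + 1\<close> costs a factor of order \<open>k\<close>, negligible against a power of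
  \<open>2 ^ k\<close>. After thinning, the time unit of a scale exceeds the whole time budget of
  the preceding one, so trials on successive scales can be run one after the other.\<close>

lemma space_cem_borel [simp]: "space cem_borel = UNIV"
  by (simp add: cem_borel_def)

lemma sets_cem_borel: "sets cem_borel = sigma_sets UNIV {U. openin cem_top U}"
  by (simp add: cem_borel_def)

lemma open_imp_Some_in_cem_borel:
  assumes "open (V :: 'a::topological_space set)"
  shows "Some ` V \<in> sets cem_borel"
  unfolding sets_cem_borel using assms by (intro sigma_sets.Basic) simp

lemma measurable_Some_cem [measurable]:
  "Some \<in> measurable (borel :: 'a::t2_space measure) cem_borel"
  unfolding cem_borel_def
proof (rule measurable_measure_of)
  fix U :: "'a option set" assume "U \<in> {U. openin cem_top U}"
  then consider V where "open V" "U = Some ` V" | C where "closed C" "U = insert None (Some ` (UNIV - C))"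
    by (auto simp: openin_Alexandroff_compactification)
  then have "open (Some -` U)"
  proof cases
    case (2 C)
    then have "Some -` U = - C" by auto
    with 2 show ?thesis by (simp add: open_Compl)
  qed (simp add: inj_vimage_image_eq)
  then show "Some -` U \<inter> space borel \<in> sets borel" by simp
qed auto

text \<open>For fixed \<open>A\<close> the hypothesis \<open>eq\<close> says that two measures on
  \<open>N\<close> coincide: the image under \<open>Y\<close> of the restriction to
  \<open>A\<close>, and the mixture of the kernels over \<open>A\<close>. Hence they integrate every
  \<open>f\<close> equally, and induction over measurable functions replaces the indicator of
  \<open>A\<close> by \<open>g\<close>.\<close>

lemma nn_integral_kernel_extend:
  assumes sub: "subalgebra M F"
    and Y[measurable]: "Y \<in> measurable M N"
    and Z: "Z \<in> measurable F E"
    and K[measurable]: "K \<in> measurable E (subprob_algebra N)"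
    and eq: "\<And>A B. A \<in> sets F \<Longrightarrow> B \<in> sets N \<Longrightarrow>
        emeasure M (A \<inter> (Y -` B \<inter> space M)) = (\<integral>\<^sup>+\<omega>. indicator A \<omega> * emeasure (K (Z \<omega>)) B \<partial>M)"
    and g: "g \<in> borel_measurable F" and f: "f \<in> borel_measurable N"
  shows "(\<integral>\<^sup>+\<omega>. g \<omega> * f (Y \<omega>) \<partial>M) = (\<integral>\<^sup>+\<omega>. g \<omega> * (\<integral>\<^sup>+y. f y \<partial>K (Z \<omega>)) \<partial>M)"
proof -
  note [measurable] = f
  have [measurable]: "Z \<in> measurable M E"
    using measurable_from_subalg[OF sub Z] .
  have FM: "h \<in> borel_measurable F \<Longrightarrow> h \<in> borel_measurable M" for h :: "_ \<Rightarrow> ennreal"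
    using measurable_from_subalg[OF sub] .
  have KZ: "(\<lambda>\<omega>. K (Z \<omega>)) \<in> measurable M (subprob_algebra N)" by measurable
  have KM[measurable]: "(\<lambda>\<omega>. \<integral>\<^sup>+y. f y \<partial>K (Z \<omega>)) \<in> borel_measurable M"
    by (rule measurable_compose[OF _ nn_integral_measurable_subprob_algebra]) measurable
  show ?thesis
    using g
  proof (induction rule: borel_measurable_induct)
    case (cong g g')
    have sp: "space F = space M" using sub by (simp add: subalgebra_def)
    have "(\<integral>\<^sup>+\<omega>. g' \<omega> * h \<omega> \<partial>M) = (\<integral>\<^sup>+\<omega>. g \<omega> * h \<omega> \<partial>M)" for h :: "_ \<Rightarrow> ennreal"
      using cong(3) sp by (intro nn_integral_cong) simp
    with cong(4) show ?case by simp
  next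
    case (set A)
    then have A[measurable]: "A \<in> sets M" using sub by (auto simp: subalgebra_def)
    let ?M = "density M (indicator A)"
    have ne: "space M \<noteq> {}" if "A \<noteq> {}" using that sets.sets_into_space[OF A] by auto
    show ?case
    proof (cases "A = {}")
      case True then show ?thesis by simp
    next
      case False
      have "distr ?M N Y = bind ?M (\<lambda>\<omega>. K (Z \<omega>))"
      proof (rule measure_eqI)
        show "sets (distr ?M N Y) = sets (bind ?M (\<lambda>\<omega>. K (Z \<omega>)))"
        proof -
          have "sets (bind ?M (\<lambda>\<omega>. K (Z \<omega>))) = sets N"
            using ne[OF False] sets_kernel[OF KZ] by (intro sets_bind) simp_all
          then show ?thesis by simp
        qed
        fix B assume "B \<in> sets (distr ?M N Y)"
        then have B[measurable]: "B \<in> sets N" by simp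
        have "emeasure (distr ?M N Y) B = (\<integral>\<^sup>+\<omega>. indicator A \<omega> * indicator (Y -` B \<inter> space M) \<omega> \<partial>M)"
          by (subst emeasure_distr) (simp_all add: emeasure_density)
        also have "\<dots> = emeasure M (A \<inter> (Y -` B \<inter> space M))"
        proof -
          have "(\<integral>\<^sup>+\<omega>. indicator A \<omega> * indicator (Y -` B \<inter> space M) \<omega> \<partial>M) =
              (\<integral>\<^sup>+\<omega>. indicator (A \<inter> (Y -` B \<inter> space M)) \<omega> \<partial>M)"
            by (intro nn_integral_cong) (simp split: split_indicator)
          also have "\<dots> = emeasure M (A \<inter> (Y -` B \<inter> space M))"
            by (rule nn_integral_indicator) measurable
          finally show ?thesis .
        qed
        also have "\<dots> = (\<integral>\<^sup>+\<omega>. indicator A \<omega> * emeasure (K (Z \<omega>)) B \<partial>M)"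
          using set B by (rule eq)
        also have "\<dots> = emeasure (bind ?M (\<lambda>\<omega>. K (Z \<omega>))) B"
        proof -
          have "emeasure (bind ?M (\<lambda>\<omega>. K (Z \<omega>))) B = (\<integral>\<^sup>+\<omega>. emeasure (K (Z \<omega>)) B \<partial>?M)"
            using ne[OF False] KZ by (intro emeasure_bind[OF _ _ B]) simp_all
          also have "\<dots> = (\<integral>\<^sup>+\<omega>. indicator A \<omega> * emeasure (K (Z \<omega>)) B \<partial>M)"
            by (rule nn_integral_density) measurable
          finally show ?thesis by simp
        qed
        finally show "emeasure (distr ?M N Y) B = emeasure (bind ?M (\<lambda>\<omega>. K (Z \<omega>))) B" .
      qed
      then have "(\<integral>\<^sup>+y. f y \<partial>distr ?M N Y) = (\<integral>\<^sup>+y. f y \<partial>bind ?M (\<lambda>\<omega>. K (Z \<omega>)))" by simp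
      moreover have "(\<integral>\<^sup>+y. f y \<partial>distr ?M N Y) = (\<integral>\<^sup>+\<omega>. indicator A \<omega> * f (Y \<omega>) \<partial>M)"
        by (simp add: nn_integral_distr nn_integral_density)
      moreover have "(\<integral>\<^sup>+y. f y \<partial>bind ?M (\<lambda>\<omega>. K (Z \<omega>))) = (\<integral>\<^sup>+\<omega>. indicator A \<omega> * (\<integral>\<^sup>+y. f y \<partial>K (Z \<omega>)) \<partial>M)"
      proof -
        have "(\<integral>\<^sup>+y. f y \<partial>bind ?M (\<lambda>\<omega>. K (Z \<omega>))) = (\<integral>\<^sup>+\<omega>. (\<integral>\<^sup>+y. f y \<partial>K (Z \<omega>)) \<partial>?M)"
          using KZ by (intro nn_integral_bind[OF f]) simp_all
        also have "\<dots> = (\<integral>\<^sup>+\<omega>. indicator A \<omega> * (\<integral>\<^sup>+y. f y \<partial>K (Z \<omega>)) \<partial>M)"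
          by (rule nn_integral_density) measurable
        finally show ?thesis .
      qed
      ultimately show ?thesis by simp
    qed
  next
    case (mult g c)
    then show ?case
      using FM[OF mult(2)] by (simp add: mult.assoc nn_integral_cmult)
  next
    case (add u v)
    then show ?case
      using FM[OF add(1)] FM[OF add(3)] by (simp add: distrib_right nn_integral_add)
  next
    case (seq U)
    have [measurable]: "U i \<in> borel_measurable M" for i using FM[OF seq(1)] .
    have S: "(\<integral>\<^sup>+\<omega>. (SUP i. U i) \<omega> * h \<omega> \<partial>M) = (SUP i. \<integral>\<^sup>+\<omega>. U i \<omega> * h \<omega> \<partial>M)"
      if [measurable]: "h \<in> borel_measurable M" for h :: "_ \<Rightarrow> ennreal"
    proof -
      have "(\<integral>\<^sup>+\<omega>. (SUP i. U i) \<omega> * h \<omega> \<partial>M) = (\<integral>\<^sup>+\<omega>. (SUP i. U i \<omega> * h \<omega>) \<partial>M)"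
        by (simp add: SUP_mult_right_ennreal image_comp)
      also have "\<dots> = (SUP i. \<integral>\<^sup>+\<omega>. U i \<omega> * h \<omega> \<partial>M)"
        using seq(3) by (intro nn_integral_monotone_convergence_SUP)
          (auto simp: incseq_def le_fun_def intro!: mult_right_mono)
      finally show ?thesis .
    qed
    show ?case
      using S[of "\<lambda>\<omega>. f (Y \<omega>)"] S[OF KM] seq.IH by simp
  qed
qed

context borel_standard_process
begin

abbreviation path_space :: "(ennreal \<Rightarrow> 'a option) measure" where
  "path_space \<equiv> PiM UNIV (\<lambda>_. cem_borel)"

text \<open>The process comes without shift operators on \<open>\<Omega>\<close>; the trajectory
  seen from time \<open>t\<close>, a point of the product space, takes their place.\<close>

definition path :: "ennreal \<Rightarrow> 'w \<Rightarrow> ennreal \<Rightarrow> 'a option" where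
  "path t \<omega> = (\<lambda>s. X (t + s) \<omega>)"

definition path_law :: "'a option \<Rightarrow> (ennreal \<Rightarrow> 'a option) measure" where
  "path_law z = distr (P z) path_space (path 0)"

lemma space_P [simp]: "space (P z) = \<Omega>"
  using sets_eq_imp_space_eq[OF sets_P] by (simp add: space_F)

lemma subalgebra_F: "subalgebra (P z) (F t)"
  unfolding subalgebra_def using sets_F_mono[of t "\<infinity>"] by (simp add: space_F sets_P)

lemma measurable_F_P: "f \<in> measurable (F t) N \<Longrightarrow> f \<in> measurable (P z) N"
  using measurable_from_subalg[OF subalgebra_F] .

lemma sets_F_P: "A \<in> sets (F t) \<Longrightarrow> A \<in> sets (P z)"
  using subalgebra_F[of z t] by (auto simp: subalgebra_def)

lemma measurable_F_mono: "s \<le> t \<Longrightarrow> f \<in> measurable (F s) N \<Longrightarrow> f \<in> measurable (F t) N"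
  by (rule measurable_from_subalg[of _ "F s"]) (auto simp: subalgebra_def space_F sets_F_mono)

lemma X_measurable [measurable]: "X t \<in> measurable (P z) cem_borel"
  by (rule measurable_F_P[OF adapted])

lemma path_measurable [measurable]: "path t \<in> measurable (P z) path_space"
  unfolding path_def by (intro measurable_PiM_single') auto

text \<open>Makes the strong Markov property at a constant time a statement about \<open>F t\<close>
  itself.\<close>

lemma sets_pre_sigma_const: "sets (pre_sigma (\<lambda>_. t)) = sets (F t)"
proof (intro set_eqI iffI)
  fix A assume "A \<in> sets (pre_sigma (\<lambda>_. t))"
  from sets_pre_sigmaD[OF stopping_time_const this, of t] show "A \<in> sets (F t)" by simp
next
  fix A assume A: "A \<in> sets (F t)"
  show "A \<in> sets (pre_sigma (\<lambda>_. t))"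
  proof (rule sets_pre_sigmaI[OF stopping_time_const])
    fix u show "{\<omega> \<in> A. t \<le> u} \<in> sets (F u)"
      using A sets_F_mono[of t u] by (cases "t \<le> u") auto
  qed
qed

lemma X_event: "B \<in> sets cem_borel \<Longrightarrow> {\<omega>\<in>\<Omega>. X t \<omega> \<in> B} \<in> sets (P z)"
  using measurable_sets[OF X_measurable[of t z], of B] by (simp add: vimage_def Collect_conj_eq Int_commute)

lemma one_step_set:
  assumes A: "A \<in> sets (F t)" and B: "B \<in> sets cem_borel"
  shows "emeasure (P z) (A \<inter> (X (t + s) -` B \<inter> space (P z))) =
    (\<integral>\<^sup>+\<omega>. indicator A \<omega> * emeasure (distr (P (X t \<omega>)) cem_borel (X s)) B \<partial>P z)"
proof -
  interpret prob_space "P z" by (rule prob_space_P)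
  have sub: "subalgebra (P z) (pre_sigma (\<lambda>_. t))"
    using subalgebra_F[of z t] by (simp add: subalgebra_def space_pre_sigma sets_pre_sigma_const)
  interpret S: finite_measure_subalgebra "P z" "pre_sigma (\<lambda>_. t)"
    by unfold_locales (rule sub)
  let ?E = "{\<omega>\<in>\<Omega>. X (t + s) \<omega> \<in> B}"
  let ?m = "\<lambda>\<omega>. measure (P (X t \<omega>)) {\<omega>'\<in>\<Omega>. X s \<omega>' \<in> B}"
  have A'[measurable]: "A \<in> sets (P z)" using A by (rule sets_F_P)
  have E[measurable]: "?E \<in> sets (P z)" using B by (rule X_event)
  have m[measurable]: "?m \<in> borel_measurable (P z)"
    unfolding measure_def
    using measurable_compose[OF X_measurable borel_transition[OF B, of s], of t z] by simp
  have em: "emeasure (distr (P w) cem_borel (X s)) B = ennreal (measure (P w) {\<omega>'\<in>\<Omega>. X s \<omega>' \<in> B})" for w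
  proof -
    interpret w: prob_space "P w" by (rule prob_space_P)
    have "X s -` B \<inter> space (P w) = {\<omega>'\<in>\<Omega>. X s \<omega>' \<in> B}" by auto
    with B show ?thesis by (simp add: emeasure_distr w.emeasure_eq_measure)
  qed
  have le1: "?m \<omega> \<le> 1" for \<omega>
    using prob_space.prob_le_1[OF prob_space_P] .
  have iE: "integrable (P z) (indicator ?E :: _ \<Rightarrow> real)"
    by (rule integrable_const_bound[of _ 1]) (auto split: split_indicator)
  have im: "integrable (P z) (\<lambda>\<omega>. indicator A \<omega> * ?m \<omega>)"
    by (rule integrable_const_bound[of _ 1]) (auto simp: le1 split: split_indicator)
  have "measure (P z) (A \<inter> ?E) = (\<integral>\<omega>. indicator A \<omega> * indicator ?E \<omega> \<partial>P z)"
    using A' E sets.sets_into_space[OF A'] 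
    by (simp add: indicator_inter_arith[symmetric] inf.absorb1 Int_absorb2 le_infI1)
  also have "\<dots> = (\<integral>\<omega>. indicator A \<omega> * real_cond_exp (P z) (pre_sigma (\<lambda>_. t)) (indicator ?E) \<omega> \<partial>P z)"
    using S.real_cond_exp_intA[OF iE, of A] A
    by (simp add: sets_pre_sigma_const set_lebesgue_integral_def)
  also have "\<dots> = (\<integral>\<omega>. indicator A \<omega> * ?m \<omega> \<partial>P z)"
    using strong_markov[OF stopping_time_const[of F t] B, of z s]
    by (intro integral_cong_AE) (auto intro!: borel_measurable_times)
  finally have *: "measure (P z) (A \<inter> ?E) = (\<integral>\<omega>. indicator A \<omega> * ?m \<omega> \<partial>P z)" .
  have "(\<integral>\<^sup>+\<omega>. indicator A \<omega> * emeasure (distr (P (X t \<omega>)) cem_borel (X s)) B \<partial>P z) =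
     (\<integral>\<^sup>+\<omega>. ennreal (indicator A \<omega> * ?m \<omega>) \<partial>P z)"
    by (intro nn_integral_cong) (simp add: em split: split_indicator)
  also have "\<dots> = ennreal (measure (P z) (A \<inter> ?E))"
    unfolding * by (rule nn_integral_eq_integral[OF im]) simp
  also have "\<dots> = emeasure (P z) (A \<inter> ?E)" by (simp add: emeasure_eq_measure)
  also have "A \<inter> ?E = A \<inter> (X (t + s) -` B \<inter> space (P z))" by auto
  finally show ?thesis ..
qed

lemma measurable_transition:
  "(\<lambda>w. distr (P w) cem_borel (X s)) \<in> measurable cem_borel (subprob_algebra cem_borel)"
proof (rule measurable_subprob_algebra)
  fix w :: "'a option"
  interpret prob_space "P w" by (rule prob_space_P)
  show "subprob_space (distr (P w) cem_borel (X s))"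
    by (intro prob_space_imp_subprob_space prob_space_distr X_measurable)
next
  fix B :: "'a option set" assume B: "B \<in> sets cem_borel"
  have "emeasure (distr (P w) cem_borel (X s)) B = emeasure (P w) {\<omega>\<in>\<Omega>. X s \<omega> \<in> B}" for w
    using B by (simp add: emeasure_distr vimage_def Collect_conj_eq Int_commute)
  with borel_transition[OF B, of s]
  show "(\<lambda>w. emeasure (distr (P w) cem_borel (X s)) B) \<in> borel_measurable cem_borel" by simp
qed simp

lemma measurable_expectation:
  assumes f: "f \<in> borel_measurable cem_borel"
  shows "(\<lambda>w. \<integral>\<^sup>+\<omega>. f (X s \<omega>) \<partial>P w) \<in> borel_measurable cem_borel"
proof -
  have "(\<lambda>w. \<integral>\<^sup>+y. f y \<partial>distr (P w) cem_borel (X s)) \<in> borel_measurable cem_borel"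
    by (rule measurable_compose[OF measurable_transition nn_integral_measurable_subprob_algebra[OF f]])
  then show ?thesis using f by (simp add: nn_integral_distr)
qed

lemma one_step:
  assumes g: "g \<in> borel_measurable (F t)" and f: "f \<in> borel_measurable cem_borel"
  shows "(\<integral>\<^sup>+\<omega>. g \<omega> * f (X (t + s) \<omega>) \<partial>P z) =
    (\<integral>\<^sup>+\<omega>. g \<omega> * (\<integral>\<^sup>+\<omega>'. f (X s \<omega>') \<partial>P (X t \<omega>)) \<partial>P z)"
proof -
  have "(\<integral>\<^sup>+y. f y \<partial>distr (P w) cem_borel (X s)) = (\<integral>\<^sup>+\<omega>'. f (X s \<omega>') \<partial>P w)" for w
    using f by (intro nn_integral_distr[OF X_measurable]) simp
  with nn_integral_kernel_extend[OF subalgebra_F X_measurable adapted measurable_transition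
      one_step_set g f, of z s]
  show ?thesis by (simp only:)
qed

text \<open>Cylinder events are coded by time increments instead of absolute times, so that removing
  the head of the list is one application of the Markov property; \<open>cylinder_kernel\<close> is
  the corresponding iterated transition.\<close>

primrec cylinder :: "ennreal \<Rightarrow> (ennreal \<times> 'a option set) list \<Rightarrow> 'w \<Rightarrow> ennreal" where
  "cylinder t [] \<omega> = 1"
| "cylinder t (p # r) \<omega> = indicator (snd p) (X (t + fst p) \<omega>) * cylinder (t + fst p) r \<omega>"

primrec cylinder_kernel :: "(ennreal \<times> 'a option set) list \<Rightarrow> 'a option \<Rightarrow> ennreal" where
  "cylinder_kernel [] w = 1"
| "cylinder_kernel (p # r) w =
     (\<integral>\<^sup>+\<omega>. indicator (snd p) (X (fst p) \<omega>) * cylinder_kernel r (X (fst p) \<omega>) \<partial>P w)"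

lemma measurable_cylinder_kernel:
  "\<forall>p\<in>set r. snd p \<in> sets cem_borel \<Longrightarrow> cylinder_kernel r \<in> borel_measurable cem_borel"
proof (induction r)
  case (Cons p r)
  then have [measurable]: "cylinder_kernel r \<in> borel_measurable cem_borel" "snd p \<in> sets cem_borel" by auto
  have "(\<lambda>w. \<integral>\<^sup>+\<omega>. (\<lambda>y. indicator (snd p) y * cylinder_kernel r y) (X (fst p) \<omega>) \<partial>P w)
      \<in> borel_measurable cem_borel"
    by (rule measurable_expectation) measurable
  then show ?case by simp
next
  case Nil
  have "cylinder_kernel [] = (\<lambda>_. 1)" by (simp add: fun_eq_iff)
  then show ?case by simp
qed

lemma cylinder_markov:
  assumes "\<forall>p\<in>set r. snd p \<in> sets cem_borel" and "g \<in> borel_measurable (F t)"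
  shows "(\<integral>\<^sup>+\<omega>. g \<omega> * cylinder t r \<omega> \<partial>P z) = (\<integral>\<^sup>+\<omega>. g \<omega> * cylinder_kernel r (X t \<omega>) \<partial>P z)"
  using assms
proof (induction r arbitrary: t g)
  case (Cons p r)
  let ?g = "\<lambda>\<omega>. g \<omega> * indicator (snd p) (X (t + fst p) \<omega>)"
  have [measurable]: "cylinder_kernel r \<in> borel_measurable cem_borel" "snd p \<in> sets cem_borel"
    using Cons.prems measurable_cylinder_kernel[of r] by auto
  have g': "?g \<in> borel_measurable (F (t + fst p))"
  proof -
    have [measurable]: "g \<in> borel_measurable (F (t + fst p))"
      using Cons.prems(2) by (rule measurable_F_mono[rotated]) simp
    have [measurable]: "(\<lambda>\<omega>. indicator (snd p) (X (t + fst p) \<omega>) :: ennreal) \<in> borel_measurable (F (t + fst p))"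
      by (rule measurable_compose[OF adapted]) measurable
    show ?thesis by measurable
  qed
  have "(\<integral>\<^sup>+\<omega>. g \<omega> * cylinder t (p # r) \<omega> \<partial>P z) = (\<integral>\<^sup>+\<omega>. ?g \<omega> * cylinder (t + fst p) r \<omega> \<partial>P z)"
    by (simp add: mult.assoc)
  also have "\<dots> = (\<integral>\<^sup>+\<omega>. ?g \<omega> * cylinder_kernel r (X (t + fst p) \<omega>) \<partial>P z)"
    using Cons.prems g' by (intro Cons.IH) auto
  also have "\<dots> = (\<integral>\<^sup>+\<omega>. g \<omega> * (\<lambda>y. indicator (snd p) y * cylinder_kernel r y) (X (t + fst p) \<omega>) \<partial>P z)"
    by (simp add: mult.assoc)
  also have "\<dots> = (\<integral>\<^sup>+\<omega>. g \<omega> * (\<integral>\<^sup>+\<omega>'. (\<lambda>y. indicator (snd p) y * cylinder_kernel r y) (X (fst p) \<omega>') \<partial>P (X t \<omega>)) \<partial>P z)"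
    by (rule one_step[OF Cons.prems(2)]) measurable
  finally show ?case by simp
qed simp

text \<open>Sorted absolute times are turned into increments. Here \<open>c\<close> is the time
  already reached, and \<open>c \<le> s\<close> allows \<open>s - c\<close> to be added back in
  \<open>ennreal\<close>.\<close>

lemma cylinder_of_sorted:
  assumes "sorted (c # ss)"
  shows "\<exists>r. (\<forall>p\<in>set r. snd p \<in> E ` set ss) \<and>
    (\<forall>t \<omega>. cylinder (t + c) r \<omega> = indicator {\<omega>. \<forall>s\<in>set ss. X (t + s) \<omega> \<in> E s} \<omega>)"
  using assms
proof (induction ss arbitrary: c)
  case Nil
  show ?case by (intro exI[of _ "[]"]) simp
next
  case (Cons s ss)
  then have "sorted (s # ss)" by simp
  from Cons.IH[OF this] obtain r where r: "\<forall>p\<in>set r. snd p \<in> E ` set ss"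
    "\<And>t \<omega>. cylinder (t + s) r \<omega> = indicator {\<omega>. \<forall>s\<in>set ss. X (t + s) \<omega> \<in> E s} \<omega>"
    by blast
  have "c \<le> s" using Cons.prems by simp
  then have eq: "t + c + (s - c) = t + s" for t
    by (metis add.assoc add_diff_inverse_ennreal)
  show ?case
  proof (intro exI[of _ "(s - c, E s) # r"] conjI allI)
    show "\<forall>p\<in>set ((s - c, E s) # r). snd p \<in> E ` set (s # ss)" using r(1) by auto
    fix t \<omega>
    show "cylinder (t + c) ((s - c, E s) # r) \<omega> = indicator {\<omega>. \<forall>s\<in>set (s # ss). X (t + s) \<omega> \<in> E s} \<omega>"
      unfolding cylinder.simps fst_conv snd_conv eq r(2) by (auto split: split_indicator)
  qed
qed

lemma cylinder_of_prod_algebra: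
  assumes C: "C \<in> prod_algebra UNIV (\<lambda>_. cem_borel)"
  shows "\<exists>r. (\<forall>p\<in>set r. snd p \<in> sets cem_borel) \<and> (\<forall>t \<omega>. cylinder t r \<omega> = indicator C (path t \<omega>))"
proof -
  from C obtain J E where J: "finite J" "\<forall>j\<in>J. E j \<in> sets cem_borel"
    and C': "C = prod_emb UNIV (\<lambda>_. cem_borel) J (Pi\<^sub>E J E)"
    by (auto elim!: prod_algebraE)
  obtain ss where ss: "sorted ss" "set ss = J" using J(1) by (metis sorted_list_of_set(1,2))
  then have "sorted (0 # ss)" by simp
  from cylinder_of_sorted[OF this, of E] obtain r where r: "\<forall>p\<in>set r. snd p \<in> E ` J"
    "\<And>t \<omega>. cylinder t r \<omega> = indicator {\<omega>. \<forall>s\<in>J. X (t + s) \<omega> \<in> E s} \<omega>"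
    by (auto simp: ss)
  have "(\<forall>s\<in>J. X (t + s) \<omega> \<in> E s) \<longleftrightarrow> path t \<omega> \<in> C" for t \<omega>
    unfolding C' path_def prod_emb_def by (auto simp: PiE_iff extensional_def space_PiM)
  with r J show ?thesis by (intro exI[of _ r]) (auto split: split_indicator)
qed

lemma prob_space_path_law: "prob_space (path_law w)"
  unfolding path_law_def by (rule prob_space.prob_space_distr[OF prob_space_P path_measurable])

lemma sets_path_law [simp, measurable_cong]: "sets (path_law w) = sets path_space"
  by (simp add: path_law_def)

lemma emeasure_path_law_cylinder:
  assumes r: "\<forall>p\<in>set r. snd p \<in> sets cem_borel" "\<And>t \<omega>. cylinder t r \<omega> = indicator C (path t \<omega>)"
    and C: "C \<in> sets path_space"
  shows "emeasure (path_law w) C = cylinder_kernel r w"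
proof -
  interpret prob_space "P w" by (rule prob_space_P)
  have "emeasure (path_law w) C = (\<integral>\<^sup>+\<omega>. indicator C (path 0 \<omega>) \<partial>P w)"
  proof -
    have "emeasure (path_law w) C = (\<integral>\<^sup>+p. indicator C p \<partial>path_law w)"
      using C by (intro nn_integral_indicator[symmetric]) simp
    also have "\<dots> = (\<integral>\<^sup>+\<omega>. indicator C (path 0 \<omega>) \<partial>P w)"
      unfolding path_law_def using C by (intro nn_integral_distr[OF path_measurable]) simp
    finally show ?thesis .
  qed
  also have "\<dots> = (\<integral>\<^sup>+\<omega>. 1 * cylinder 0 r \<omega> \<partial>P w)" by (simp add: r)
  also have "\<dots> = (\<integral>\<^sup>+\<omega>. 1 * cylinder_kernel r (X 0 \<omega>) \<partial>P w)"
    using r by (intro cylinder_markov) auto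
  also have "\<dots> = (\<integral>\<^sup>+\<omega>. cylinder_kernel r w \<partial>P w)"
    using normal[of w] by (intro nn_integral_cong_AE) auto
  finally show ?thesis by (simp add: emeasure_space_1[simplified])
qed

lemma sets_path_space_sigma:
  "sets path_space = sigma_sets UNIV (prod_algebra UNIV (\<lambda>_. cem_borel))"
  by (simp add: sets_PiM)

lemma measurable_path_law [measurable]: "path_law \<in> measurable cem_borel (prob_algebra path_space)"
proof (rule measurable_prob_algebra_generated[OF sets_path_space_sigma Int_stable_prod_algebra])
  fix C :: "(ennreal \<Rightarrow> 'a option) set" assume C: "C \<in> prod_algebra UNIV (\<lambda>_. cem_borel)"
  then have C': "C \<in> sets path_space" by (auto simp: sets_PiM)
  from cylinder_of_prod_algebra[OF C] obtain r where r: "\<forall>p\<in>set r. snd p \<in> sets cem_borel"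
    "\<And>t \<omega>. cylinder t r \<omega> = indicator C (path t \<omega>)" by blast
  show "(\<lambda>w. emeasure (path_law w) C) \<in> borel_measurable cem_borel"
    using measurable_cylinder_kernel[OF r(1)] emeasure_path_law_cylinder[OF r C'] by simp
qed (simp_all add: prob_space_path_law)

lemma measurable_path_law_subprob [measurable]:
  "path_law \<in> measurable cem_borel (subprob_algebra path_space)"
  by (rule measurable_prob_algebraD) measurable

text \<open>Both sides are finite measures in \<open>C\<close>. They agree on cylinders by
  \<open>cylinder_markov\<close>, and cylinders form an intersection-stable generator.\<close>

lemma markov_set:
  assumes A: "A \<in> sets (F t)" and C: "C \<in> sets path_space"
  shows "emeasure (P z) (A \<inter> (path t -` C \<inter> space (P z))) =
    (\<integral>\<^sup>+\<omega>. indicator A \<omega> * emeasure (path_law (X t \<omega>)) C \<partial>P z)"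
proof (cases "A = {}")
  case False
  interpret prob_space "P z" by (rule prob_space_P)
  have A'[measurable]: "A \<in> sets (P z)" using A by (rule sets_F_P)
  have ne: "\<Omega> \<noteq> {}" using False sets.sets_into_space[OF A'] by auto
  let ?M = "density (P z) (indicator A)"
  have K: "(\<lambda>\<omega>. path_law (X t \<omega>)) \<in> measurable ?M (subprob_algebra path_space)" by measurable
  let ?M1 = "distr ?M path_space (path t)" and ?M2 = "bind ?M (\<lambda>\<omega>. path_law (X t \<omega>))"
  have e1: "emeasure ?M1 B = (\<integral>\<^sup>+\<omega>. indicator A \<omega> * indicator B (path t \<omega>) \<partial>P z)"
    if B[measurable]: "B \<in> sets path_space" for B
  proof -
    have "emeasure ?M1 B = (\<integral>\<^sup>+p. indicator B p \<partial>?M1)"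
      using B by (intro nn_integral_indicator[symmetric]) simp
    also have "\<dots> = (\<integral>\<^sup>+\<omega>. indicator B (path t \<omega>) \<partial>?M)"
      by (rule nn_integral_distr) measurable
    also have "\<dots> = (\<integral>\<^sup>+\<omega>. indicator A \<omega> * indicator B (path t \<omega>) \<partial>P z)"
      by (rule nn_integral_density) measurable
    finally show ?thesis .
  qed
  have e2: "emeasure ?M2 B = (\<integral>\<^sup>+\<omega>. indicator A \<omega> * emeasure (path_law (X t \<omega>)) B \<partial>P z)"
    if B[measurable]: "B \<in> sets path_space" for B
  proof -
    have "emeasure ?M2 B = (\<integral>\<^sup>+\<omega>. emeasure (path_law (X t \<omega>)) B \<partial>?M)"
      using ne by (intro emeasure_bind[OF _ K B]) simp
    also have "\<dots> = (\<integral>\<^sup>+\<omega>. indicator A \<omega> * emeasure (path_law (X t \<omega>)) B \<partial>P z)"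
      by (rule nn_integral_density) measurable
    finally show ?thesis .
  qed
  have "?M1 = ?M2"
  proof (rule measure_eqI_generator_eq[where E="prod_algebra UNIV (\<lambda>_. cem_borel)" and \<Omega>=UNIV and A="\<lambda>_. UNIV"])
    show "Int_stable (prod_algebra (UNIV :: ennreal set) (\<lambda>_. cem_borel :: 'a option measure))" by (rule Int_stable_prod_algebra)
    show "prod_algebra UNIV (\<lambda>_. cem_borel) \<subseteq> Pow (UNIV :: (ennreal \<Rightarrow> 'a option) set)" by simp
    fix C :: "(ennreal \<Rightarrow> 'a option) set" assume C: "C \<in> prod_algebra UNIV (\<lambda>_. cem_borel)"
    then have C': "C \<in> sets path_space" by (auto simp: sets_PiM)
    from cylinder_of_prod_algebra[OF C] obtain r where r: "\<forall>p\<in>set r. snd p \<in> sets cem_borel"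
      "\<And>t \<omega>. cylinder t r \<omega> = indicator C (path t \<omega>)" by blast
    have "emeasure ?M1 C = (\<integral>\<^sup>+\<omega>. indicator A \<omega> * cylinder t r \<omega> \<partial>P z)"
      using e1[OF C'] by (simp add: r)
    also have "\<dots> = (\<integral>\<^sup>+\<omega>. indicator A \<omega> * cylinder_kernel r (X t \<omega>) \<partial>P z)"
      using r A by (intro cylinder_markov) auto
    also have "\<dots> = emeasure ?M2 C"
      using e2[OF C'] emeasure_path_law_cylinder[OF r C'] by simp
    finally show "emeasure ?M1 C = emeasure ?M2 C" .
  next
    show "sets ?M1 = sigma_sets UNIV (prod_algebra UNIV (\<lambda>_. cem_borel))"
      by (simp add: sets_PiM)
    have "sets ?M2 = sets path_space"
      using ne sets_kernel[OF K] by (intro sets_bind) simp_all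
    then show "sets ?M2 = sigma_sets UNIV (prod_algebra UNIV (\<lambda>_. cem_borel))"
      by (simp add: sets_PiM)
    have U: "UNIV \<in> sets path_space" using sets.top[of path_space] by (simp add: space_PiM)
    show "range (\<lambda>_::nat. UNIV) \<subseteq> prod_algebra (UNIV :: ennreal set) (\<lambda>_. cem_borel :: 'a option measure)"
    proof -
      \<comment> \<open>Members of \<open>prod_algebra\<close> are cylinders over nonempty index
        sets, so the whole space is written as a cylinder over the single time
        \<open>0\<close>.\<close>
      have eq: "UNIV = prod_emb UNIV (\<lambda>_. cem_borel) {0 :: ennreal} (Pi\<^sub>E {0} (\<lambda>_. UNIV :: 'a option set))"
        by (rule set_eqI) (simp add: prod_emb_iff restrict_PiE_iff)
      have "UNIV \<in> prod_algebra (UNIV :: ennreal set) (\<lambda>_. cem_borel :: 'a option measure)"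
        using sets.top[of "cem_borel :: 'a option measure"]
        by (subst eq, intro prod_algebraI) auto
      then show ?thesis by simp
    qed
    show "emeasure ?M1 UNIV \<noteq> \<infinity>"
    proof -
      have "emeasure ?M1 UNIV = (\<integral>\<^sup>+\<omega>. indicator A \<omega> \<partial>P z)"
        unfolding e1[OF U] by simp
      also have "\<dots> = emeasure (P z) A" using A' by (rule nn_integral_indicator)
      finally show ?thesis using emeasure_finite[of A] by simp
    qed
  qed auto
  have "emeasure (P z) (A \<inter> (path t -` C \<inter> space (P z))) = (\<integral>\<^sup>+\<omega>. indicator (A \<inter> (path t -` C \<inter> space (P z))) \<omega> \<partial>P z)"
    by (rule nn_integral_indicator[symmetric, OF sets.Int[OF A' measurable_sets[OF path_measurable C]]])
  also have "\<dots> = (\<integral>\<^sup>+\<omega>. indicator A \<omega> * indicator C (path t \<omega>) \<partial>P z)"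
    by (intro nn_integral_cong) (simp split: split_indicator)
  also have "\<dots> = emeasure ?M1 C" by (rule e1[OF C, symmetric])
  finally show ?thesis using \<open>?M1 = ?M2\<close> e2[OF C] by simp
qed simp

lemma markov:
  assumes g: "g \<in> borel_measurable (F t)" and f: "f \<in> borel_measurable path_space"
  shows "(\<integral>\<^sup>+\<omega>. g \<omega> * f (path t \<omega>) \<partial>P z) = (\<integral>\<^sup>+\<omega>. g \<omega> * (\<integral>\<^sup>+p. f p \<partial>path_law (X t \<omega>)) \<partial>P z)"
  by (rule nn_integral_kernel_extend[OF subalgebra_F path_measurable adapted
      measurable_path_law_subprob markov_set g f])

end

section \<open>Occupation times as functionals of the path\<close>

text \<open>
  Right-continuity makes \<open>X\<^sub>u \<in> ball x r\<close> a property of the samples of the path at the grid points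
  \<open>\<lceil>u n\<rceil> / n\<close>. With \<open>near\<close> in place of membership, occupation times are measurable for the product
  \<open>\<sigma>\<close>-algebra, although the set of right-continuous paths is not.
\<close>

definition near :: "'a::metric_space \<Rightarrow> real \<Rightarrow> ennreal \<Rightarrow> (ennreal \<Rightarrow> 'a option) \<Rightarrow> real \<Rightarrow> bool" where
  "near x r T p u \<longleftrightarrow> (\<exists>j N. \<forall>n\<ge>N.
     p (min T (ennreal (of_int \<lceil>u * real (Suc n)\<rceil> / real (Suc n)))) \<in> Some ` ball x (r - 1 / real (Suc j)))"

definition occ :: "'a::metric_space \<Rightarrow> real \<Rightarrow> ennreal \<Rightarrow> (ennreal \<Rightarrow> 'a option) \<Rightarrow> ennreal" where
  "occ x r T p = (\<integral>\<^sup>+ u. indicator {u. 0 \<le> u \<and> ennreal u \<le> T \<and> near x r T p u} u \<partial>lborel)"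

text \<open>Sampling at \<open>min T\<close> involves only coordinates up to \<open>T\<close>. This
  is what makes the occupation up to \<open>T\<close> after time \<open>s\<close> measurable for
  \<open>F (s + T)\<close>.\<close>

lemma pred_near_gen:
  fixes Z :: "'c \<Rightarrow> ennreal \<Rightarrow> 'a::{metric_space, second_countable_topology} option"
  assumes Z: "\<And>v. v \<le> T \<Longrightarrow> (\<lambda>\<omega>. Z \<omega> v) \<in> measurable N cem_borel"
  shows "Measurable.pred (N \<Otimes>\<^sub>M lborel) (\<lambda>y. near x r T (Z (fst y)) (snd y))"
proof -
  have [measurable]: "Some ` ball x q \<in> sets cem_borel" for q
    by (rule open_imp_Some_in_cem_borel) simp
  have [measurable]: "(\<lambda>y. Z (fst y) (min T (ennreal (of_int \<lceil>snd y * real (Suc n)\<rceil> / real (Suc n)))))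
      \<in> measurable (N \<Otimes>\<^sub>M lborel) cem_borel" for n
  proof (rule measurable_compose_countable[where g="\<lambda>y. \<lceil>snd y * real (Suc n)\<rceil>"
        and f="\<lambda>i y. Z (fst y) (min T (ennreal (of_int i / real (Suc n))))"])
    show "(\<lambda>y. Z (fst y) (min T (ennreal (real_of_int i / real (Suc n)))))
      \<in> measurable (N \<Otimes>\<^sub>M lborel) cem_borel" for i
      by (rule measurable_compose[OF measurable_fst Z]) simp
  qed measurable
  show ?thesis unfolding near_def by measurable
qed

lemma measurable_occ_gen:
  fixes Z :: "'c \<Rightarrow> ennreal \<Rightarrow> 'a::{metric_space, second_countable_topology} option"
  assumes Z: "\<And>v. v \<le> T \<Longrightarrow> (\<lambda>\<omega>. Z \<omega> v) \<in> measurable N cem_borel"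
  shows "(\<lambda>\<omega>. occ x r T (Z \<omega>)) \<in> borel_measurable N"
proof -
  have [measurable]: "Measurable.pred (N \<Otimes>\<^sub>M lborel) (\<lambda>y. near x r T (Z (fst y)) (snd y))"
    by (rule pred_near_gen[OF Z])
  have "(\<lambda>y. indicator {y. 0 \<le> snd y \<and> ennreal (snd y) \<le> T \<and> near x r T (Z (fst y)) (snd y)} y :: ennreal)
      \<in> borel_measurable (N \<Otimes>\<^sub>M lborel)"
    by measurable
  also have "(\<lambda>y. indicator {y. 0 \<le> snd y \<and> ennreal (snd y) \<le> T \<and> near x r T (Z (fst y)) (snd y)} y :: ennreal)
      = (\<lambda>(\<omega>, u). indicator {u. 0 \<le> u \<and> ennreal u \<le> T \<and> near x r T (Z \<omega>) u} u)"
    by (auto split: split_indicator simp: fun_eq_iff)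
  finally show ?thesis
    unfolding occ_def by (rule lborel.borel_measurable_nn_integral)
qed

lemma measurable_occ [measurable]:
  "occ x r T \<in> borel_measurable (PiM UNIV (\<lambda>_. cem_borel :: 'a::{metric_space, second_countable_topology} option measure))"
  by (rule measurable_occ_gen) simp

lemma occ_le: "occ x r T p \<le> T"
proof (cases T)
  case (real t)
  have "occ x r T p \<le> (\<integral>\<^sup>+ u. indicator {0..t} u \<partial>lborel)"
    unfolding occ_def using real by (intro nn_integral_mono) (auto split: split_indicator)
  also have "\<dots> = ennreal t" using real by simp
  finally show ?thesis using real by simp
qed simp

lemma ceiling_approx_tendsto:
  "(\<lambda>n. of_int \<lceil>u * real (Suc n)\<rceil> / real (Suc n)) \<longlonglongrightarrow> (u::real)"
proof (rule tendsto_sandwich)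
  show "\<forall>\<^sub>F n in sequentially. u \<le> of_int \<lceil>u * real (Suc n)\<rceil> / real (Suc n)"
    by (intro always_eventually allI) (simp add: field_simps del: of_nat_Suc)
  show "\<forall>\<^sub>F n in sequentially. of_int \<lceil>u * real (Suc n)\<rceil> / real (Suc n) \<le> u + 1 / real (Suc n)"
  proof (intro always_eventually allI)
    fix n
    have "of_int \<lceil>u * real (Suc n)\<rceil> \<le> u * real (Suc n) + 1" by linarith
    then show "of_int \<lceil>u * real (Suc n)\<rceil> / real (Suc n) \<le> u + 1 / real (Suc n)"
      by (simp add: field_simps del: of_nat_Suc)
  qed
  show "(\<lambda>n. u + 1 / real (Suc n)) \<longlonglongrightarrow> u"
    using tendsto_add[OF tendsto_const[of u] LIMSEQ_inverse_real_of_nat] by (simp add: inverse_eq_divide)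
qed simp

context borel_standard_process
begin

lemma eventually_right:
  assumes \<omega>: "\<omega> \<in> \<Omega>" and w: "\<And>n. t \<le> w n" "w \<longlonglongrightarrow> t"
    and V: "X t \<omega> = Some y" "open V" "y \<in> V"
  shows "\<forall>\<^sub>F n in sequentially. X (w n) \<omega> \<in> Some ` V"
proof -
  have "\<forall>\<^sub>F s in at_right t. X s \<omega> \<in> Some ` V"
    using right_continuous_paths[OF \<omega>, of t] V unfolding limitin_def by auto
  then have "\<forall>\<^sub>F s in nhds t. s \<noteq> t \<longrightarrow> s \<in> {t<..} \<longrightarrow> X s \<omega> \<in> Some ` V"
    by (simp add: eventually_at_filter)
  then have "\<forall>\<^sub>F n in sequentially. w n \<noteq> t \<longrightarrow> w n \<in> {t<..} \<longrightarrow> X (w n) \<omega> \<in> Some ` V"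
    using w(2) by (rule eventually_compose_filterlim)
  then show ?thesis
    using w(1) V by (auto elim!: eventually_mono) (metis image_eqI order_less_le)
qed

text \<open>The sampling times approach \<open>u\<close> from the right. If the position lies in the
  open ball, it lies in a slightly smaller one, which the samples eventually share. If its distance
  is at least \<open>r\<close>, the samples eventually leave each of the smaller balls. At the
  cemetery all later samples are absorbed.\<close>

lemma near_path:
  assumes \<omega>: "\<omega> \<in> \<Omega>" and u: "0 \<le> u" "ennreal u \<le> T"
  shows "near x r T (path s \<omega>) u \<longleftrightarrow> X (s + ennreal u) \<omega> \<in> Some ` ball x r"
proof -
  define w where "w n = s + min T (ennreal (of_int \<lceil>u * real (Suc n)\<rceil> / real (Suc n)))" for n
  have "u \<le> of_int \<lceil>u * real (Suc n)\<rceil> / real (Suc n)" for n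
    by (simp add: field_simps del: of_nat_Suc)
  then have w1: "s + ennreal u \<le> w n" for n
    unfolding w_def using u by (intro add_left_mono) (simp add: ennreal_leI)
  have "(\<lambda>n. s + min T (ennreal (of_int \<lceil>u * real (Suc n)\<rceil> / real (Suc n)))) \<longlonglongrightarrow> s + min T (ennreal u)"
    by (intro tendsto_intros tendsto_min tendsto_ennrealI ceiling_approx_tendsto)
  then have w2: "w \<longlonglongrightarrow> s + ennreal u" using u by (simp add: w_def[abs_def] min_absorb2)
  have near: "near x r T (path s \<omega>) u \<longleftrightarrow>
      (\<exists>j. \<forall>\<^sub>F n in sequentially. X (w n) \<omega> \<in> Some ` ball x (r - 1 / real (Suc j)))"
    by (simp add: near_def path_def w_def eventually_sequentially)
  show ?thesis
  proof (cases "X (s + ennreal u) \<omega>")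
    case None
    then have "X (w n) \<omega> = None" for n using absorbing[OF \<omega> w1] by blast
    with None near show ?thesis by auto
  next
    case (Some y)
    show ?thesis
    proof (cases "dist x y < r")
      case True
      then obtain j where "inverse (real (Suc j)) < r - dist x y"
        using reals_Archimedean[of "r - dist x y"] by auto
      then have y: "y \<in> ball x (r - 1 / real (Suc j))" by (simp add: inverse_eq_divide)
      have "\<forall>\<^sub>F n in sequentially. X (w n) \<omega> \<in> Some ` ball x (r - 1 / real (Suc j))"
        by (rule eventually_right[OF \<omega> w1 w2 Some open_ball y])
      then show ?thesis unfolding near using Some True by auto
    next
      case False
      have "\<not> (\<forall>\<^sub>F n in sequentially. X (w n) \<omega> \<in> Some ` ball x (r - 1 / real (Suc j)))" for j
      proof
        assume *: "\<forall>\<^sub>F n in sequentially. X (w n) \<omega> \<in> Some ` ball x (r - 1 / real (Suc j))"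
        have V: "open {z. r - 1 / real (Suc j) < dist x z}"
          by (intro open_Collect_less continuous_intros)
        have "0 < 1 / real (Suc j)" by simp
        with False have y: "y \<in> {z. r - 1 / real (Suc j) < dist x z}"
          unfolding mem_Collect_eq by linarith
        have "\<forall>\<^sub>F n in sequentially. X (w n) \<omega> \<in> Some ` {z. r - 1 / real (Suc j) < dist x z}"
          by (rule eventually_right[OF \<omega> w1 w2 Some V y])
        with * have "\<forall>\<^sub>F n in sequentially. False" by eventually_elim auto
        then show False by simp
      qed
      then show ?thesis unfolding near using Some False by auto
    qed
  qed
qed

lemma occ_path:
  assumes "\<omega> \<in> \<Omega>"
  shows "occ x r T (path s \<omega>) =
    (\<integral>\<^sup>+ u. indicator {u. 0 \<le> u \<and> ennreal u \<le> T \<and> X (s + ennreal u) \<omega> \<in> Some ` ball x r} u \<partial>lborel)"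
  unfolding occ_def using near_path[OF assms]
  by (intro nn_integral_cong) (auto split: split_indicator)

lemma occupation_time_eq:
  assumes "\<omega> \<in> \<Omega>"
  shows "occupation_time X (ball x r) T \<omega> = occ x r T (path 0 \<omega>)"
  unfolding occupation_time_def occ_path[OF assms]
  by (intro nn_integral_cong) (auto split: split_indicator)

lemma sets_in_ball:
  assumes \<omega>: "\<omega> \<in> \<Omega>"
  shows "{u. 0 \<le> u \<and> ennreal u \<le> T \<and> X (s + ennreal u) \<omega> \<in> Some ` ball x r} \<in> sets lborel"
proof -
  have [measurable]: "Measurable.pred (PiM UNIV (\<lambda>_. cem_borel :: 'a option measure) \<Otimes>\<^sub>M lborel) (\<lambda>y. near x r T (fst y) (snd y))"
    by (rule pred_near_gen) simp
  have "(\<lambda>u. (path s \<omega>, u)) \<in> measurable lborel (PiM UNIV (\<lambda>_. cem_borel :: 'a option measure) \<Otimes>\<^sub>M lborel)"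
    by (rule measurable_Pair1') (simp add: space_PiM)
  from measurable_compose[OF this \<open>Measurable.pred _ _\<close>]
  have [measurable]: "Measurable.pred lborel (\<lambda>u. near x r T (path s \<omega>) u)" by simp
  have "{u \<in> space lborel. 0 \<le> u \<and> ennreal u \<le> T \<and> near x r T (path s \<omega>) u} \<in> sets lborel"
    by measurable
  also have "{u \<in> space lborel. 0 \<le> u \<and> ennreal u \<le> T \<and> near x r T (path s \<omega>) u} =
     {u. 0 \<le> u \<and> ennreal u \<le> T \<and> X (s + ennreal u) \<omega> \<in> Some ` ball x r}"
    using near_path[OF \<omega>] by auto
  finally show ?thesis .
qed

lemma occ_mono:
  assumes "\<omega> \<in> \<Omega>" "T \<le> T'" "r \<le> r'"
  shows "occ x r T (path s \<omega>) \<le> occ x r' T' (path s \<omega>)"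
  unfolding occ_path[OF assms(1)] using assms(2,3)
  by (intro nn_integral_mono) (auto split: split_indicator intro: order_trans order.strict_trans2 simp: image_iff)

lemma occ_split:
  assumes \<omega>: "\<omega> \<in> \<Omega>" and a: "0 \<le> a"
  shows "occ x r (ennreal a + T) (path s \<omega>) = occ x r (ennreal a) (path s \<omega>) + occ x r T (path (s + ennreal a) \<omega>)"
proof -
  let ?I = "\<lambda>T s u. indicator {u. 0 \<le> u \<and> ennreal u \<le> T \<and> X (s + ennreal u) \<omega> \<in> Some ` ball x r} u :: ennreal"
  have m: "?I T s \<in> borel_measurable lborel" for T s
    using sets_in_ball[OF \<omega>] by (rule borel_measurable_indicator)
  have m': "(\<lambda>u. ?I T (s + ennreal a) (- a + 1 * u)) \<in> borel_measurable lborel"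
    by (rule measurable_compose[OF _ m, where f="\<lambda>u. - a + 1 * u"]) simp
  have "occ x r (ennreal a + T) (path s \<omega>) = (\<integral>\<^sup>+u. ?I (ennreal a + T) s u \<partial>lborel)"
    by (rule occ_path[OF \<omega>])
  also have "\<dots> = (\<integral>\<^sup>+u. ?I (ennreal a) s u + ?I T (s + ennreal a) (- a + 1 * u) \<partial>lborel)"
  proof (rule nn_integral_cong_AE)
    \<comment> \<open>The time \<open>u = a\<close> belongs to both windows, so the indicators add
      up only off a null set.\<close>
    have eq: "?I (ennreal a + T) s u = ?I (ennreal a) s u + ?I T (s + ennreal a) (- a + 1 * u)" if ne: "u \<noteq> a" for u
    proof -
      consider "u < 0" | "0 \<le> u" "u < a" | "u > a" using ne by linarith
      then show ?thesis
      proof cases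
        case 2
        then have "ennreal u \<le> ennreal a" by (simp add: ennreal_leI)
        then have "ennreal u \<le> ennreal a + T" by (metis add.right_neutral add_mono zero_le)
        with 2 \<open>ennreal u \<le> ennreal a\<close> show ?thesis by (simp split: split_indicator)
      next
        case 3
        then have e: "ennreal u = ennreal a + ennreal (u - a)" using a by (simp flip: ennreal_plus)
        have le: "ennreal u \<le> ennreal a + T \<longleftrightarrow> ennreal (- a + 1 * u) \<le> T"
          unfolding e by (simp add: ennreal_add_left_cancel_le)
        have eqX: "X (s + ennreal a + ennreal (- a + 1 * u)) = X (s + ennreal u)"
          unfolding e by (simp add: add.assoc)
        have "(0 \<le> u) = (0 \<le> - a + 1 * u)" using 3 a by simp
        then have "?I (ennreal a + T) s u = ?I T (s + ennreal a) (- a + 1 * u)"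
          unfolding indicator_def mem_Collect_eq le eqX by (simp only:)
        moreover have "?I (ennreal a) s u = 0"
          unfolding indicator_def mem_Collect_eq using 3 a by (simp add: ennreal_le_iff)
        ultimately show ?thesis by simp
      next
        case 1
        with a show ?thesis by simp
      qed
    qed
    show "AE u in lborel. ?I (ennreal a + T) s u = ?I (ennreal a) s u + ?I T (s + ennreal a) (- a + 1 * u)"
      using AE_lborel_singleton[of a] by eventually_elim (rule eq)
  qed
  also have "\<dots> = (\<integral>\<^sup>+u. ?I (ennreal a) s u \<partial>lborel) + (\<integral>\<^sup>+u. ?I T (s + ennreal a) (- a + 1 * u) \<partial>lborel)"
    by (rule nn_integral_add[OF m m'])
  also have "(\<integral>\<^sup>+u. ?I T (s + ennreal a) (- a + 1 * u) \<partial>lborel) = (\<integral>\<^sup>+u. ?I T (s + ennreal a) u \<partial>lborel)"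
  proof -
    have "(\<integral>\<^sup>+u. ?I T (s + ennreal a) u \<partial>lborel) = ennreal \<bar>1\<bar> * (\<integral>\<^sup>+u. ?I T (s + ennreal a) (- a + 1 * u) \<partial>lborel)"
      by (rule nn_integral_real_affine) (use m in simp_all)
    then show ?thesis by (simp only: abs_one ennreal_1 mult_1_left)
  qed
  finally show ?thesis unfolding occ_path[OF \<omega>] .
qed

lemma occ_SUP:
  assumes \<omega>: "\<omega> \<in> \<Omega>" and h: "0 < h"
  shows "occ x r \<infinity> (path s \<omega>) = (SUP k. occ x r (ennreal (real k * h)) (path s \<omega>))"
proof -
  let ?I = "\<lambda>T u. indicator {u. 0 \<le> u \<and> ennreal u \<le> T \<and> X (s + ennreal u) \<omega> \<in> Some ` ball x r} u :: ennreal"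
  have m: "?I T \<in> borel_measurable lborel" for T
    using sets_in_ball[OF \<omega>] by (intro borel_measurable_indicator)
  have le: "ennreal (real k * h) \<le> ennreal (real (Suc k) * h)" for k
    using h by (intro ennreal_leI mult_right_mono) auto
  have inc: "incseq (\<lambda>k. ?I (ennreal (real k * h)))"
    by (intro incseq_SucI le_funI) (auto split: split_indicator intro: order_trans[OF _ le] simp del: of_nat_Suc)
  have "(SUP k. ?I (ennreal (real k * h)) u) = ?I \<infinity> u" for u
  proof (rule antisym)
    show "(SUP k. ?I (ennreal (real k * h)) u) \<le> ?I \<infinity> u"
      by (intro SUP_least) (auto split: split_indicator)
    obtain k where k: "u / h \<le> real k" using real_arch_simple by blast
    then have "ennreal u \<le> ennreal (real k * h)" using h by (intro ennreal_leI) (simp add: field_simps)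
    then have "?I \<infinity> u \<le> ?I (ennreal (real k * h)) u" by (auto split: split_indicator)
    also have "\<dots> \<le> (SUP k. ?I (ennreal (real k * h)) u)" by (rule SUP_upper) simp
    finally show "?I \<infinity> u \<le> (SUP k. ?I (ennreal (real k * h)) u)" .
  qed
  then have "(\<integral>\<^sup>+u. ?I \<infinity> u \<partial>lborel) = (\<integral>\<^sup>+u. (SUP k. ?I (ennreal (real k * h)) u) \<partial>lborel)" by simp
  also have "\<dots> = (SUP k. \<integral>\<^sup>+u. ?I (ennreal (real k * h)) u \<partial>lborel)"
    by (rule nn_integral_monotone_convergence_SUP[OF inc m])
  finally show ?thesis unfolding occ_path[OF \<omega>] .
qed

lemma occ_full:
  assumes \<omega>: "\<omega> \<in> \<Omega>" and a: "0 \<le> a" and stay: "\<And>u. 0 < u \<Longrightarrow> u \<le> a \<Longrightarrow> X (s + ennreal u) \<omega> \<in> Some ` ball x r"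
  shows "occ x r (ennreal a) (path s \<omega>) = ennreal a"
proof (rule antisym[OF occ_le])
  have "ennreal a = (\<integral>\<^sup>+u. indicator {0<..a} u \<partial>lborel)" using a by simp
  also have "\<dots> \<le> occ x r (ennreal a) (path s \<omega>)"
    unfolding occ_path[OF \<omega>] using stay by (intro nn_integral_mono) (auto split: split_indicator intro: ennreal_leI)
  finally show "ennreal a \<le> occ x r (ennreal a) (path s \<omega>)" .
qed

lemma measurable_occ_path_F [measurable]:
  "(\<lambda>\<omega>. occ x r T (path s \<omega>)) \<in> borel_measurable (F (s + T))"
proof (rule measurable_occ_gen)
  fix v assume "v \<le> T"
  show "(\<lambda>\<omega>. path s \<omega> v) \<in> measurable (F (s + T)) cem_borel"
    unfolding path_def using \<open>v \<le> T\<close> by (intro measurable_F_mono[OF _ adapted] add_left_mono)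
qed

lemma nn_integral_path_law:
  assumes "f \<in> borel_measurable path_space"
  shows "(\<integral>\<^sup>+p. f p \<partial>path_law w) = (\<integral>\<^sup>+\<omega>. f (path 0 \<omega>) \<partial>P w)"
  unfolding path_law_def using assms by (intro nn_integral_distr[OF path_measurable]) simp

lemma emeasure_path_law:
  assumes "C \<in> sets path_space"
  shows "emeasure (path_law w) C = emeasure (P w) {\<omega>\<in>\<Omega>. path 0 \<omega> \<in> C}"
proof -
  have "emeasure (path_law w) C = emeasure (P w) (path 0 -` C \<inter> space (P w))"
    unfolding path_law_def using assms by (intro emeasure_distr[OF path_measurable]) simp
  also have "path 0 -` C \<inter> space (P w) = {\<omega>\<in>\<Omega>. path 0 \<omega> \<in> C}" by auto
  finally show ?thesis .
qed

lemma nn_integral_occ: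
  "(\<integral>\<^sup>+p. occ x r T p \<partial>path_law w) =
    (\<integral>\<^sup>+u. indicator {u. 0 \<le> u \<and> ennreal u \<le> T} u * emeasure (P w) {\<omega>\<in>\<Omega>. X (ennreal u) \<omega> \<in> Some ` ball x r} \<partial>lborel)"
proof -
  interpret prob_space "P w" by (rule prob_space_P)
  interpret pair_sigma_finite "P w" lborel ..
  let ?G = "\<lambda>\<omega> u. indicator {u. 0 \<le> u \<and> ennreal u \<le> T \<and> near x r T (path 0 \<omega>) u} u :: ennreal"
  have [measurable]: "Measurable.pred (P w \<Otimes>\<^sub>M lborel) (\<lambda>y. near x r T (path 0 (fst y)) (snd y))"
    by (rule pred_near_gen) (simp add: path_def)
  have G: "(\<lambda>(\<omega>, u). ?G \<omega> u) \<in> borel_measurable (P w \<Otimes>\<^sub>M lborel)"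
  proof -
    have "(\<lambda>y. indicator {y. 0 \<le> snd y \<and> ennreal (snd y) \<le> T \<and> near x r T (path 0 (fst y)) (snd y)} y :: ennreal)
      \<in> borel_measurable (P w \<Otimes>\<^sub>M lborel)"
      by measurable
    also have "(\<lambda>y. indicator {y. 0 \<le> snd y \<and> ennreal (snd y) \<le> T \<and> near x r T (path 0 (fst y)) (snd y)} y :: ennreal)
      = (\<lambda>(\<omega>, u). ?G \<omega> u)"
      by (auto split: split_indicator simp: fun_eq_iff)
    finally show ?thesis .
  qed
  have "(\<integral>\<^sup>+p. occ x r T p \<partial>path_law w) = (\<integral>\<^sup>+\<omega>. occ x r T (path 0 \<omega>) \<partial>P w)"
    by (rule nn_integral_path_law[OF measurable_occ])
  also have "\<dots> = (\<integral>\<^sup>+u. (\<integral>\<^sup>+\<omega>. ?G \<omega> u \<partial>P w) \<partial>lborel)"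
    unfolding occ_def by (rule Fubini'[OF G, symmetric])
  also have "\<dots> = (\<integral>\<^sup>+u. indicator {u. 0 \<le> u \<and> ennreal u \<le> T} u * emeasure (P w) {\<omega>\<in>\<Omega>. X (ennreal u) \<omega> \<in> Some ` ball x r} \<partial>lborel)"
  proof (rule nn_integral_cong)
    fix u :: real
    have "(\<integral>\<^sup>+\<omega>. ?G \<omega> u \<partial>P w) = (\<integral>\<^sup>+\<omega>. indicator {u. 0 \<le> u \<and> ennreal u \<le> T} u *
        indicator {\<omega>\<in>\<Omega>. X (ennreal u) \<omega> \<in> Some ` ball x r} \<omega> \<partial>P w)"
      using near_path[of _ u T x r 0] by (intro nn_integral_cong) (auto split: split_indicator)
    also have "\<dots> = indicator {u. 0 \<le> u \<and> ennreal u \<le> T} u * emeasure (P w) {\<omega>\<in>\<Omega>. X (ennreal u) \<omega> \<in> Some ` ball x r}"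
      by (intro nn_integral_cmult_indicator X_event open_imp_Some_in_cem_borel) simp
    finally show "(\<integral>\<^sup>+\<omega>. ?G \<omega> u \<partial>P w) = indicator {u. 0 \<le> u \<and> ennreal u \<le> T} u * emeasure (P w) {\<omega>\<in>\<Omega>. X (ennreal u) \<omega> \<in> Some ` ball x r}" .
  qed
  finally show ?thesis .
qed

section \<open>Events on path space and decompositions at a first index\<close>

definition pr :: "'a option \<Rightarrow> ((ennreal \<Rightarrow> 'a option) \<Rightarrow> bool) \<Rightarrow> ennreal" where
  "pr w A = emeasure (path_law w) {p. A p}"

lemma pr_le_1: "pr w A \<le> 1"
  unfolding pr_def using prob_space.emeasure_le_1[OF prob_space_path_law] .

lemma pred_path_sets: "Measurable.pred path_space A \<Longrightarrow> {p. A p} \<in> sets path_space"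
  by (simp add: pred_def space_PiM)

lemma pr_eq: "Measurable.pred path_space A \<Longrightarrow> pr w A = emeasure (P w) {\<omega>\<in>\<Omega>. A (path 0 \<omega>)}"
  unfolding pr_def by (subst emeasure_path_law) (simp_all add: pred_path_sets)

lemma event_path: "Measurable.pred path_space A \<Longrightarrow> {\<omega>\<in>\<Omega>. A (path t \<omega>)} \<in> sets (P z)"
  using measurable_sets[OF path_measurable[of t z] pred_path_sets] by (simp add: vimage_def Collect_conj_eq Int_commute)

lemma measurable_pr: "Measurable.pred path_space A \<Longrightarrow> (\<lambda>w. pr w A) \<in> borel_measurable cem_borel"
  unfolding pr_def
  by (rule measurable_compose[OF measurable_path_law_subprob measurable_emeasure_subprob_algebra])
    (rule pred_path_sets)

lemma markov_event:
  assumes "G \<in> sets (F t)" "Measurable.pred path_space A"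
  shows "emeasure (P z) (G \<inter> {\<omega>\<in>\<Omega>. A (path t \<omega>)}) = (\<integral>\<^sup>+\<omega>. indicator G \<omega> * pr (X t \<omega>) A \<partial>P z)"
proof -
  have "path t -` {p. A p} \<inter> space (P z) = {\<omega>\<in>\<Omega>. A (path t \<omega>)}" by auto
  with markov_set[OF assms(1) pred_path_sets[OF assms(2)]] show ?thesis by (simp add: pr_def)
qed

lemma pr_mono: "Measurable.pred path_space A \<Longrightarrow> Measurable.pred path_space B \<Longrightarrow>
   (\<And>\<omega>. \<omega> \<in> \<Omega> \<Longrightarrow> A (path 0 \<omega>) \<Longrightarrow> B (path 0 \<omega>)) \<Longrightarrow> pr w A \<le> pr w B"
  by (simp add: pr_eq) (rule emeasure_mono, auto intro: event_path)

lemma disjointed_F: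
  assumes Q: "\<And>k. Q k \<in> sets (F (t k))" and t: "incseq t"
  shows "disjointed Q k \<in> sets (F (t k))"
proof -
  have "Q i \<in> sets (F (t k))" if "i \<le> k" for i
    using Q[of i] sets_F_mono[of "t i" "t k"] incseqD[OF t that] by auto
  then show ?thesis unfolding disjointed_def by (intro sets.Diff sets.countable_UN'') auto
qed

text \<open>A discrete substitute for the strong Markov property at a hitting time:
  \<open>disjointed Q k\<close> says that \<open>k\<close> is the first index with
  \<open>Q k\<close>, and on each such piece the Markov property is applied at the deterministic
  time \<open>t k\<close>.\<close>

lemma first_time_le:
  assumes Q: "\<And>k. Q k \<in> sets (F (t k))" and t: "incseq t" and A: "Measurable.pred path_space A"
    and c: "\<And>k \<omega>. \<omega> \<in> Q k \<Longrightarrow> pr (X (t k) \<omega>) A \<le> c"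
    and E: "E \<subseteq> \<Omega>" "\<And>\<omega>. \<omega> \<in> E \<Longrightarrow> \<exists>k. \<omega> \<in> Q k"
      "\<And>\<omega> k. \<omega> \<in> E \<Longrightarrow> \<omega> \<in> Q k \<Longrightarrow> \<forall>i<k. \<omega> \<notin> Q i \<Longrightarrow> A (path (t k) \<omega>)"
  shows "emeasure (P z) E \<le> c * emeasure (P z) (\<Union>k. Q k)"
proof -
  let ?G = "disjointed Q"
  have G: "?G k \<in> sets (F (t k))" for k using disjointed_F[OF Q t] .
  have G': "?G k \<in> sets (P z)" for k using G sets_F_P by blast
  have "E \<subseteq> (\<Union>k. ?G k \<inter> {\<omega>\<in>\<Omega>. A (path (t k) \<omega>)})"
  proof
    fix \<omega> assume w: "\<omega> \<in> E"
    then have "\<omega> \<in> (\<Union>k. ?G k)" using E(2) by (simp add: UN_disjointed_eq)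
    then obtain k where k: "\<omega> \<in> ?G k" by blast
    then have "\<omega> \<in> Q k" "\<forall>i<k. \<omega> \<notin> Q i" by (auto simp: disjointed_def)
    with w k E show "\<omega> \<in> (\<Union>k. ?G k \<inter> {\<omega>\<in>\<Omega>. A (path (t k) \<omega>)})" by blast
  qed
  then have "emeasure (P z) E \<le> emeasure (P z) (\<Union>k. ?G k \<inter> {\<omega>\<in>\<Omega>. A (path (t k) \<omega>)})"
    by (rule emeasure_mono) (auto intro!: sets.countable_UN sets.Int G' event_path A)
  also have "\<dots> \<le> (\<Sum>k. emeasure (P z) (?G k \<inter> {\<omega>\<in>\<Omega>. A (path (t k) \<omega>)}))"
    by (rule emeasure_subadditive_countably) (auto intro!: sets.Int G' event_path A)
  also have "\<dots> \<le> (\<Sum>k. c * emeasure (P z) (?G k))"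
  proof (rule suminf_le)
    fix k
    have "emeasure (P z) (?G k \<inter> {\<omega>\<in>\<Omega>. A (path (t k) \<omega>)}) = (\<integral>\<^sup>+\<omega>. indicator (?G k) \<omega> * pr (X (t k) \<omega>) A \<partial>P z)"
      by (rule markov_event[OF G A])
    also have "\<dots> \<le> (\<integral>\<^sup>+\<omega>. c * indicator (?G k) \<omega> \<partial>P z)"
      using c disjointed_subset[of Q k] by (intro nn_integral_mono) (auto split: split_indicator)
    also have "\<dots> = c * emeasure (P z) (?G k)"
      by (rule nn_integral_cmult_indicator[OF G'])
    finally show "emeasure (P z) (?G k \<inter> {\<omega>\<in>\<Omega>. A (path (t k) \<omega>)}) \<le> c * emeasure (P z) (?G k)" .
  qed auto
  also have "\<dots> = c * (\<Sum>k. emeasure (P z) (?G k))" by simp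
  also have "(\<Sum>k. emeasure (P z) (?G k)) = emeasure (P z) (\<Union>k. ?G k)"
    by (rule suminf_emeasure) (auto intro: G' disjoint_family_disjointed)
  finally show ?thesis by (simp add: UN_disjointed_eq)
qed

text \<open>The pieces belonging to different first indices are disjoint, so the lower bounds
  obtained from the Markov property on each of them add up.\<close>

lemma first_time_ge:
  assumes Q: "\<And>k. Q k \<in> sets (F (t k))" and t: "incseq t" and A: "Measurable.pred path_space A"
    and c: "\<And>k \<omega>. \<omega> \<in> Q k \<Longrightarrow> c \<le> pr (X (t k) \<omega>) A"
    and E: "E \<in> sets (P z)"
      "\<And>\<omega> k. \<omega> \<in> \<Omega> \<Longrightarrow> \<omega> \<in> Q k \<Longrightarrow> \<forall>i<k. \<omega> \<notin> Q i \<Longrightarrow> A (path (t k) \<omega>) \<Longrightarrow> \<omega> \<in> E"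
  shows "c * emeasure (P z) (\<Union>k. Q k) \<le> emeasure (P z) E"
proof -
  let ?G = "disjointed Q"
  have G: "?G k \<in> sets (F (t k))" for k using disjointed_F[OF Q t] .
  have G': "?G k \<in> sets (P z)" for k using G sets_F_P by blast
  let ?H = "\<lambda>k. ?G k \<inter> {\<omega>\<in>\<Omega>. A (path (t k) \<omega>)}"
  have H: "?H k \<in> sets (P z)" for k by (intro sets.Int G' event_path A)
  have "c * emeasure (P z) (\<Union>k. Q k) = c * emeasure (P z) (\<Union>k. ?G k)" by (simp add: UN_disjointed_eq)
  also have "emeasure (P z) (\<Union>k. ?G k) = (\<Sum>k. emeasure (P z) (?G k))"
    by (rule suminf_emeasure[symmetric]) (auto intro: G' disjoint_family_disjointed)
  also have "c * (\<Sum>k. emeasure (P z) (?G k)) = (\<Sum>k. c * emeasure (P z) (?G k))" by simp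
  also have "\<dots> \<le> (\<Sum>k. emeasure (P z) (?H k))"
  proof (rule suminf_le)
    fix k
    have "c * emeasure (P z) (?G k) = (\<integral>\<^sup>+\<omega>. c * indicator (?G k) \<omega> \<partial>P z)"
      by (rule nn_integral_cmult_indicator[OF G', symmetric])
    also have "\<dots> \<le> (\<integral>\<^sup>+\<omega>. indicator (?G k) \<omega> * pr (X (t k) \<omega>) A \<partial>P z)"
      using c disjointed_subset[of Q k] by (intro nn_integral_mono) (auto split: split_indicator)
    also have "\<dots> = emeasure (P z) (?H k)"
      by (rule markov_event[OF G A, symmetric])
    finally show "c * emeasure (P z) (?G k) \<le> emeasure (P z) (?H k)" .
  qed auto
  also have "\<dots> = emeasure (P z) (\<Union>k. ?H k)"
    using disjoint_family_disjointed[of Q] H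
    by (intro suminf_emeasure) (auto simp: disjoint_family_on_def)
  also have "\<dots> \<le> emeasure (P z) E"
  proof (rule emeasure_mono[OF _ E(1)])
    show "(\<Union>k. ?H k) \<subseteq> E" using E(2) by (auto simp: disjointed_def)
  qed
  finally show ?thesis .
qed

lemma emeasure_P_le_1: "emeasure (P z) A \<le> 1"
  using prob_space.emeasure_le_1[OF prob_space_P] .

lemma path_apply: "path t \<omega> s = X (t + s) \<omega>"
  by (simp add: path_def)

definition shift :: "ennreal \<Rightarrow> (ennreal \<Rightarrow> 'a option) \<Rightarrow> ennreal \<Rightarrow> 'a option" where
  "shift t p = (\<lambda>s. p (t + s))"

lemma shift_path [simp]: "shift t (path s \<omega>) = path (s + t) \<omega>"
  by (simp add: shift_def path_def fun_eq_iff add.assoc)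

lemma measurable_shift [measurable]: "shift t \<in> measurable path_space path_space"
  unfolding shift_def by (intro measurable_PiM_single') auto

lemma ball_cem [measurable]: "Some ` ball x r \<in> sets cem_borel"
  by (rule open_imp_Some_in_cem_borel) simp

lemma pr_markov:
  assumes A: "Measurable.pred path_space A" and B: "Measurable.pred path_space B"
    and s: "\<And>\<omega>. \<omega> \<in> \<Omega> \<Longrightarrow> A (path t \<omega>) \<Longrightarrow> B (path 0 \<omega>)"
  shows "(\<integral>\<^sup>+\<omega>. pr (X t \<omega>) A \<partial>P w) \<le> pr w B"
proof -
  have "(\<integral>\<^sup>+\<omega>. pr (X t \<omega>) A \<partial>P w) = (\<integral>\<^sup>+\<omega>. indicator \<Omega> \<omega> * pr (X t \<omega>) A \<partial>P w)"
    by (intro nn_integral_cong) simp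
  also have "\<dots> = emeasure (P w) (\<Omega> \<inter> {\<omega>\<in>\<Omega>. A (path t \<omega>)})"
    using sets.top[of "F t"] by (intro markov_event[symmetric, OF _ A]) (simp add: space_F)
  also have "\<dots> \<le> emeasure (P w) {\<omega>\<in>\<Omega>. B (path 0 \<omega>)}"
    using s by (intro emeasure_mono event_path B) auto
  also have "\<dots> = pr w B" by (rule pr_eq[OF B, symmetric])
  finally show ?thesis .
qed

lemma pr_markov_eq:
  assumes A: "Measurable.pred path_space A"
  shows "(\<integral>\<^sup>+\<omega>. pr (X t \<omega>) A \<partial>P w) = emeasure (P w) {\<omega>\<in>\<Omega>. A (path t \<omega>)}"
proof -
  have "(\<integral>\<^sup>+\<omega>. pr (X t \<omega>) A \<partial>P w) = (\<integral>\<^sup>+\<omega>. indicator \<Omega> \<omega> * pr (X t \<omega>) A \<partial>P w)"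
    by (intro nn_integral_cong) simp
  also have "\<dots> = emeasure (P w) (\<Omega> \<inter> {\<omega>\<in>\<Omega>. A (path t \<omega>)})"
    using sets.top[of "F t"] by (intro markov_event[symmetric, OF _ A]) (simp add: space_F)
  also have "\<Omega> \<inter> {\<omega>\<in>\<Omega>. A (path t \<omega>)} = {\<omega>\<in>\<Omega>. A (path t \<omega>)}" by auto
  finally show ?thesis .
qed

end

section \<open>Occupation of one ball on a fixed scale\<close>

text \<open>
  The occupied ball has radius \<open>r\<close>, visits are counted in the ball \<open>D\<close> of radius \<open>\<rho>\<close>, and the process is
  sampled at the multiples of \<open>u / H\<close>. In the application \<open>\<nu>\<close> is the normalised restriction of \<open>\<mu>\<close> to \<open>D\<close>.
  Assumption \<open>j0\<close> bounds by \<open>2\<^bsup>-j0\<^esup>\<close> the probability of occupying the small ball for a time \<open>u\<close> without being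
  seen in \<open>D\<close> on the grid; \<open>CH\<close> grows only polynomially in \<open>H\<close>, so this error beats it.
\<close>

locale two_ball = borel_standard_process \<Omega> F X P
  for \<Omega> :: "'w set" and F :: "ennreal \<Rightarrow> 'w measure"
    and X :: "ennreal \<Rightarrow> 'w \<Rightarrow> 'a::{metric_space, second_countable_topology} option"
    and P :: "'a option \<Rightarrow> 'w measure" +
  fixes c C \<gamma> :: real and H j0 :: nat and CH :: real and u :: real and x :: 'a and r \<rho> :: real
    and \<nu> :: "'a measure"
  assumes c: "0 < c" "c \<le> 1" and C: "1 \<le> C" and gam: "1 < \<gamma>" and H: "1 \<le> H" and CH: "1 \<le> CH"
    and u: "0 < u" and r\<rho>: "r \<le> \<rho>"
    and nu: "sets \<nu> = sets borel" "emeasure \<nu> UNIV \<le> 1"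
    and A1: "\<And>y s. y \<in> ball x r \<Longrightarrow> 0 \<le> s \<Longrightarrow> s \<le> u / real H \<Longrightarrow>
        ennreal c \<le> pr (Some y) (\<lambda>p. p (ennreal s) \<in> Some ` ball x \<rho>)"
    and A2: "\<And>y t g. y \<in> ball x \<rho> \<Longrightarrow> u \<le> t \<Longrightarrow> g \<in> borel_measurable borel \<Longrightarrow> (\<And>y. g y \<le> 1) \<Longrightarrow>
        (\<integral>\<^sup>+\<omega>. case_option 0 (\<lambda>y. indicator (ball x \<rho>) y * g y) (X (ennreal t) \<omega>) \<partial>P (Some y))
          \<le> ennreal (C * (u / t) powr \<gamma>) * (\<integral>\<^sup>+y. g y \<partial>\<nu>)"
    and A3: "\<And>y g. y \<in> ball x \<rho> \<Longrightarrow> g \<in> borel_measurable borel \<Longrightarrow> (\<And>y. g y \<le> 1) \<Longrightarrow>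
        ennreal c * (\<integral>\<^sup>+y. g y \<partial>\<nu>) \<le> (\<integral>\<^sup>+\<omega>. case_option 0 g (X (ennreal u) \<omega>) \<partial>P (Some y))"
    and A4: "\<And>y. y \<in> ball x \<rho> \<Longrightarrow>
        ennreal c \<le> pr (Some y) (\<lambda>p. ennreal (7 * u) < occ x r (ennreal (9 * u)) p \<and> p (ennreal (9 * u)) \<in> Some ` ball x \<rho>)"
    and j0: "real j0 * (2 / c + 1) \<le> real H"
    and CH_sum: "(\<Sum>k. ennreal (C * (real H / real (H + Suc k)) powr \<gamma>)) \<le> ennreal CH"
    and CH_small: "(CH + 2) * (1/2) ^ j0 \<le> c / 8"
begin

definition h :: real where "h = u / real H"
definition tk :: "nat \<Rightarrow> ennreal" where "tk k = ennreal (real k * h)"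
abbreviation D :: "'a option set" where "D \<equiv> Some ` ball x \<rho>"
text \<open>The mean occupation before the first grid visit to \<open>D\<close> is at most
  \<open>h / c\<close>; at twice that level Markov's inequality gives probability one half
  (\<open>Np_K0\<close>).\<close>

definition K0 :: real where "K0 = 2 * h / c"
definition \<delta> :: ennreal where "\<delta> = ennreal ((1/2) ^ j0)"

text \<open>
  \<open>Np K\<close>: occupation beyond \<open>K\<close> before the first grid visit to \<open>D\<close>. \<open>Jp b\<close>: level \<open>b\<close> is exceeded
  at a grid visit to \<open>D\<close>. \<open>Rp b\<close>: it is exceeded after a grid visit to \<open>D\<close>.
\<close>

definition exc :: "real \<Rightarrow> 'a option \<Rightarrow> ennreal" where
  "exc b w = pr w (\<lambda>p. ennreal b < occ x r \<infinity> p)"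
definition sS :: "real \<Rightarrow> ennreal" where "sS b = (SUP w. exc b w)"
definition sD :: "real \<Rightarrow> ennreal" where "sD b = (SUP y\<in>ball x \<rho>. exc b (Some y))"
definition Np :: "real \<Rightarrow> (ennreal \<Rightarrow> 'a option) \<Rightarrow> bool" where
  "Np K p \<longleftrightarrow> (\<exists>m. ennreal K < occ x r (tk m) p \<and> (\<forall>k\<in>{1..m}. p (tk k) \<notin> D))"
definition Jp :: "real \<Rightarrow> (ennreal \<Rightarrow> 'a option) \<Rightarrow> bool" where
  "Jp b p \<longleftrightarrow> (\<exists>k\<ge>1. ennreal b < occ x r (tk k) p \<and> p (tk k) \<in> D)"
definition iD :: "real \<Rightarrow> ennreal" where "iD b = (INF y\<in>ball x \<rho>. pr (Some y) (Jp b))"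
definition Rp :: "real \<Rightarrow> (ennreal \<Rightarrow> 'a option) \<Rightarrow> bool" where
  "Rp b p \<longleftrightarrow> (\<exists>k\<ge>1. p (tk k) \<in> D \<and> ennreal b < occ x r \<infinity> (shift (tk k) p))"

lemma h: "0 < h" using u H by (simp add: h_def)
lemma Hh: "real H * h = u" using H by (simp add: h_def)
lemma h_le_u: "h \<le> u" using H u by (simp add: h_def field_simps)
lemma tk_add: "tk (i + k) = tk i + tk k" unfolding tk_def using h by (simp add: algebra_simps flip: ennreal_plus)
lemma tk_0 [simp]: "tk 0 = 0" by (simp add: tk_def)
lemma tk_H: "tk H = ennreal u" by (simp add: tk_def Hh)
lemma tk_1: "tk (Suc 0) = ennreal h" by (simp add: tk_def)
lemma tk_Suc: "tk (Suc k) = tk k + ennreal h" using tk_add[of k 1] by (simp add: tk_1)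
lemma tk_mono: "i \<le> k \<Longrightarrow> tk i \<le> tk k" unfolding tk_def using h by (intro ennreal_leI mult_right_mono) auto
lemma incseq_tk: "incseq tk" by (auto simp: incseq_def tk_mono)
lemma K0: "0 < K0" using h c by (simp add: K0_def)

lemma pred_exc [measurable]: "Measurable.pred path_space (\<lambda>p. ennreal b < occ x r T p)"
  by measurable
lemma pred_Np [measurable]: "Measurable.pred path_space (Np K)"
  unfolding Np_def by measurable
lemma pred_Jp [measurable]: "Measurable.pred path_space (Jp b)"
  unfolding Jp_def by measurable
lemma pred_Rp [measurable]: "Measurable.pred path_space (Rp b)"
  unfolding Rp_def by measurable

lemma exc_le_sS: "exc b w \<le> sS b"
  unfolding sS_def by (rule SUP_upper) simp
lemma exc_le_1: "exc b w \<le> 1" by (simp add: exc_def pr_le_1)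
lemma sS_le_1: "sS b \<le> 1" unfolding sS_def by (intro SUP_least exc_le_1)
lemma exc_le_sD: "y \<in> ball x \<rho> \<Longrightarrow> exc b (Some y) \<le> sD b"
  unfolding sD_def by (rule SUP_upper)
lemma exc_antimono: "b \<le> b' \<Longrightarrow> exc b' w \<le> exc b w"
  unfolding exc_def by (intro pr_mono) (auto intro: order_le_less_trans[OF ennreal_leI])
lemma sS_antimono: "b \<le> b' \<Longrightarrow> sS b' \<le> sS b"
  unfolding sS_def by (intro SUP_mono) (auto intro: exc_antimono)
lemma occ_tk_add:
  "\<omega> \<in> \<Omega> \<Longrightarrow> occ x r (tk i + T) (path s \<omega>) = occ x r (tk i) (path s \<omega>) + occ x r T (path (s + tk i) \<omega>)"
  unfolding tk_def using h by (intro occ_split) auto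

lemma occ_tk_Suc_le: "\<omega> \<in> \<Omega> \<Longrightarrow> occ x r (tk (Suc k)) (path s \<omega>) \<le> occ x r (tk k) (path s \<omega>) + ennreal h"
  unfolding tk_Suc by (subst occ_tk_add) (auto intro!: add_left_mono occ_le)

lemma occ_inf_split: "\<omega> \<in> \<Omega> \<Longrightarrow> occ x r \<infinity> (path s \<omega>) = occ x r (tk i) (path s \<omega>) + occ x r \<infinity> (path (s + tk i) \<omega>)"
  using occ_tk_add[of \<omega> i \<infinity> s] by simp

lemma occ_inf_exceeds:
  assumes "\<omega> \<in> \<Omega>" "b < occ x r \<infinity> (path s \<omega>)"
  obtains k where "b < occ x r (tk k) (path s \<omega>)"
  using assms(2) unfolding occ_SUP[OF assms(1) h] less_SUP_iff tk_def by blast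

lemma event_F:
  assumes "s + T \<le> t"
  shows "{\<omega>\<in>\<Omega>. ennreal b < occ x r T (path s \<omega>)} \<in> sets (F t)"
proof -
  have "(\<lambda>\<omega>. occ x r T (path s \<omega>)) \<in> borel_measurable (F t)"
    using measurable_F_mono[OF assms measurable_occ_path_F] .
  then have "{\<omega>\<in>space (F t). ennreal b < occ x r T (path s \<omega>)} \<in> sets (F t)" by measurable
  then show ?thesis by (simp add: space_F)
qed

lemma X_event_F:
  assumes "s \<le> t" "B \<in> sets cem_borel"
  shows "{\<omega>\<in>\<Omega>. X s \<omega> \<in> B} \<in> sets (F t)"
  using measurable_sets[OF measurable_F_mono[OF assms(1) adapted] assms(2)]
  by (simp add: vimage_def Collect_conj_eq Int_commute space_F)

text \<open>Time \<open>0\<close> is left out, so that after a restart from a point of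
  \<open>D\<close> the count begins with the next grid time.\<close>

definition noD :: "nat \<Rightarrow> 'w set" where
  "noD m = {\<omega>\<in>\<Omega>. \<forall>k\<in>{1..m}. X (tk k) \<omega> \<notin> D}"

lemma noD_F: "noD m \<in> sets (F (tk m))"
proof -
  have "noD m = \<Omega> - (\<Union>k\<in>{1..m}. {\<omega>\<in>\<Omega>. X (tk k) \<omega> \<in> D})" by (auto simp: noD_def)
  also have "\<dots> \<in> sets (F (tk m))"
    using sets.top[of "F (tk m)"] by (intro sets.Diff sets.finite_UN X_event_F tk_mono) (auto simp: space_F)
  finally show ?thesis .
qed

text \<open>From any moment \<open>s\<close> of the step at which the small ball is occupied,
  \<open>A1\<close> leads to \<open>D\<close> at the end of the step with probability at least
  \<open>c\<close>. Integrating over \<open>s\<close> in \<open>{0..h}\<close> gives the factor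
  \<open>h\<close>.\<close>

lemma expected_occ_step:
  "ennreal c * (\<integral>\<^sup>+p. occ x r (ennreal h) p \<partial>path_law w) \<le> ennreal h * pr w (\<lambda>p. p (ennreal h) \<in> D)"
proof -
  let ?q = "\<lambda>s. emeasure (P w) {\<omega>\<in>\<Omega>. X (ennreal s) \<omega> \<in> Some ` ball x r}"
  have q: "ennreal c * ?q s \<le> pr w (\<lambda>p. p (ennreal h) \<in> D)" if s: "0 \<le> s" "s \<le> h" for s
  proof -
    let ?G = "{\<omega>\<in>\<Omega>. X (ennreal s) \<omega> \<in> Some ` ball x r}"
    let ?A = "\<lambda>p. p (ennreal (h - s)) \<in> D"
    have G: "?G \<in> sets (F (ennreal s))" by (rule X_event_F) auto
    have "ennreal c * ?q s = (\<integral>\<^sup>+\<omega>. ennreal c * indicator ?G \<omega> \<partial>P w)"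
      by (rule nn_integral_cmult_indicator[symmetric, OF sets_F_P[OF G]])
    also have "\<dots> \<le> (\<integral>\<^sup>+\<omega>. indicator ?G \<omega> * pr (X (ennreal s) \<omega>) ?A \<partial>P w)"
      using s A1[of _ "h - s"] by (intro nn_integral_mono) (auto split: split_indicator simp: h_def)
    also have "\<dots> = emeasure (P w) (?G \<inter> {\<omega>\<in>\<Omega>. ?A (path (ennreal s) \<omega>)})"
      by (rule markov_event[OF G, symmetric]) measurable
    also have "\<dots> \<le> emeasure (P w) {\<omega>\<in>\<Omega>. path 0 \<omega> (ennreal h) \<in> D}"
    proof (rule emeasure_mono)
      show "{\<omega>\<in>\<Omega>. path 0 \<omega> (ennreal h) \<in> D} \<in> sets (P w)" by (rule event_path) measurable
      have "ennreal s + ennreal (h - s) = ennreal h" using s by (simp flip: ennreal_plus)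
      then show "?G \<inter> {\<omega>\<in>\<Omega>. ?A (path (ennreal s) \<omega>)} \<subseteq> {\<omega>\<in>\<Omega>. path 0 \<omega> (ennreal h) \<in> D}"
        by (auto simp: path_apply)
    qed
    also have "\<dots> = pr w (\<lambda>p. p (ennreal h) \<in> D)" by (rule pr_eq[symmetric]) measurable
    finally show ?thesis .
  qed
  have cc: "ennreal (1 / c) * ennreal c = 1" using c by (simp flip: ennreal_mult')
  have q': "?q s \<le> ennreal (1 / c) * pr w (\<lambda>p. p (ennreal h) \<in> D)" if s: "0 \<le> s" "s \<le> h" for s
    using mult_left_mono[OF q[OF s], of "ennreal (1 / c)"] cc by (simp add: mult.assoc[symmetric])
  have "(\<integral>\<^sup>+p. occ x r (ennreal h) p \<partial>path_law w)
      \<le> (\<integral>\<^sup>+s. (ennreal (1 / c) * pr w (\<lambda>p. p (ennreal h) \<in> D)) * indicator {0..h} s \<partial>lborel)"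
    unfolding nn_integral_occ using q' h by (intro nn_integral_mono) (auto split: split_indicator)
  also have "\<dots> = (ennreal (1 / c) * pr w (\<lambda>p. p (ennreal h) \<in> D)) * ennreal h"
    using h by (subst nn_integral_cmult_indicator) auto
  finally have "ennreal c * (\<integral>\<^sup>+p. occ x r (ennreal h) p \<partial>path_law w)
      \<le> ennreal c * ((ennreal (1 / c) * pr w (\<lambda>p. p (ennreal h) \<in> D)) * ennreal h)"
    by (rule mult_left_mono) simp
  also have "\<dots> = (ennreal (1 / c) * ennreal c) * (ennreal h * pr w (\<lambda>p. p (ennreal h) \<in> D))"
    by (simp only: mult_ac)
  finally show ?thesis by (simp add: cc)
qed

end

lemma ennreal_less_add_imp:
  assumes "ennreal (b + b') < s + t" "s \<le> ennreal b" "0 \<le> b" "0 \<le> b'"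
  shows "ennreal b' < t"
proof (rule ccontr)
  assume "\<not> ennreal b' < t"
  then have "s + t \<le> ennreal b + ennreal b'" using assms(2) by (intro add_mono) auto
  also have "\<dots> = ennreal (b + b')" using assms by simp
  finally show False using assms(1) by simp
qed

section \<open>Occupation before the first grid visit\<close>

context two_ball
begin

lemma occ_0 [simp]: "occ x r 0 p = 0"
  using occ_le[of x r 0 p] by simp

lemma occ_eq_sum: "\<omega> \<in> \<Omega> \<Longrightarrow> occ x r (tk m) (path 0 \<omega>) = (\<Sum>k<m. occ x r (ennreal h) (path (tk k) \<omega>))"
proof (induction m)
  case (Suc m)
  then show ?case using occ_tk_add[of \<omega> m "ennreal h" 0] by (simp add: tk_Suc)
qed simp

lemma occ_tk_mono: "\<omega> \<in> \<Omega> \<Longrightarrow> i \<le> k \<Longrightarrow> occ x r (tk i) (path s \<omega>) \<le> occ x r (tk k) (path s \<omega>)"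
  by (intro occ_mono tk_mono) auto

text \<open>Occupation grows by at most \<open>h\<close> per grid step, which bounds the overshoot
  at the first grid time past \<open>b\<close>. The index \<open>0\<close> cannot be such a time
  because occupation starts from \<open>0\<close>.\<close>

lemma first_crossing_le:
  assumes "\<omega> \<in> \<Omega>" "0 \<le> b" "ennreal b < occ x r (tk k) (path 0 \<omega>)"
    "\<forall>i<k. \<not> ennreal b < occ x r (tk i) (path 0 \<omega>)"
  shows "occ x r (tk k) (path 0 \<omega>) \<le> ennreal (b + h)"
proof (cases k)
  case (Suc i)
  then have "occ x r (tk i) (path 0 \<omega>) \<le> ennreal b" using assms(4) by auto
  then have "occ x r (tk k) (path 0 \<omega>) \<le> ennreal b + ennreal h"
    using occ_tk_Suc_le[OF assms(1), of i 0] Suc by (auto intro: order_trans add_right_mono)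
  also have "\<dots> = ennreal (b + h)" using assms(2) h by simp
  finally show ?thesis .
qed (use assms in simp)

text \<open>By \<open>expected_occ_step\<close>, occupation collected in step \<open>k\<close>
  without an earlier visit is charged to the event that the first visit occurs at grid time
  \<open>k + 1\<close>. These events are disjoint, so the mean occupation before the first visit is
  at most \<open>h / c\<close>.\<close>

lemma Np_K0: "pr w (Np K0) \<le> ennreal (1/2)"
proof -
  interpret Pw: prob_space "P w" by (rule prob_space_P)
  let ?u = "\<lambda>k \<omega>. occ x r (ennreal h) (path (tk k) \<omega>)"
  let ?f = "\<lambda>\<omega>. \<Sum>k. indicator (noD k) \<omega> * ?u k \<omega>"
  let ?E = "\<lambda>k. noD k \<inter> {\<omega>\<in>\<Omega>. X (tk (Suc k)) \<omega> \<in> D}"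
  have E: "?E k \<in> sets (P w)" for k
    by (intro sets.Int sets_F_P[OF noD_F] X_event ball_cem)
  have [measurable]: "noD k \<in> sets (P w)" for k by (rule sets_F_P[OF noD_F])
  have trm: "ennreal c * (\<integral>\<^sup>+\<omega>. indicator (noD k) \<omega> * ?u k \<omega> \<partial>P w) \<le> ennreal h * emeasure (P w) (?E k)" for k
  proof -
    have m: "(\<lambda>\<omega>. \<integral>\<^sup>+p. occ x r (ennreal h) p \<partial>path_law (X (tk k) \<omega>)) \<in> borel_measurable (P w)"
      by (rule measurable_compose[OF X_measurable
          measurable_compose[OF measurable_path_law_subprob nn_integral_measurable_subprob_algebra[OF measurable_occ]]])
    have m2: "(\<lambda>\<omega>. pr (X (tk k) \<omega>) (\<lambda>p. p (ennreal h) \<in> D)) \<in> borel_measurable (P w)"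
      by (rule measurable_compose[OF X_measurable measurable_pr]) measurable
    have "(\<integral>\<^sup>+\<omega>. indicator (noD k) \<omega> * ?u k \<omega> \<partial>P w) =
        (\<integral>\<^sup>+\<omega>. indicator (noD k) \<omega> * (\<integral>\<^sup>+p. occ x r (ennreal h) p \<partial>path_law (X (tk k) \<omega>)) \<partial>P w)"
      by (rule markov[OF borel_measurable_indicator[OF noD_F] measurable_occ])
    then have "ennreal c * (\<integral>\<^sup>+\<omega>. indicator (noD k) \<omega> * ?u k \<omega> \<partial>P w) =
       (\<integral>\<^sup>+\<omega>. ennreal c * (indicator (noD k) \<omega> * (\<integral>\<^sup>+p. occ x r (ennreal h) p \<partial>path_law (X (tk k) \<omega>))) \<partial>P w)"
      using m by (simp add: nn_integral_cmult)
    also have "\<dots> \<le> (\<integral>\<^sup>+\<omega>. ennreal h * (indicator (noD k) \<omega> * pr (X (tk k) \<omega>) (\<lambda>p. p (ennreal h) \<in> D)) \<partial>P w)"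
      using expected_occ_step by (intro nn_integral_mono) (auto split: split_indicator)
    also have "\<dots> = ennreal h * (\<integral>\<^sup>+\<omega>. indicator (noD k) \<omega> * pr (X (tk k) \<omega>) (\<lambda>p. p (ennreal h) \<in> D) \<partial>P w)"
      using m2 by (intro nn_integral_cmult) simp
    also have "(\<integral>\<^sup>+\<omega>. indicator (noD k) \<omega> * pr (X (tk k) \<omega>) (\<lambda>p. p (ennreal h) \<in> D) \<partial>P w)
        = emeasure (P w) (noD k \<inter> {\<omega>\<in>\<Omega>. path (tk k) \<omega> (ennreal h) \<in> D})"
      by (rule markov_event[OF noD_F, symmetric]) measurable
    also have "{\<omega>\<in>\<Omega>. path (tk k) \<omega> (ennreal h) \<in> D} = {\<omega>\<in>\<Omega>. X (tk (Suc k)) \<omega> \<in> D}"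
      by (simp add: path_apply tk_Suc)
    finally show ?thesis .
  qed
  have d: "?E i \<inter> ?E k = {}" if "i < k" for i k
  proof -
    have "Suc i \<in> {1..k}" using that by simp
    then have "X (tk (Suc i)) \<omega> \<notin> D" if "\<omega> \<in> noD k" for \<omega> using that unfolding noD_def by blast
    then show ?thesis by blast
  qed
  have disj: "disjoint_family ?E"
    unfolding disjoint_family_on_def
  proof (intro ballI impI)
    fix i k :: nat assume "i \<noteq> k"
    then have "i < k \<or> k < i" by linarith
    with d[of i k] d[of k i] show "?E i \<inter> ?E k = {}" by (auto simp only: Int_commute)
  qed
  have "ennreal c * (\<integral>\<^sup>+\<omega>. ?f \<omega> \<partial>P w) = (\<Sum>k. ennreal c * (\<integral>\<^sup>+\<omega>. indicator (noD k) \<omega> * ?u k \<omega> \<partial>P w))"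
    by (subst nn_integral_suminf) auto
  also have "\<dots> \<le> (\<Sum>k. ennreal h * emeasure (P w) (?E k))"
    by (intro suminf_le trm) auto
  also have "\<dots> = ennreal h * emeasure (P w) (\<Union>k. ?E k)"
    using E disj by (simp add: suminf_emeasure image_subset_iff)
  also have "\<dots> \<le> ennreal h * 1" by (intro mult_left_mono emeasure_P_le_1) simp
  finally have cI: "ennreal c * (\<integral>\<^sup>+\<omega>. ?f \<omega> \<partial>P w) \<le> ennreal h" by simp
  have cc: "ennreal (1 / c) * ennreal c = 1" using c by (simp flip: ennreal_mult')
  have "(\<integral>\<^sup>+\<omega>. ?f \<omega> \<partial>P w) = ennreal (1 / c) * (ennreal c * (\<integral>\<^sup>+\<omega>. ?f \<omega> \<partial>P w))"
    using cc by (simp add: mult.assoc[symmetric])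
  also have "\<dots> \<le> ennreal (1 / c) * ennreal h" by (intro mult_left_mono cI) simp
  finally have I: "(\<integral>\<^sup>+\<omega>. ?f \<omega> \<partial>P w) \<le> ennreal (h / c)"
    using c h by (simp flip: ennreal_mult')
  have "pr w (Np K0) = emeasure (P w) {\<omega>\<in>\<Omega>. Np K0 (path 0 \<omega>)}" by (rule pr_eq) measurable
  also have "\<dots> \<le> emeasure (P w) {\<omega>\<in>space (P w). 1 \<le> ennreal (1 / K0) * ?f \<omega>}"
  proof (rule emeasure_mono)
    show "{\<omega>\<in>space (P w). 1 \<le> ennreal (1 / K0) * ?f \<omega>} \<in> sets (P w)" by measurable
    show "{\<omega>\<in>\<Omega>. Np K0 (path 0 \<omega>)} \<subseteq> {\<omega>\<in>space (P w). 1 \<le> ennreal (1 / K0) * ?f \<omega>}"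
    proof safe
      fix \<omega> assume w: "\<omega> \<in> \<Omega>" and "Np K0 (path 0 \<omega>)"
      then obtain m where m: "ennreal K0 < occ x r (tk m) (path 0 \<omega>)" "\<forall>k\<in>{1..m}. X (tk k) \<omega> \<notin> D"
        by (auto simp: Np_def path_apply)
      show "\<omega> \<in> space (P w)" using w by simp
      have "ennreal K0 \<le> (\<Sum>k<m. ?u k \<omega>)" using m(1) occ_eq_sum[OF w] by simp
      also have "\<dots> = (\<Sum>k<m. indicator (noD k) \<omega> * ?u k \<omega>)"
        using m(2) w by (intro sum.cong) (auto simp: noD_def)
      also have "\<dots> \<le> ?f \<omega>" by (rule sum_le_suminf) auto
      finally have "ennreal (1 / K0) * ennreal K0 \<le> ennreal (1 / K0) * ?f \<omega>" by (rule mult_left_mono) simp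
      moreover have "ennreal (1 / K0) * ennreal K0 = 1" using K0 by (simp flip: ennreal_mult')
      ultimately show "1 \<le> ennreal (1 / K0) * ?f \<omega>" by simp
    qed
  qed
  also have "\<dots> \<le> ennreal (1 / K0) * (\<integral>\<^sup>+\<omega>. ?f \<omega> * indicator (space (P w)) \<omega> \<partial>P w)"
    by (rule nn_integral_Markov_inequality) measurable
  also have "(\<integral>\<^sup>+\<omega>. ?f \<omega> * indicator (space (P w)) \<omega> \<partial>P w) = (\<integral>\<^sup>+\<omega>. ?f \<omega> \<partial>P w)"
    by (intro nn_integral_cong) simp
  also have "ennreal (1 / K0) * \<dots> \<le> ennreal (1 / K0) * ennreal (h / c)" by (intro mult_left_mono I) simp
  also have "\<dots> = ennreal (1/2)" using K0 h c by (simp add: K0_def flip: ennreal_mult')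
  finally show ?thesis .
qed

text \<open>Restart at the first grid time past \<open>K0\<close>. No visit has happened up to then,
  and more than \<open>K\<close> must still be collected without a visit; the summand
  \<open>h\<close> pays for the overshoot.\<close>

lemma Np_step:
  assumes q: "\<And>v. pr v (Np K) \<le> q" and K: "0 \<le> K"
  shows "pr w (Np (K + K0 + h)) \<le> q * ennreal (1/2)"
proof -
  let ?Q = "\<lambda>k. {\<omega>\<in>\<Omega>. ennreal K0 < occ x r (tk k) (path 0 \<omega>)} \<inter> noD k"
  let ?E = "{\<omega>\<in>\<Omega>. Np (K + K0 + h) (path 0 \<omega>)}"
  have "emeasure (P w) ?E \<le> q * emeasure (P w) (\<Union>k. ?Q k)"
  proof (rule first_time_le[where t=tk and A="Np K", OF _ incseq_tk pred_Np q])
    show "?Q k \<in> sets (F (tk k))" for k by (intro sets.Int event_F noD_F) simp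
    show "?E \<subseteq> \<Omega>" by auto
  next
    fix \<omega> assume w: "\<omega> \<in> ?E"
    then obtain m where m: "ennreal (K + K0 + h) < occ x r (tk m) (path 0 \<omega>)" "\<forall>k\<in>{1..m}. X (tk k) \<omega> \<notin> D"
      by (auto simp: Np_def path_apply)
    have "ennreal K0 \<le> ennreal (K + K0 + h)" using K h by (intro ennreal_leI) simp
    then have mQ: "\<omega> \<in> ?Q m" using w m by (auto simp: noD_def)
    then show "\<exists>k. \<omega> \<in> ?Q k" ..
    fix k assume k: "\<omega> \<in> ?Q k" "\<forall>i<k. \<omega> \<notin> ?Q i"
    then have km: "k \<le> m" using mQ not_le by blast
    have "\<forall>i<k. \<omega> \<in> noD i" using k(1) by (auto simp: noD_def)
    then have le: "occ x r (tk k) (path 0 \<omega>) \<le> ennreal (K0 + h)"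
      using k w K0 by (intro first_crossing_le) auto
    have "occ x r (tk m) (path 0 \<omega>) = occ x r (tk k) (path 0 \<omega>) + occ x r (tk (m - k)) (path (tk k) \<omega>)"
      using w km occ_tk_add[of \<omega> k "tk (m - k)" 0] by (simp add: tk_add[symmetric])
    then have "ennreal (K0 + h + K) < occ x r (tk k) (path 0 \<omega>) + occ x r (tk (m - k)) (path (tk k) \<omega>)"
      using m(1) by (simp add: ac_simps)
    from ennreal_less_add_imp[OF this le] have "ennreal K < occ x r (tk (m - k)) (path (tk k) \<omega>)"
      using K K0 h by simp
    moreover have "\<forall>i\<in>{1..m - k}. path (tk k) \<omega> (tk i) \<notin> D"
    proof
      fix i assume "i \<in> {1..m - k}"
      then have "k + i \<in> {1..m}" using km by auto
      with m(2) show "path (tk k) \<omega> (tk i) \<notin> D" by (simp add: path_apply tk_add[symmetric])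
    qed
    ultimately show "Np K (path (tk k) \<omega>)" unfolding Np_def by blast
  qed
  also have "(\<Union>k. ?Q k) = {\<omega>\<in>\<Omega>. Np K0 (path 0 \<omega>)}"
    by (auto simp: Np_def noD_def path_apply)
  also have "emeasure (P w) \<dots> = pr w (Np K0)" by (rule pr_eq[symmetric]) measurable
  also have "q * \<dots> \<le> q * ennreal (1/2)" by (intro mult_left_mono Np_K0) simp
  finally show ?thesis by (simp add: pr_eq)
qed

lemma Np_antimono: "K \<le> K' \<Longrightarrow> pr w (Np K') \<le> pr w (Np K)"
  by (rule pr_mono) (auto simp: Np_def intro: order_le_less_trans[OF ennreal_leI])

lemma Np_power: "pr w (Np (real j * (K0 + h))) \<le> ennreal ((1/2) ^ j)"
proof (induction j arbitrary: w)
  case 0 then show ?case by (simp add: pr_le_1)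
next
  case (Suc j)
  have "real (Suc j) * (K0 + h) = real j * (K0 + h) + K0 + h" by (simp add: algebra_simps)
  moreover have "0 \<le> real j * (K0 + h)" using K0 h by simp
  ultimately have "pr w (Np (real (Suc j) * (K0 + h))) \<le> ennreal ((1/2) ^ j) * ennreal (1/2)"
    using Np_step[OF Suc.IH] by simp
  also have "\<dots> = ennreal ((1/2) ^ j * (1/2))" by (rule ennreal_mult'[symmetric]) simp
  also have "\<dots> = ennreal ((1/2) ^ Suc j)" by (simp add: mult.commute)
  finally show ?case .
qed

text \<open>Assumption \<open>j0\<close> says that \<open>j0\<close> blocks of length
  \<open>K0 + h = (2 / c + 1) * h\<close> fit into \<open>u = H * h\<close>.\<close>

lemma Np_u: "pr w (Np u) \<le> \<delta>"
proof -
  have "real j0 * (K0 + h) = real j0 * (2 / c + 1) * h" by (simp add: K0_def algebra_simps)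
  also have "\<dots> \<le> real H * h" using j0 h by (intro mult_right_mono) auto
  finally have "real j0 * (K0 + h) \<le> u" by (simp add: Hh)
  from Np_antimono[OF this] Np_power[of w j0] show ?thesis unfolding \<delta>_def by (rule order_trans)
qed

section \<open>Decompositions at level crossings and at visits\<close>

lemma exc_eq: "exc b w = emeasure (P w) {\<omega>\<in>\<Omega>. ennreal b < occ x r \<infinity> (path 0 \<omega>)}"
  unfolding exc_def by (rule pr_eq) measurable

lemma Un_crossing:
  "(\<Union>k. {\<omega>\<in>\<Omega>. ennreal b < occ x r (tk k) (path 0 \<omega>)}) = {\<omega>\<in>\<Omega>. ennreal b < occ x r \<infinity> (path 0 \<omega>)}"
proof safe
  fix k \<omega> assume w: "\<omega> \<in> \<Omega>" and k: "ennreal b < occ x r (tk k) (path 0 \<omega>)"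
  have "occ x r (tk k) (path 0 \<omega>) \<le> occ x r \<infinity> (path 0 \<omega>)"
    using w by (rule occ_mono) auto
  with k show "ennreal b < occ x r \<infinity> (path 0 \<omega>)" by (rule order_less_le_trans)
next
  fix \<omega> assume w: "\<omega> \<in> \<Omega>" "ennreal b < occ x r \<infinity> (path 0 \<omega>)"
  from occ_inf_exceeds[OF this] obtain k where "ennreal b < occ x r (tk k) (path 0 \<omega>)" .
  with w show "\<omega> \<in> (\<Union>k. {\<omega>\<in>\<Omega>. ennreal b < occ x r (tk k) (path 0 \<omega>)})" by blast
qed

lemma least_crossing:
  assumes "\<omega> \<in> \<Omega>" "ennreal b < occ x r \<infinity> (path 0 \<omega>)"
  obtains k where "ennreal b < occ x r (tk k) (path 0 \<omega>)" "\<forall>i<k. \<not> ennreal b < occ x r (tk i) (path 0 \<omega>)"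
proof -
  obtain k where "ennreal b < occ x r (tk k) (path 0 \<omega>)" using occ_inf_exceeds[OF assms] .
  then show thesis using that exists_least_iff[of "\<lambda>k. ennreal b < occ x r (tk k) (path 0 \<omega>)"] by blast
qed

text \<open>Suppose the level is exceeded but \<open>Rp b\<close> fails. At the first crossing of
  \<open>u\<close> more than \<open>b\<close> is still to come, so no visit can have occurred
  before. The part up to this crossing is an instance of \<open>Np u\<close>, of probability at most
  \<open>\<delta>\<close>, and the part after it contributes \<open>sS b\<close>.\<close>

lemma exc_le_Rp:
  assumes b: "0 \<le> b"
  shows "exc (b + u + h) w \<le> pr w (Rp b) + \<delta> * sS b"
proof -
  let ?Q = "\<lambda>k. {\<omega>\<in>\<Omega>. ennreal u < occ x r (tk k) (path 0 \<omega>)} \<inter> noD k"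
  let ?E = "{\<omega>\<in>\<Omega>. ennreal (b + u + h) < occ x r \<infinity> (path 0 \<omega>) \<and> \<not> Rp b (path 0 \<omega>)}"
  have E: "?E \<in> sets (P w)" by (rule event_path) measurable
  have R: "{\<omega>\<in>\<Omega>. Rp b (path 0 \<omega>)} \<in> sets (P w)" by (rule event_path) measurable
  have "emeasure (P w) ?E \<le> sS b * emeasure (P w) (\<Union>k. ?Q k)"
  proof (rule first_time_le[where t=tk and A="\<lambda>p. ennreal b < occ x r \<infinity> p", OF _ incseq_tk pred_exc])
    show "?Q k \<in> sets (F (tk k))" for k by (intro sets.Int event_F noD_F) simp
    show "?E \<subseteq> \<Omega>" by auto
    show "pr (X (tk k) \<omega>) (\<lambda>p. ennreal b < occ x r \<infinity> p) \<le> sS b" for k \<omega>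
      using exc_le_sS unfolding exc_def .
  next
    fix \<omega> assume w: "\<omega> \<in> ?E"
    then have wO: "\<omega> \<in> \<Omega>" and U: "ennreal (b + u + h) < occ x r \<infinity> (path 0 \<omega>)" and nR: "\<not> Rp b (path 0 \<omega>)" by auto
    have "ennreal u \<le> ennreal (b + u + h)" using b h by (intro ennreal_leI) simp
    then have "ennreal u < occ x r \<infinity> (path 0 \<omega>)" using U by simp
    from least_crossing[OF wO this] obtain k where k: "ennreal u < occ x r (tk k) (path 0 \<omega>)"
      "\<forall>i<k. \<not> ennreal u < occ x r (tk i) (path 0 \<omega>)" .
    have le: "occ x r (tk k) (path 0 \<omega>) \<le> ennreal (u + h)"
      using k u by (intro first_crossing_le[OF wO]) auto
    have "ennreal (u + h + b) < occ x r (tk k) (path 0 \<omega>) + occ x r \<infinity> (path (tk k) \<omega>)"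
      using U occ_inf_split[OF wO, of 0 k] by (simp add: ac_simps)
    from ennreal_less_add_imp[OF this le] have Ak: "ennreal b < occ x r \<infinity> (path (tk k) \<omega>)"
      using b u h by simp
    have "\<omega> \<in> noD k"
      unfolding noD_def
    proof (intro CollectI conjI ballI wO)
      fix i assume i: "i \<in> {1..k}"
      show "X (tk i) \<omega> \<notin> D"
      proof
        assume D: "X (tk i) \<omega> \<in> D"
        have "occ x r \<infinity> (path (tk k) \<omega>) \<le> occ x r \<infinity> (path (tk i) \<omega>)"
          using i occ_inf_split[OF wO, of "tk i" "k - i"] by (simp add: tk_add[symmetric])
        with Ak have "ennreal b < occ x r \<infinity> (path (tk i) \<omega>)" by simp
        with D i have "Rp b (path 0 \<omega>)" unfolding Rp_def by (auto simp: path_apply)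
        with nR show False ..
      qed
    qed
    with k wO have kQ: "\<omega> \<in> ?Q k" by simp
    then show "\<exists>k. \<omega> \<in> ?Q k" ..
    fix k' assume k': "\<omega> \<in> ?Q k'" "\<forall>i<k'. \<omega> \<notin> ?Q i"
    then have "k' = k" using k(2) kQ wO by (metis (no_types, lifting) Int_iff linorder_neqE_nat mem_Collect_eq)
    with Ak show "ennreal b < occ x r \<infinity> (path (tk k') \<omega>)" by simp
  qed
  also have "(\<Union>k. ?Q k) = {\<omega>\<in>\<Omega>. Np u (path 0 \<omega>)}"
    by (auto simp: Np_def noD_def path_apply)
  also have "emeasure (P w) \<dots> = pr w (Np u)" by (rule pr_eq[symmetric]) measurable
  also have "sS b * \<dots> \<le> sS b * \<delta>" by (intro mult_left_mono Np_u) simp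
  finally have 1: "emeasure (P w) ?E \<le> \<delta> * sS b" by (simp add: mult.commute)
  have "exc (b + u + h) w \<le> emeasure (P w) ({\<omega>\<in>\<Omega>. Rp b (path 0 \<omega>)} \<union> ?E)"
    unfolding exc_eq using E R by (intro emeasure_mono) auto
  also have "\<dots> \<le> emeasure (P w) {\<omega>\<in>\<Omega>. Rp b (path 0 \<omega>)} + emeasure (P w) ?E"
    using R E by (rule emeasure_subadditive)
  also have "\<dots> \<le> pr w (Rp b) + \<delta> * sS b"
    using 1 by (intro add_mono) (simp_all add: pr_eq)
  finally show ?thesis .
qed

text \<open>What remains after the first visit is at least what remains after any later one.\<close>

lemma Rp_le_sD: "pr w (Rp b) \<le> sD b"
proof -
  let ?Q = "\<lambda>k. if k \<ge> 1 then {\<omega>\<in>\<Omega>. X (tk k) \<omega> \<in> D} else {}"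
  let ?E = "{\<omega>\<in>\<Omega>. Rp b (path 0 \<omega>)}"
  have "emeasure (P w) ?E \<le> sD b * emeasure (P w) (\<Union>k. ?Q k)"
  proof (rule first_time_le[where t=tk and A="\<lambda>p. ennreal b < occ x r \<infinity> p", OF _ incseq_tk pred_exc])
    show "?Q k \<in> sets (F (tk k))" for k using X_event_F[of "tk k" "tk k" D] by simp
    show "?E \<subseteq> \<Omega>" by auto
    show "pr (X (tk k) \<omega>) (\<lambda>p. ennreal b < occ x r \<infinity> p) \<le> sD b" if "\<omega> \<in> ?Q k" for k \<omega>
      using that exc_le_sD unfolding exc_def by (auto split: if_splits)
  next
    fix \<omega> assume w: "\<omega> \<in> ?E"
    then obtain m where m: "m \<ge> 1" "X (tk m) \<omega> \<in> D" "ennreal b < occ x r \<infinity> (path (tk m) \<omega>)" and wO: "\<omega> \<in> \<Omega>"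
      by (auto simp: Rp_def path_apply)
    then have mQ: "\<omega> \<in> ?Q m" by simp
    then show "\<exists>k. \<omega> \<in> ?Q k" ..
    fix k assume k: "\<omega> \<in> ?Q k" "\<forall>i<k. \<omega> \<notin> ?Q i"
    then have "k \<le> m" using mQ not_le by blast
    then have "occ x r \<infinity> (path (tk m) \<omega>) \<le> occ x r \<infinity> (path (tk k) \<omega>)"
      using occ_inf_split[OF wO, of "tk k" "m - k"] by (simp add: tk_add[symmetric])
    with m(3) show "ennreal b < occ x r \<infinity> (path (tk k) \<omega>)" by simp
  qed
  also have "\<dots> \<le> sD b * 1" by (intro mult_left_mono emeasure_P_le_1) simp
  finally show ?thesis by (simp add: pr_eq)
qed

lemma sS_le_sD: "0 \<le> b \<Longrightarrow> sS (b + u + h) \<le> sD b + \<delta> * sS b"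
  unfolding sS_def[of "b + u + h"] by (rule SUP_least) (rule order_trans[OF exc_le_Rp add_right_mono[OF Rp_le_sD]])

text \<open>Bounds the expected number of grid visits to \<open>D\<close> after index
  \<open>n\<close>: the quotient of \<open>H\<close> and the index is \<open>u\<close> divided by
  the grid time, as in \<open>A2\<close>.\<close>

definition tl :: "nat \<Rightarrow> ennreal" where
  "tl n = (\<Sum>k. ennreal (C * (real H / real (n + Suc k)) powr \<gamma>))"

lemma A2_grid:
  assumes y: "y \<in> ball x \<rho>" and k: "H \<le> k" "1 \<le> k" and A: "Measurable.pred path_space A"
  shows "emeasure (P (Some y)) ({\<omega>\<in>\<Omega>. X (tk k) \<omega> \<in> D} \<inter> {\<omega>\<in>\<Omega>. A (path (tk k) \<omega>)})
     \<le> ennreal (C * (real H / real k) powr \<gamma>) * (\<integral>\<^sup>+y. pr (Some y) A \<partial>\<nu>)"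
proof -
  have "u \<le> real k * h" using k h Hh by (metis mult_right_mono of_nat_le_iff less_imp_le)
  moreover have "u / (real k * h) = real H / real k" using h Hh by (metis divide_divide_eq_left mult.commute nonzero_mult_div_cancel_left less_irrefl times_divide_times_eq divide_self mult.right_neutral)
  moreover have "(\<lambda>y. pr (Some y) A) \<in> borel_measurable borel"
    by (rule measurable_compose[OF measurable_Some_cem measurable_pr[OF A]])
  ultimately have A2': "(\<integral>\<^sup>+\<omega>. case_option 0 (\<lambda>y. indicator (ball x \<rho>) y * pr (Some y) A) (X (tk k) \<omega>) \<partial>P (Some y))
     \<le> ennreal (C * (real H / real k) powr \<gamma>) * (\<integral>\<^sup>+y. pr (Some y) A \<partial>\<nu>)"
    using A2[OF y, of "real k * h" "\<lambda>y. pr (Some y) A"] unfolding tk_def by (simp add: pr_le_1)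
  have "emeasure (P (Some y)) ({\<omega>\<in>\<Omega>. X (tk k) \<omega> \<in> D} \<inter> {\<omega>\<in>\<Omega>. A (path (tk k) \<omega>)}) =
     (\<integral>\<^sup>+\<omega>. indicator {\<omega>\<in>\<Omega>. X (tk k) \<omega> \<in> D} \<omega> * pr (X (tk k) \<omega>) A \<partial>P (Some y))"
    by (rule markov_event[OF X_event_F A]) auto
  also have "\<dots> \<le> (\<integral>\<^sup>+\<omega>. case_option 0 (\<lambda>y. indicator (ball x \<rho>) y * pr (Some y) A) (X (tk k) \<omega>) \<partial>P (Some y))"
    by (intro nn_integral_mono) (auto split: split_indicator option.splits)
  finally show ?thesis using A2' by (rule order_trans)
qed

text \<open>The first \<open>n\<close> steps contribute at most \<open>n * h\<close>, which is given
  away. At time \<open>tk n\<close> the bound \<open>exc_le_Rp\<close> leaves a visit after index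
  \<open>n\<close>; a union bound over these visits and \<open>A2_grid\<close> replace the starting
  point by the average over \<open>\<nu>\<close>. All visit times are beyond \<open>u\<close>
  because \<open>H \<le> n\<close>.\<close>

lemma exc_le_nu:
  assumes b: "0 \<le> b" and y: "y \<in> ball x \<rho>" and n: "H \<le> n"
  shows "exc (b + u + h + real n * h) (Some y) \<le> tl n * (\<integral>\<^sup>+y. exc b (Some y) \<partial>\<nu>) + \<delta> * sS b"
proof -
  interpret Py: prob_space "P (Some y)" by (rule prob_space_P)
  let ?M = "P (Some y)" and ?b = "b + u + h"
  have S: "{\<omega>\<in>\<Omega>. X (tk (n + Suc k)) \<omega> \<in> D} \<inter> {\<omega>\<in>\<Omega>. ennreal b < occ x r \<infinity> (path (tk (n + Suc k)) \<omega>)} \<in> sets ?M" for k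
    by (rule sets.Int[OF X_event[OF ball_cem] event_path[where A="\<lambda>p. ennreal b < occ x r \<infinity> p", OF pred_exc]])
  have "exc (?b + real n * h) (Some y) \<le> emeasure ?M {\<omega>\<in>\<Omega>. ennreal ?b < occ x r \<infinity> (path (tk n) \<omega>)}"
    unfolding exc_eq
  proof (rule emeasure_mono)
    show "{\<omega>\<in>\<Omega>. ennreal ?b < occ x r \<infinity> (path (tk n) \<omega>)} \<in> sets ?M"
      by (rule event_path[where A="\<lambda>p. ennreal ?b < occ x r \<infinity> p"]) measurable
    show "{\<omega>\<in>\<Omega>. ennreal (?b + real n * h) < occ x r \<infinity> (path 0 \<omega>)} \<subseteq> {\<omega>\<in>\<Omega>. ennreal ?b < occ x r \<infinity> (path (tk n) \<omega>)}"
    proof safe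
      fix \<omega> assume w: "\<omega> \<in> \<Omega>" and U: "ennreal (?b + real n * h) < occ x r \<infinity> (path 0 \<omega>)"
      have "ennreal (real n * h + ?b) < occ x r (tk n) (path 0 \<omega>) + occ x r \<infinity> (path (tk n) \<omega>)"
        using U occ_inf_split[OF w, of 0 n] by (simp add: ac_simps)
      moreover have "occ x r (tk n) (path 0 \<omega>) \<le> ennreal (real n * h)" using occ_le[of x r "tk n"] by (simp add: tk_def)
      ultimately show "ennreal ?b < occ x r \<infinity> (path (tk n) \<omega>)"
        by (rule ennreal_less_add_imp) (use b u h in auto)
    qed
  qed
  also have "\<dots> = (\<integral>\<^sup>+\<omega>. exc ?b (X (tk n) \<omega>) \<partial>?M)"
    unfolding exc_def by (rule pr_markov_eq[symmetric]) measurable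
  also have "\<dots> \<le> (\<integral>\<^sup>+\<omega>. pr (X (tk n) \<omega>) (Rp b) + \<delta> * sS b \<partial>?M)"
    by (intro nn_integral_mono exc_le_Rp b)
  also have "\<dots> = (\<integral>\<^sup>+\<omega>. pr (X (tk n) \<omega>) (Rp b) \<partial>?M) + (\<integral>\<^sup>+\<omega>. \<delta> * sS b \<partial>?M)"
    by (intro nn_integral_add measurable_compose[OF X_measurable measurable_pr] pred_Rp) simp
  also have "(\<integral>\<^sup>+\<omega>. \<delta> * sS b \<partial>?M) = \<delta> * sS b"
    using Py.emeasure_space_1 by simp
  also have "(\<integral>\<^sup>+\<omega>. pr (X (tk n) \<omega>) (Rp b) \<partial>?M) = emeasure ?M {\<omega>\<in>\<Omega>. Rp b (path (tk n) \<omega>)}"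
    by (rule pr_markov_eq) measurable
  also have "\<dots> \<le> emeasure ?M (\<Union>k. {\<omega>\<in>\<Omega>. X (tk (n + Suc k)) \<omega> \<in> D} \<inter> {\<omega>\<in>\<Omega>. ennreal b < occ x r \<infinity> (path (tk (n + Suc k)) \<omega>)})"
  proof (rule emeasure_mono)
    show "{\<omega>\<in>\<Omega>. Rp b (path (tk n) \<omega>)} \<subseteq> (\<Union>k. {\<omega>\<in>\<Omega>. X (tk (n + Suc k)) \<omega> \<in> D} \<inter> {\<omega>\<in>\<Omega>. ennreal b < occ x r \<infinity> (path (tk (n + Suc k)) \<omega>)})"
    proof safe
      fix \<omega> assume w: "\<omega> \<in> \<Omega>" and "Rp b (path (tk n) \<omega>)"
      then obtain k where k: "k \<ge> 1" "path (tk n) \<omega> (tk k) \<in> D" "ennreal b < occ x r \<infinity> (shift (tk k) (path (tk n) \<omega>))"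
        unfolding Rp_def by blast
      then obtain i where i: "k = Suc i" by (cases k) auto
      show "\<omega> \<in> (\<Union>k. {\<omega>\<in>\<Omega>. X (tk (n + Suc k)) \<omega> \<in> D} \<inter> {\<omega>\<in>\<Omega>. ennreal b < occ x r \<infinity> (path (tk (n + Suc k)) \<omega>)})"
        using k w unfolding i by (intro UN_I[of i]) (auto simp: path_apply tk_add[symmetric])
    qed
    show "(\<Union>k. {\<omega>\<in>\<Omega>. X (tk (n + Suc k)) \<omega> \<in> D} \<inter> {\<omega>\<in>\<Omega>. ennreal b < occ x r \<infinity> (path (tk (n + Suc k)) \<omega>)}) \<in> sets ?M"
      by (rule sets.countable_UN) (use S in blast)
  qed
  also have "\<dots> \<le> (\<Sum>k. emeasure ?M ({\<omega>\<in>\<Omega>. X (tk (n + Suc k)) \<omega> \<in> D} \<inter> {\<omega>\<in>\<Omega>. ennreal b < occ x r \<infinity> (path (tk (n + Suc k)) \<omega>)}))"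
    by (rule emeasure_subadditive_countably)
      (use S in blast)
  also have "\<dots> \<le> (\<Sum>k. ennreal (C * (real H / real (n + Suc k)) powr \<gamma>) * (\<integral>\<^sup>+y. exc b (Some y) \<partial>\<nu>))"
    unfolding exc_def using n by (intro suminf_le A2_grid y pred_exc) auto
  also have "\<dots> = tl n * (\<integral>\<^sup>+y. exc b (Some y) \<partial>\<nu>)"
    unfolding tl_def by simp
  finally show ?thesis by (simp add: add_right_mono)
qed

text \<open>If level \<open>b\<close> is never found exceeded at a visit, then after its first
  crossing more than \<open>u\<close> is collected without a visit. By \<open>Np_u\<close> this has
  conditional probability at most \<open>\<delta>\<close>.\<close>

lemma exc_le_Jp:
  assumes b: "0 \<le> b"
  shows "exc (b + u + h) w \<le> pr w (Jp b) + \<delta> * sS b"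
proof -
  let ?Q = "\<lambda>k. {\<omega>\<in>\<Omega>. ennreal b < occ x r (tk k) (path 0 \<omega>)}"
  let ?E = "{\<omega>\<in>\<Omega>. ennreal (b + u + h) < occ x r \<infinity> (path 0 \<omega>) \<and> \<not> Jp b (path 0 \<omega>)}"
  have E: "?E \<in> sets (P w)" by (rule event_path) measurable
  have J: "{\<omega>\<in>\<Omega>. Jp b (path 0 \<omega>)} \<in> sets (P w)" by (rule event_path) measurable
  have "emeasure (P w) ?E \<le> \<delta> * emeasure (P w) (\<Union>k. ?Q k)"
  proof (rule first_time_le[where t=tk and A="Np u", OF _ incseq_tk pred_Np Np_u])
    show "?Q k \<in> sets (F (tk k))" for k by (intro event_F) simp
    show "?E \<subseteq> \<Omega>" by auto
  next
    fix \<omega> assume w: "\<omega> \<in> ?E"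
    then have wO: "\<omega> \<in> \<Omega>" and U: "ennreal (b + u + h) < occ x r \<infinity> (path 0 \<omega>)" and nJ: "\<not> Jp b (path 0 \<omega>)" by auto
    have "ennreal b \<le> ennreal (b + u + h)" using u h by (intro ennreal_leI) simp
    then have "ennreal b < occ x r \<infinity> (path 0 \<omega>)" using U by simp
    then show "\<exists>k. \<omega> \<in> ?Q k" using occ_inf_exceeds[OF wO] wO by blast
    fix k assume k: "\<omega> \<in> ?Q k" "\<forall>i<k. \<omega> \<notin> ?Q i"
    have le: "occ x r (tk k) (path 0 \<omega>) \<le> ennreal (b + h)"
      using k b wO by (intro first_crossing_le[OF wO]) auto
    have "ennreal (b + h + u) < occ x r (tk k) (path 0 \<omega>) + occ x r \<infinity> (path (tk k) \<omega>)"
      using U occ_inf_split[OF wO, of 0 k] by (simp add: ac_simps)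
    from ennreal_less_add_imp[OF this le] have "ennreal u < occ x r \<infinity> (path (tk k) \<omega>)"
      using b u h by simp
    from occ_inf_exceeds[OF wO this] obtain m where m: "ennreal u < occ x r (tk m) (path (tk k) \<omega>)" .
    have "path (tk k) \<omega> (tk i) \<notin> D" if i: "i \<in> {1..m}" for i
    proof
      assume "path (tk k) \<omega> (tk i) \<in> D"
      then have "X (tk (k + i)) \<omega> \<in> D" by (simp add: path_apply tk_add)
      moreover have "ennreal b < occ x r (tk (k + i)) (path 0 \<omega>)"
        using k(1) occ_tk_mono[OF wO, of k "k + i" 0] by auto
      ultimately have "Jp b (path 0 \<omega>)" unfolding Jp_def using i by (auto simp: path_apply intro!: exI[of _ "k + i"])
      with nJ show False ..
    qed
    with m show "Np u (path (tk k) \<omega>)" unfolding Np_def by blast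
  qed
  also have "\<dots> = \<delta> * exc b w" unfolding Un_crossing exc_eq ..
  also have "\<dots> \<le> \<delta> * sS b" by (intro mult_left_mono exc_le_sS) simp
  finally have 1: "emeasure (P w) ?E \<le> \<delta> * sS b" .
  have "exc (b + u + h) w \<le> emeasure (P w) ({\<omega>\<in>\<Omega>. Jp b (path 0 \<omega>)} \<union> ?E)"
    unfolding exc_eq using E J by (intro emeasure_mono) auto
  also have "\<dots> \<le> emeasure (P w) {\<omega>\<in>\<Omega>. Jp b (path 0 \<omega>)} + emeasure (P w) ?E"
    using J E by (rule emeasure_subadditive)
  also have "\<dots> \<le> pr w (Jp b) + \<delta> * sS b"
    using 1 by (intro add_mono) (simp_all add: pr_eq)
  finally show ?thesis .
qed

lemma pr_True [simp]: "pr w (\<lambda>_. True) = 1"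
  unfolding pr_def using prob_space.emeasure_space_1[OF prob_space_path_law, of w]
  by (simp add: path_law_def space_PiM)

lemma measurable_pr_Some [measurable]:
  "Measurable.pred path_space A \<Longrightarrow> (\<lambda>y. pr (Some y) A) \<in> borel_measurable borel"
  by (rule measurable_compose[OF measurable_Some_cem measurable_pr])

lemma nu_borel: "f \<in> borel_measurable borel \<Longrightarrow> f \<in> borel_measurable \<nu>"
  using measurable_cong_sets[OF nu(1) refl] by auto

lemma nn_integral_nu_const_le: "(\<integral>\<^sup>+y. k \<partial>\<nu>) \<le> k"
proof -
  have "space \<nu> = UNIV" using sets_eq_imp_space_eq[OF nu(1)] by simp
  then have "(\<integral>\<^sup>+y. k \<partial>\<nu>) = k * emeasure \<nu> UNIV" by simp
  also have "\<dots> \<le> k * 1" by (intro mult_left_mono nu) simp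
  finally show ?thesis by simp
qed

lemma Jp_shift:
  assumes "\<omega> \<in> \<Omega>" "Jp b (path (tk i) \<omega>)"
  shows "Jp b (path 0 \<omega>)"
proof -
  from assms(2) obtain k where k: "1 \<le> k" "ennreal b < occ x r (tk k) (path (tk i) \<omega>)" "path (tk i) \<omega> (tk k) \<in> D"
    unfolding Jp_def by blast
  have "occ x r (tk k) (path (tk i) \<omega>) \<le> occ x r (tk (i + k)) (path 0 \<omega>)"
    using occ_tk_add[OF assms(1), of i "tk k" 0] by (simp add: tk_add)
  with k(2) have "ennreal b < occ x r (tk (i + k)) (path 0 \<omega>)" by (rule order_less_le_trans)
  with k show ?thesis unfolding Jp_def by (intro exI[of _ "i + k"]) (simp add: path_apply tk_add)
qed

text \<open>By \<open>A3\<close> the law at time \<open>u = tk H\<close> dominates \<open>c\<close>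
  times \<open>\<nu>\<close> uniformly over starts in \<open>D\<close>, and success of the path
  after this grid time is success of the whole path.\<close>

lemma Jp_nu_le_iD: "ennreal c * (\<integral>\<^sup>+y. pr (Some y) (Jp b) \<partial>\<nu>) \<le> iD b"
  unfolding iD_def
proof (rule INF_greatest)
  fix y assume y: "y \<in> ball x \<rho>"
  have "ennreal c * (\<integral>\<^sup>+y. pr (Some y) (Jp b) \<partial>\<nu>)
      \<le> (\<integral>\<^sup>+\<omega>. case_option 0 (\<lambda>y. pr (Some y) (Jp b)) (X (ennreal u) \<omega>) \<partial>P (Some y))"
    by (rule A3[OF y measurable_pr_Some[OF pred_Jp]]) (rule pr_le_1)
  also have "\<dots> \<le> (\<integral>\<^sup>+\<omega>. pr (X (tk H) \<omega>) (Jp b) \<partial>P (Some y))"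
    unfolding tk_H by (intro nn_integral_mono) (simp split: option.split)
  also have "\<dots> \<le> pr (Some y) (Jp b)"
    by (rule pr_markov[OF pred_Jp pred_Jp Jp_shift])
  finally show "ennreal c * (\<integral>\<^sup>+y. pr (Some y) (Jp b) \<partial>\<nu>) \<le> pr (Some y) (Jp b)" .
qed

section \<open>Uniform comparison of the supremum with the infimum\<close>

lemma tl_H_le: "tl H \<le> ennreal CH"
  using CH_sum unfolding tl_def .

lemma delta_le: "(ennreal CH + 2) * \<delta> \<le> ennreal (c / 8)"
proof -
  have "(ennreal CH + 2) * \<delta> = ennreal ((CH + 2) * (1/2) ^ j0)"
    using CH unfolding \<delta>_def by (simp add: ennreal_mult' ennreal_plus)
  also have "\<dots> \<le> ennreal (c / 8)" by (intro ennreal_leI CH_small)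
  finally show ?thesis .
qed

text \<open>Level budget: \<open>u + h\<close> for \<open>exc_le_Jp\<close>,
  \<open>u + h + u\<close> for \<open>exc_le_nu\<close> with \<open>n = H\<close>, and
  \<open>u + h\<close> for \<open>sS_le_sD\<close>, in total
  \<open>4 * u + 3 * h \<le> 7 * u\<close>. The three error terms add up to
  \<open>(CH + 2) * \<delta> * sS b\<close>.\<close>

lemma sS_le_iD_step:
  assumes b: "0 \<le> b"
  shows "sS (b + 7 * u) \<le> ennreal (CH / c) * iD b + ennreal (c / 2) * sS b"
proof -
  let ?J = "\<integral>\<^sup>+y. pr (Some y) (Jp b) \<partial>\<nu>"
  let ?b1 = "b + u + h" and ?b2 = "b + u + h + u + h + real H * h"
  have b1: "0 \<le> ?b1" and b2: "0 \<le> ?b2" using b u h by simp_all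
  have m: "(\<lambda>y. pr (Some y) (Jp b)) \<in> borel_measurable \<nu>"
    by (intro nu_borel measurable_pr_Some pred_Jp)
  have "(\<integral>\<^sup>+y. exc ?b1 (Some y) \<partial>\<nu>) \<le> (\<integral>\<^sup>+y. pr (Some y) (Jp b) + \<delta> * sS b \<partial>\<nu>)"
    by (intro nn_integral_mono exc_le_Jp b)
  also have "\<dots> = ?J + (\<integral>\<^sup>+y. \<delta> * sS b \<partial>\<nu>)"
    using m by (intro nn_integral_add) auto
  also have "\<dots> \<le> ?J + \<delta> * sS b"
    by (intro add_left_mono nn_integral_nu_const_le)
  finally have e: "(\<integral>\<^sup>+y. exc ?b1 (Some y) \<partial>\<nu>) \<le> ?J + \<delta> * sS b" .
  have s1: "sS ?b1 \<le> sS b" using u h by (intro sS_antimono) simp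
  have s2: "sS ?b2 \<le> sS b" using u h by (intro sS_antimono) simp
  have "sD ?b2 \<le> ennreal CH * (?J + \<delta> * sS b) + \<delta> * sS b"
    unfolding sD_def
  proof (rule SUP_least)
    fix y assume y: "y \<in> ball x \<rho>"
    have "exc ?b2 (Some y) \<le> tl H * (\<integral>\<^sup>+y. exc ?b1 (Some y) \<partial>\<nu>) + \<delta> * sS ?b1"
      by (rule exc_le_nu[OF b1 y]) simp
    also have "\<dots> \<le> ennreal CH * (?J + \<delta> * sS b) + \<delta> * sS b"
      by (intro add_mono mult_mono tl_H_le e s1) auto
    finally show "exc ?b2 (Some y) \<le> ennreal CH * (?J + \<delta> * sS b) + \<delta> * sS b" .
  qed
  moreover have "sS (?b2 + u + h) \<le> sD ?b2 + \<delta> * sS ?b2" by (rule sS_le_sD[OF b2])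
  moreover have "\<delta> * sS ?b2 \<le> \<delta> * sS b" by (intro mult_left_mono s2) simp
  moreover have "sS (b + 7 * u) \<le> sS (?b2 + u + h)"
    using h_le_u Hh by (intro sS_antimono) simp
  ultimately have "sS (b + 7 * u) \<le> ennreal CH * (?J + \<delta> * sS b) + \<delta> * sS b + \<delta> * sS b"
    by (meson add_mono order_trans)
  also have "\<dots> = ennreal CH * ?J + (ennreal CH + 2) * \<delta> * sS b"
    by (simp add: algebra_simps mult_2)
  also have "\<dots> \<le> ennreal (CH / c) * iD b + ennreal (c / 2) * sS b"
  proof (intro add_mono mult_right_mono)
    have "ennreal CH * ?J = ennreal (CH / c) * (ennreal c * ?J)"
      using c CH by (simp add: mult.assoc[symmetric] flip: ennreal_mult')
    also have "\<dots> \<le> ennreal (CH / c) * iD b"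
      by (intro mult_left_mono Jp_nu_le_iD) simp
    finally show "ennreal CH * ?J \<le> ennreal (CH / c) * iD b" .
    show "(ennreal CH + 2) * \<delta> \<le> ennreal (c / 2)"
      using delta_le c by (elim order_trans) (intro ennreal_leI, simp)
  qed simp
  finally show ?thesis .
qed

lemma tk_9H: "tk (9 * H) = ennreal (9 * u)"
  using Hh by (simp add: tk_def mult.assoc)

lemma iD_le_1: "ball x \<rho> \<noteq> {} \<Longrightarrow> iD b \<le> 1"
  unfolding iD_def by (meson INF_lower2 pr_le_1 ex_in_conv)

lemma iD_antimono: "b \<le> b' \<Longrightarrow> iD b' \<le> iD b"
  unfolding iD_def
  by (intro INF_superset_mono pr_mono) (auto simp: Jp_def intro: order_le_less_trans[OF ennreal_leI])

lemma iD_le: "y \<in> ball x \<rho> \<Longrightarrow> iD b \<le> pr (Some y) (Jp b)"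
  unfolding iD_def by (rule INF_lower)

lemma c_le_iD:
  assumes "b \<le> 7 * u"
  shows "ennreal c \<le> iD b"
  unfolding iD_def
proof (rule INF_greatest)
  fix y assume y: "y \<in> ball x \<rho>"
  note A4[OF y]
  also have "pr (Some y) (\<lambda>p. ennreal (7 * u) < occ x r (ennreal (9 * u)) p \<and> p (ennreal (9 * u)) \<in> D) \<le> pr (Some y) (Jp b)"
  proof (rule pr_mono)
    fix \<omega> assume *: "ennreal (7 * u) < occ x r (ennreal (9 * u)) (path 0 \<omega>) \<and> path 0 \<omega> (ennreal (9 * u)) \<in> D"
    have "ennreal b \<le> ennreal (7 * u)" using assms by (rule ennreal_leI)
    with * have "ennreal b < occ x r (tk (9 * H)) (path 0 \<omega>)" unfolding tk_9H by (blast intro: order_le_less_trans)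
    with * show "Jp b (path 0 \<omega>)" unfolding Jp_def using H by (intro exI[of _ "9 * H"]) (simp add: tk_9H)
  qed measurable
  finally show "ennreal c \<le> pr (Some y) (Jp b)" .
qed

text \<open>Put one stretch of \<open>A4\<close> in front: within time \<open>9 * u\<close> it
  collects more than \<open>7 * u\<close> and ends in \<open>D\<close>, from where only level
  \<open>b\<close> remains to be passed.\<close>

lemma c_iD_le: 
  assumes b: "0 \<le> b"
  shows "ennreal c * iD b \<le> iD (b + 7 * u)"
  unfolding iD_def[of "b + 7 * u"]
proof (rule INF_greatest)
  fix y assume y: "y \<in> ball x \<rho>"
  let ?M = "P (Some y)"
  let ?G = "{\<omega>\<in>\<Omega>. ennreal (7 * u) < occ x r (ennreal (9 * u)) (path 0 \<omega>)} \<inter> {\<omega>\<in>\<Omega>. X (tk (9 * H)) \<omega> \<in> D}"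
  have G: "?G \<in> sets (F (tk (9 * H)))" by (intro sets.Int event_F X_event_F) (auto simp: tk_9H)
  have "ennreal c \<le> emeasure ?M {\<omega>\<in>\<Omega>. ennreal (7 * u) < occ x r (ennreal (9 * u)) (path 0 \<omega>) \<and> path 0 \<omega> (ennreal (9 * u)) \<in> D}"
    using A4[OF y] by (subst (asm) pr_eq) measurable
  also have "\<dots> = emeasure ?M ?G"
    by (rule arg_cong[where f="emeasure ?M"]) (auto simp: path_apply tk_9H)
  finally have "ennreal c * iD b \<le> iD b * emeasure ?M ?G" by (subst mult.commute) (intro mult_left_mono, auto)
  also have "\<dots> = (\<integral>\<^sup>+\<omega>. iD b * indicator ?G \<omega> \<partial>?M)"
    by (rule nn_integral_cmult_indicator[symmetric, OF sets_F_P[OF G]])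
  also have "\<dots> \<le> (\<integral>\<^sup>+\<omega>. indicator ?G \<omega> * pr (X (tk (9 * H)) \<omega>) (Jp b) \<partial>?M)"
    by (intro nn_integral_mono) (auto split: split_indicator simp: iD_le)
  also have "\<dots> = emeasure ?M (?G \<inter> {\<omega>\<in>\<Omega>. Jp b (path (tk (9 * H)) \<omega>)})"
    by (rule markov_event[OF G pred_Jp, symmetric])
  also have "\<dots> \<le> emeasure ?M {\<omega>\<in>\<Omega>. Jp (b + 7 * u) (path 0 \<omega>)}"
  proof (rule emeasure_mono)
    show "{\<omega>\<in>\<Omega>. Jp (b + 7 * u) (path 0 \<omega>)} \<in> sets ?M" by (rule event_path) measurable
    show "?G \<inter> {\<omega>\<in>\<Omega>. Jp b (path (tk (9 * H)) \<omega>)} \<subseteq> {\<omega>\<in>\<Omega>. Jp (b + 7 * u) (path 0 \<omega>)}"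
    proof safe
      fix \<omega> assume w: "\<omega> \<in> \<Omega>" and U: "ennreal (7 * u) < occ x r (ennreal (9 * u)) (path 0 \<omega>)"
        and J: "Jp b (path (tk (9 * H)) \<omega>)"
      from J obtain k where k: "1 \<le> k" "ennreal b < occ x r (tk k) (path (tk (9 * H)) \<omega>)"
        "path (tk (9 * H)) \<omega> (tk k) \<in> D" unfolding Jp_def by blast
      let ?s = "occ x r (ennreal (9 * u)) (path 0 \<omega>)"
      have fin: "?s \<noteq> \<infinity>" using occ_le[of x r "ennreal (9 * u)"] by (metis ennreal_less_top infinity_ennreal_def leD)
      have "ennreal (b + 7 * u) = ennreal (7 * u) + ennreal b" using b u by (simp add: add.commute)
      also have "\<dots> \<le> ?s + ennreal b" using U by (intro add_right_mono) simp
      also have "\<dots> < ?s + occ x r (tk k) (path (tk (9 * H)) \<omega>)"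
        using fin k(2) by (simp add: ennreal_add_left_cancel_less)
      also have "\<dots> = occ x r (tk (9 * H + k)) (path 0 \<omega>)"
        using occ_tk_add[OF w, of "9 * H" "tk k" 0] by (simp add: tk_add tk_9H)
      finally show "Jp (b + 7 * u) (path 0 \<omega>)"
        unfolding Jp_def using k by (intro exI[of _ "9 * H + k"]) (simp add: path_apply tk_add)
    qed
  qed
  also have "\<dots> = pr (Some y) (Jp (b + 7 * u))" by (rule pr_eq[symmetric]) measurable
  finally show "ennreal c * iD b \<le> pr (Some y) (Jp (b + 7 * u))" .
qed

text \<open>The error term of \<open>sS_le_iD_step\<close> is absorbed by induction in steps of
  \<open>7 * u\<close>. The previous step and \<open>c_iD_le\<close> bound \<open>sS b\<close> by
  \<open>2 * CH / c * (1 / c)\<close> times \<open>iD b\<close>, and the factor \<open>c / 2\<close>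
  turns this into \<open>CH / c\<close>, the same as the main term. No constant deteriorates along
  the induction, hence the uniformity in \<open>b\<close>.\<close>

lemma sS_le_iD:
  assumes "0 \<le> b"
  shows "sS (b + 7 * u) \<le> ennreal (2 * CH / c) * iD b"
proof -
  have cc: "ennreal (1 / c) * ennreal c = 1" using c by (simp flip: ennreal_mult')
  have "0 \<le> b \<Longrightarrow> b < 7 * u * real n \<Longrightarrow> sS (b + 7 * u) \<le> ennreal (2 * CH / c) * iD b" for n
  proof (induction n arbitrary: b)
    case (Suc n)
    show ?case
    proof (cases "b < 7 * u")
      case True
      then have "ennreal (1 / c) * ennreal c \<le> ennreal (1 / c) * iD b"
        by (intro mult_left_mono c_le_iD) auto
      then have "sS b \<le> ennreal (1 / c) * iD b" using sS_le_1[of b] cc by simp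
      then have "ennreal (c / 2) * sS b \<le> ennreal (c / 2) * (ennreal (1 / c) * iD b)"
        by (intro mult_left_mono) auto
      also have "\<dots> = ennreal (1 / 2) * iD b"
        using c by (simp add: mult.assoc[symmetric] flip: ennreal_mult')
      finally have "sS (b + 7 * u) \<le> ennreal (CH / c) * iD b + ennreal (1 / 2) * iD b"
        using sS_le_iD_step[OF Suc.prems(1)] by (meson add_left_mono order_trans)
      also have "\<dots> = ennreal (CH / c + 1 / 2) * iD b"
        using CH c by (subst ennreal_plus) (auto simp: distrib_right)
      also have "\<dots> \<le> ennreal (2 * CH / c) * iD b"
        using CH c by (intro mult_right_mono ennreal_leI) (auto simp: field_simps)
      finally show ?thesis .
    next
      case False
      let ?b = "b - 7 * u"
      have "sS (?b + 7 * u) \<le> ennreal (2 * CH / c) * iD ?b"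
        using False Suc.prems by (intro Suc.IH) (auto simp: algebra_simps)
      also have "\<dots> = ennreal (2 * CH / c) * (ennreal (1 / c) * (ennreal c * iD ?b))"
        using cc by (simp add: mult.assoc[symmetric])
      also have "ennreal c * iD ?b \<le> iD (?b + 7 * u)" using False by (intro c_iD_le) simp
      finally have "sS b \<le> ennreal (2 * CH / c) * (ennreal (1 / c) * iD b)"
        by (simp add: mult_left_mono)
      then have "ennreal (c / 2) * sS b \<le> ennreal (c / 2) * (ennreal (2 * CH / c) * (ennreal (1 / c) * iD b))"
        by (intro mult_left_mono) auto
      also have "\<dots> = ennreal (CH / c) * iD b"
        using c CH by (simp add: mult.assoc[symmetric] flip: ennreal_mult')
      finally have "sS (b + 7 * u) \<le> ennreal (CH / c) * iD b + ennreal (CH / c) * iD b"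
        using sS_le_iD_step[OF Suc.prems(1)] by (meson add_left_mono order_trans)
      also have "\<dots> = ennreal (2 * CH / c) * iD b"
        using CH c by (simp add: distrib_right[symmetric] flip: ennreal_plus)
      finally show ?thesis .
    qed
  qed simp
  moreover obtain n where "b / (7 * u) < real n" using reals_Archimedean2 by blast
  then have "b < 7 * u * real n" using u by (simp add: field_simps)
  ultimately show ?thesis using assms by blast
qed

text \<open>A crude lower bound; it tells how small the truncation error \<open>tl n\<close> has to
  be in \<open>iD_le_iL\<close>.\<close>

lemma c_power_le_iD:
  assumes "1 \<le> m" "b \<le> 7 * u * real m"
  shows "ennreal (c ^ m) \<le> iD b"
proof -
  have "ennreal (c ^ m) \<le> iD (7 * u * real m)" using assms(1)
  proof (induction m rule: dec_induct)
    case base then show ?case using c_le_iD[of "7 * u"] by simp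
  next
    case (step m)
    have "ennreal (c ^ Suc m) = ennreal c * ennreal (c ^ m)" using c by (simp add: ennreal_mult')
    also have "\<dots> \<le> ennreal c * iD (7 * u * real m)" by (intro mult_left_mono step.IH) simp
    also have "\<dots> \<le> iD (7 * u * real m + 7 * u)" using u by (intro c_iD_le) simp
    finally show ?case by (simp add: algebra_simps)
  qed
  also have "\<dots> \<le> iD b" by (intro iD_antimono assms(2))
  finally show ?thesis .
qed

section \<open>Finite horizons and powers of blocks\<close>

definition JL :: "nat \<Rightarrow> real \<Rightarrow> (ennreal \<Rightarrow> 'a option) \<Rightarrow> bool" where
  "JL n b p \<longleftrightarrow> (\<exists>k\<in>{1..n}. ennreal b < occ x r (tk k) p \<and> p (tk k) \<in> D)"
definition iL :: "nat \<Rightarrow> real \<Rightarrow> ennreal" where "iL n b = (INF y\<in>ball x \<rho>. pr (Some y) (JL n b))"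

lemma pred_JL [measurable]: "Measurable.pred path_space (JL n b)"
  unfolding JL_def by measurable

lemma Jp_le_JL:
  assumes y: "y \<in> ball x \<rho>" and n: "H \<le> n"
  shows "pr (Some y) (Jp b) \<le> pr (Some y) (JL n b) + tl n"
proof -
  let ?M = "P (Some y)"
  let ?T = "\<lambda>k. {\<omega>\<in>\<Omega>. X (tk (n + Suc k)) \<omega> \<in> D}"
  have T: "?T k \<in> sets ?M" for k by (rule X_event[OF ball_cem])
  have J: "{\<omega>\<in>\<Omega>. JL n b (path 0 \<omega>)} \<in> sets ?M" by (rule event_path) measurable
  have TU: "(\<Union>k. ?T k) \<in> sets ?M" by (rule sets.countable_UN) (use T in blast)
  have "pr (Some y) (Jp b) = emeasure ?M {\<omega>\<in>\<Omega>. Jp b (path 0 \<omega>)}" by (rule pr_eq) measurable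
  also have "\<dots> \<le> emeasure ?M ({\<omega>\<in>\<Omega>. JL n b (path 0 \<omega>)} \<union> (\<Union>k. ?T k))"
  proof (rule emeasure_mono[OF _ sets.Un[OF J TU]])
    show "{\<omega>\<in>\<Omega>. Jp b (path 0 \<omega>)} \<subseteq> {\<omega>\<in>\<Omega>. JL n b (path 0 \<omega>)} \<union> (\<Union>k. ?T k)"
    proof
      fix \<omega> assume "\<omega> \<in> {\<omega>\<in>\<Omega>. Jp b (path 0 \<omega>)}"
      then obtain k where w: "\<omega> \<in> \<Omega>" and k: "1 \<le> k" "ennreal b < occ x r (tk k) (path 0 \<omega>)" "X (tk k) \<omega> \<in> D"
        by (auto simp: Jp_def path_apply)
      show "\<omega> \<in> {\<omega>\<in>\<Omega>. JL n b (path 0 \<omega>)} \<union> (\<Union>k. ?T k)"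
      proof (cases "k \<le> n")
        case True then show ?thesis using k w by (auto simp: JL_def path_apply)
      next
        case False
        then obtain i where "k = n + Suc i" using less_imp_Suc_add[of n k] by auto
        with k w show ?thesis by blast
      qed
    qed
  qed
  also have "\<dots> \<le> emeasure ?M {\<omega>\<in>\<Omega>. JL n b (path 0 \<omega>)} + emeasure ?M (\<Union>k. ?T k)"
    by (rule emeasure_subadditive[OF J TU])
  also have "emeasure ?M (\<Union>k. ?T k) \<le> (\<Sum>k. emeasure ?M (?T k))"
    by (rule emeasure_subadditive_countably) (use T in blast)
  also have "\<dots> \<le> tl n"
    unfolding tl_def
  proof (rule suminf_le)
    fix k
    have "emeasure ?M (?T k) = emeasure ?M (?T k \<inter> {\<omega>\<in>\<Omega>. True})"
      by (rule arg_cong[where f="emeasure ?M"]) auto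
    also have "\<dots> \<le> ennreal (C * (real H / real (n + Suc k)) powr \<gamma>) * (\<integral>\<^sup>+y. pr (Some y) (\<lambda>_. True) \<partial>\<nu>)"
      using n by (intro A2_grid y) auto
    also have "\<dots> \<le> ennreal (C * (real H / real (n + Suc k)) powr \<gamma>) * 1"
      using nn_integral_nu_const_le[of 1] by (intro mult_left_mono) auto
    finally show "emeasure ?M (?T k) \<le> ennreal (C * (real H / real (n + Suc k)) powr \<gamma>)" by simp
  qed auto
  finally show ?thesis using pr_eq[OF pred_JL, of "Some y"] by (simp add: add_left_mono)
qed

text \<open>Success after index \<open>n\<close> requires a visit after \<open>n\<close>, of
  probability at most \<open>tl n\<close>. This is at most half of \<open>iD b\<close> by
  \<open>c_power_le_iD\<close>, so it can be moved to the left-hand side.\<close>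

lemma iD_le_iL:
  assumes ne: "ball x \<rho> \<noteq> {}" and n: "H \<le> n" and m: "1 \<le> m" "b \<le> 7 * u * real m" and t: "tl n \<le> ennreal (c ^ m / 2)"
  shows "iD b \<le> 2 * iL n b"
proof -
  have "iD b \<le> iL n b + tl n"
  proof -
    have fin: "iD b \<noteq> \<top>" using iD_le_1[OF ne, of b] by (auto simp: top_unique)
    have "iD b - tl n \<le> iL n b"
      unfolding iL_def
    proof (rule INF_greatest)
      fix y assume y: "y \<in> ball x \<rho>"
      have "iD b \<le> pr (Some y) (JL n b) + tl n"
        using iD_le[OF y] Jp_le_JL[OF y n] by (rule order_trans)
      then show "iD b - tl n \<le> pr (Some y) (JL n b)"
        using fin by (simp add: ennreal_minus_le_iff add.commute)
    qed
    then show ?thesis using fin by (simp add: ennreal_minus_le_iff add.commute)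
  qed
  also have "tl n \<le> ennreal (1/2) * iD b"
  proof -
    have "ennreal (1/2 * c ^ m) = ennreal (1/2) * ennreal (c ^ m)" using c by (intro ennreal_mult) auto
    with t have "tl n \<le> ennreal (1/2) * ennreal (c ^ m)" by simp
    also have "\<dots> \<le> ennreal (1/2) * iD b" by (intro mult_left_mono c_power_le_iD m) simp
    finally show ?thesis .
  qed
  finally have *: "iD b \<le> iL n b + ennreal (1/2) * iD b" by (simp add: add_left_mono)
  obtain d where d: "iD b = ennreal d" "0 \<le> d" using iD_le_1[OF ne, of b]
    by (metis ennreal_cases ennreal_one_less_top infinity_ennreal_def leD)
  show ?thesis
  proof (cases "iL n b")
    case (real l)
    have "ennreal (1/2 * d) = ennreal (1/2) * ennreal d" using d by (intro ennreal_mult) auto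
    with * d real have "ennreal d \<le> ennreal l + ennreal (1/2 * d)" by simp
    also have "\<dots> = ennreal (l + d / 2)" using d real by (subst ennreal_plus[symmetric]) auto
    finally have "ennreal d \<le> ennreal (l + d / 2)" .
    then have "d \<le> l + d / 2" using real d by (subst (asm) ennreal_le_iff) auto
    then have "d \<le> 2 * l" by simp
    then have "ennreal d \<le> ennreal (2 * l)" by (rule ennreal_leI)
    then show ?thesis using real d by (simp add: ennreal_mult')
  qed (simp add: ennreal_mult_top)
qed

text \<open>Restart at the first grid time past \<open>b\<close>; the summand \<open>h\<close>
  covers the overshoot.\<close>

lemma exc_add:
  assumes b: "0 \<le> b" "0 \<le> b'"
  shows "exc (b' + (b + h)) w \<le> sS b' * sS b"
proof -
  let ?Q = "\<lambda>k. {\<omega>\<in>\<Omega>. ennreal b < occ x r (tk k) (path 0 \<omega>)}"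
  let ?E = "{\<omega>\<in>\<Omega>. ennreal (b' + (b + h)) < occ x r \<infinity> (path 0 \<omega>)}"
  have "emeasure (P w) ?E \<le> sS b' * emeasure (P w) (\<Union>k. ?Q k)"
  proof (rule first_time_le[where t=tk and A="\<lambda>p. ennreal b' < occ x r \<infinity> p", OF _ incseq_tk pred_exc])
    show "?Q k \<in> sets (F (tk k))" for k by (intro event_F) simp
    show "pr (X (tk k) \<omega>) (\<lambda>p. ennreal b' < occ x r \<infinity> p) \<le> sS b'" for k \<omega>
      using exc_le_sS unfolding exc_def .
    show "?E \<subseteq> \<Omega>" by auto
  next
    fix \<omega> assume w: "\<omega> \<in> ?E"
    then have wO: "\<omega> \<in> \<Omega>" and U: "ennreal (b' + (b + h)) < occ x r \<infinity> (path 0 \<omega>)" by auto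
    have "ennreal b \<le> ennreal (b' + (b + h))" using b h by (intro ennreal_leI) simp
    then have "ennreal b < occ x r \<infinity> (path 0 \<omega>)" using U by simp
    then show "\<exists>k. \<omega> \<in> ?Q k" using occ_inf_exceeds[OF wO] wO by blast
    fix k assume k: "\<omega> \<in> ?Q k" "\<forall>i<k. \<omega> \<notin> ?Q i"
    have le: "occ x r (tk k) (path 0 \<omega>) \<le> ennreal (b + h)"
      using k b wO by (intro first_crossing_le[OF wO]) auto
    have "ennreal (b + h + b') < occ x r (tk k) (path 0 \<omega>) + occ x r \<infinity> (path (tk k) \<omega>)"
      using U occ_inf_split[OF wO, of 0 k] by (simp add: ac_simps)
    from ennreal_less_add_imp[OF this le] show "ennreal b' < occ x r \<infinity> (path (tk k) \<omega>)"
      using b h by simp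
  qed
  also have "\<dots> = sS b' * exc b w" unfolding Un_crossing exc_eq ..
  also have "\<dots> \<le> sS b' * sS b" by (intro mult_left_mono exc_le_sS) simp
  finally show ?thesis unfolding exc_eq .
qed

lemma sS_power: 
  assumes b: "0 \<le> b"
  shows "sS (real j * (b + h)) \<le> sS b ^ j"
proof (induction j)
  case 0 then show ?case by (simp add: sS_le_1)
next
  case (Suc j)
  have "sS (real (Suc j) * (b + h)) \<le> sS (real j * (b + h)) * sS b"
    unfolding sS_def[of "real (Suc j) * (b + h)"]
  proof (rule SUP_least)
    fix w
    have "exc (real j * (b + h) + (b + h)) w \<le> sS (real j * (b + h)) * sS b"
      using b h by (intro exc_add) auto
    then show "exc (real (Suc j) * (b + h)) w \<le> sS (real j * (b + h)) * sS b"
      by (simp add: algebra_simps)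
  qed
  also have "\<dots> \<le> sS b ^ j * sS b" by (intro mult_right_mono Suc.IH) simp
  finally show ?case by (simp add: mult.commute)
qed

text \<open>At level \<open>2 * u + 2 * h + real n * h\<close> the supremum is at most
  \<open>1/4 + 1/8 + 1/8\<close>: a late return, and twice the error \<open>\<delta>\<close>. The
  third \<open>h\<close> is the overshoot per block in \<open>sS_power\<close>.\<close>

lemma sS_decay:
  assumes n: "H \<le> n" and t: "tl n \<le> ennreal (1/4)"
  shows "sS (real j * (2 * u + 3 * h + real n * h)) \<le> ennreal ((1/2) ^ j)"
proof -
  let ?b = "0 + u + h + real n * h"
  have "3 * (1/2) ^ j0 \<le> (CH + 2) * (1/2) ^ j0" using CH by (intro mult_right_mono) auto
  also have "\<dots> \<le> 1 / 8" using CH_small c by simp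
  finally have d: "\<delta> \<le> ennreal (1/8)" unfolding \<delta>_def by (intro ennreal_leI) simp
  have d': "\<delta> * sS b \<le> ennreal (1/8)" for b
    using mult_mono[OF d sS_le_1[of b]] by simp
  have "sD ?b \<le> ennreal (1/4) + ennreal (1/8)"
    unfolding sD_def
  proof (rule SUP_least)
    fix y assume y: "y \<in> ball x \<rho>"
    have "(\<integral>\<^sup>+y. exc 0 (Some y) \<partial>\<nu>) \<le> (\<integral>\<^sup>+y. 1 \<partial>\<nu>)" by (intro nn_integral_mono exc_le_1)
    also have "\<dots> \<le> 1" by (rule nn_integral_nu_const_le)
    finally have "tl n * (\<integral>\<^sup>+y. exc 0 (Some y) \<partial>\<nu>) \<le> ennreal (1/4) * 1" using t by (intro mult_mono) auto
    then have "tl n * (\<integral>\<^sup>+y. exc 0 (Some y) \<partial>\<nu>) + \<delta> * sS 0 \<le> ennreal (1/4) * 1 + ennreal (1/8)"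
      by (intro add_mono d')
    with exc_le_nu[OF order_refl y n] show "exc ?b (Some y) \<le> ennreal (1/4) + ennreal (1/8)"
      by (simp only: mult_1_right)
  qed
  moreover have "sS (?b + u + h) \<le> sD ?b + \<delta> * sS ?b" using u h by (intro sS_le_sD) simp
  ultimately have "sS (?b + u + h) \<le> (ennreal (1/4) + ennreal (1/8)) + ennreal (1/8)"
    using d' by (meson add_mono order_trans)
  also have "\<dots> = ennreal (1/2)" by (simp add: ennreal_plus[symmetric] del: ennreal_plus)
  finally have "sS (?b + u + h) ^ j \<le> ennreal (1/2) ^ j" by (rule power_mono) simp
  moreover have "sS (real j * (?b + u + h + h)) \<le> sS (?b + u + h) ^ j"
    using u h by (intro sS_power) simp
  ultimately have "sS (real j * (?b + u + h + h)) \<le> ennreal (1/2) ^ j" by (rule order_trans[rotated])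
  moreover have "ennreal (1/2) ^ j = ennreal ((1/2) ^ j)" by (rule ennreal_power) simp
  moreover have "?b + u + h + h = 2 * u + 3 * h + real n * h" by simp
  ultimately show ?thesis by (simp only:)
qed

text \<open>Each successful block ends at a visit to \<open>D\<close>, where the next one starts;
  the infimum over \<open>D\<close> makes the position irrelevant. The weak inequality is the form
  that also holds for \<open>j = 0\<close>.\<close>

lemma iL_power:
  assumes b: "0 \<le> b" and y: "y \<in> ball x \<rho>"
  shows "iL n b ^ j \<le> pr (Some y) (\<lambda>p. \<exists>k\<le>j * n. ennreal (real j * b) \<le> occ x r (tk k) p \<and> p (tk k) \<in> D)"
  using y
proof (induction j arbitrary: y)
  case 0
  interpret Py: prob_space "P (Some y)" by (rule prob_space_P)
  have "1 = emeasure (P (Some y)) \<Omega>" using Py.emeasure_space_1 by simp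
  also have "\<dots> \<le> emeasure (P (Some y)) {\<omega>\<in>\<Omega>. path 0 \<omega> 0 \<in> D}"
  proof (rule emeasure_mono_AE)
    show "AE \<omega> in P (Some y). \<omega> \<in> \<Omega> \<longrightarrow> \<omega> \<in> {\<omega>\<in>\<Omega>. path 0 \<omega> 0 \<in> D}"
      using normal[of "Some y"] 0 by (auto simp: path_apply)
    show "{\<omega>\<in>\<Omega>. path 0 \<omega> 0 \<in> D} \<in> sets (P (Some y))" by (rule event_path) measurable
  qed
  also have "\<dots> = pr (Some y) (\<lambda>p. p 0 \<in> D)" by (rule pr_eq[symmetric]) measurable
  finally show ?case by simp
next
  case (Suc j)
  let ?M = "P (Some y)"
  let ?A = "\<lambda>p. \<exists>k\<le>j * n. ennreal (real j * b) \<le> occ x r (tk k) p \<and> p (tk k) \<in> D"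
  let ?B = "\<lambda>p. \<exists>k\<le>Suc j * n. ennreal (real (Suc j) * b) \<le> occ x r (tk k) p \<and> p (tk k) \<in> D"
  let ?Q = "\<lambda>k. if k \<in> {1..n} then {\<omega>\<in>\<Omega>. ennreal b < occ x r (tk k) (path 0 \<omega>)} \<inter> {\<omega>\<in>\<Omega>. X (tk k) \<omega> \<in> D} else {}"
  have [measurable]: "Measurable.pred path_space ?A" "Measurable.pred path_space ?B" by measurable
  have "iL n b ^ j * emeasure ?M (\<Union>k. ?Q k) \<le> emeasure ?M {\<omega>\<in>\<Omega>. ?B (path 0 \<omega>)}"
  proof (rule first_time_ge[where t=tk and A="?A", OF _ incseq_tk])
    show "?Q k \<in> sets (F (tk k))" for k using sets.Int[OF event_F[of 0 "tk k" "tk k" b] X_event_F[of "tk k" "tk k" D]] by auto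
    show "Measurable.pred path_space ?A" by fact
    show "iL n b ^ j \<le> pr (X (tk k) \<omega>) ?A" if "\<omega> \<in> ?Q k" for k \<omega>
      using that Suc.IH by (auto split: if_splits)
    show "{\<omega>\<in>\<Omega>. ?B (path 0 \<omega>)} \<in> sets ?M" by (rule event_path) fact
  next
    fix \<omega> k assume w: "\<omega> \<in> \<Omega>" and Q: "\<omega> \<in> ?Q k" and A: "?A (path (tk k) \<omega>)"
    from A obtain i where i: "i \<le> j * n" "ennreal (real j * b) \<le> occ x r (tk i) (path (tk k) \<omega>)" "X (tk (k + i)) \<omega> \<in> D"
      by (auto simp: path_apply tk_add)
    from Q have k: "1 \<le> k" "k \<le> n" "ennreal b < occ x r (tk k) (path 0 \<omega>)" by (auto split: if_splits)
    have "ennreal (real (Suc j) * b) = ennreal b + ennreal (real j * b)" using b by (simp add: algebra_simps)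
    also have "\<dots> \<le> occ x r (tk k) (path 0 \<omega>) + occ x r (tk i) (path (tk k) \<omega>)" using k i by (intro add_mono) auto
    also have "\<dots> = occ x r (tk (k + i)) (path 0 \<omega>)"
      using occ_tk_add[OF w, of k "tk i" 0] by (simp add: tk_add)
    finally show "\<omega> \<in> {\<omega>\<in>\<Omega>. ?B (path 0 \<omega>)}"
      using w k i by (auto simp: path_apply intro!: exI[of _ "k + i"])
  qed
  note step = this
  have Q: "emeasure ?M (\<Union>k. ?Q k) = pr (Some y) (JL n b)"
  proof -
    have "(\<Union>k. ?Q k) = {\<omega>\<in>\<Omega>. JL n b (path 0 \<omega>)}"
      by (auto simp: JL_def path_apply split: if_splits)
    then show ?thesis by (simp add: pr_eq[OF pred_JL])
  qed
  have "iL n b ^ j * iL n b \<le> iL n b ^ j * pr (Some y) (JL n b)"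
    unfolding iL_def using Suc.prems by (intro mult_left_mono INF_lower) auto
  with step have "iL n b ^ j * iL n b \<le> emeasure ?M {\<omega>\<in>\<Omega>. ?B (path 0 \<omega>)}"
    unfolding Q by (rule order_trans[rotated])
  also have "\<dots> = pr (Some y) ?B" by (rule pr_eq[symmetric]) fact
  finally show ?case by (simp add: mult.commute)
qed

lemma sS_power_le_pr:
  assumes b: "0 \<le> b" and y: "y \<in> ball x \<rho>"
    and n: "H \<le> n" and m: "1 \<le> m" "b \<le> 7 * u * real m" and t: "tl n \<le> ennreal (c ^ m / 2)"
  shows "sS (b + 7 * u) ^ j \<le> ennreal ((4 * CH / c) ^ j) * pr (Some y) (\<lambda>p. ennreal (real j * b) \<le> occ x r (tk (j * n)) p)"
proof -
  have "sS (b + 7 * u) \<le> ennreal (2 * CH / c) * iD b" by (rule sS_le_iD[OF b])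
  also have "\<dots> \<le> ennreal (2 * CH / c) * (2 * iL n b)"
  proof (rule mult_left_mono)
    show "iD b \<le> 2 * iL n b" by (rule iD_le_iL[OF _ n m t]) (use y in blast)
  qed simp
  also have "\<dots> = ennreal (4 * CH / c) * iL n b"
  proof -
    have "ennreal (4 * CH / c) = ennreal (2 * CH / c * 2)" by (rule arg_cong[where f=ennreal]) simp
    also have "\<dots> = ennreal (2 * CH / c) * ennreal 2" using c CH by (intro ennreal_mult) auto
    finally show ?thesis by (simp add: mult.assoc)
  qed
  finally have "sS (b + 7 * u) ^ j \<le> (ennreal (4 * CH / c) * iL n b) ^ j" by (rule power_mono) simp
  also have "\<dots> = ennreal ((4 * CH / c) ^ j) * iL n b ^ j"
    using c CH by (simp add: power_mult_distrib ennreal_power)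
  also have "\<dots> \<le> ennreal ((4 * CH / c) ^ j) * pr (Some y) (\<lambda>p. ennreal (real j * b) \<le> occ x r (tk (j * n)) p)"
  proof (rule mult_left_mono)
    note iL_power[OF b y, of n j]
    also have "pr (Some y) (\<lambda>p. \<exists>k\<le>j * n. ennreal (real j * b) \<le> occ x r (tk k) p \<and> p (tk k) \<in> D)
      \<le> pr (Some y) (\<lambda>p. ennreal (real j * b) \<le> occ x r (tk (j * n)) p)"
      by (rule pr_mono) (measurable, auto intro: order_trans[OF _ occ_tk_mono])
    finally show "iL n b ^ j \<le> pr (Some y) (\<lambda>p. ennreal (real j * b) \<le> occ x r (tk (j * n)) p)" .
  qed simp
  finally show ?thesis .
qed

end

section \<open>Verification from the heat kernel bounds\<close>

locale diffusive_process = borel_standard_process \<Omega> F X P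
  for \<Omega> :: "'w set" and F :: "ennreal \<Rightarrow> 'w measure"
    and X :: "ennreal \<Rightarrow> 'w \<Rightarrow> 'a::{metric_space, second_countable_topology} option"
    and P :: "'a option \<Rightarrow> 'w measure" +
  fixes \<mu> :: "'a measure" and x0 :: 'a and \<Phi> :: "real \<Rightarrow> real"
    and R \<upsilon> d1 d2 cm Cm l CU \<beta> \<eta> cl cu :: real and pM :: "real \<Rightarrow> 'a \<Rightarrow> 'a \<Rightarrow> ennreal"
  assumes sets_mu: "sets \<mu> = sets borel"
    and Phi_pos: "\<And>r. 0 < r \<Longrightarrow> 0 < \<Phi> r"
    and Phi_mono: "strict_mono_on {0<..} \<Phi>"
    and Phi_cont: "continuous_on {0<..} \<Phi>"
    and R: "1 \<le> R" and ups: "0 < \<upsilon>" "\<upsilon> < 1"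
    and vrd_const: "0 < d1" "0 < d2" "0 < cm" "0 < Cm"
    and vrd: "\<And>x r s. s \<le> r \<Longrightarrow> R * dd x0 x powr \<upsilon> < s \<Longrightarrow>
        cm * (r / s) powr d1 \<le> vol \<mu> x r / vol \<mu> x s \<and> vol \<mu> x r / vol \<mu> x s \<le> Cm * (r / s) powr d2"
    and l: "1 < l" and uls: "\<And>s. R < s \<Longrightarrow> 2 * \<Phi> (s / l) \<le> \<Phi> s"
    and beta: "0 < \<beta>" "\<beta> < d1" and CU: "1 \<le> CU"
    and Phi_upper: "\<And>r s. s \<le> r \<Longrightarrow> R < s \<Longrightarrow> \<Phi> r / \<Phi> s \<le> CU * (r / s) powr \<beta>"
    and eta: "0 < \<eta>" "\<eta> < 1" and cl: "0 < cl"
    and ndl: "\<And>x r. R * dd x0 x powr \<upsilon> < r \<Longrightarrow>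
        \<exists>p. is_heat_kernel X P \<mu> (ball x r) p \<and>
           (\<forall>y\<in>ball x (\<eta>\<^sup>2 * r). \<forall>z\<in>ball x (\<eta>\<^sup>2 * r). p (\<Phi> (\<eta> * r)) y z \<ge> ennreal (cl / vol \<mu> x r))"
    and cu: "0 < cu" and pM: "is_heat_kernel X P \<mu> UNIV pM"
    and ndu: "\<And>x y t. \<Phi> (R * (max (dd x0 x) (dd x0 y)) powr \<upsilon>) \<le> t \<Longrightarrow>
        pM t x y \<le> ennreal (cu / min (vol \<mu> x (inv_into {0<..} \<Phi> t)) (vol \<mu> y (inv_into {0<..} \<Phi> t)))"
begin

section \<open>Consequences of the growth, volume and heat kernel conditions\<close>

lemma Phi_le: "0 < a \<Longrightarrow> a \<le> b \<Longrightarrow> \<Phi> a \<le> \<Phi> b"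
  using strict_mono_onD[OF Phi_mono, of a b] by (cases "a = b") auto

lemma Phi_le_iff: "0 < a \<Longrightarrow> 0 < b \<Longrightarrow> \<Phi> a \<le> \<Phi> b \<longleftrightarrow> a \<le> b"
  using strict_mono_onD[OF Phi_mono, of b a] Phi_le[of a b] by (cases "a \<le> b") auto

lemma Phi_upper': "s \<le> r \<Longrightarrow> R < s \<Longrightarrow> \<Phi> r \<le> CU * (r / s) powr \<beta> * \<Phi> s"
  using Phi_upper[of s r] Phi_pos[of s] R by (simp add: field_simps)

lemma Phi_IVT:
  assumes "0 < a" "a \<le> b" "\<Phi> a \<le> t" "t \<le> \<Phi> b"
  obtains v where "a \<le> v" "v \<le> b" "\<Phi> v = t"
proof -
  have "continuous_on {a..b} \<Phi>"
    using assms(1) by (intro continuous_on_subset[OF Phi_cont]) auto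
  from IVT'[of \<Phi> a t b, OF assms(3,4,2) this] that show thesis by blast
qed

lemma Phi_growth: "R < s \<Longrightarrow> 2 ^ k * \<Phi> s \<le> \<Phi> (s * l ^ k)"
proof (induction k)
  case (Suc k)
  have "1 \<le> l ^ Suc k" using l by (intro one_le_power) simp
  then have "R < s * l ^ Suc k" using Suc.prems R
    by (smt (verit) mult_le_cancel_left1)
  from uls[OF this] have "2 * \<Phi> (s * l ^ k) \<le> \<Phi> (s * l ^ Suc k)" using l by (simp add: field_simps)
  with Suc show ?case by simp
qed simp

lemma Phi_surj:
  assumes "0 < a" "\<Phi> a \<le> t"
  obtains s where "a \<le> s" "\<Phi> s = t" "inv_into {0<..} \<Phi> t = s"
proof -
  obtain k where k: "t / \<Phi> (R + 1) < 2 ^ k" using real_arch_pow[of 2 "t / \<Phi> (R + 1)"] by auto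
  have p: "0 < \<Phi> (R + 1)" using R by (intro Phi_pos) simp
  have "t \<le> 2 ^ k * \<Phi> (R + 1)" using k p by (simp add: field_simps)
  also have "\<dots> \<le> \<Phi> ((R + 1) * l ^ k)" by (intro Phi_growth) simp
  also have "\<dots> \<le> \<Phi> (max a ((R + 1) * l ^ k))" using R l by (intro Phi_le) auto
  finally obtain s where s: "a \<le> s" "\<Phi> s = t" using Phi_IVT[OF assms(1) _ assms(2)] by (metis max.cobounded1)
  have "inv_into {0<..} \<Phi> (\<Phi> s) = s"
    using s assms by (intro inv_into_f_f strict_mono_on_imp_inj_on[OF Phi_mono]) auto
  with s that show thesis by blast
qed

lemma vol_pos:
  assumes "R * dd x0 x powr \<upsilon> < r"
  shows "0 < vol \<mu> x r" "emeasure \<mu> (ball x r) = ennreal (vol \<mu> x r)"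
proof -
  have "0 < r" using assms R by (smt (verit) mult_nonneg_nonneg powr_ge_zero)
  \<comment> \<open>A ball of volume \<open>0\<close> would make this quotient \<open>0\<close>.
    Infinite measure is excluded in the same way, since \<open>measure\<close> then takes the value
    \<open>0\<close>.\<close>
  then have "cm \<le> vol \<mu> x r / vol \<mu> x r" using vrd[OF order_refl assms] by simp
  then have "vol \<mu> x r \<noteq> 0" using vrd_const by auto
  moreover have "0 \<le> vol \<mu> x r" by (simp add: vol_def)
  ultimately show *: "0 < vol \<mu> x r" by simp
  then have "emeasure \<mu> (ball x r) \<noteq> \<infinity>" unfolding vol_def measure_def by (metis enn2real_top infinity_ennreal_def less_irrefl)
  then show "emeasure \<mu> (ball x r) = ennreal (vol \<mu> x r)"
    unfolding vol_def by (intro emeasure_eq_ennreal_measure) simp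
qed

lemma vol_ratio:
  assumes "s \<le> r" "R * dd x0 x powr \<upsilon> < s"
  shows "vol \<mu> x r \<le> Cm * (r / s) powr d2 * vol \<mu> x s" "cm * (r / s) powr d1 * vol \<mu> x s \<le> vol \<mu> x r"
  using vrd[OF assms] vol_pos(1)[OF assms(2)] by (auto simp: field_simps)

lemma part_process_in:
  assumes "part_process X B t \<omega> = Some y"
  shows "X t \<omega> = Some y" "\<And>s. 0 < s \<Longrightarrow> s \<le> t \<Longrightarrow> X s \<omega> \<in> Some ` B"
proof -
  have t: "t < exit_time X B \<omega>" and y: "X t \<omega> = Some y"
    using assms by (auto simp: part_process_def split: if_splits)
  show "X t \<omega> = Some y" by fact
  fix s :: ennreal assume s: "0 < s" "s \<le> t"
  show "X s \<omega> \<in> Some ` B"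
  proof (rule ccontr)
    assume "X s \<omega> \<notin> Some ` B"
    then have "exit_time X B \<omega> \<le> s" unfolding exit_time_def using s by (intro Inf_lower) auto
    with t s show False by auto
  qed
qed

text \<open>A path alive at \<open>t\<close> was alive before by absorption, and stays alive for a
  while by right-continuity since \<open>range Some\<close> is open. So the infimum defining the
  exit time is strictly larger than \<open>t\<close>.\<close>

lemma part_process_UNIV:
  assumes \<omega>: "\<omega> \<in> \<Omega>" and t: "t < \<infinity>"
  shows "part_process X UNIV t \<omega> = X t \<omega>"
proof (cases "X t \<omega>")
  case (Some y)
  have "limitin cem_top (\<lambda>s. X s \<omega>) (X t \<omega>) (at_right t)" by (rule right_continuous_paths[OF \<omega>])
  then have "\<forall>\<^sub>F s in at_right t. X s \<omega> \<in> Some ` UNIV"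
    unfolding limitin_def using Some by auto
  moreover have "t < \<top>" using t by simp
  ultimately obtain b where b: "b > t" "\<And>s. t < s \<Longrightarrow> s < b \<Longrightarrow> X s \<omega> \<in> Some ` UNIV"
    using eventually_at_right[of t \<top>] by auto
  have "b \<le> exit_time X UNIV \<omega>"
    unfolding exit_time_def
  proof (rule Inf_greatest, clarsimp)
    fix s assume s: "X s \<omega> \<notin> range Some"
    show "b \<le> s"
    proof (rule ccontr)
      assume "\<not> b \<le> s"
      with b s have "s \<le> t" by (metis linorder_not_le)
      moreover have "X s \<omega> = None" using s by (metis option.exhaust rangeI)
      ultimately show False using absorbing[OF \<omega>] Some by fastforce
    qed
  qed
  with b(1) have "t < exit_time X UNIV \<omega>" by (rule order_less_le_trans)
  then show ?thesis by (simp add: part_process_def)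
qed (simp add: part_process_def)

lemma ndl_integral:
  assumes r: "R * dd x0 x powr \<upsilon> < r" and y: "y \<in> ball x (\<eta>\<^sup>2 * r)"
    and f: "f \<in> borel_measurable borel" "\<And>z. f z \<le> 1"
  shows "ennreal (cl / vol \<mu> x r) * (\<integral>\<^sup>+z. f z * indicator (ball x (\<eta>\<^sup>2 * r)) z \<partial>\<mu>)
    \<le> (\<integral>\<^sup>+\<omega>. case_option 0 f (part_process X (ball x r) (ennreal (\<Phi> (\<eta> * r))) \<omega>) \<partial>P (Some y))"
proof -
  have r0: "0 < r" using r R by (smt (verit) mult_nonneg_nonneg powr_ge_zero)
  have sub: "ball x (\<eta>\<^sup>2 * r) \<subseteq> ball x r"
    using r0 eta by (intro subset_ball) (simp add: power_le_one)
  obtain p where p: "is_heat_kernel X P \<mu> (ball x r) p"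
    and lb: "\<And>y z. y \<in> ball x (\<eta>\<^sup>2 * r) \<Longrightarrow> z \<in> ball x (\<eta>\<^sup>2 * r) \<Longrightarrow> p (\<Phi> (\<eta> * r)) y z \<ge> ennreal (cl / vol \<mu> x r)"
    using ndl[OF r] by blast
  have "0 < \<Phi> (\<eta> * r)" using r0 eta by (intro Phi_pos) simp
  moreover have "y \<in> ball x r" using y sub by blast
  moreover have "\<exists>C<\<infinity>. AE z in \<mu>. z \<in> ball x r \<longrightarrow> f z \<le> C"
    using f(2) by (intro exI[of _ 1]) auto
  ultimately have eq: "(\<integral>\<^sup>+\<omega>. case_option 0 f (part_process X (ball x r) (ennreal (\<Phi> (\<eta> * r))) \<omega>) \<partial>P (Some y))
     = (\<integral>\<^sup>+z\<in>ball x r. p (\<Phi> (\<eta> * r)) y z * f z \<partial>\<mu>)"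
    using p f(1) unfolding is_heat_kernel_def by blast
  have m: "(\<lambda>z. f z * indicator (ball x (\<eta>\<^sup>2 * r)) z) \<in> borel_measurable \<mu>"
  proof -
    have "(\<lambda>z. f z * indicator (ball x (\<eta>\<^sup>2 * r)) z) \<in> borel_measurable borel"
      using f(1) by (intro borel_measurable_times_ennreal borel_measurable_indicator) simp_all
    then show ?thesis by (simp add: measurable_cong_sets[OF sets_mu refl])
  qed
  have "ennreal (cl / vol \<mu> x r) * (\<integral>\<^sup>+z. f z * indicator (ball x (\<eta>\<^sup>2 * r)) z \<partial>\<mu>)
     = (\<integral>\<^sup>+z. ennreal (cl / vol \<mu> x r) * (f z * indicator (ball x (\<eta>\<^sup>2 * r)) z) \<partial>\<mu>)"
    by (rule nn_integral_cmult[OF m, symmetric])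
  also have "\<dots> \<le> (\<integral>\<^sup>+z\<in>ball x r. p (\<Phi> (\<eta> * r)) y z * f z \<partial>\<mu>)"
    using sub lb[OF y] by (intro nn_integral_mono) (auto split: split_indicator intro!: mult_right_mono)
  finally show ?thesis using eq by simp
qed

text \<open>The lower bound concerns the killed process, so it controls the whole trajectory up to
  time \<open>\<Phi> (\<eta> * r)\<close> along with its end point; \<open>E\<close> may use
  both.\<close>

lemma ndl_event:
  assumes r: "R * dd x0 x powr \<upsilon> < r" and y: "y \<in> ball x (\<eta>\<^sup>2 * r)"
    and B: "B \<in> sets borel" "B \<subseteq> ball x (\<eta>\<^sup>2 * r)" and E: "E \<in> sets (P (Some y))"
    and st: "\<And>\<omega>. \<omega> \<in> \<Omega> \<Longrightarrow> X (ennreal (\<Phi> (\<eta> * r))) \<omega> \<in> Some ` B \<Longrightarrow>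
      (\<And>s. 0 < s \<Longrightarrow> s \<le> ennreal (\<Phi> (\<eta> * r)) \<Longrightarrow> X s \<omega> \<in> Some ` ball x r) \<Longrightarrow> \<omega> \<in> E"
  shows "ennreal (cl / vol \<mu> x r) * emeasure \<mu> B \<le> emeasure (P (Some y)) E"
proof -
  have "(\<integral>\<^sup>+z. indicator B z * indicator (ball x (\<eta>\<^sup>2 * r)) z \<partial>\<mu>) = (\<integral>\<^sup>+z. indicator B z \<partial>\<mu>)"
    using B(2) by (intro nn_integral_cong) (auto split: split_indicator)
  also have "\<dots> = emeasure \<mu> B" using B(1) sets_mu by simp
  finally have "(\<integral>\<^sup>+z. indicator B z * indicator (ball x (\<eta>\<^sup>2 * r)) z \<partial>\<mu>) = emeasure \<mu> B" .
  then have "ennreal (cl / vol \<mu> x r) * emeasure \<mu> B \<le>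
    (\<integral>\<^sup>+\<omega>. case_option 0 (indicator B) (part_process X (ball x r) (ennreal (\<Phi> (\<eta> * r))) \<omega>) \<partial>P (Some y))"
  proof -
    have "indicator B z \<le> (1 :: ennreal)" for z by (simp split: split_indicator)
    from ndl_integral[OF r y borel_measurable_indicator[OF B(1)] this] show ?thesis
      by (simp only: \<open>(\<integral>\<^sup>+z. indicator B z * indicator (ball x (\<eta>\<^sup>2 * r)) z \<partial>\<mu>) = emeasure \<mu> B\<close>)
  qed
  also have "\<dots> \<le> (\<integral>\<^sup>+\<omega>. indicator E \<omega> \<partial>P (Some y))"
  proof (rule nn_integral_mono)
    fix \<omega> assume "\<omega> \<in> space (P (Some y))"
    then have w: "\<omega> \<in> \<Omega>" by simp
    show "case_option 0 (indicator B) (part_process X (ball x r) (ennreal (\<Phi> (\<eta> * r))) \<omega>) \<le> (indicator E \<omega> :: ennreal)"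
    proof (cases "part_process X (ball x r) (ennreal (\<Phi> (\<eta> * r))) \<omega>")
      case (Some z)
      show ?thesis
      proof (cases "z \<in> B")
        case True
        have "\<omega> \<in> E" using part_process_in[OF Some] True by (intro st[OF w]) auto
        then show ?thesis using Some by (simp split: split_indicator)
      qed (use Some in simp)
    qed simp
  qed
  also have "\<dots> = emeasure (P (Some y)) E" using E by simp
  finally show ?thesis .
qed

text \<open>
  All volume and near-diagonal estimates are available at every centre within \<open>r / \<eta>\<^sup>2\<close> of \<open>x\<close>
  for all radii from \<open>\<eta>\<^sup>2 r / l\<close> on.
\<close>

definition large :: "'a \<Rightarrow> real \<Rightarrow> bool" where
  "large x r \<longleftrightarrow> 0 < r \<and> R * (dd x0 x + r / \<eta>\<^sup>2) powr \<upsilon> < \<eta>\<^sup>2 * r / l"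

lemma dd_ge_1: "1 \<le> dd x0 x" by (simp add: dd_def)

lemma largeD:
  assumes "large x r" "y \<in> ball x (r / \<eta>\<^sup>2)"
  shows "R * dd x0 y powr \<upsilon> < \<eta>\<^sup>2 * r / l" 
proof -
  have "dist y x0 \<le> dist x x0 + dist x y" by (metis add.commute dist_commute dist_triangle)
  then have "dd x0 y \<le> dd x0 x + r / \<eta>\<^sup>2" using assms(2) by (simp add: dd_def)
  then have "dd x0 y powr \<upsilon> \<le> (dd x0 x + r / \<eta>\<^sup>2) powr \<upsilon>"
    using ups dd_ge_1[of y] by (intro powr_mono2) auto
  then have "R * dd x0 y powr \<upsilon> \<le> R * (dd x0 x + r / \<eta>\<^sup>2) powr \<upsilon>" using R by (intro mult_left_mono) auto
  with assms(1) show ?thesis by (simp add: large_def)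
qed

lemma large_simps:
  assumes "large x r"
  shows "0 < r" "R * dd x0 x powr \<upsilon> < \<eta>\<^sup>2 * r / l" "R < \<eta>\<^sup>2 * r / l" "R < \<eta> * r / l" "R < r"
    "\<eta>\<^sup>2 * r / l \<le> \<eta>\<^sup>2 * r" "\<eta>\<^sup>2 * r < r" "r < r / \<eta>" "r / \<eta> < r / \<eta>\<^sup>2" "r / \<eta>\<^sup>2 < r / \<eta>^3" "r / \<eta> ^ 3 < r / \<eta> ^ 4"
proof -
  show r: "0 < r" using assms by (simp add: large_def)
  have x: "x \<in> ball x (r / \<eta>\<^sup>2)" using r eta by simp
  show a: "R * dd x0 x powr \<upsilon> < \<eta>\<^sup>2 * r / l" by (rule largeD[OF assms x])
  have "1 \<le> dd x0 x powr \<upsilon>" using dd_ge_1[of x] ups by (intro ge_one_powr_ge_zero) auto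
  then have "R \<le> R * dd x0 x powr \<upsilon>" using R by simp
  with a show b: "R < \<eta>\<^sup>2 * r / l" by simp
  have "\<eta>\<^sup>2 * r / l \<le> \<eta> * r / l" using r eta l by (intro divide_right_mono mult_right_mono) (auto simp: power2_eq_square mult_left_le)
  with b show "R < \<eta> * r / l" by simp
  show c: "\<eta>\<^sup>2 * r / l \<le> \<eta>\<^sup>2 * r" using l r eta by (simp add: divide_le_eq)
  have e2: "\<eta>\<^sup>2 < 1" using eta by (simp add: power_less_one_iff)
  then show d: "\<eta>\<^sup>2 * r < r" using r by simp
  with b c show "R < r" by linarith
  show "r < r / \<eta>" using r eta by (simp add: field_simps)
  show "r / \<eta> < r / \<eta>\<^sup>2" using r eta by (simp add: field_simps power2_eq_square)
  show "r / \<eta>\<^sup>2 < r / \<eta>^3" using r eta by (intro divide_strict_left_mono) (auto intro!: power_strict_decreasing)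
  show "r / \<eta>^3 < r / \<eta>^4" using r eta by (intro divide_strict_left_mono) (auto intro!: power_strict_decreasing)
qed

text \<open>As \<open>\<upsilon> < 1\<close>, the left side in \<open>large\<close> is sublinear in
  \<open>r\<close>.\<close>

lemma eventually_large: "\<forall>\<^sub>F r in at_top. large x r"
proof -
  have lim: "((\<lambda>r. R * (dd x0 x + r / \<eta>\<^sup>2) powr \<upsilon> / r) \<longlongrightarrow> 0) at_top"
  proof -
    have e: "0 < \<eta>\<^sup>2" using eta by simp
    have d: "0 < dd x0 x" using dd_ge_1[of x] by simp
    have hi: "\<forall>\<^sub>F r in at_top. R * (dd x0 x + r / \<eta>\<^sup>2) powr \<upsilon> / r \<le> R * (2 / \<eta>\<^sup>2) powr \<upsilon> * r powr (\<upsilon> - 1)"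
      using eventually_ge_at_top[of "max 1 (dd x0 x * \<eta>\<^sup>2)"]
    proof eventually_elim
      case (elim r)
      then have r: "0 < r" "dd x0 x * \<eta>\<^sup>2 \<le> r" by auto
      have "dd x0 x + r / \<eta>\<^sup>2 \<le> 2 / \<eta>\<^sup>2 * r"
      proof -
        have "dd x0 x \<le> r / \<eta>\<^sup>2" using r e by (simp add: pos_le_divide_eq)
        then show ?thesis by simp
      qed
      then have "(dd x0 x + r / \<eta>\<^sup>2) powr \<upsilon> \<le> (2 / \<eta>\<^sup>2 * r) powr \<upsilon>"
        using ups d r e by (intro powr_mono2) auto
      also have "\<dots> = (2 / \<eta>\<^sup>2) powr \<upsilon> * r powr \<upsilon>" by (rule powr_mult)
      finally have "R * (dd x0 x + r / \<eta>\<^sup>2) powr \<upsilon> / r \<le> R * ((2 / \<eta>\<^sup>2) powr \<upsilon> * r powr \<upsilon>) / r"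
        using R r by (intro divide_right_mono mult_left_mono) auto
      also have "\<dots> = R * (2 / \<eta>\<^sup>2) powr \<upsilon> * r powr (\<upsilon> - 1)" using r by (simp add: powr_diff)
      finally show ?case .
    qed
    have lo: "\<forall>\<^sub>F r in at_top. 0 \<le> R * (dd x0 x + r / \<eta>\<^sup>2) powr \<upsilon> / r"
      using eventually_gt_at_top[of 0] by eventually_elim (use R in auto)
    have up: "((\<lambda>r. R * (2 / \<eta>\<^sup>2) powr \<upsilon> * r powr (\<upsilon> - 1)) \<longlongrightarrow> 0) at_top"
    proof -
      have "((\<lambda>r::real. r powr (\<upsilon> - 1)) \<longlongrightarrow> 0) at_top"
        by (rule tendsto_neg_powr[OF _ filterlim_ident]) (use ups in simp)
      from tendsto_mult_right_zero[OF this] show ?thesis .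
    qed
    show ?thesis by (rule tendsto_sandwich[OF lo hi tendsto_const up])
  qed
  have "0 < \<eta>\<^sup>2 / l" using eta l by simp
  from order_tendstoD(2)[OF lim this] eventually_gt_at_top[of 0]
  show ?thesis
    by eventually_elim (simp add: large_def field_simps)
qed

text \<open>Visits are counted in the ball of radius \<open>r / \<eta>\<^sup>2\<close>. The
  near-diagonal bound on the ball of radius \<open>r / \<eta> ^ 4\<close> covers all pairs of points
  of that ball, and its time is \<open>\<Phi> (\<eta> * (r / \<eta> ^ 4))\<close>, the time unit
  chosen here.\<close>

definition U0 :: "real \<Rightarrow> real" where "U0 r = \<Phi> (r / \<eta> ^ 3)"
definition \<nu> :: "'a \<Rightarrow> real \<Rightarrow> 'a measure" where "\<nu> x r = uniform_measure \<mu> (ball x (r / \<eta>\<^sup>2))"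
text \<open>The volume quotient for radii of ratio at most \<open>l / \<eta> ^ 6\<close>. The
  extreme pair, \<open>\<eta>\<^sup>2 * r / l\<close> and \<open>r / \<eta> ^ 4\<close>, occurs in
  \<open>scale_A4\<close>.\<close>

definition kap :: real where "kap = Cm * (l / \<eta> ^ 6) powr d2"
text \<open>Decay exponent of return probabilities in time: volume grows in the radius at least with
  exponent \<open>d1\<close>, time at most with exponent \<open>\<beta>\<close>.\<close>

definition gam :: real where "gam = d1 / \<beta>"
definition c5 :: real where "c5 = min 1 (cl / kap)"
text \<open>Bounds the number of pieces \<open>m1\<close> into which \<open>scale_A4\<close> divides
  one time unit.\<close>

definition mbar :: nat where "mbar = nat \<lceil>CU * (1 / \<eta> ^ 4) powr \<beta>\<rceil> + 1"
text \<open>One transition into a smaller ball, followed by \<open>8 * mbar\<close> stays there,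
  each of probability at least \<open>c5\<close>.\<close>

definition c0 :: real where "c0 = c5 * c5 ^ (8 * mbar)"
definition C0 :: real where "C0 = max 1 (cu * (Cm * 2 powr d2) / cm * CU powr gam)"
text \<open>A grid with \<open>H \<ge> H0\<close> has step at most
  \<open>\<Phi> (r / \<eta>)\<close>, the time of the near-diagonal bound on
  \<open>ball x (r / \<eta>\<^sup>2)\<close>.\<close>

definition H0 :: real where "H0 = CU * (1 / \<eta>\<^sup>2) powr \<beta>"

lemma kap_pos: "0 < kap" using vrd_const l eta by (simp add: kap_def)
lemma gam_gt_1: "1 < gam" using beta by (simp add: gam_def)
lemma c5: "0 < c5" "c5 \<le> 1" using cl kap_pos by (simp_all add: c5_def)
lemma c0: "0 < c0" "c0 \<le> c5" "c0 \<le> 1"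
  using c5 by (auto simp: c0_def power_le_one mult_left_le intro: mult_le_one)

lemma vol_ratio_kap:
  assumes "R * dd x0 x powr \<upsilon> < s" "s \<le> r" "r \<le> s * (l / \<eta> ^ 6)"
  shows "c5 \<le> cl * vol \<mu> x s / vol \<mu> x r"
proof -
  have s: "0 < s" using assms(1) R by (smt (verit) mult_nonneg_nonneg powr_ge_zero)
  have vs: "0 < vol \<mu> x s" and vr: "0 < vol \<mu> x r" using vol_pos assms by auto
  have "vol \<mu> x r \<le> Cm * (r / s) powr d2 * vol \<mu> x s" by (rule vol_ratio(1)[OF assms(2,1)])
  also have "\<dots> \<le> kap * vol \<mu> x s"
    unfolding kap_def using s assms vs vrd_const by (intro mult_right_mono mult_left_mono powr_mono2) (auto simp: field_simps)
  finally have "cl / kap \<le> cl * vol \<mu> x s / vol \<mu> x r"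
    using vs vr kap_pos cl by (simp add: field_simps)
  then show ?thesis by (simp add: c5_def)
qed

lemma ndl_ball_event:
  assumes r: "R * dd x0 x powr \<upsilon> < s" "s \<le> \<eta>\<^sup>2 * r" "r \<le> s * (l / \<eta> ^ 6)" and y: "y \<in> ball x (\<eta>\<^sup>2 * r)"
    and E: "E \<in> sets (P (Some y))"
    and st: "\<And>\<omega>. \<omega> \<in> \<Omega> \<Longrightarrow> X (ennreal (\<Phi> (\<eta> * r))) \<omega> \<in> Some ` ball x s \<Longrightarrow>
      (\<And>s. 0 < s \<Longrightarrow> s \<le> ennreal (\<Phi> (\<eta> * r)) \<Longrightarrow> X s \<omega> \<in> Some ` ball x r) \<Longrightarrow> \<omega> \<in> E"
  shows "ennreal c5 \<le> emeasure (P (Some y)) E"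
proof -
  have s: "0 < s" using r(1) R by (smt (verit) mult_nonneg_nonneg powr_ge_zero)
  have e1: "0 < \<eta>\<^sup>2" "\<eta>\<^sup>2 \<le> 1" using eta by (auto simp: power_le_one)
  have "0 < r" using s r(2) e1 by (metis order_less_le_trans zero_less_mult_pos)
  then have sr: "s \<le> r" using r(2) e1 by (meson mult_left_le_one_le order_trans less_imp_le)
  have "ennreal c5 \<le> ennreal (cl / vol \<mu> x r) * emeasure \<mu> (ball x s)"
    using vol_ratio_kap[OF r(1) sr r(3)] vol_pos[OF r(1)] cl
    by (simp add: ennreal_mult''[symmetric] ennreal_leI)
  also have "\<dots> \<le> emeasure (P (Some y)) E"
    using r sr st by (intro ndl_event[OF _ y _ _ E]) auto
  finally show ?thesis .
qed

end

context borel_standard_process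
begin

lemma pr_start:
  assumes "y \<in> ball x r"
  shows "pr (Some y) (\<lambda>p. p 0 \<in> Some ` ball x r) = 1"
proof (rule antisym[OF pr_le_1])
  interpret Py: prob_space "P (Some y)" by (rule prob_space_P)
  have m: "Measurable.pred path_space (\<lambda>p. p 0 \<in> Some ` ball x r)" by measurable
  have "1 = emeasure (P (Some y)) \<Omega>" using Py.emeasure_space_1 by simp
  also have "\<dots> \<le> emeasure (P (Some y)) {\<omega>\<in>\<Omega>. path 0 \<omega> 0 \<in> Some ` ball x r}"
  proof (rule emeasure_mono_AE)
    show "AE \<omega> in P (Some y). \<omega> \<in> \<Omega> \<longrightarrow> \<omega> \<in> {\<omega>\<in>\<Omega>. path 0 \<omega> 0 \<in> Some ` ball x r}"
      using normal[of "Some y"] assms by (auto simp: path_apply)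
    show "{\<omega>\<in>\<Omega>. path 0 \<omega> 0 \<in> Some ` ball x r} \<in> sets (P (Some y))" by (rule event_path[OF m])
  qed
  also have "\<dots> = pr (Some y) (\<lambda>p. p 0 \<in> Some ` ball x r)" by (rule pr_eq[OF m, symmetric])
  finally show "1 \<le> pr (Some y) (\<lambda>p. p 0 \<in> Some ` ball x r)" .
qed

end

context diffusive_process
begin

section \<open>Verification of the one-scale assumptions\<close>

lemma eta_le: "r / \<eta>\<^sup>2 \<le> r * (l / \<eta> ^ 6)" "r / \<eta> ^ 4 \<le> r / \<eta>\<^sup>2 * (l / \<eta> ^ 6)" if "0 < r"
proof -
  have e: "\<eta> ^ 6 \<le> \<eta>\<^sup>2" using eta by (intro power_decreasing) auto
  have "\<eta> ^ 6 * 1 \<le> \<eta>\<^sup>2 * l" using e l eta by (intro mult_mono) auto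
  then show "r / \<eta>\<^sup>2 \<le> r * (l / \<eta> ^ 6)" using that eta by (simp add: field_simps)
  have "\<eta> ^ 8 \<le> \<eta> ^ 4" using eta by (intro power_decreasing) auto
  then have "\<eta> ^ 8 * 1 \<le> \<eta> ^ 4 * l" using l eta by (intro mult_mono) auto
  then show "r / \<eta> ^ 4 \<le> r / \<eta>\<^sup>2 * (l / \<eta> ^ 6)" using that eta by (simp add: field_simps flip: power_add)
qed

text \<open>The near-diagonal bound on \<open>ball x (r / \<eta>\<^sup>2)\<close> keeps the path in
  this ball throughout the positive times up to \<open>\<Phi> (r / \<eta>)\<close>, and these
  include every \<open>s > 0\<close> of a grid step. At \<open>s = 0\<close> the starting point
  itself decides.\<close>

lemma scale_A1:
  assumes r: "large x r" and H: "H0 \<le> real H" "1 \<le> H" and y: "y \<in> ball x r" and s: "0 \<le> s" "s \<le> U0 r / real H"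
  shows "ennreal c0 \<le> pr (Some y) (\<lambda>p. p (ennreal s) \<in> Some ` ball x (r / \<eta>\<^sup>2))"
proof (cases "s = 0")
  case True
  have "y \<in> ball x (r / \<eta>\<^sup>2)" using y large_simps[OF r] by auto
  from pr_start[OF this] c0 True show ?thesis by (simp add: ennreal_le_1)
next
  case False
  note L = large_simps[OF r]
  have "U0 r \<le> CU * (r / \<eta> ^ 3 / (r / \<eta>)) powr \<beta> * \<Phi> (r / \<eta>)"
    unfolding U0_def using L by (intro Phi_upper') linarith+
  also have "r / \<eta> ^ 3 / (r / \<eta>) = 1 / \<eta>\<^sup>2" using L(1) eta by (simp add: field_simps power3_eq_cube power2_eq_square)
  finally have "U0 r \<le> H0 * \<Phi> (r / \<eta>)" by (simp add: H0_def)
  also have "\<dots> \<le> real H * \<Phi> (r / \<eta>)" using Phi_pos[of "r / \<eta>"] L(1) eta H by (intro mult_right_mono) auto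
  finally have "U0 r / real H \<le> \<Phi> (r / \<eta>)" using H by (simp add: field_simps)
  then have s': "s \<le> \<Phi> (r / \<eta>)" using s by simp
  have e: "\<eta>\<^sup>2 * (r / \<eta>\<^sup>2) = r" "\<eta> * (r / \<eta>\<^sup>2) = r / \<eta>" using eta by (auto simp: power2_eq_square)
  have m: "Measurable.pred path_space (\<lambda>p. p (ennreal s) \<in> Some ` ball x (r / \<eta>\<^sup>2))" by measurable
  have "ennreal c5 \<le> emeasure (P (Some y)) {\<omega>\<in>\<Omega>. path 0 \<omega> (ennreal s) \<in> Some ` ball x (r / \<eta>\<^sup>2)}"
  proof (rule ndl_ball_event[where r="r / \<eta>\<^sup>2" and s=r and x=x])
    show "R * dd x0 x powr \<upsilon> < r" using L by linarith
    show "r / \<eta>\<^sup>2 \<le> r * (l / \<eta> ^ 6)" using eta_le[OF L(1)] by simp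
    fix \<omega> assume "\<omega> \<in> \<Omega>" and st: "\<And>s. 0 < s \<Longrightarrow> s \<le> ennreal (\<Phi> (\<eta> * (r / \<eta>\<^sup>2))) \<Longrightarrow> X s \<omega> \<in> Some ` ball x (r / \<eta>\<^sup>2)"
    then show "\<omega> \<in> {\<omega>\<in>\<Omega>. path 0 \<omega> (ennreal s) \<in> Some ` ball x (r / \<eta>\<^sup>2)}"
      using st[of "ennreal s"] s s' False unfolding e by (simp add: path_apply ennreal_leI)
  qed (use y e event_path[OF m] in auto)
  moreover have "ennreal c0 \<le> ennreal c5" using c0 by (intro ennreal_leI) simp
  ultimately show ?thesis unfolding pr_eq[OF m] by (rule order_trans[rotated])
qed

lemma emeasure_D:
  assumes "large x r"
  shows "emeasure \<mu> (ball x (r / \<eta>\<^sup>2)) = ennreal (vol \<mu> x (r / \<eta>\<^sup>2))" "0 < vol \<mu> x (r / \<eta>\<^sup>2)"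
proof -
  have "R * dd x0 x powr \<upsilon> < r / \<eta>\<^sup>2" using large_simps[OF assms] by linarith
  then show "emeasure \<mu> (ball x (r / \<eta>\<^sup>2)) = ennreal (vol \<mu> x (r / \<eta>\<^sup>2))" "0 < vol \<mu> x (r / \<eta>\<^sup>2)"
    using vol_pos by auto
qed

lemma nn_integral_nu:
  assumes "large x r" "g \<in> borel_measurable borel"
  shows "(\<integral>\<^sup>+y. g y \<partial>\<nu> x r) = ennreal (1 / vol \<mu> x (r / \<eta>\<^sup>2)) * (\<integral>\<^sup>+y. g y * indicator (ball x (r / \<eta>\<^sup>2)) y \<partial>\<mu>)"
proof -
  have "(\<integral>\<^sup>+y. g y \<partial>\<nu> x r) = (\<integral>\<^sup>+y. g y * indicator (ball x (r / \<eta>\<^sup>2)) y \<partial>\<mu>) / emeasure \<mu> (ball x (r / \<eta>\<^sup>2))"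
    unfolding \<nu>_def using assms(2) sets_mu
    by (intro nn_integral_uniform_measure) (simp_all add: measurable_cong_sets[OF sets_mu refl])
  then show ?thesis
    using emeasure_D[OF assms(1)] by (simp add: divide_ennreal_def inverse_ennreal mult.commute inverse_eq_divide)
qed

lemma scale_A3:
  assumes r: "large x r" and y: "y \<in> ball x (r / \<eta>\<^sup>2)" and g: "g \<in> borel_measurable borel" "\<And>y. g y \<le> 1"
  shows "ennreal c0 * (\<integral>\<^sup>+y. g y \<partial>\<nu> x r) \<le> (\<integral>\<^sup>+\<omega>. case_option 0 g (X (ennreal (U0 r)) \<omega>) \<partial>P (Some y))"
proof -
  note L = large_simps[OF r]
  have e: "\<eta>\<^sup>2 * (r / \<eta>^4) = r / \<eta>\<^sup>2" "\<eta> * (r / \<eta>^4) = r / \<eta>^3"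
    using eta by (auto simp: field_simps power_numeral_reduce)
  have R1: "R * dd x0 x powr \<upsilon> < r / \<eta>\<^sup>2" and R2: "R * dd x0 x powr \<upsilon> < r / \<eta>^4" using L by linarith+
  let ?I = "\<integral>\<^sup>+y. g y * indicator (ball x (r / \<eta>\<^sup>2)) y \<partial>\<mu>"
  have "c5 \<le> cl * vol \<mu> x (r / \<eta>\<^sup>2) / vol \<mu> x (r / \<eta>^4)"
    using L eta_le[OF L(1)] by (intro vol_ratio_kap R1) auto
  then have "c0 * (1 / vol \<mu> x (r / \<eta>\<^sup>2)) \<le> cl / vol \<mu> x (r / \<eta>^4)"
    using c0 vol_pos(1)[OF R1] vol_pos(1)[OF R2] by (simp add: field_simps) (smt (verit) mult_right_mono)
  then have "ennreal c0 * (\<integral>\<^sup>+y. g y \<partial>\<nu> x r) \<le> ennreal (cl / vol \<mu> x (r / \<eta>^4)) * ?I"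
    unfolding nn_integral_nu[OF r g(1)] mult.assoc[symmetric]
    using c0 emeasure_D(2)[OF r] by (intro mult_right_mono) (auto simp: ennreal_mult''[symmetric] intro!: ennreal_leI)
  also have "\<dots> \<le> (\<integral>\<^sup>+\<omega>. case_option 0 g (part_process X (ball x (r / \<eta>^4)) (ennreal (U0 r)) \<omega>) \<partial>P (Some y))"
    using ndl_integral[OF R2 _ g, of y] y unfolding e U0_def by simp
  also have "\<dots> \<le> (\<integral>\<^sup>+\<omega>. case_option 0 g (X (ennreal (U0 r)) \<omega>) \<partial>P (Some y))"
    by (intro nn_integral_mono) (simp add: part_process_def)
  finally show ?thesis .
qed

text \<open>Iterate the near-diagonal bound on \<open>ball x q\<close>: during each period
  \<open>\<tau>\<close> the path remains in this ball, hence occupies \<open>ball x r\<close> for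
  the full period, and it ends in the core \<open>ball x (\<eta>\<^sup>2 * q)\<close>, from which
  the next period can start.\<close>

lemma stay_power:
  assumes r: "R * dd x0 x powr \<upsilon> < \<eta>\<^sup>2 * q" "0 < q" "q \<le> r" and y: "y \<in> ball x (\<eta>\<^sup>2 * q)" and k: "\<tau> = \<Phi> (\<eta> * q)"
  shows "ennreal (c5 ^ k) \<le> pr (Some y) (\<lambda>p. ennreal (real k * \<tau>) \<le> occ x r (ennreal (real k * \<tau>)) p \<and>
      p (ennreal (real k * \<tau>)) \<in> Some ` ball x (\<eta>\<^sup>2 * q))"
  using y
proof (induction k arbitrary: y)
  case 0
  then show ?case using pr_start[OF 0] by simp
next
  case (Suc k)
  let ?B = "Some ` ball x (\<eta>\<^sup>2 * q)"
  let ?A = "\<lambda>k p. ennreal (real k * \<tau>) \<le> occ x r (ennreal (real k * \<tau>)) p \<and> p (ennreal (real k * \<tau>)) \<in> ?B"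
  have \<tau>: "0 < \<tau>" unfolding k using r eta by (intro Phi_pos) simp
  have m[measurable]: "Measurable.pred path_space (?A k)" for k by measurable
  let ?G = "{\<omega>\<in>\<Omega>. ennreal \<tau> \<le> occ x r (ennreal \<tau>) (path 0 \<omega>)} \<inter> {\<omega>\<in>\<Omega>. X (ennreal \<tau>) \<omega> \<in> ?B}"
  have G: "?G \<in> sets (F (ennreal \<tau>))"
  proof (rule sets.Int)
    have "(\<lambda>\<omega>. occ x r (ennreal \<tau>) (path 0 \<omega>)) \<in> borel_measurable (F (ennreal \<tau>))"
      using measurable_occ_path_F[of x r "ennreal \<tau>" 0] by simp
    then have "{\<omega>\<in>space (F (ennreal \<tau>)). ennreal \<tau> \<le> occ x r (ennreal \<tau>) (path 0 \<omega>)} \<in> sets (F (ennreal \<tau>))" by measurable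
    then show "{\<omega>\<in>\<Omega>. ennreal \<tau> \<le> occ x r (ennreal \<tau>) (path 0 \<omega>)} \<in> sets (F (ennreal \<tau>))" by (simp add: space_F)
    show "{\<omega>\<in>\<Omega>. X (ennreal \<tau>) \<omega> \<in> ?B} \<in> sets (F (ennreal \<tau>))"
      using measurable_sets[OF adapted ball_cem, of "ennreal \<tau>" x "\<eta>\<^sup>2 * q"]
      by (simp add: vimage_def Collect_conj_eq Int_commute space_F)
  qed
  have cG: "ennreal c5 \<le> emeasure (P (Some y)) ?G"
  proof (rule ndl_ball_event[where r=q and s="\<eta>\<^sup>2 * q" and x=x])
    have e: "\<eta>\<^sup>2 \<le> 1" using eta by (simp add: power_le_one)
    have "\<eta> ^ 6 \<le> \<eta>\<^sup>2" using eta by (intro power_decreasing) auto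
    then have "\<eta> ^ 6 * 1 \<le> \<eta>\<^sup>2 * l" using l eta by (intro mult_mono) auto
    then show "q \<le> \<eta>\<^sup>2 * q * (l / \<eta> ^ 6)" using r eta by (simp add: field_simps)
    fix \<omega> assume w: "\<omega> \<in> \<Omega>" "X (ennreal (\<Phi> (\<eta> * q))) \<omega> \<in> ?B"
      and st: "\<And>s. 0 < s \<Longrightarrow> s \<le> ennreal (\<Phi> (\<eta> * q)) \<Longrightarrow> X s \<omega> \<in> Some ` ball x q"
    have "occ x r (ennreal \<tau>) (path 0 \<omega>) = ennreal \<tau>"
    proof (rule occ_full[OF w(1)])
      fix v assume "0 < v" "v \<le> \<tau>"
      then have "X (ennreal v) \<omega> \<in> Some ` ball x q" using st[of "ennreal v"] by (simp add: k ennreal_leI)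
      then show "X (0 + ennreal v) \<omega> \<in> Some ` ball x r" using r(3) by auto
    qed (use \<tau> in simp)
    then show "\<omega> \<in> ?G" using w by (simp add: k)
  qed (use r Suc.prems sets_F_P[OF G] in auto)
  have "ennreal (c5 ^ Suc k) = ennreal (c5 ^ k) * ennreal c5" using c5 by (simp add: ennreal_mult' mult.commute)
  also have "\<dots> \<le> ennreal (c5 ^ k) * emeasure (P (Some y)) ?G" by (intro mult_left_mono cG) simp
  also have "\<dots> = (\<integral>\<^sup>+\<omega>. ennreal (c5 ^ k) * indicator ?G \<omega> \<partial>P (Some y))"
    by (rule nn_integral_cmult_indicator[symmetric, OF sets_F_P[OF G]])
  also have "\<dots> \<le> (\<integral>\<^sup>+\<omega>. indicator ?G \<omega> * pr (X (ennreal \<tau>) \<omega>) (?A k) \<partial>P (Some y))"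
    using Suc.IH by (intro nn_integral_mono) (auto split: split_indicator)
  also have "\<dots> = emeasure (P (Some y)) (?G \<inter> {\<omega>\<in>\<Omega>. ?A k (path (ennreal \<tau>) \<omega>)})"
    by (rule markov_event[OF G m, symmetric])
  also have "\<dots> \<le> emeasure (P (Some y)) {\<omega>\<in>\<Omega>. ?A (Suc k) (path 0 \<omega>)}"
  proof (rule emeasure_mono[OF _ event_path[OF m]])
    have sum: "ennreal (real (Suc k) * \<tau>) = ennreal \<tau> + ennreal (real k * \<tau>)"
      using \<tau> by (simp add: algebra_simps)
    show "?G \<inter> {\<omega>\<in>\<Omega>. ?A k (path (ennreal \<tau>) \<omega>)} \<subseteq> {\<omega>\<in>\<Omega>. ?A (Suc k) (path 0 \<omega>)}"
    proof
      fix \<omega> assume w: "\<omega> \<in> ?G \<inter> {\<omega>\<in>\<Omega>. ?A k (path (ennreal \<tau>) \<omega>)}"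
      then have wO: "\<omega> \<in> \<Omega>" by simp
      have "occ x r (ennreal \<tau> + ennreal (real k * \<tau>)) (path 0 \<omega>) =
        occ x r (ennreal \<tau>) (path 0 \<omega>) + occ x r (ennreal (real k * \<tau>)) (path (0 + ennreal \<tau>) \<omega>)"
        using \<tau> by (intro occ_split[OF wO]) simp
      then have "ennreal \<tau> + ennreal (real k * \<tau>) \<le> occ x r (ennreal \<tau> + ennreal (real k * \<tau>)) (path 0 \<omega>)"
        using w by (auto intro!: add_mono)
      moreover have "path 0 \<omega> (ennreal \<tau> + ennreal (real k * \<tau>)) \<in> ?B" using w by (auto simp: path_apply)
      ultimately show "\<omega> \<in> {\<omega>\<in>\<Omega>. ?A (Suc k) (path 0 \<omega>)}" using wO unfolding sum by blast
    qed
  qed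
  also have "\<dots> = pr (Some y) (?A (Suc k))" by (rule pr_eq[OF m, symmetric])
  finally show ?case .
qed

text \<open>After one unit the process is in a core ball with probability at least
  \<open>c5\<close>; then it stays for exactly eight units. To make the stays fit, the radius
  \<open>q\<close> is chosen by the intermediate value theorem so that
  \<open>\<Phi> (\<eta> * q)\<close> is one unit divided by the integer \<open>m1\<close>.\<close>

lemma scale_A4:
  assumes r: "large x r" and y: "y \<in> ball x (r / \<eta>\<^sup>2)"
  shows "ennreal c0 \<le> pr (Some y) (\<lambda>p. ennreal (7 * U0 r) < occ x r (ennreal (9 * U0 r)) p \<and>
     p (ennreal (9 * U0 r)) \<in> Some ` ball x (r / \<eta>\<^sup>2))"
proof -
  note L = large_simps[OF r]
  let ?u = "U0 r"
  have u: "0 < ?u" unfolding U0_def using L(1) eta by (intro Phi_pos) simp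
  \<comment> \<open>Rounding up puts \<open>?u / real m1\<close> between
    \<open>\<Phi> (\<eta> * r) / 2\<close> and \<open>\<Phi> (\<eta> * r)\<close>, hence by
    \<open>uls\<close> between the values of \<open>\<Phi>\<close> at \<open>\<eta> * r / l\<close>
    and \<open>\<eta> * r\<close>.\<close>
  define m1 where "m1 = nat \<lceil>?u / \<Phi> (\<eta> * r)\<rceil>"
  have er: "0 < \<eta> * r" and pe: "0 < \<Phi> (\<eta> * r)" using L(1) eta by (auto intro!: Phi_pos)
  have "\<eta> * r \<le> r / \<eta> ^ 3" using L eta by (smt (verit) mult_left_le_one_le)
  then have "\<Phi> (\<eta> * r) \<le> ?u" unfolding U0_def using er by (intro Phi_le)
  then have q1: "1 \<le> ?u / \<Phi> (\<eta> * r)" using pe by simp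
  then have m1: "?u / \<Phi> (\<eta> * r) \<le> real m1" "real m1 \<le> ?u / \<Phi> (\<eta> * r) + 1" "1 \<le> m1" unfolding m1_def by linarith+
  have m1_2: "real m1 \<le> 2 * (?u / \<Phi> (\<eta> * r))" using m1 q1 by linarith
  have "R < \<eta> * r" using L(4) l er by (smt (verit) divide_le_eq_1_pos mult_imp_div_pos_le mult_le_cancel_left1)
  then have "?u \<le> CU * (r / \<eta>^3 / (\<eta> * r)) powr \<beta> * \<Phi> (\<eta> * r)"
    unfolding U0_def using \<open>\<eta> * r \<le> r / \<eta> ^ 3\<close> by (intro Phi_upper')
  also have "r / \<eta>^3 / (\<eta> * r) = 1 / \<eta> ^ 4" using L(1) eta by (simp add: field_simps power_numeral_reduce)
  finally have "?u / \<Phi> (\<eta> * r) \<le> CU * (1 / \<eta> ^ 4) powr \<beta>" using pe by (simp add: field_simps)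
  then have "m1 \<le> mbar" unfolding m1_def mbar_def by linarith
  have "2 * \<Phi> (\<eta> * r / l) \<le> \<Phi> (\<eta> * r)" by (rule uls) fact
  also have "\<dots> \<le> 2 * (?u / real m1)" using m1_2 m1(3) pe by (simp add: field_simps)
  finally have a: "\<Phi> (\<eta> * r / l) \<le> ?u / real m1" by simp
  have b: "?u / real m1 \<le> \<Phi> (\<eta> * r)" using m1 pe by (simp add: field_simps)
  have "\<eta> * r / l \<le> \<eta> * r" using er l divide_left_mono[of 1 l "\<eta> * r"] by simp
  from Phi_IVT[OF _ this a b] er l obtain v where v: "\<eta> * r / l \<le> v" "v \<le> \<eta> * r" "\<Phi> v = ?u / real m1"
    by (metis divide_pos_pos less_trans zero_less_one)
  define q where "q = v / \<eta>"
  have qv: "\<eta> * q = v" using eta by (simp add: q_def)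
  have q: "r / l \<le> q" "q \<le> r" using v eta by (auto simp: q_def field_simps)
  have q0: "0 < q" using q(1) L(1) l by (smt (verit) divide_pos_pos)
  have e2: "0 < \<eta>\<^sup>2" "\<eta>\<^sup>2 \<le> 1" using eta by (auto simp: power_le_one)
  have Rq: "R * dd x0 x powr \<upsilon> < \<eta>\<^sup>2 * q"
    using L(2) mult_left_mono[OF q(1), of "\<eta>\<^sup>2"] e2 by simp
  let ?B = "Some ` ball x (\<eta>\<^sup>2 * q)"
  define \<tau> where "\<tau> = \<Phi> (\<eta> * q)"
  have \<tau>: "real (8 * m1) * \<tau> = 8 * ?u" using m1(3) by (simp add: \<tau>_def qv v)
  let ?A = "\<lambda>p. ennreal (8 * ?u) \<le> occ x r (ennreal (8 * ?u)) p \<and> p (ennreal (8 * ?u)) \<in> ?B"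
  have mA: "Measurable.pred path_space ?A" by measurable
  let ?G = "{\<omega>\<in>\<Omega>. X (ennreal ?u) \<omega> \<in> ?B}"
  have G: "?G \<in> sets (F (ennreal ?u))"
    using measurable_sets[OF adapted ball_cem, of "ennreal ?u" x "\<eta>\<^sup>2 * q"]
    by (simp add: vimage_def Collect_conj_eq Int_commute space_F)
  have A: "ennreal (c5 ^ (8 * mbar)) \<le> pr (Some z) ?A" if "z \<in> ball x (\<eta>\<^sup>2 * q)" for z
  proof -
    have "c5 ^ (8 * mbar) \<le> c5 ^ (8 * m1)" using c5 \<open>m1 \<le> mbar\<close> by (intro power_decreasing) auto
    then have "ennreal (c5 ^ (8 * mbar)) \<le> ennreal (c5 ^ (8 * m1))" by (rule ennreal_leI)
    also have "\<dots> \<le> pr (Some z) ?A" using stay_power[OF Rq q0 q(2) that \<tau>_def, of "8 * m1"] unfolding \<tau> .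
    finally show ?thesis .
  qed
  have e: "\<eta>\<^sup>2 * (r / \<eta>^4) = r / \<eta>\<^sup>2" "\<eta> * (r / \<eta>^4) = r / \<eta>^3"
    using eta by (auto simp: field_simps power_numeral_reduce)
  have qr: "\<eta>\<^sup>2 * q \<le> r" using q(2) q0 e2 by (meson mult_left_le_one_le order_trans less_imp_le)
  have cG: "ennreal c5 \<le> emeasure (P (Some y)) ?G"
  proof (rule ndl_ball_event[where r="r / \<eta>^4" and s="\<eta>\<^sup>2 * q" and x=x])
    show "\<eta>\<^sup>2 * q \<le> \<eta>\<^sup>2 * (r / \<eta>^4)" unfolding e using qr L by linarith
    have "r \<le> l * q" using q(1) l by (simp add: field_simps)
    then have "r * \<eta>\<^sup>2 \<le> l * q * \<eta>\<^sup>2" using e2 by (intro mult_right_mono) auto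
    moreover have "r / \<eta>^4 = r * \<eta>\<^sup>2 / \<eta>^6" using eta by (simp add: field_simps flip: power_add)
    ultimately show "r / \<eta>^4 \<le> \<eta>\<^sup>2 * q * (l / \<eta> ^ 6)" using eta by (simp add: divide_right_mono mult_ac)
    fix \<omega> assume "\<omega> \<in> \<Omega>" "X (ennreal (\<Phi> (\<eta> * (r / \<eta> ^ 4)))) \<omega> \<in> ?B"
    then show "\<omega> \<in> ?G" unfolding e U0_def by simp
  qed (use Rq y sets_F_P[OF G] e in auto)
  let ?C = "\<lambda>p. ennreal (7 * ?u) < occ x r (ennreal (9 * ?u)) p \<and> p (ennreal (9 * ?u)) \<in> Some ` ball x (r / \<eta>\<^sup>2)"
  have mC: "Measurable.pred path_space ?C" by measurable
  have "ennreal c0 = ennreal (c5 ^ (8 * mbar)) * ennreal c5"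
    using c5 by (simp add: c0_def ennreal_mult' mult.commute)
  also have "\<dots> \<le> ennreal (c5 ^ (8 * mbar)) * emeasure (P (Some y)) ?G" by (intro mult_left_mono cG) simp
  also have "\<dots> = (\<integral>\<^sup>+\<omega>. ennreal (c5 ^ (8 * mbar)) * indicator ?G \<omega> \<partial>P (Some y))"
    by (rule nn_integral_cmult_indicator[symmetric, OF sets_F_P[OF G]])
  also have "\<dots> \<le> (\<integral>\<^sup>+\<omega>. indicator ?G \<omega> * pr (X (ennreal ?u) \<omega>) ?A \<partial>P (Some y))"
    using A by (intro nn_integral_mono) (auto split: split_indicator)
  also have "\<dots> = emeasure (P (Some y)) (?G \<inter> {\<omega>\<in>\<Omega>. ?A (path (ennreal ?u) \<omega>)})"
    by (rule markov_event[OF G mA, symmetric])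
  also have "\<dots> \<le> emeasure (P (Some y)) {\<omega>\<in>\<Omega>. ?C (path 0 \<omega>)}"
  proof (rule emeasure_mono[OF _ event_path[OF mC]])
    have sum: "ennreal (9 * ?u) = ennreal ?u + ennreal (8 * ?u)"
      using u by (subst ennreal_plus[symmetric]) auto
    show "?G \<inter> {\<omega>\<in>\<Omega>. ?A (path (ennreal ?u) \<omega>)} \<subseteq> {\<omega>\<in>\<Omega>. ?C (path 0 \<omega>)}"
    proof
      fix \<omega> assume w: "\<omega> \<in> ?G \<inter> {\<omega>\<in>\<Omega>. ?A (path (ennreal ?u) \<omega>)}"
      then have wO: "\<omega> \<in> \<Omega>" by simp
      have "occ x r (ennreal ?u + ennreal (8 * ?u)) (path 0 \<omega>) =
        occ x r (ennreal ?u) (path 0 \<omega>) + occ x r (ennreal (8 * ?u)) (path (0 + ennreal ?u) \<omega>)"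
        using u by (intro occ_split[OF wO]) simp
      then have "0 + ennreal (8 * ?u) \<le> occ x r (ennreal ?u + ennreal (8 * ?u)) (path 0 \<omega>)"
        using w by (auto intro!: add_increasing)
      moreover have "ennreal (7 * ?u) < ennreal (8 * ?u)" using u by (simp add: ennreal_lessI)
      ultimately have "ennreal (7 * ?u) < occ x r (ennreal (9 * ?u)) (path 0 \<omega>)" unfolding sum by simp
      moreover have "path 0 \<omega> (ennreal ?u + ennreal (8 * ?u)) \<in> Some ` ball x (r / \<eta>\<^sup>2)"
        using w qr L by (auto simp: path_apply)
      ultimately show "\<omega> \<in> {\<omega>\<in>\<Omega>. ?C (path 0 \<omega>)}" using wO unfolding sum by blast
    qed
  qed
  also have "\<dots> = pr (Some y) ?C" by (rule pr_eq[OF mC, symmetric])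
  finally show ?thesis .
qed

text \<open>Write \<open>t = \<Phi> s\<close>. The inclusion of \<open>ball x s\<close> in
  \<open>ball z (2 * s)\<close> and volume doubling move the volumes from the centres
  \<open>y\<close>, \<open>w\<close> to \<open>x\<close>. Growth of order \<open>d1\<close> of the
  volume and of order at most \<open>\<beta>\<close> of \<open>\<Phi>\<close> then give the factor
  \<open>(U0 r / t) powr gam\<close>.\<close>

lemma pM_le:
  assumes r: "large x r" and y: "y \<in> ball x (r / \<eta>\<^sup>2)" and w: "w \<in> ball x (r / \<eta>\<^sup>2)" and t: "U0 r \<le> t"
  shows "pM t y w \<le> ennreal (C0 * (U0 r / t) powr gam * (1 / vol \<mu> x (r / \<eta>\<^sup>2)))"
proof -
  note L = large_simps[OF r]
  let ?\<rho> = "r / \<eta>\<^sup>2" and ?q = "r / \<eta> ^ 3"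
  have u: "0 < U0 r" unfolding U0_def using L(1) eta by (intro Phi_pos) simp
  have q0: "0 < ?q" using L(1) eta by simp
  obtain s where s: "?q \<le> s" "\<Phi> s = t" "inv_into {0<..} \<Phi> t = s"
    using Phi_surj[OF q0] t unfolding U0_def by metis
  have s0: "0 < s" using s q0 by linarith
  have dl: "R * dd x0 z powr \<upsilon> < s" if "z \<in> ball x ?\<rho>" for z
    using largeD[OF r that] L s by linarith
  define V where "V = vol \<mu> x ?\<rho>"
  have V: "0 < V" unfolding V_def by (rule emeasure_D(2)[OF r])
  have lower: "cm * (s / ?\<rho>) powr d1 * V / (Cm * 2 powr d2) \<le> vol \<mu> z s" if z: "z \<in> ball x ?\<rho>" for z
  proof -
    have x: "x \<in> ball x ?\<rho>" using L(1) eta by simp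
    have "R * dd x0 x powr \<upsilon> < ?\<rho>" using L by linarith
    then have "cm * (s / ?\<rho>) powr d1 * V \<le> vol \<mu> x s"
      unfolding V_def using L s by (intro vol_ratio(2)) linarith+
    also have "\<dots> \<le> vol \<mu> z (2 * s)"
    proof -
      have z2: "R * dd x0 z powr \<upsilon> < 2 * s" using dl[OF z] s0 by linarith
      have "ball x s \<subseteq> ball z (2 * s)"
      proof
        fix a assume "a \<in> ball x s"
        moreover have "dist x z < s" using z s L by auto
        moreover have "dist z a \<le> dist x z + dist x a" by (metis dist_commute dist_triangle)
        ultimately show "a \<in> ball z (2 * s)" by simp
      qed
      then show ?thesis unfolding vol_def using vol_pos(2)[OF z2] sets_mu
        by (intro measure_mono_fmeasurable) (auto simp: fmeasurable_def)
    qed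
    also have "\<dots> \<le> Cm * (2 * s / s) powr d2 * vol \<mu> z s"
      using dl[OF z] s0 by (intro vol_ratio(1)) auto
    finally show ?thesis using s0 vrd_const by (simp add: field_simps)
  qed
  have "t \<le> CU * (s / ?q) powr \<beta> * U0 r"
    unfolding U0_def s(2)[symmetric] using s L by (intro Phi_upper') linarith+
  then have "t / (CU * U0 r) \<le> (s / ?q) powr \<beta>" using u CU by (simp add: field_simps)
  also have "\<dots> \<le> (s / ?\<rho>) powr \<beta>"
  proof (rule powr_mono2)
    have "0 < ?\<rho>" using L(1) eta by simp
    then have qr: "0 < ?q * ?\<rho>" using q0 by (rule mult_pos_pos[rotated])
    have "?\<rho> \<le> ?q" using L by linarith
    then show "s / ?q \<le> s / ?\<rho>" by (rule divide_left_mono[OF _ less_imp_le[OF s0] qr])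
    show "0 \<le> s / ?q" by (rule divide_nonneg_pos) (use s0 q0 in auto)
  qed (use beta in simp)
  finally have "(t / (CU * U0 r)) powr gam \<le> ((s / ?\<rho>) powr \<beta>) powr gam"
    using t u CU gam_gt_1 by (intro powr_mono2) auto
  also have "\<dots> = (s / ?\<rho>) powr d1" using beta by (simp add: powr_powr gam_def)
  finally have g1: "(t / (CU * U0 r)) powr gam \<le> (s / ?\<rho>) powr d1" .
  have t0: "0 < t" using t u by linarith
  have g2: "(t / (CU * U0 r)) powr gam = 1 / (CU powr gam * (U0 r / t) powr gam)"
    using t0 u CU by (simp add: powr_divide powr_mult field_simps)
  have pos: "0 < CU powr gam * (U0 r / t) powr gam" using t0 u CU by simp
  define K where "K = Cm * 2 powr d2"
  have K: "0 < K" using vrd_const by (simp add: K_def)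
  have lower': "cm * V / (K * (CU powr gam * (U0 r / t) powr gam)) \<le> vol \<mu> z s" if z: "z \<in> ball x ?\<rho>" for z
  proof -
    have "cm * V / (K * (CU powr gam * (U0 r / t) powr gam)) = cm * (t / (CU * U0 r)) powr gam * V / K"
      unfolding g2 using K pos by (simp add: field_simps)
    also have "\<dots> \<le> cm * (s / ?\<rho>) powr d1 * V / K"
      using g1 vrd_const V K by (intro divide_right_mono mult_right_mono mult_left_mono) auto
    also have "\<dots> \<le> vol \<mu> z s" using lower[OF z] by (simp add: K_def)
    finally show ?thesis .
  qed
  let ?m = "cm * V / (K * (CU powr gam * (U0 r / t) powr gam))"
  have m0: "0 < ?m" using vrd_const V K pos by simp
  have "pM t y w \<le> ennreal (cu / min (vol \<mu> y s) (vol \<mu> w s))"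
  proof -
    have "R * dd x0 y powr \<upsilon> \<le> ?q" "R * dd x0 w powr \<upsilon> \<le> ?q"
      using largeD[OF r y] largeD[OF r w] L by linarith+
    then have "R * (max (dd x0 y) (dd x0 w)) powr \<upsilon> \<le> ?q" by (simp add: max_def)
    moreover have "0 < R * (max (dd x0 y) (dd x0 w)) powr \<upsilon>" using R dd_ge_1[of y] by (intro mult_pos_pos) auto
    ultimately have "\<Phi> (R * (max (dd x0 y) (dd x0 w)) powr \<upsilon>) \<le> t" using t unfolding U0_def by (meson Phi_le order_trans)
    from ndu[OF this] show ?thesis unfolding s(3) .
  qed
  also have "\<dots> \<le> ennreal (cu / ?m)"
  proof (intro ennreal_leI divide_left_mono)
    show mm: "?m \<le> min (vol \<mu> y s) (vol \<mu> w s)" using lower'[OF y] lower'[OF w] by (rule min.boundedI)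
    show "0 < min (vol \<mu> y s) (vol \<mu> w s) * ?m"
      by (rule mult_pos_pos[OF order_less_le_trans[OF m0 mm] m0])
  qed (use cu in simp)
  also have "\<dots> \<le> ennreal (C0 * (U0 r / t) powr gam * (1 / V))"
  proof (rule ennreal_leI)
    have "cu / ?m = (cu * K / cm * CU powr gam) * ((U0 r / t) powr gam * (1 / V))"
      using K V vrd_const by (simp add: field_simps)
    also have "\<dots> \<le> C0 * ((U0 r / t) powr gam * (1 / V))"
      using V by (intro mult_right_mono) (auto simp: C0_def K_def)
    finally show "cu / ?m \<le> C0 * (U0 r / t) powr gam * (1 / V)" by (simp add: mult.assoc)
  qed
  finally show ?thesis by (simp add: V_def)
qed

lemma scale_A2:
  assumes r: "large x r" and y: "y \<in> ball x (r / \<eta>\<^sup>2)" and t: "U0 r \<le> t" and g: "g \<in> borel_measurable borel" "\<And>y. g y \<le> 1"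
  shows "(\<integral>\<^sup>+\<omega>. case_option 0 (\<lambda>y. indicator (ball x (r / \<eta>\<^sup>2)) y * g y) (X (ennreal t) \<omega>) \<partial>P (Some y))
          \<le> ennreal (C0 * (U0 r / t) powr gam) * (\<integral>\<^sup>+y. g y \<partial>\<nu> x r)"
proof -
  note L = large_simps[OF r]
  let ?D = "ball x (r / \<eta>\<^sup>2)"
  let ?g = "\<lambda>y. indicator ?D y * g y"
  have u: "0 < U0 r" unfolding U0_def using L(1) eta by (intro Phi_pos) simp
  then have t0: "0 < t" using t by linarith
  have gm: "?g \<in> borel_measurable borel" using g(1) by (intro borel_measurable_times_ennreal borel_measurable_indicator) simp_all
  have g1: "?g z \<le> 1" for z using g(2) by (simp split: split_indicator)
  have V: "0 < vol \<mu> x (r / \<eta>\<^sup>2)" by (rule emeasure_D(2)[OF r])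
  have "(\<integral>\<^sup>+\<omega>. case_option 0 ?g (X (ennreal t) \<omega>) \<partial>P (Some y)) =
     (\<integral>\<^sup>+\<omega>. case_option 0 ?g (part_process X UNIV (ennreal t) \<omega>) \<partial>P (Some y))"
    by (intro nn_integral_cong) (simp add: part_process_UNIV)
  also have "\<dots> = (\<integral>\<^sup>+z\<in>UNIV. pM t y z * ?g z \<partial>\<mu>)"
  proof -
    have "\<exists>C<\<infinity>. AE z in \<mu>. z \<in> UNIV \<longrightarrow> ?g z \<le> C" using g1 by (intro exI[of _ 1]) auto
    then show ?thesis using pM gm t0 unfolding is_heat_kernel_def by blast
  qed
  also have "\<dots> \<le> (\<integral>\<^sup>+z. ennreal (C0 * (U0 r / t) powr gam * (1 / vol \<mu> x (r / \<eta>\<^sup>2))) * (g z * indicator ?D z) \<partial>\<mu>)"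
    using pM_le[OF r y _ t] by (intro nn_integral_mono) (auto split: split_indicator intro!: mult_right_mono)
  also have "\<dots> = ennreal (C0 * (U0 r / t) powr gam * (1 / vol \<mu> x (r / \<eta>\<^sup>2))) * (\<integral>\<^sup>+z. g z * indicator ?D z \<partial>\<mu>)"
  proof (rule nn_integral_cmult)
    have "(\<lambda>z. g z * indicator ?D z) \<in> borel_measurable borel"
      using g(1) by (intro borel_measurable_times_ennreal borel_measurable_indicator) simp_all
    then show "(\<lambda>z. g z * indicator ?D z) \<in> borel_measurable \<mu>" by (simp add: measurable_cong_sets[OF sets_mu refl])
  qed
  also have "ennreal (C0 * (U0 r / t) powr gam * (1 / vol \<mu> x (r / \<eta>\<^sup>2))) =
     ennreal (C0 * (U0 r / t) powr gam) * ennreal (1 / vol \<mu> x (r / \<eta>\<^sup>2))"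
    using V by (intro ennreal_mult) (auto simp: C0_def)
  finally show ?thesis unfolding nn_integral_nu[OF r g(1)] by (simp add: mult.assoc)
qed

lemma scale_two_ball:
  assumes r: "large x r" and H: "H0 \<le> real H" "1 \<le> H" and CH: "1 \<le> CH"
    and j0: "real j0 * (2 / c0 + 1) \<le> real H"
    and CH_sum: "(\<Sum>k. ennreal (C0 * (real H / real (H + Suc k)) powr gam)) \<le> ennreal CH"
    and CH_small: "(CH + 2) * (1/2) ^ j0 \<le> c0 / 8"
  shows "two_ball \<Omega> F X P c0 C0 gam H j0 CH (U0 r) x r (r / \<eta>\<^sup>2) (\<nu> x r)"
proof (unfold_locales)
  note L = large_simps[OF r]
  show "0 < U0 r" unfolding U0_def using L(1) eta by (intro Phi_pos) simp
  show "r \<le> r / \<eta>\<^sup>2" using L by linarith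
  show "sets (\<nu> x r) = sets borel" by (simp add: \<nu>_def sets_mu)
  have "space \<mu> = UNIV" using sets_eq_imp_space_eq[OF sets_mu] by simp
  then have "emeasure (\<nu> x r) (space (\<nu> x r)) = 1"
    unfolding \<nu>_def using emeasure_D[OF r] by (intro prob_space.emeasure_space_1 prob_space_uniform_measure) auto
  then show "emeasure (\<nu> x r) UNIV \<le> 1" using \<open>space \<mu> = UNIV\<close> by (simp add: \<nu>_def)
  show "1 \<le> C0" by (simp add: C0_def)
qed (use c0 gam_gt_1 H CH j0 CH_sum CH_small scale_A1[OF r H] scale_A2[OF r] scale_A3[OF r] scale_A4[OF r] in auto)

end

section \<open>Choice of the grid and the resulting tail bounds\<close>

lemma summable_power_tail:
  assumes "1 < \<gamma>"
  shows "summable (\<lambda>k. C * (real H / real (n + Suc k)) powr \<gamma>)"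
proof -
  have "summable (\<lambda>k. real k powr (- \<gamma>))" using assms by (simp add: summable_real_powr_iff)
  then have "summable (\<lambda>k. real (k + Suc n) powr (- \<gamma>))" by (rule summable_ignore_initial_segment)
  then have "summable (\<lambda>k. C * real H powr \<gamma> * real (k + Suc n) powr (- \<gamma>))" by (rule summable_mult)
  moreover have "C * real H powr \<gamma> * real (k + Suc n) powr (- \<gamma>) = C * (real H / real (n + Suc k)) powr \<gamma>" for k
  proof -
    have "(real H / real (n + Suc k)) powr \<gamma> = real H powr \<gamma> / real (n + Suc k) powr \<gamma>"
      by (rule powr_divide)
    moreover have "k + Suc n = n + Suc k" by simp
    ultimately show ?thesis by (simp only: powr_minus divide_inverse mult.assoc)
  qed
  ultimately show ?thesis by (simp only:)
qed

lemma ex_small_tail: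
  assumes "1 < \<gamma>" "0 \<le> C" "0 < \<epsilon>"
  shows "\<exists>n\<ge>H. (\<Sum>k. ennreal (C * (real H / real (n + Suc k)) powr \<gamma>)) \<le> ennreal \<epsilon>"
proof -
  let ?f = "\<lambda>k. C * (real H / real (0 + Suc k)) powr \<gamma>"
  have s: "summable ?f" by (rule summable_power_tail[OF assms(1)])
  from suminf_exist_split[OF assms(3) s] obtain N where N: "\<And>n. n \<ge> N \<Longrightarrow> norm (\<Sum>i. ?f (i + n)) < \<epsilon>" by blast
  let ?n = "max N H"
  have "(\<Sum>k. ennreal (C * (real H / real (?n + Suc k)) powr \<gamma>)) = ennreal (\<Sum>k. C * (real H / real (?n + Suc k)) powr \<gamma>)"
    using assms(2) by (intro suminf_ennreal2 summable_power_tail assms(1)) simp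
  also have "(\<Sum>k. C * (real H / real (?n + Suc k)) powr \<gamma>) = (\<Sum>i. ?f (i + ?n))"
    by (intro suminf_cong) (simp add: add_ac)
  also have "ennreal \<dots> \<le> ennreal \<epsilon>" using N[of ?n] by (intro ennreal_leI) auto
  finally show ?thesis by (intro exI[of _ ?n]) simp
qed

text \<open>With \<open>j0\<close> proportional to \<open>H\<close>, the error
  \<open>(1/2) ^ j0\<close> is exponentially small in \<open>H\<close>, while the sum of return
  bounds is at most a constant times \<open>H powr \<gamma>\<close>. A large \<open>H\<close>
  therefore meets all requirements, with \<open>CH = Z * real H powr \<gamma> + 1\<close>.\<close>

lemma ex_grid_constants:
  assumes "1 < \<gamma>" "0 < c" "0 \<le> C"
  obtains H j0 :: nat and CH :: real where "H0 \<le> real H" "1 \<le> H" "1 \<le> CH" "real j0 * (2 / c + 1) \<le> real H"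
    "(\<Sum>k. ennreal (C * (real H / real (H + Suc k)) powr \<gamma>)) \<le> ennreal CH"
    "(CH + 2) * (1/2) ^ j0 \<le> c / 8"
proof -
  define Z where "Z = (\<Sum>k. C * (real (1::nat) / real (0 + Suc k)) powr \<gamma>)"
  have sZ: "summable (\<lambda>k. C * (real (1::nat) / real (0 + Suc k)) powr \<gamma>)" by (rule summable_power_tail[OF assms(1)])
  have Z: "0 \<le> Z" unfolding Z_def using assms by (intro suminf_nonneg sZ) simp
  define s where "s = 1 / (2 / c + 1)"
  have s: "0 < s" using assms by (simp add: s_def add_pos_pos)
  have "((\<lambda>h. (Z * h powr \<gamma> + 3) * (2 * exp (- (s * ln 2) * h))) \<longlongrightarrow> 0) at_top"
  proof -
    define a where "a = s * ln 2"
    have a: "0 < a" using s by (simp add: a_def)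
    have "((\<lambda>h. h powr \<gamma> * exp (- a * h)) \<longlongrightarrow> 0) at_top" using a assms(1) by real_asymp
    moreover have "((\<lambda>h. exp (- a * h)) \<longlongrightarrow> 0) at_top" using a by real_asymp
    ultimately have "((\<lambda>h. 2 * Z * (h powr \<gamma> * exp (- a * h)) + 6 * exp (- a * h)) \<longlongrightarrow> 2 * Z * 0 + 6 * 0) at_top"
      by (intro tendsto_intros)
    moreover have "(\<lambda>h. 2 * Z * (h powr \<gamma> * exp (- a * h)) + 6 * exp (- a * h)) =
      (\<lambda>h. (Z * h powr \<gamma> + 3) * (2 * exp (- (s * ln 2) * h)))"
      by (simp add: fun_eq_iff a_def algebra_simps)
    ultimately show ?thesis by simp
  qed
  moreover have "0 < c / 8" using assms by simp
  ultimately have "\<forall>\<^sub>F h in at_top. (Z * h powr \<gamma> + 3) * (2 * exp (- (s * ln 2) * h)) < c / 8"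
    by (rule order_tendstoD)
  then have "\<forall>\<^sub>F n in sequentially. (Z * real n powr \<gamma> + 3) * (2 * exp (- (s * ln 2) * real n)) < c / 8"
    using filterlim_real_sequentially by (rule eventually_compose_filterlim)
  moreover have "\<forall>\<^sub>F n in sequentially. H0 \<le> real n"
    using filterlim_real_sequentially by (simp add: filterlim_at_top)
  ultimately have "\<forall>\<^sub>F n in sequentially. (Z * real n powr \<gamma> + 3) * (2 * exp (- (s * ln 2) * real n)) < c / 8 \<and> H0 \<le> real n \<and> 1 \<le> n"
    using eventually_ge_at_top[of 1] by eventually_elim simp
  then obtain H where H: "(Z * real H powr \<gamma> + 3) * (2 * exp (- (s * ln 2) * real H)) < c / 8" "H0 \<le> real H" "1 \<le> H"
    by (auto dest!: eventually_happens)
  define j0 where "j0 = nat \<lfloor>s * real H\<rfloor>"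
  have j0: "real j0 \<le> s * real H" "s * real H - 1 \<le> real j0" using s unfolding j0_def by (simp_all add: of_nat_floor)
  have "(1/2) ^ j0 = exp (- (ln 2 * real j0))" by (simp add: exp_minus exp_of_nat2_mult power_one_over inverse_eq_divide)
  also have "\<dots> \<le> exp (- (ln 2 * (s * real H - 1)))" using j0 by simp
  also have "- (ln 2 * (s * real H - 1)) = ln 2 + - (s * ln 2) * real H" by (simp add: algebra_simps)
  also have "exp \<dots> = 2 * exp (- (s * ln 2) * real H)" by (subst exp_add) simp
  finally have p: "(1/2) ^ j0 \<le> 2 * exp (- (s * ln 2) * real H)" .
  show thesis
  proof (rule that[of H "Z * real H powr \<gamma> + 1" j0])
    show "H0 \<le> real H" "1 \<le> H" "1 \<le> Z * real H powr \<gamma> + 1" using H Z by auto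
    show "real j0 * (2 / c + 1) \<le> real H" using j0(1) assms by (simp add: s_def field_simps)
    show "(Z * real H powr \<gamma> + 1 + 2) * (1/2) ^ j0 \<le> c / 8"
    proof -
      have n: "0 \<le> Z * real H powr \<gamma> + 3" using Z by simp
      have "Z * real H powr \<gamma> + 1 + 2 = Z * real H powr \<gamma> + 3" by simp
      then show ?thesis
        using order_trans[OF mult_left_mono[OF p n] less_imp_le[OF H(1)]] by (simp only:)
    qed
    have "(\<Sum>k. ennreal (C * (real H / real (H + Suc k)) powr \<gamma>)) = ennreal (\<Sum>k. C * (real H / real (H + Suc k)) powr \<gamma>)"
      using assms by (intro suminf_ennreal2 summable_power_tail) auto
    also have "\<dots> \<le> ennreal (\<Sum>k. real H powr \<gamma> * (C * (real (1::nat) / real (0 + Suc k)) powr \<gamma>))"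
    proof (intro ennreal_leI suminf_le summable_power_tail summable_mult sZ assms(1))
      fix k
      have "(real H / real (H + Suc k)) powr \<gamma> \<le> (real H * (1 / real (0 + Suc k))) powr \<gamma>"
        using assms(1) by (intro powr_mono2) (auto simp: divide_simps intro!: mult_left_mono)
      also have "\<dots> = real H powr \<gamma> * (1 / real (0 + Suc k)) powr \<gamma>" by (rule powr_mult)
      finally show "C * (real H / real (H + Suc k)) powr \<gamma> \<le> real H powr \<gamma> * (C * (real (1::nat) / real (0 + Suc k)) powr \<gamma>)"
        using assms(3) by (simp add: mult.left_commute mult_left_mono)
    qed
    also have "(\<Sum>k. real H powr \<gamma> * (C * (real (1::nat) / real (0 + Suc k)) powr \<gamma>)) = real H powr \<gamma> * Z"
      unfolding Z_def by (rule suminf_mult[OF sZ])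
    also have "ennreal \<dots> \<le> ennreal (Z * real H powr \<gamma> + 1)" by (intro ennreal_leI) simp
    finally show "(\<Sum>k. ennreal (C * (real H / real (H + Suc k)) powr \<gamma>)) \<le> ennreal (Z * real H powr \<gamma> + 1)" .
  qed
qed

context diffusive_process
begin

text \<open>The same \<open>S\<close>, the supremum at level \<open>(b + 7) * U0 r\<close>, appears
  in the upper and in the lower bound, up to the factor \<open>K1\<close> per block. Only the
  horizon \<open>L\<close> depends on \<open>b\<close>; \<open>c1\<close> and \<open>K1\<close> do
  not. Of the \<open>8\<close> in the upper block length, \<open>7\<close> come from the comparison
  and \<open>1\<close> bounds the overshoot of a grid step.\<close>

lemma occupation_tail_bounds:
  obtains c1 K1 :: real where "0 < c1" "1 \<le> K1"
    "\<And>b. 1 \<le> b \<Longrightarrow> \<exists>L\<ge>1. \<forall>x r. large x r \<longrightarrow> (\<exists>S. 0 \<le> S \<and> S \<le> 1 \<and> S \<le> K1 * exp (- c1 * b) \<and>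
       (\<forall>j w. pr w (\<lambda>p. ennreal (real j * (b + 8) * U0 r) < occ x r \<infinity> p) \<le> ennreal (S ^ j)) \<and>
       (\<forall>j. \<forall>y\<in>ball x (r / \<eta>\<^sup>2). ennreal (S ^ j) \<le>
          ennreal (K1 ^ j) * pr (Some y) (\<lambda>p. ennreal (real j * b * U0 r) \<le> occ x r (ennreal (real j * L * U0 r)) p)))"
proof -
  have C0: "0 \<le> C0" by (simp add: C0_def)
  obtain H j0 CH where G: "H0 \<le> real H" "1 \<le> H" "1 \<le> CH" "real j0 * (2 / c0 + 1) \<le> real H"
    "(\<Sum>k. ennreal (C0 * (real H / real (H + Suc k)) powr gam)) \<le> ennreal CH"
    "(CH + 2) * (1/2) ^ j0 \<le> c0 / 8"
    using ex_grid_constants[OF gam_gt_1 c0(1) C0] by blast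
  have loc: "two_ball \<Omega> F X P c0 C0 gam H j0 CH (U0 r) x r (r / \<eta>\<^sup>2) (\<nu> x r)" if "large x r" for x r
    by (rule scale_two_ball[OF that G])
  obtain n0 where n0: "n0 \<ge> H" "(\<Sum>k. ennreal (C0 * (real H / real (n0 + Suc k)) powr gam)) \<le> ennreal (1/4)"
    using ex_small_tail[OF gam_gt_1 C0, of "1/4" H] by auto
  \<comment> \<open>In time units this is the level at which \<open>sS_decay\<close> gains a factor
    one half, whence the rate \<open>ln 2 / B0\<close>.\<close>
  define B0 where "B0 = 2 + 3 / real H + real n0 / real H"
  \<comment> \<open>The entry \<open>2\<close> absorbs rounding \<open>b / B0\<close> down to an
    integer, the other one is the constant of \<open>sS_power_le_pr\<close>.\<close>
  define K1 where "K1 = max 2 (4 * CH / c0)"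
  have B0: "2 \<le> B0" using G by (simp add: B0_def)
  have K1: "2 \<le> K1" "4 * CH / c0 \<le> K1" by (simp_all add: K1_def)
  show thesis
  proof (rule that[of "ln 2 / B0" K1])
    show "0 < ln 2 / B0" "1 \<le> K1" using B0 K1 by auto
    fix b :: real assume b: "1 \<le> b"
    \<comment> \<open>The number of stretches of length \<open>7\<close> covering \<open>b\<close>;
      it determines the required smallness \<open>c0 ^ m / 2\<close> of the tail and thereby the
      horizon.\<close>
    define m where "m = nat \<lceil>b / 7\<rceil>"
    have m: "1 \<le> m" "b \<le> 7 * real m" using b unfolding m_def by linarith+
    obtain n where n: "n \<ge> H" "(\<Sum>k. ennreal (C0 * (real H / real (n + Suc k)) powr gam)) \<le> ennreal (c0 ^ m / 2)"
      using ex_small_tail[OF gam_gt_1 C0, of "c0 ^ m / 2" H] c0 by auto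
    define L where "L = real n / real H"
    have L: "1 \<le> L" using n G by (simp add: L_def)
    have "\<exists>S. 0 \<le> S \<and> S \<le> 1 \<and> S \<le> K1 * exp (- (ln 2 / B0) * b) \<and>
       (\<forall>j w. pr w (\<lambda>p. ennreal (real j * (b + 8) * U0 r) < occ x r \<infinity> p) \<le> ennreal (S ^ j)) \<and>
       (\<forall>j. \<forall>y\<in>ball x (r / \<eta>\<^sup>2). ennreal (S ^ j) \<le>
          ennreal (K1 ^ j) * pr (Some y) (\<lambda>p. ennreal (real j * b * U0 r) \<le> occ x r (ennreal (real j * L * U0 r)) p))"
      if large: "large x r" for x r
    proof -
      interpret T: two_ball \<Omega> F X P c0 C0 gam H j0 CH "U0 r" x r "r / \<eta>\<^sup>2" "\<nu> x r" by (rule loc[OF large])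
      let ?u = "U0 r"
      define S where "S = enn2real (T.sS (b * ?u + 7 * ?u))"
      have fin: "T.sS (b * ?u + 7 * ?u) = ennreal S"
      proof -
        have "T.sS (b * ?u + 7 * ?u) < \<top>"
          by (rule order_le_less_trans[OF T.sS_le_1 ennreal_one_less_top])
        then show ?thesis unfolding S_def by (rule ennreal_enn2real[symmetric])
      qed
      have S: "0 \<le> S" "S \<le> 1"
      proof -
        show "0 \<le> S" by (simp add: S_def)
        have "ennreal S \<le> ennreal 1" using T.sS_le_1[of "b * ?u + 7 * ?u"] unfolding fin by simp
        then show "S \<le> 1" by (subst (asm) ennreal_le_iff) auto
      qed
      have bu: "0 \<le> b * ?u" using b T.u by simp
      have decay: "S \<le> K1 * exp (- (ln 2 / B0) * b)"
      proof -
        define j where "j = nat \<lfloor>b / B0\<rfloor>"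
        have j: "real j \<le> b / B0" "b / B0 - 1 \<le> real j" using b B0 unfolding j_def by (simp_all add: of_nat_floor)
        have "real j * (2 * ?u + 3 * T.h + real n0 * T.h) = real j * B0 * ?u"
          unfolding B0_def T.h_def by (simp add: algebra_simps)
        also have "\<dots> \<le> b * ?u + 7 * ?u"
        proof -
          have "real j * B0 \<le> b" using j(1) B0 by (simp add: field_simps)
          then have "real j * B0 * ?u \<le> b * ?u" using T.u by (intro mult_right_mono) auto
          then show ?thesis using T.u by linarith
        qed
        finally have "ennreal S \<le> T.sS (real j * (2 * ?u + 3 * T.h + real n0 * T.h))"
          unfolding fin[symmetric] by (rule T.sS_antimono)
        also have "\<dots> \<le> ennreal ((1/2) ^ j)"
          using n0 by (intro T.sS_decay) (simp_all add: T.tl_def)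
        finally have "S \<le> (1/2) ^ j" by (subst (asm) ennreal_le_iff) auto
        also have "(1/2) ^ j = exp (- (ln 2 * real j))" by (simp add: exp_minus exp_of_nat2_mult power_one_over inverse_eq_divide)
        also have "\<dots> \<le> exp (- (ln 2 * (b / B0 - 1)))" using j by simp
        also have "- (ln 2 * (b / B0 - 1)) = ln 2 + - (ln 2 / B0) * b" by (simp add: algebra_simps)
        also have "exp \<dots> = 2 * exp (- (ln 2 / B0) * b)" by (subst exp_add) simp
        also have "\<dots> \<le> K1 * exp (- (ln 2 / B0) * b)" using K1 by (intro mult_right_mono) auto
        finally show ?thesis .
      qed
      have up: "pr w (\<lambda>p. ennreal (real j * (b + 8) * ?u) < occ x r \<infinity> p) \<le> ennreal (S ^ j)" for j w
      proof -
        have "pr w (\<lambda>p. ennreal (real j * (b + 8) * ?u) < occ x r \<infinity> p) = T.exc (real j * (b + 8) * ?u) w"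
          by (simp add: T.exc_def)
        also have "\<dots> \<le> T.exc (real j * ((b * ?u + 7 * ?u) + T.h)) w"
        proof (rule T.exc_antimono)
          have "real j * ((b * ?u + 7 * ?u) + T.h) \<le> real j * (b * ?u + 8 * ?u)"
            using T.h_le_u by (intro mult_left_mono) auto
          then show "real j * ((b * ?u + 7 * ?u) + T.h) \<le> real j * (b + 8) * ?u" by (simp add: algebra_simps)
        qed
        also have "\<dots> \<le> T.sS (real j * ((b * ?u + 7 * ?u) + T.h))" by (rule T.exc_le_sS)
        also have "\<dots> \<le> T.sS (b * ?u + 7 * ?u) ^ j" using bu T.u by (intro T.sS_power) simp
        also have "\<dots> = ennreal (S ^ j)" unfolding fin by (rule ennreal_power) (rule S)
        finally show ?thesis .
      qed
      have low: "ennreal (S ^ j) \<le> ennreal (K1 ^ j) * pr (Some y) (\<lambda>p. ennreal (real j * b * ?u) \<le> occ x r (ennreal (real j * L * ?u)) p)"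
        if y: "y \<in> ball x (r / \<eta>\<^sup>2)" for j y
      proof -
        have tk: "T.tk (j * n) = ennreal (real j * L * ?u)"
          unfolding T.tk_def T.h_def L_def by (rule arg_cong[where f=ennreal]) simp
        have bm: "b * ?u \<le> 7 * ?u * real m" using mult_right_mono[OF m(2), of ?u] T.u by (simp add: mult_ac)
        have "ennreal (S ^ j) = T.sS (b * ?u + 7 * ?u) ^ j" unfolding fin by (rule ennreal_power[symmetric]) (rule S)
        also have "\<dots> \<le> ennreal ((4 * CH / c0) ^ j) * pr (Some y) (\<lambda>p. ennreal (real j * (b * ?u)) \<le> occ x r (T.tk (j * n)) p)"
          using n(2) by (intro T.sS_power_le_pr[OF bu y n(1) m(1) bm]) (simp add: T.tl_def)
        also have "\<dots> \<le> ennreal (K1 ^ j) * pr (Some y) (\<lambda>p. ennreal (real j * (b * ?u)) \<le> occ x r (T.tk (j * n)) p)"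
          using K1 G(3) c0 by (intro mult_right_mono ennreal_leI power_mono) auto
        finally show ?thesis unfolding tk by (simp add: mult.assoc)
      qed
      show ?thesis using S decay up low by blast
    qed
    with L show "\<exists>L\<ge>1. \<forall>x r. large x r \<longrightarrow> (\<exists>S. 0 \<le> S \<and> S \<le> 1 \<and> S \<le> K1 * exp (- (ln 2 / B0) * b) \<and>
       (\<forall>j w. pr w (\<lambda>p. ennreal (real j * (b + 8) * U0 r) < occ x r \<infinity> p) \<le> ennreal (S ^ j)) \<and>
       (\<forall>j. \<forall>y\<in>ball x (r / \<eta>\<^sup>2). ennreal (S ^ j) \<le>
          ennreal (K1 ^ j) * pr (Some y) (\<lambda>p. ennreal (real j * b * U0 r) \<le> occ x r (ennreal (real j * L * U0 r)) p)))"
      by blast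
  qed
qed

end

section \<open>The normalising function\<close>

lemma integral_inverse_ln:
  assumes "0 < a" "a \<le> b"
  shows "((\<lambda>s::real. 1 / s) has_integral (ln b - ln a)) {a..b}"
proof (rule fundamental_theorem_of_calculus[OF assms(2)])
  fix s assume "s \<in> {a..b}"
  then have "0 < s" using assms by simp
  then show "(ln has_vector_derivative 1 / s) (at s within {a..b})"
    by (auto intro!: derivative_eq_intros simp flip: has_real_derivative_iff_has_vector_derivative)
qed

lemma eventually_ge_of_at_top: "filterlim f at_top F \<Longrightarrow> \<forall>\<^sub>F x in F. (c::real) \<le> f x"
  by (simp add: filterlim_at_top)

context diffusive_process
begin

abbreviation \<phi> :: "real \<Rightarrow> real" where "\<phi> \<equiv> phi \<Phi>"
definition ll :: "real \<Rightarrow> real" where "ll r = ln (ln (\<phi> r))"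
definition gg :: "real \<Rightarrow> real" where "gg r = \<phi> r * ll r"

section \<open>Comparison of the integral \<open>\<phi>\<close> with \<open>\<Phi>\<close>\<close>

lemma integrable_phi: "0 < a \<Longrightarrow> (\<lambda>s. \<Phi> s / s) integrable_on {a..b}"
  by (intro integrable_continuous_real continuous_on_divide continuous_on_subset[OF Phi_cont] continuous_on_id) auto

lemma phi_split: "1 \<le> r \<Longrightarrow> r \<le> r' \<Longrightarrow> \<phi> r' = \<phi> r + integral {r..r'} (\<lambda>s. \<Phi> s / s)"
  unfolding phi_def by (rule Henstock_Kurzweil_Integration.integral_combine[symmetric]) (auto intro: integrable_phi)

lemma phi_diff_bounds:
  assumes "1 \<le> r" "r \<le> r'"
  shows "\<Phi> r * ln (r' / r) \<le> \<phi> r' - \<phi> r" "\<phi> r' - \<phi> r \<le> \<Phi> r' * ln (r' / r)"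
proof -
  have r: "0 < r" using assms by simp
  have i: "((\<lambda>s. \<Phi> s / s) has_integral (\<phi> r' - \<phi> r)) {r..r'}"
    using integrable_phi[OF r, of r'] phi_split[OF assms] by (simp add: integrable_integral)
  have j: "((\<lambda>s. k * (1 / s)) has_integral (k * (ln r' - ln r))) {r..r'}" for k
    using integral_inverse_ln[OF r assms(2)] by (rule has_integral_mult_right)
  have e: "ln r' - ln r = ln (r' / r)" using assms by (simp add: ln_div)
  show "\<Phi> r * ln (r' / r) \<le> \<phi> r' - \<phi> r"
    unfolding e[symmetric] using r by (rule_tac has_integral_le[OF j i]) (auto intro!: divide_right_mono Phi_le)
  show "\<phi> r' - \<phi> r \<le> \<Phi> r' * ln (r' / r)"
    unfolding e[symmetric] using r by (rule_tac has_integral_le[OF i j]) (auto intro!: divide_right_mono Phi_le)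
qed

lemma phi_mono: "1 \<le> r \<Longrightarrow> r \<le> r' \<Longrightarrow> \<phi> r \<le> \<phi> r'"
  using phi_diff_bounds(1)[of r r'] Phi_pos[of r] by (smt (verit) divide_le_eq_1_pos ln_ge_zero mult_nonneg_nonneg le_divide_eq_1_pos)

lemma phi_1: "\<phi> 1 = 0" by (simp add: phi_def)

definition Kl :: real where "Kl = CU * 2 powr \<beta> / ln 2"

lemma Kl: "0 < Kl" using CU by (simp add: Kl_def)

text \<open>The part of the integral over \<open>{r / 2..r}\<close> is already at least
  \<open>\<Phi> (r / 2) * ln 2\<close>, and \<open>\<Phi> (r / 2)\<close> is comparable to
  \<open>\<Phi> r\<close>.\<close>

lemma Phi_le_phi:
  assumes "2 * R < r"
  shows "\<Phi> r \<le> Kl * \<phi> r"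
proof -
  have r2: "1 \<le> r / 2" "R < r / 2" using assms R by auto
  have "\<Phi> r \<le> CU * (r / (r / 2)) powr \<beta> * \<Phi> (r / 2)" using r2 by (intro Phi_upper') auto
  also have "r / (r / 2) = 2" using r2 by simp
  finally have a: "\<Phi> r \<le> CU * 2 powr \<beta> * \<Phi> (r / 2)" .
  have "\<Phi> (r / 2) * ln (r / (r / 2)) \<le> \<phi> r - \<phi> (r / 2)" using r2 by (intro phi_diff_bounds) auto
  also have "\<dots> \<le> \<phi> r" using phi_mono[of 1 "r / 2"] r2 phi_1 by simp
  also have "r / (r / 2) = 2" using r2 by simp
  finally have "\<Phi> (r / 2) \<le> \<phi> r / ln 2" by (simp add: field_simps)
  then have "CU * 2 powr \<beta> * \<Phi> (r / 2) \<le> CU * 2 powr \<beta> * (\<phi> r / ln 2)"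
    using CU by (intro mult_left_mono) auto
  with a show ?thesis by (simp add: Kl_def)
qed

lemma phi_le_Phi: obtains Ku where "0 < Ku" "\<And>r. R + 1 \<le> r \<Longrightarrow> \<phi> r \<le> Ku * \<Phi> r"
proof -
  define s where "s = R + 1"
  define A where "A = \<phi> (s * l) / \<Phi> s"
  \<comment> \<open>Passing from \<open>r / l\<close> to \<open>r\<close> adds at most
    \<open>\<Phi> r * ln l\<close>, while \<open>\<Phi>\<close> at least doubles. So half of
    \<open>K\<close> carries the induction hypothesis and the other half, at least
    \<open>ln l\<close>, the new piece.\<close>
  define K where "K = max (max A (2 * ln l)) 1"
  have s: "1 \<le> s" "R < s" using R by (auto simp: s_def)
  have ps: "0 < \<Phi> s" using s by (intro Phi_pos) simp
  have K: "A \<le> K" "2 * ln l \<le> K" "0 < K" by (auto simp: K_def)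
  have "s \<le> r \<Longrightarrow> r \<le> s * l ^ Suc n \<Longrightarrow> \<phi> r \<le> K * \<Phi> r" for n r
  proof (induction n arbitrary: r)
    case 0
    have "\<phi> r \<le> \<phi> (s * l)" using 0 s by (intro phi_mono) auto
    also have "\<dots> = A * \<Phi> s" using ps by (simp add: A_def)
    also have "\<dots> \<le> K * \<Phi> r" using K ps s 0 by (intro mult_mono Phi_le) auto
    finally show ?case .
  next
    case (Suc n)
    show ?case
    proof (cases "r \<le> s * l ^ Suc n")
      case True then show ?thesis using Suc by simp
    next
      case False
      have "s * l \<le> s * l ^ Suc n" using s l by (intro mult_left_mono) auto
      then have sr: "s * l \<le> r" using False by simp
      then have rl: "s \<le> r / l" using l by (simp add: field_simps)
      have "r / l \<le> s * l ^ Suc n" using Suc.prems l by (simp add: field_simps)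
      from Suc.IH[OF rl this] have IH: "\<phi> (r / l) \<le> K * \<Phi> (r / l)" .
      have r0: "0 < r" using Suc.prems s by simp
      have "\<phi> r - \<phi> (r / l) \<le> \<Phi> r * ln (r / (r / l))"
      proof (rule phi_diff_bounds)
        show "1 \<le> r / l" using rl s by linarith
        show "r / l \<le> r" using r0 l divide_left_mono[of 1 l r] by simp
      qed
      also have "r / (r / l) = l" using r0 l by simp
      finally have a: "\<phi> r - \<phi> (r / l) \<le> \<Phi> r * ln l" .
      have "2 * \<Phi> (r / l) \<le> \<Phi> r" using Suc.prems s by (intro uls) simp
      then have "K * \<Phi> (r / l) \<le> K / 2 * \<Phi> r" using K(3) by (simp add: field_simps)
      moreover have "\<Phi> r * ln l \<le> K / 2 * \<Phi> r" using K(2) Phi_pos[OF r0] by (simp add: field_simps)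
      ultimately show ?thesis using a IH by (simp add: field_simps)
    qed
  qed
  moreover have "\<exists>n. r \<le> s * l ^ Suc n" for r
  proof -
    obtain n where "r / s < l ^ n" using real_arch_pow[OF l] by blast
    then have "r \<le> s * l ^ n" using s by (simp add: field_simps)
    also have "\<dots> \<le> s * l ^ Suc n" using s l by (intro mult_left_mono power_increasing) auto
    finally show ?thesis ..
  qed
  ultimately show thesis using that[OF K(3)] unfolding s_def by blast
qed

lemma Phi_at_top: "filterlim \<Phi> at_top at_top"
  unfolding filterlim_at_top
proof
  fix Z
  have p: "0 < \<Phi> (R + 1)" using R by (intro Phi_pos) simp
  obtain k where k: "Z / \<Phi> (R + 1) < 2 ^ k" using real_arch_pow[of 2 "Z / \<Phi> (R + 1)"] by auto
  have "Z \<le> 2 ^ k * \<Phi> (R + 1)" using k p by (simp add: field_simps)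
  also have "\<dots> \<le> \<Phi> ((R + 1) * l ^ k)" by (intro Phi_growth) simp
  finally have Z: "Z \<le> \<Phi> ((R + 1) * l ^ k)" .
  have pos: "0 < (R + 1) * l ^ k" using R l by simp
  show "\<forall>\<^sub>F r in at_top. Z \<le> \<Phi> r"
    using eventually_ge_at_top[of "(R + 1) * l ^ k"]
  proof eventually_elim
    case (elim r)
    then show ?case using Z Phi_le[OF pos elim] by linarith
  qed
qed

lemma phi_at_top: "filterlim \<phi> at_top at_top"
proof (rule filterlim_at_top_mono)
  show "filterlim (\<lambda>r. (1 / Kl) * \<Phi> r) at_top at_top"
    using Kl by (intro filterlim_tendsto_pos_mult_at_top[OF tendsto_const _ Phi_at_top]) simp
  show "\<forall>\<^sub>F r in at_top. (1 / Kl) * \<Phi> r \<le> \<phi> r"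
    using eventually_gt_at_top[of "2 * R"] by eventually_elim (use Phi_le_phi Kl in \<open>simp add: field_simps\<close>)
qed

lemma ll_at_top: "filterlim ll at_top at_top"
  unfolding ll_def by (intro filterlim_compose[OF ln_at_top] phi_at_top)

text \<open>In time units \<open>U0 r\<close>, the normalisation \<open>gg r\<close> is of order
  \<open>ll r\<close>; this is the order of the number of blocks that fit into one scale.\<close>

lemma gg_U0_bounds:
  obtains \<alpha> A r1 where "0 < \<alpha>" "\<alpha> \<le> A" "0 < r1"
    "\<And>r. r1 \<le> r \<Longrightarrow> \<alpha> * ll r * U0 r \<le> gg r"
    "\<And>r. r1 \<le> r \<Longrightarrow> gg r \<le> A * ll r * U0 r" "\<And>r. r1 \<le> r \<Longrightarrow> 1 \<le> ll r"
proof -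
  obtain Ku where Ku: "0 < Ku" "\<And>r. R + 1 \<le> r \<Longrightarrow> \<phi> r \<le> Ku * \<Phi> r" using phi_le_Phi by blast
  define \<alpha> where "\<alpha> = 1 / (Kl * CU * (1 / \<eta>^3) powr \<beta>)"
  have al: "0 < \<alpha>" using Kl CU eta by (simp add: \<alpha>_def)
  obtain r2 where r2: "\<And>r. r2 \<le> r \<Longrightarrow> 1 \<le> ll r"
    using eventually_ge_of_at_top[OF ll_at_top, of 1] by (auto simp: eventually_at_top_linorder)
  define r1 where "r1 = max r2 (2 * R + 1)"
  show thesis
  proof (rule that[of \<alpha> "max \<alpha> Ku" r1])
    show "0 < \<alpha>" "\<alpha> \<le> max \<alpha> Ku" by (fact al) simp
    show "0 < r1" using R by (simp add: r1_def)
    fix r assume r: "r1 \<le> r"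
    then have r': "R + 1 \<le> r" "2 * R < r" "1 \<le> r" using R by (auto simp: r1_def)
    show ll: "1 \<le> ll r" using r by (intro r2) (simp add: r1_def)
    have e3: "\<eta>^3 \<le> 1" "0 < \<eta>^3" using eta by (auto simp: power_le_one)
    have rr: "r \<le> r / \<eta>^3" using r' e3 by (simp add: pos_le_divide_eq mult_left_le)
    have "U0 r \<le> CU * (r / \<eta>^3 / r) powr \<beta> * \<Phi> r" unfolding U0_def using rr r' by (intro Phi_upper') auto
    also have "r / \<eta>^3 / r = 1 / \<eta>^3" using r' by simp
    also have "CU * (1 / \<eta>^3) powr \<beta> * \<Phi> r \<le> CU * (1 / \<eta>^3) powr \<beta> * (Kl * \<phi> r)"
      using CU Phi_le_phi[OF r'(2)] by (intro mult_left_mono) auto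
    finally have "\<alpha> * U0 r \<le> \<phi> r" using Kl CU eta unfolding \<alpha>_def by (simp add: field_simps)
    then have "\<alpha> * U0 r * ll r \<le> \<phi> r * ll r" using ll by (intro mult_right_mono) auto
    then show "\<alpha> * ll r * U0 r \<le> gg r" by (simp add: gg_def mult_ac)
    have u: "0 < U0 r" unfolding U0_def using r' e3 by (intro Phi_pos) simp
    have "\<phi> r \<le> Ku * \<Phi> r" using r' by (intro Ku)
    also have "\<dots> \<le> Ku * U0 r" unfolding U0_def using rr r' Ku by (intro mult_left_mono Phi_le) auto
    also have "\<dots> \<le> max \<alpha> Ku * U0 r" using u by (intro mult_right_mono) auto
    finally have "\<phi> r * ll r \<le> max \<alpha> Ku * U0 r * ll r" using ll by (intro mult_right_mono) auto
    then show "gg r \<le> max \<alpha> Ku * ll r * U0 r" by (simp add: gg_def mult_ac)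
  qed
qed

section \<open>Behaviour along geometric scales\<close>

lemma gg_mono:
  assumes "1 \<le> r" "r \<le> r'" "1 < \<phi> r" "0 \<le> ll r"
  shows "gg r \<le> gg r'" "ll r \<le> ll r'"
proof -
  have p: "\<phi> r \<le> \<phi> r'" using assms by (intro phi_mono)
  show l: "ll r \<le> ll r'" unfolding ll_def using p assms by (intro ln_mono) auto
  show "gg r \<le> gg r'" unfolding gg_def using p l assms by (intro mult_mono) auto
qed

text \<open>The increment of \<open>\<phi>\<close> from \<open>r\<close> to \<open>q * r\<close> is
  at most \<open>\<Phi> (q * r) * ln q\<close>, a small multiple of \<open>\<phi> r\<close> for
  \<open>q\<close> near \<open>1\<close>; the iterated logarithm changes even less. Needed to
  interpolate between the radii \<open>q ^ n\<close>.\<close>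

lemma gg_quotient:
  assumes "0 < \<epsilon>"
  obtains q where "1 < q" "\<forall>\<^sub>F r in at_top. gg (q * r) \<le> (1 + \<epsilon>) * gg r"
proof -
  \<comment> \<open>Both factors of \<open>gg\<close> lose at most \<open>1 + e\<close>, and
    \<open>(1 + e) * (1 + e) \<le> 1 + 3 * e\<close> for \<open>e \<le> 1\<close>.\<close>
  define e where "e = min 1 (\<epsilon> / 3)"
  have e: "0 < e" "e \<le> 1" "3 * e \<le> \<epsilon>" using assms by (auto simp: e_def)
  define k where "k = CU * 2 powr \<beta> * Kl"
  have k: "0 < k" using CU Kl by (simp add: k_def)
  define q where "q = 1 + min 1 (e / k)"
  have q: "1 < q" "q \<le> 2" "q - 1 \<le> e / k" using e k by (auto simp: q_def)
  have lq: "0 \<le> ln q" "k * ln q \<le> e"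
  proof -
    show "0 \<le> ln q" using q by simp
    have "ln q \<le> e / k" using ln_le_minus_one[of q] q by linarith
    then show "k * ln q \<le> e" using k by (simp add: field_simps)
  qed
  have "\<forall>\<^sub>F r in at_top. 1 \<le> ll r" by (rule eventually_ge_of_at_top[OF ll_at_top])
  moreover have "\<forall>\<^sub>F r in at_top. max 2 (ln 2 / e) \<le> ln (\<phi> r)"
    by (rule eventually_ge_of_at_top[OF filterlim_compose[OF ln_at_top phi_at_top]])
  moreover have "\<forall>\<^sub>F r in at_top. 2 \<le> \<phi> r" by (rule eventually_ge_of_at_top[OF phi_at_top])
  ultimately have "\<forall>\<^sub>F r in at_top. gg (q * r) \<le> (1 + \<epsilon>) * gg r"
    using eventually_gt_at_top[of "2 * R"]
  proof eventually_elim
    case (elim r)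
    then have r: "1 \<le> r" "R < r" "0 < r" using R by auto
    have rq: "r \<le> q * r" using q r by simp
    have "\<Phi> (q * r) \<le> CU * (q * r / r) powr \<beta> * \<Phi> r" using rq r by (intro Phi_upper')
    also have "q * r / r = q" using r by simp
    also have "CU * q powr \<beta> * \<Phi> r \<le> CU * 2 powr \<beta> * (Kl * \<phi> r)"
      using CU q beta Phi_le_phi[of r] elim Phi_pos[OF r(3)] by (intro mult_mono powr_mono2) auto
    finally have P: "\<Phi> (q * r) \<le> k * \<phi> r" by (simp add: k_def mult_ac)
    have "\<phi> (q * r) - \<phi> r \<le> \<Phi> (q * r) * ln (q * r / r)" using r rq by (intro phi_diff_bounds)
    also have "q * r / r = q" using r by simp
    also have "\<Phi> (q * r) * ln q \<le> (k * \<phi> r) * ln q" using P lq by (intro mult_right_mono)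
    also have "\<dots> = (k * ln q) * \<phi> r" by simp
    also have "\<dots> \<le> e * \<phi> r" using lq elim by (intro mult_right_mono) auto
    finally have p1: "\<phi> (q * r) \<le> (1 + e) * \<phi> r" by (simp add: algebra_simps)
    have p0: "\<phi> r \<le> \<phi> (q * r)" using r rq by (intro phi_mono)
    have lp: "0 < ln (\<phi> r)" "ln 2 / e \<le> ln (\<phi> r)" using elim by auto
    have "(1 + e) * \<phi> r \<le> 2 * \<phi> r" using e elim by (intro mult_right_mono) auto
    with p1 have "\<phi> (q * r) \<le> 2 * \<phi> r" by linarith
    then have "ln (\<phi> (q * r)) \<le> ln (2 * \<phi> r)" using elim p0 by (intro ln_mono) auto
    also have "\<dots> = ln 2 + ln (\<phi> r)" using elim by (simp add: ln_mult)
    also have "\<dots> = ln (\<phi> r) * (1 + ln 2 / ln (\<phi> r))" using lp by (simp add: field_simps)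
    finally have a: "ln (\<phi> (q * r)) \<le> ln (\<phi> r) * (1 + ln 2 / ln (\<phi> r))" .
    have lq0: "0 < ln (\<phi> (q * r))" using p0 elim by simp
    have pos: "0 < 1 + ln 2 / ln (\<phi> r)" using lp by (simp add: add_pos_nonneg)
    have "ll (q * r) \<le> ln (ln (\<phi> r) * (1 + ln 2 / ln (\<phi> r)))"
      unfolding ll_def using a lq0 by (intro ln_mono) auto
    also have "\<dots> = ll r + ln (1 + ln 2 / ln (\<phi> r))" using lp pos by (simp add: ln_mult ll_def)
    also have "ln (1 + ln 2 / ln (\<phi> r)) \<le> ln 2 / ln (\<phi> r)" using lp by (intro ln_add_one_self_le_self) simp
    also have "ln 2 / ln (\<phi> r) \<le> e" using lp e by (simp add: field_simps)
    also have "e \<le> e * ll r" using e elim by simp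
    finally have l1: "ll (q * r) \<le> (1 + e) * ll r" by (simp add: algebra_simps)
    have l0: "0 \<le> ll (q * r)"
      using gg_mono(2)[OF r(1) rq] elim by linarith
    have "gg (q * r) \<le> ((1 + e) * \<phi> r) * ((1 + e) * ll r)"
      unfolding gg_def using p1 l1 l0 e elim by (intro mult_mono) auto
    also have "\<dots> = ((1 + e) * (1 + e)) * gg r" by (simp add: gg_def mult_ac)
    also have "\<dots> \<le> (1 + \<epsilon>) * gg r"
    proof (rule mult_right_mono)
      have "(1 + e) * (1 + e) = 1 + 2 * e + e * e" by (simp add: algebra_simps)
      also have "e * e \<le> e" using e by (simp add: mult_left_le)
      finally show "(1 + e) * (1 + e) \<le> 1 + \<epsilon>" using e by linarith
      show "0 \<le> gg r" using elim by (simp add: gg_def)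
    qed
    finally show ?case .
  qed
  with q(1) show thesis by (rule that)
qed

text \<open>Choose \<open>m0\<close> with \<open>l < q ^ m0\<close>; then every \<open>m0\<close>
  indices double the time unit.\<close>

lemma U0_growth:
  assumes q: "1 < q"
  obtains m0 :: nat where "1 \<le> m0" "\<And>n k. R < q ^ n \<Longrightarrow> 2 ^ k * U0 (q ^ n) \<le> U0 (q ^ (n + m0 * k))"
proof -
  obtain m0 where m0: "l < q ^ m0" using real_arch_pow[OF q] by blast
  have m1: "1 \<le> m0" using m0 l by (cases m0) auto
  have e3: "\<eta>^3 \<le> 1" "0 < \<eta>^3" using eta by (auto simp: power_le_one)
  show thesis
  proof (rule that[OF m1])
    fix n k assume n: "R < q ^ n"
    have qn: "0 < q ^ n" using q by simp
    have "q ^ n \<le> q ^ n / \<eta>^3" using e3 qn by (simp add: pos_le_divide_eq mult_left_le)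
    then have "2 ^ k * \<Phi> (q ^ n / \<eta>^3) \<le> \<Phi> (q ^ n / \<eta>^3 * l ^ k)" using n by (intro Phi_growth) simp
    also have "\<dots> \<le> \<Phi> (q ^ (n + m0 * k) / \<eta>^3)"
    proof (rule Phi_le)
      have "l ^ k \<le> (q ^ m0) ^ k" using m0 l by (intro power_mono) auto
      then have "q ^ n / \<eta>^3 * l ^ k \<le> q ^ n / \<eta>^3 * (q ^ m0) ^ k" using qn e3 by (intro mult_left_mono) auto
      then show "q ^ n / \<eta>^3 * l ^ k \<le> q ^ (n + m0 * k) / \<eta>^3" by (simp add: power_add power_mult)
    qed (use qn e3 l in simp)
    finally show "2 ^ k * U0 (q ^ n) \<le> U0 (q ^ (n + m0 * k))" by (simp add: U0_def)
  qed
qed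

text \<open>Doubling of the time unit every \<open>m0\<close> indices bounds \<open>\<phi>\<close>
  from below, the exponent \<open>\<beta>\<close> from above. Thus powers of
  \<open>ln (\<phi> (q ^ n))\<close> can be replaced by powers of \<open>n\<close>.\<close>

lemma ln_phi_bounds:
  assumes q: "1 < q"
  obtains cq Cq where "0 < cq" "\<forall>\<^sub>F n in sequentially. cq * real n \<le> ln (\<phi> (q ^ n)) \<and> ln (\<phi> (q ^ n)) \<le> Cq * real n"
proof -
  obtain m0 where m0: "1 \<le> m0" "\<And>n k. R < q ^ n \<Longrightarrow> 2 ^ k * U0 (q ^ n) \<le> U0 (q ^ (n + m0 * k))"
    using U0_growth[OF q] by blast
  obtain \<alpha> A r1 where al: "0 < \<alpha>" "\<alpha> \<le> A" "0 < r1" and gl: "\<And>r. r1 \<le> r \<Longrightarrow> \<alpha> * ll r * U0 r \<le> gg r"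
    and gu: "\<And>r. r1 \<le> r \<Longrightarrow> gg r \<le> A * ll r * U0 r" and l1: "\<And>r. r1 \<le> r \<Longrightarrow> 1 \<le> ll r"
    using gg_U0_bounds by blast
  have cmp: "\<alpha> * U0 r \<le> \<phi> r" "\<phi> r \<le> A * U0 r" if "r1 \<le> r" for r
    using gl[OF that] gu[OF that] l1[OF that] unfolding gg_def
    by (simp_all add: mult.commute[of _ "ll r"] mult.left_commute[of _ "ll r"] mult_le_cancel_left)
  obtain n0 where n0: "max (R + 1) r1 < q ^ n0" using real_arch_pow[OF q] by blast
  have qn: "q ^ n0 \<le> q ^ n" if "n0 \<le> n" for n using q that by (intro power_increasing) auto
  have u0: "0 < U0 (q ^ n0)" unfolding U0_def using q eta by (intro Phi_pos) simp
  have e3: "\<eta>^3 \<le> 1" "0 < \<eta>^3" using eta by (auto simp: power_le_one)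
  define B where "B = ln (\<alpha> * U0 (q ^ n0))"
  define B' where "B' = ln (A * CU * U0 (q ^ n0))"
  \<comment> \<open>Half of the rate \<open>ln 2 / real m0\<close>; the other half absorbs the
    additive constants for large \<open>n\<close>.\<close>
  define a where "a = ln 2 / (2 * real m0)"
  have lo: "ln (\<phi> (q ^ n)) \<ge> ln 2 * (real (n - n0) / real m0 - 1) + B" if n: "n0 \<le> n" for n
  proof -
    define k where "k = (n - n0) div m0"
    have kk: "real (n - n0) / real m0 - 1 \<le> real k"
    proof -
      have "n - n0 < m0 * (k + 1)" using m0(1) unfolding k_def by (metis Suc_eq_plus1 dividend_less_times_div mult_Suc_right less_le_trans add.commute order_refl zero_less_one)
      then have "real (n - n0) < real m0 * (real k + 1)" by (metis of_nat_1 of_nat_add of_nat_less_iff of_nat_mult)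
      then show ?thesis using m0(1) by (simp add: field_simps)
    qed
    have "n0 + m0 * k \<le> n" using n by (simp add: k_def) (metis add.commute le_add_diff_inverse2 nat_add_left_cancel_le times_div_less_eq_dividend)
    then have qq: "q ^ (n0 + m0 * k) \<le> q ^ n" using q by (intro power_increasing) auto
    have "2 ^ k * U0 (q ^ n0) \<le> U0 (q ^ (n0 + m0 * k))" using n0 by (intro m0) auto
    also have "\<dots> \<le> U0 (q ^ n)" unfolding U0_def using qq q e3 by (intro Phi_le divide_right_mono) auto
    finally have "\<alpha> * (2 ^ k * U0 (q ^ n0)) \<le> \<alpha> * U0 (q ^ n)" using al by (intro mult_left_mono) auto
    also have "\<dots> \<le> \<phi> (q ^ n)" using qn[OF n] n0 by (intro cmp) auto
    finally have "ln (2 ^ k * (\<alpha> * U0 (q ^ n0))) \<le> ln (\<phi> (q ^ n))" using al u0 by (intro ln_mono) (auto simp: mult_ac)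
    moreover have "ln (2 ^ k * (\<alpha> * U0 (q ^ n0))) = real k * ln 2 + B"
      using al u0 by (simp add: ln_mult ln_realpow B_def)
    moreover have "ln 2 * (real (n - n0) / real m0 - 1) \<le> real k * ln 2" using kk by (simp add: mult.commute)
    ultimately show ?thesis by linarith
  qed
  have up: "ln (\<phi> (q ^ n)) \<le> \<beta> * (real n * ln q) + B'" if n: "n0 \<le> n" for n
  proof -
    have r: "0 < q ^ n0" "0 < q ^ n" using q by auto
    have "q ^ n0 \<le> q ^ n0 / \<eta>^3" using e3 r by (simp add: pos_le_divide_eq mult_left_le)
    then have R3: "R < q ^ n0 / \<eta>^3" using n0 by simp
    have "U0 (q ^ n) \<le> CU * ((q ^ n / \<eta>^3) / (q ^ n0 / \<eta>^3)) powr \<beta> * U0 (q ^ n0)"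
      unfolding U0_def using qn[OF n] e3 R3 by (intro Phi_upper' divide_right_mono) auto
    also have "(q ^ n / \<eta>^3) / (q ^ n0 / \<eta>^3) = q ^ n / q ^ n0" using e3 by simp
    also have "CU * (q ^ n / q ^ n0) powr \<beta> * U0 (q ^ n0) \<le> CU * (q ^ n) powr \<beta> * U0 (q ^ n0)"
    proof (intro mult_right_mono mult_left_mono powr_mono2)
      have "1 \<le> q ^ n0" using q by simp
      then show "q ^ n / q ^ n0 \<le> q ^ n" using r by (simp add: divide_le_eq)
    qed (use u0 CU beta r in auto)
    finally have "A * U0 (q ^ n) \<le> A * (CU * (q ^ n) powr \<beta> * U0 (q ^ n0))" using al by (intro mult_left_mono) auto
    moreover have "\<phi> (q ^ n) \<le> A * U0 (q ^ n)" using qn[OF n] n0 by (intro cmp) auto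
    ultimately have "\<phi> (q ^ n) \<le> (q ^ n) powr \<beta> * (A * CU * U0 (q ^ n0))" by (simp add: mult_ac)
    moreover have "0 < \<phi> (q ^ n)"
    proof -
      have "0 < U0 (q ^ n)" unfolding U0_def using r e3 by (intro Phi_pos) simp
      then have "0 < \<alpha> * U0 (q ^ n)" using al by simp
      also have "\<dots> \<le> \<phi> (q ^ n)" using qn[OF n] n0 by (intro cmp) auto
      finally show ?thesis .
    qed
    ultimately have "ln (\<phi> (q ^ n)) \<le> ln ((q ^ n) powr \<beta> * (A * CU * U0 (q ^ n0)))" by (intro ln_mono) auto
    also have "\<dots> = \<beta> * (real n * ln q) + B'"
      using al CU u0 r q by (simp add: ln_mult ln_powr ln_realpow B'_def)
    finally show ?thesis .
  qed
  have a: "0 < a" using m0(1) by (simp add: a_def)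
  have lim: "filterlim (\<lambda>n. a * real n) at_top sequentially"
    using a by (intro filterlim_tendsto_pos_mult_at_top[OF tendsto_const _ filterlim_real_sequentially])
  have lim1: "filterlim (\<lambda>n. 1 * real n) at_top sequentially"
    by (simp add: filterlim_real_sequentially)
  show thesis
  proof (rule that[OF a, of "\<beta> * ln q + 1"])
    show "\<forall>\<^sub>F n in sequentially. a * real n \<le> ln (\<phi> (q ^ n)) \<and> ln (\<phi> (q ^ n)) \<le> (\<beta> * ln q + 1) * real n"
      using eventually_ge_of_at_top[OF lim, of "ln 2 * (real n0 / real m0 + 1) - B"] eventually_ge_of_at_top[OF lim1, of B'] eventually_ge_at_top[of n0]
    proof eventually_elim
      case (elim n)
      have "ln 2 * (real (n - n0) / real m0 - 1) = 2 * (a * real n) - ln 2 * (real n0 / real m0 + 1)"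
        using elim(3) m0(1) by (simp add: a_def of_nat_diff field_simps)
      with lo[OF elim(3)] elim(1) have "a * real n \<le> ln (\<phi> (q ^ n))" by linarith
      moreover have "ln (\<phi> (q ^ n)) \<le> (\<beta> * ln q + 1) * real n"
        using up[OF elim(3)] elim(2) by (simp add: algebra_simps)
      ultimately show ?case ..
    qed
  qed
qed

end

section \<open>Borel--Cantelli arguments along geometric scales\<close>

lemma filterlim_power_at_top: "1 < (q::real) \<Longrightarrow> filterlim (\<lambda>n::nat. q ^ n) at_top sequentially"
  by real_asymp

context diffusive_process
begin

section \<open>Comparison of tails at two levels\<close>

lemma U0_pos: "0 < r \<Longrightarrow> 0 < U0 r"
  unfolding U0_def using eta by (intro Phi_pos) simp

lemma U0_mono: "0 < r \<Longrightarrow> r \<le> r' \<Longrightarrow> U0 r \<le> U0 r'"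
  unfolding U0_def using eta by (intro Phi_le divide_right_mono) auto

text \<open>With \<open>v\<close> the budget \<open>gg r\<close> in time units, about
  \<open>\<zeta> * v / b\<close> blocks serve for the lower bound and about
  \<open>\<xi> * v / (b + 8)\<close> for the upper one. The quotient of the two bounds is
  \<open>K1 ^ j * S ^ (j' - j)\<close>. For large \<open>b\<close> the cost \<open>K1 ^ j\<close> is
  beaten by the decay of the additional blocks, leaving \<open>exp (- th * ll r)\<close> up to a
  constant, that is, a negative power of \<open>ln (\<phi> r)\<close>.\<close>

lemma tail_comparison:
  assumes q: "1 < q"
  obtains \<theta> where "0 < \<theta>"
    "\<And>\<zeta> \<xi>. 0 < \<zeta> \<Longrightarrow> \<zeta> < \<xi> \<Longrightarrow> \<exists>\<kappa>\<ge>1. \<exists>K>0. \<forall>x z. \<forall>\<^sub>F n in sequentially. \<exists>a. 0 \<le> a \<and> a \<le> 1 \<and>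
       pr z (\<lambda>p. ennreal (\<xi> * gg (q ^ n)) < occ x (q ^ n) \<infinity> p) \<le> ennreal (a * (K * real n powr (- \<theta> * (\<xi> - \<zeta>)))) \<and>
       (\<forall>y\<in>ball x (q ^ n / \<eta>\<^sup>2). ennreal a \<le>
          pr (Some y) (\<lambda>p. ennreal (\<zeta> * gg (q ^ n)) \<le> occ x (q ^ n) (ennreal (\<kappa> * gg (q ^ n))) p))"
proof -
  obtain c1 K1 where c1: "0 < c1" and K1: "1 \<le> K1" and tb: "\<And>b. 1 \<le> b \<Longrightarrow> \<exists>L\<ge>1. \<forall>x r. large x r \<longrightarrow>
       (\<exists>S. 0 \<le> S \<and> S \<le> 1 \<and> S \<le> K1 * exp (- c1 * b) \<and>
       (\<forall>j w. pr w (\<lambda>p. ennreal (real j * (b + 8) * U0 r) < occ x r \<infinity> p) \<le> ennreal (S ^ j)) \<and>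
       (\<forall>j. \<forall>y\<in>ball x (r / \<eta>\<^sup>2). ennreal (S ^ j) \<le>
          ennreal (K1 ^ j) * pr (Some y) (\<lambda>p. ennreal (real j * b * U0 r) \<le> occ x r (ennreal (real j * L * U0 r)) p)))"
    using occupation_tail_bounds by blast
  obtain \<alpha> A r1 where al: "0 < \<alpha>" "\<alpha> \<le> A" "0 < r1" and gl: "\<And>r. r1 \<le> r \<Longrightarrow> \<alpha> * ll r * U0 r \<le> gg r"
    and gu: "\<And>r. r1 \<le> r \<Longrightarrow> gg r \<le> A * ll r * U0 r" and l1: "\<And>r. r1 \<le> r \<Longrightarrow> 1 \<le> ll r"
    using gg_U0_bounds by blast
  obtain cq Cq where cq: "0 < cq" and lnphi: "\<forall>\<^sub>F n in sequentially. cq * real n \<le> ln (\<phi> (q ^ n)) \<and> ln (\<phi> (q ^ n)) \<le> Cq * real n"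
    using ln_phi_bounds[OF q] by blast
  note qlim = filterlim_power_at_top[OF q]
  define lnK where "lnK = ln K1"
  have lnK: "0 \<le> lnK" "K1 = exp lnK" using K1 by (auto simp: lnK_def)
  show thesis
  proof (rule that[of "c1 * \<alpha> / 8"])
    show "0 < c1 * \<alpha> / 8" using c1 al by simp
    fix \<zeta> \<xi> :: real assume lam: "0 < \<zeta>" "\<zeta> < \<xi>"
    define e where "e = (\<xi> - \<zeta>) / 4"
    have e: "0 < e" "\<xi> = \<zeta> + 4 * e" using lam by (simp_all add: e_def field_simps)
    \<comment> \<open>The middle entry guarantees
      \<open>(\<zeta> + 2 * e) / b \<le> \<xi> / (b + 8)\<close>, so the summand \<open>8\<close>
      does not eat up the gap between the levels. The last one makes the total cost of
      \<open>K1\<close> at most half of the gain \<open>c1 * e * b\<close>.\<close>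
    define b where "b = max 1 (max (4 * (\<zeta> + 2 * e) / e) (2 * lnK * (\<zeta> + e) / (c1 * e)))"
    have b1: "1 \<le> b" and b2: "(\<zeta> + 2 * e) * (b + 8) \<le> \<xi> * b" and b3: "lnK * (\<zeta> + e) \<le> c1 * e * b / 2"
    proof -
      show "1 \<le> b" by (simp add: b_def)
      have "4 * (\<zeta> + 2 * e) / e \<le> b" by (simp add: b_def)
      then have "4 * (\<zeta> + 2 * e) \<le> e * b" using e by (simp add: field_simps)
      then show "(\<zeta> + 2 * e) * (b + 8) \<le> \<xi> * b" using e(2) by (simp add: algebra_simps)
      have "2 * lnK * (\<zeta> + e) / (c1 * e) \<le> b" by (simp add: b_def)
      then have "2 * lnK * (\<zeta> + e) \<le> b * (c1 * e)" using e c1 by (simp add: pos_divide_le_eq)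
      then show "lnK * (\<zeta> + e) \<le> c1 * e * b / 2" by (simp add: algebra_simps)
    qed
    have w0: "0 \<le> c1 * b - lnK"
    proof -
      have "lnK * e \<le> lnK * (\<zeta> + e)" using lnK lam e by (intro mult_left_mono) auto
      also have "\<dots> \<le> (c1 * b / 2) * e" using b3 by (simp add: mult_ac)
      finally have "lnK \<le> c1 * b / 2" using e by simp
      moreover have "0 \<le> c1 * b" using c1 b1 by simp
      ultimately show ?thesis by simp
    qed
    from tb[OF b1] obtain L where L: "1 \<le> L" and tL': "\<forall>x r. large x r \<longrightarrow>
       (\<exists>S. 0 \<le> S \<and> S \<le> 1 \<and> S \<le> K1 * exp (- c1 * b) \<and>
       (\<forall>j w. pr w (\<lambda>p. ennreal (real j * (b + 8) * U0 r) < occ x r \<infinity> p) \<le> ennreal (S ^ j)) \<and>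
       (\<forall>j. \<forall>y\<in>ball x (r / \<eta>\<^sup>2). ennreal (S ^ j) \<le>
          ennreal (K1 ^ j) * pr (Some y) (\<lambda>p. ennreal (real j * b * U0 r) \<le> occ x r (ennreal (real j * L * U0 r)) p)))"
      by (elim exE conjE) (rule that)
    note tL = tL'[THEN spec, THEN spec, THEN mp]
    \<comment> \<open>The lower bound uses \<open>j\<close> horizons of length \<open>L * u\<close>,
      and \<open>j \<le> (\<zeta> / b + 1) * v\<close> once \<open>v \<ge> 1\<close>.\<close>
    define \<kappa> where "\<kappa> = max 1 ((\<zeta> / b + 1) * L)"
    define th where "th = c1 * \<alpha> / 8 * (\<xi> - \<zeta>)"
    have "\<xi> - \<zeta> = 4 * e" using e(2) by simp
    then have th1: "th = c1 * e * \<alpha> / 2" by (simp add: th_def)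
    have "0 < c1 * e * \<alpha>" using e(1) c1 al(1) by simp
    with th1 have th: "th = c1 * e * \<alpha> / 2" "0 < th" by simp_all
    define K where "K = K1 * cq powr (- th)"
    have K: "0 < K" using K1 cq by (simp add: K_def)
    have ev: "\<forall>\<^sub>F n in sequentially. \<exists>a. 0 \<le> a \<and> a \<le> 1 \<and>
       pr z (\<lambda>p. ennreal (\<xi> * gg (q ^ n)) < occ x (q ^ n) \<infinity> p) \<le> ennreal (a * (K * real n powr (- th))) \<and>
       (\<forall>y\<in>ball x (q ^ n / \<eta>\<^sup>2). ennreal a \<le>
          pr (Some y) (\<lambda>p. ennreal (\<zeta> * gg (q ^ n)) \<le> occ x (q ^ n) (ennreal (\<kappa> * gg (q ^ n))) p))" for x z
    proof -
      have "\<forall>\<^sub>F n in sequentially. large x (q ^ n)"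
        by (rule eventually_compose_filterlim[OF eventually_large qlim])
      moreover have "\<forall>\<^sub>F n in sequentially. r1 \<le> q ^ n" by (rule eventually_ge_of_at_top[OF qlim])
      moreover have "\<forall>\<^sub>F n in sequentially. max 1 (2 * b / e) / \<alpha> \<le> ll (q ^ n)"
        by (rule eventually_ge_of_at_top[OF filterlim_compose[OF ll_at_top qlim]])
      ultimately show ?thesis using lnphi eventually_ge_at_top[of 1]
      proof eventually_elim
        case (elim n)
        define r where "r = q ^ n"
        define u where "u = U0 r"
        define v where "v = gg r / u"
        have r: "large x r" "r1 \<le> r" "max 1 (2 * b / e) / \<alpha> \<le> ll r" "cq * real n \<le> ln (\<phi> r)" "1 \<le> n"
          using elim by (auto simp: r_def)
        have u: "0 < u" unfolding u_def using large_simps(1)[OF r(1)] by (rule U0_pos)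
        have g: "gg r = v * u" using u by (simp add: v_def)
        have "\<alpha> * ll r * u \<le> v * u" using gl[OF r(2)] g by (simp add: u_def)
        then have v: "\<alpha> * ll r \<le> v" using u by simp
        have "max 1 (2 * b / e) \<le> v" using r(3) v al by (simp add: field_simps)
        then have v1: "1 \<le> v" and v2: "2 \<le> e * v / b" using e b1 by (auto simp: field_simps)
        obtain S where S: "0 \<le> S" "S \<le> 1" "S \<le> K1 * exp (- c1 * b)"
          and up: "\<And>j w. pr w (\<lambda>p. ennreal (real j * (b + 8) * u) < occ x r \<infinity> p) \<le> ennreal (S ^ j)"
          and low: "\<And>j y. y \<in> ball x (r / \<eta>\<^sup>2) \<Longrightarrow> ennreal (S ^ j) \<le>
          ennreal (K1 ^ j) * pr (Some y) (\<lambda>p. ennreal (real j * b * u) \<le> occ x r (ennreal (real j * L * u)) p)"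
          using tL[OF r(1)] unfolding u_def by blast
        define j where "j = nat \<lceil>\<zeta> * v / b\<rceil>"
        define j' where "j' = nat \<lfloor>\<xi> * v / (b + 8)\<rfloor>"
        have x1: "0 \<le> \<zeta> * v / b" "0 \<le> \<xi> * v / (b + 8)" using lam v1 b1 by auto
        have j: "\<zeta> * v / b \<le> real j" "real j \<le> \<zeta> * v / b + 1" using x1 unfolding j_def by linarith+
        have j': "real j' \<le> \<xi> * v / (b + 8)" "\<xi> * v / (b + 8) - 1 \<le> real j'" using x1 unfolding j'_def by linarith+
        have "(\<zeta> + 2 * e) * v / b \<le> \<xi> * v / (b + 8)"
        proof -
          have "(\<zeta> + 2 * e) * (b + 8) * v \<le> \<xi> * b * v" using b2 v1 by (intro mult_right_mono) auto
          then show ?thesis using b1 by (simp add: divide_simps mult_ac)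
        qed
        moreover have "(\<zeta> + 2 * e) * v / b = \<zeta> * v / b + 2 * (e * v / b)" by (simp add: algebra_simps add_divide_distrib)
        ultimately have jj: "real j + e * v / b \<le> real j'" using j(2) j'(2) v2 by linarith
        then have jle: "j \<le> j'" using v2 by linarith
        \<comment> \<open>What \<open>low\<close> yields for the probability of reaching level
          \<open>\<zeta>\<close> in time; the upper bound for level \<open>\<xi>\<close> is then
          factored through it.\<close>
        define a where "a = S ^ j / K1 ^ j"
        have K1j: "1 \<le> K1 ^ j" using K1 by simp
        have a: "0 \<le> a" "a \<le> 1"
        proof -
          show "0 \<le> a" using S K1 by (simp add: a_def)
          have "S ^ j \<le> 1" using S by (intro power_le_one)
          then show "a \<le> 1" using K1j unfolding a_def by (simp add: divide_le_eq)
        qed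
        have "S ^ (j' - j) \<le> (K1 * exp (- c1 * b)) ^ (j' - j)" using S by (intro power_mono)
        also have "K1 * exp (- c1 * b) = exp (- (c1 * b - lnK))" using lnK by (simp add: exp_add[symmetric])
        also have "exp (- (c1 * b - lnK)) ^ (j' - j) = exp (real (j' - j) * (- (c1 * b - lnK)))"
          by (rule exp_of_nat_mult[symmetric])
        also have "\<dots> \<le> exp (- (c1 * b - lnK) * (e * v / b))"
        proof -
          have "e * v / b \<le> real (j' - j)" using jj jle by (simp add: of_nat_diff)
          then have "(c1 * b - lnK) * (e * v / b) \<le> (c1 * b - lnK) * real (j' - j)" using w0 by (intro mult_left_mono)
          moreover have "s * (- w) \<le> - w * t" if "w * t \<le> w * s" for w t s :: real
            using that by (simp add: mult.commute)
          ultimately show ?thesis unfolding exp_le_cancel_iff by blast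
        qed
        finally have A1: "S ^ (j' - j) \<le> exp (- (c1 * b - lnK) * (e * v / b))" .
        have "K1 ^ j = exp (real j * lnK)" unfolding lnK(2) by (rule exp_of_nat_mult[symmetric])
        also have "\<dots> \<le> exp ((\<zeta> * v / b + 1) * lnK)" using j(2) lnK by (simp add: mult_right_mono)
        finally have A2: "K1 ^ j \<le> exp ((\<zeta> * v / b + 1) * lnK)" .
        have ex: "(\<zeta> * v / b + 1) * lnK + - (c1 * b - lnK) * (e * v / b) \<le> lnK - th * ll r"
        proof -
          have "(\<zeta> * v / b + 1) * lnK + - (c1 * b - lnK) * (e * v / b) = lnK + (lnK * (\<zeta> + e) - c1 * e * b) * (v / b)"
            using b1 by (simp add: field_simps)
          also have "\<dots> \<le> lnK + (- (c1 * e * b / 2)) * (v / b)"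
            using b3 v1 b1 by (intro add_left_mono mult_right_mono) auto
          also have "\<dots> = lnK - (c1 * e / 2) * v" using b1 by simp
          also have "\<dots> \<le> lnK - (c1 * e / 2) * (\<alpha> * ll r)" using v c1 e by (intro diff_left_mono mult_left_mono) auto
          finally show ?thesis by (simp add: th(1) mult_ac)
        qed
        have lp: "0 < cq * real n" using cq r(5) by simp
        have "K1 ^ j * S ^ (j' - j) \<le> exp ((\<zeta> * v / b + 1) * lnK) * exp (- (c1 * b - lnK) * (e * v / b))"
          using A1 A2 S K1 by (intro mult_mono) auto
        also have "\<dots> \<le> exp (lnK - th * ll r)" unfolding exp_add[symmetric] using ex by simp
        also have "\<dots> = K1 * ln (\<phi> r) powr (- th)"
          using lp r(4) by (simp add: lnK(2) exp_diff powr_def ll_def exp_minus field_simps)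
        also have "\<dots> \<le> K1 * (cq * real n) powr (- th)"
          using lp r(4) K1 th by (intro mult_left_mono powr_mono2') auto
        also have "\<dots> = K * real n powr (- th)" by (simp add: K_def powr_mult)
        finally have A3: "K1 ^ j * S ^ (j' - j) \<le> K * real n powr (- th)" .
        have "S ^ j' = S ^ j * S ^ (j' - j)" using jle by (simp add: power_add[symmetric])
        also have "\<dots> = a * (K1 ^ j * S ^ (j' - j))" using K1 by (simp add: a_def)
        also have "\<dots> \<le> a * (K * real n powr (- th))" using a A3 by (intro mult_left_mono)
        finally have A4: "S ^ j' \<le> a * (K * real n powr (- th))" .
        have "pr z (\<lambda>p. ennreal (\<xi> * gg r) < occ x r \<infinity> p) \<le> pr z (\<lambda>p. ennreal (real j' * (b + 8) * u) < occ x r \<infinity> p)"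
        proof (rule pr_mono)
          have "real j' * (b + 8) \<le> \<xi> * v" using j'(1) b1 by (simp add: field_simps)
          then have "real j' * (b + 8) * u \<le> \<xi> * gg r" unfolding g using u by (simp add: mult.assoc[symmetric])
          then have "ennreal (real j' * (b + 8) * u) \<le> ennreal (\<xi> * gg r)" by (rule ennreal_leI)
          then show "ennreal (real j' * (b + 8) * u) < occ x r \<infinity> (path 0 \<omega>)"
            if "ennreal (\<xi> * gg r) < occ x r \<infinity> (path 0 \<omega>)" for \<omega>
            using that by (rule order_le_less_trans)
        qed measurable
        also have "\<dots> \<le> ennreal (S ^ j')" by (rule up)
        also have "\<dots> \<le> ennreal (a * (K * real n powr (- th)))" by (rule ennreal_leI[OF A4])
        finally have U: "pr z (\<lambda>p. ennreal (\<xi> * gg r) < occ x r \<infinity> p) \<le> ennreal (a * (K * real n powr (- th)))" .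
        have Lw: "ennreal a \<le> pr (Some y) (\<lambda>p. ennreal (\<zeta> * gg r) \<le> occ x r (ennreal (\<kappa> * gg r)) p)"
          if y: "y \<in> ball x (r / \<eta>\<^sup>2)" for y
        proof -
          let ?p = "pr (Some y) (\<lambda>p. ennreal (real j * b * u) \<le> occ x r (ennreal (real j * L * u)) p)"
          have "ennreal (1 / K1 ^ j) * ennreal (S ^ j) \<le> ennreal (1 / K1 ^ j) * (ennreal (K1 ^ j) * ?p)"
            by (rule mult_left_mono[OF low[OF y]]) simp
          also have "ennreal (1 / K1 ^ j) * (ennreal (K1 ^ j) * ?p) = ?p"
            using K1j K1 by (simp add: mult.assoc[symmetric] ennreal_mult'[symmetric])
          also have "ennreal (1 / K1 ^ j) * ennreal (S ^ j) = ennreal a"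
            using S K1j K1 by (simp add: a_def ennreal_mult'[symmetric])
          finally have "ennreal a \<le> ?p" .
          also have "?p \<le> pr (Some y) (\<lambda>p. ennreal (\<zeta> * gg r) \<le> occ x r (ennreal (\<kappa> * gg r)) p)"
          proof (rule pr_mono)
            fix \<omega> assume w: "\<omega> \<in> \<Omega>" and o: "ennreal (real j * b * u) \<le> occ x r (ennreal (real j * L * u)) (path 0 \<omega>)"
            have "\<zeta> * v \<le> real j * b" using j(1) b1 by (simp add: field_simps)
            then have "\<zeta> * gg r \<le> real j * b * u" unfolding g using u by (simp add: mult.assoc[symmetric])
            then have i1: "ennreal (\<zeta> * gg r) \<le> ennreal (real j * b * u)" by (rule ennreal_leI)
            have "real j \<le> (\<zeta> / b + 1) * v" using j(2) v1 by (simp add: algebra_simps)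
            then have "real j * L \<le> (\<zeta> / b + 1) * v * L" using L by (intro mult_right_mono) auto
            also have "\<dots> \<le> \<kappa> * v" using v1 by (simp add: \<kappa>_def mult_ac mult_left_mono)
            finally have "real j * L * u \<le> \<kappa> * gg r" unfolding g using u by (simp add: mult.assoc[symmetric])
            then have "occ x r (ennreal (real j * L * u)) (path 0 \<omega>) \<le> occ x r (ennreal (\<kappa> * gg r)) (path 0 \<omega>)"
              by (intro occ_mono[OF w] ennreal_leI) auto
            with i1 o show "ennreal (\<zeta> * gg r) \<le> occ x r (ennreal (\<kappa> * gg r)) (path 0 \<omega>)" by (meson order_trans)
          qed measurable
          finally show ?thesis .
        qed
        show ?case using a U Lw unfolding r_def by blast
      qed
    qed
    have e': "- (c1 * \<alpha> / 8) * (\<xi> - \<zeta>) = - th" by (simp add: th_def)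
    have k1: "1 \<le> \<kappa>" by (simp add: \<kappa>_def)
    show "\<exists>\<kappa>\<ge>1. \<exists>K>0. \<forall>x z. \<forall>\<^sub>F n in sequentially. \<exists>a. 0 \<le> a \<and> a \<le> 1 \<and>
       pr z (\<lambda>p. ennreal (\<xi> * gg (q ^ n)) < occ x (q ^ n) \<infinity> p) \<le> ennreal (a * (K * real n powr (- (c1 * \<alpha> / 8) * (\<xi> - \<zeta>)))) \<and>
       (\<forall>y\<in>ball x (q ^ n / \<eta>\<^sup>2). ennreal a \<le>
          pr (Some y) (\<lambda>p. ennreal (\<zeta> * gg (q ^ n)) \<le> occ x (q ^ n) (ennreal (\<kappa> * gg (q ^ n))) p))"
      unfolding e' by (intro exI[of _ \<kappa>] exI[of _ K] conjI allI) (fact k1 K ev)+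
  qed
qed

definition tail :: "'a \<Rightarrow> 'a option \<Rightarrow> real \<Rightarrow> real \<Rightarrow> nat \<Rightarrow> real" where
  "tail x z \<zeta> q n = enn2real (pr z (\<lambda>p. ennreal (\<zeta> * gg (q ^ n)) < occ x (q ^ n) \<infinity> p))"

lemma ennreal_tail: "ennreal (tail x z \<zeta> q n) = pr z (\<lambda>p. ennreal (\<zeta> * gg (q ^ n)) < occ x (q ^ n) \<infinity> p)"
  unfolding tail_def by (rule ennreal_enn2real, rule order_le_less_trans[OF pr_le_1 ennreal_one_less_top])

lemma tail_nonneg: "0 \<le> tail x z \<zeta> q n" by (simp add: tail_def)

lemma summable_tail:
  assumes q: "1 < q"
  obtains \<zeta> where "0 < \<zeta>" "\<And>x z. summable (tail x z \<zeta> q)"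
proof -
  obtain \<theta> where th: "0 < \<theta>" and cmp: "\<And>\<zeta> \<xi>. 0 < \<zeta> \<Longrightarrow> \<zeta> < \<xi> \<Longrightarrow> \<exists>\<kappa>\<ge>1. \<exists>K>0. \<forall>x z. \<forall>\<^sub>F n in sequentially. \<exists>a. 0 \<le> a \<and> a \<le> 1 \<and>
       pr z (\<lambda>p. ennreal (\<xi> * gg (q ^ n)) < occ x (q ^ n) \<infinity> p) \<le> ennreal (a * (K * real n powr (- \<theta> * (\<xi> - \<zeta>)))) \<and>
       (\<forall>y\<in>ball x (q ^ n / \<eta>\<^sup>2). ennreal a \<le>
          pr (Some y) (\<lambda>p. ennreal (\<zeta> * gg (q ^ n)) \<le> occ x (q ^ n) (ennreal (\<kappa> * gg (q ^ n))) p))"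
    using tail_comparison[OF q] by blast
  \<comment> \<open>Starting from level \<open>1\<close>, this makes the exponent of
    \<open>n\<close> equal to \<open>-2\<close>; the factor \<open>a\<close> is estimated by
    \<open>1\<close>.\<close>
  define \<xi> where "\<xi> = 1 + 2 / \<theta>"
  have lam: "1 < \<xi>" "- \<theta> * (\<xi> - 1) = -2" using th by (auto simp: \<xi>_def)
  obtain K where K: "0 < K" and b: "\<And>x z. \<forall>\<^sub>F n in sequentially. \<exists>a. 0 \<le> a \<and> a \<le> 1 \<and>
       pr z (\<lambda>p. ennreal (\<xi> * gg (q ^ n)) < occ x (q ^ n) \<infinity> p) \<le> ennreal (a * (K * real n powr (- \<theta> * (\<xi> - 1))))"
    using cmp[OF zero_less_one lam(1)] by (fast elim: eventually_mono)
  show thesis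
  proof (rule that[of \<xi>])
    show "0 < \<xi>" using lam by simp
    fix x z
    show "summable (tail x z \<xi> q)"
    proof (rule summable_comparison_test_ev)
      show "summable (\<lambda>n. K * real n powr (-2))" by (intro summable_mult) (simp add: summable_real_powr_iff)
      show "\<forall>\<^sub>F n in sequentially. norm (tail x z \<xi> q n) \<le> K * real n powr (-2)"
        using b[where x=x and z=z]
      proof eventually_elim
        case (elim n)
        then obtain a where a: "0 \<le> a" "a \<le> 1" "ennreal (tail x z \<xi> q n) \<le> ennreal (a * (K * real n powr (-2)))"
          unfolding ennreal_tail lam(2) by blast
        have "tail x z \<xi> q n \<le> a * (K * real n powr (-2))" using a K by (subst (asm) ennreal_le_iff) auto
        also have "\<dots> \<le> 1 * (K * real n powr (-2))" using a K by (intro mult_right_mono) auto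
        finally show ?case by (simp add: tail_nonneg)
      qed
    qed
  qed
qed

lemma ev_occ_le:
  assumes "summable (tail x z \<zeta> q)"
  shows "AE \<omega> in P z. \<forall>\<^sub>F n in sequentially. occ x (q ^ n) \<infinity> (path 0 \<omega>) \<le> ennreal (\<zeta> * gg (q ^ n))"
proof -
  let ?A = "\<lambda>n. {\<omega>\<in>\<Omega>. ennreal (\<zeta> * gg (q ^ n)) < occ x (q ^ n) \<infinity> (path 0 \<omega>)}"
  have m: "Measurable.pred path_space (\<lambda>p. ennreal (\<zeta> * gg (q ^ n)) < occ x (q ^ n) \<infinity> p)" for n by measurable
  have A: "?A n \<in> sets (P z)" for n by (rule event_path[OF m])
  have e: "emeasure (P z) (?A n) = ennreal (tail x z \<zeta> q n)" for n
    unfolding ennreal_tail by (rule pr_eq[OF m, symmetric])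
  have "AE \<omega> in P z. \<forall>\<^sub>F n in sequentially. \<omega> \<in> space (P z) - ?A n"
  proof (rule borel_cantelli_AE1[OF A])
    show "emeasure (P z) (?A n) < \<infinity>" for n unfolding e by simp
    show "summable (\<lambda>n. measure (P z) (?A n))" using assms unfolding measure_def e by (simp add: tail_nonneg)
  qed
  then show ?thesis
  proof eventually_elim
    case (elim \<omega>)
    then show ?case by eventually_elim (auto simp: not_less)
  qed
qed

end

section \<open>Divergent series and sparse index sets\<close>

lemma sum_lessThan_add:
  fixes f :: "nat \<Rightarrow> real"
  shows "(\<Sum>i<a + b. f i) = (\<Sum>i<a. f i) + (\<Sum>m<b. f (a + m))"
  by (induction b) (simp_all add: add.assoc)

lemma summable_dyadic:
  fixes p s :: "nat \<Rightarrow> real"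
  assumes p: "\<And>n. 0 \<le> p n" and s: "summable s" "\<And>k. 0 \<le> s k"
    and le: "\<And>k. k0 \<le> k \<Longrightarrow> (\<Sum>m<2 ^ k. p (2 ^ k + m)) \<le> s k"
  shows "summable p"
proof -
  have dy: "(\<Sum>i<2 ^ (k0 + k). p i) \<le> (\<Sum>i<2 ^ k0. p i) + (\<Sum>j<k. s (k0 + j))" for k
  proof (induction k)
    case (Suc k)
    have e: "(2::nat) ^ (k0 + Suc k) = 2 ^ (k0 + k) + 2 ^ (k0 + k)" by simp
    have "(\<Sum>i<2 ^ (k0 + Suc k). p i) = (\<Sum>i<2 ^ (k0 + k). p i) + (\<Sum>m<2 ^ (k0 + k). p (2 ^ (k0 + k) + m))"
      unfolding e by (rule sum_lessThan_add)
    also have "(\<Sum>m<2 ^ (k0 + k). p (2 ^ (k0 + k) + m)) \<le> s (k0 + k)" by (rule le) simp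
    finally show ?case using Suc by simp
  qed simp
  have ss: "summable (\<lambda>j. s (k0 + j))" using summable_ignore_initial_segment[OF s(1), of k0] by (simp add: add.commute)
  show ?thesis
  proof (rule summableI_nonneg_bounded[OF p])
    fix n :: nat
    have "n < 2 ^ n" by (rule less_exp)
    also have "(2::nat) ^ n \<le> 2 ^ (k0 + n)" by (intro power_increasing) auto
    finally have "(\<Sum>i<n. p i) \<le> (\<Sum>i<2 ^ (k0 + n). p i)" using p by (intro sum_mono2) auto
    also have "\<dots> \<le> (\<Sum>i<2 ^ k0. p i) + (\<Sum>j<n. s (k0 + j))" by (rule dy)
    also have "(\<Sum>j<n. s (k0 + j)) \<le> (\<Sum>j. s (k0 + j))" using s(2) by (intro sum_le_suminf ss) auto
    finally show "(\<Sum>i<n. p i) \<le> (\<Sum>i<2 ^ k0. p i) + (\<Sum>j. s (k0 + j))" by simp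
  qed
qed

text \<open>
  A divergent series keeps infinitely many large dyadic blocks after multiplication by a power of the
  index; within a block, some residue class modulo the (logarithmic) number \<open>k + 1\<close> still has a
  large sum.
\<close>

lemma ex_large_residue_class:
  fixes p a :: "nat \<Rightarrow> real"
  assumes p: "\<And>n. 0 \<le> p n" "\<not> summable p" and a: "\<And>n. 0 \<le> a n" and K: "0 < K" "0 < \<theta>"
    and le: "\<And>n. N0 \<le> n \<Longrightarrow> p n \<le> a n * (K * real n powr (- \<theta>))" and M: "0 \<le> M"
  shows "\<exists>k\<ge>k0. \<exists>i\<le>k. M < (\<Sum>j<2 ^ k. a (2 ^ k + i + (k + 1) * j))"
proof (rule ccontr)
  assume neg: "\<not> ?thesis"
  \<comment> \<open>If every residue class had sum at most \<open>M\<close>, the block of order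
    \<open>k\<close> would contribute at most \<open>s k\<close>: there are \<open>k + 1\<close>
    classes, and the power of the index is at most \<open>(2 powr (- \<theta>)) ^ k\<close>. Since
    \<open>s\<close> is summable, \<open>p\<close> would be too.\<close>
  define s where "s k = K * M * (real (k + 1) * (2 powr (- \<theta>)) ^ k)" for k
  have "summable (\<lambda>k. real k * (2 powr (- \<theta>)) ^ k)"
  proof (rule summable_comparison_test_ev[where g="\<lambda>k. (2 powr (- \<theta> / 2)) ^ k"])
    have "(\<lambda>k. real k * 2 powr (- \<theta> / 2 * real k)) \<longlonglongrightarrow> 0" using K by real_asymp
    then have "\<forall>\<^sub>F k in sequentially. real k * 2 powr (- \<theta> / 2 * real k) < 1" by (rule order_tendstoD) simp
    then show "\<forall>\<^sub>F k in sequentially. norm (real k * (2 powr (- \<theta>)) ^ k) \<le> (2 powr (- \<theta> / 2)) ^ k"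
    proof eventually_elim
      case (elim k)
      have "(2 powr (- \<theta>)) ^ k = 2 powr (- \<theta> / 2 * real k) * (2 powr (- \<theta> / 2)) ^ k"
        by (simp add: powr_realpow[symmetric] powr_powr flip: powr_add)
      then have "real k * (2 powr (- \<theta>)) ^ k = (real k * 2 powr (- \<theta> / 2 * real k)) * (2 powr (- \<theta> / 2)) ^ k" by simp
      also have "\<dots> \<le> 1 * (2 powr (- \<theta> / 2)) ^ k" using elim by (intro mult_right_mono) auto
      finally show ?case by simp
    qed
    have "2 powr (- \<theta> / 2) < 2 powr 0" using K by (intro powr_less_mono) auto
    then show "summable (\<lambda>k. (2 powr (- \<theta> / 2)) ^ k)" by (intro summable_geometric) simp
  qed
  moreover have "summable (\<lambda>k. (2 powr (- \<theta>)) ^ k)"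
  proof -
    have "2 powr (- \<theta>) < 2 powr 0" using K by (intro powr_less_mono) auto
    then show ?thesis by (intro summable_geometric) simp
  qed
  ultimately have "summable (\<lambda>k. real k * (2 powr (- \<theta>)) ^ k + (2 powr (- \<theta>)) ^ k)" by (rule summable_add)
  then have "summable (\<lambda>k. K * M * (real k * (2 powr (- \<theta>)) ^ k + (2 powr (- \<theta>)) ^ k))" by (rule summable_mult)
  then have s: "summable s" unfolding s_def by (simp add: algebra_simps)
  have "summable p"
  proof (rule summable_dyadic[OF p(1) s])
    show "0 \<le> s k" for k using K M by (simp add: s_def)
    fix k assume k: "max k0 N0 \<le> k"
    have "(\<Sum>m<2 ^ k. p (2 ^ k + m)) \<le> (\<Sum>m<2 ^ k. a (2 ^ k + m) * (K * (2 powr (- \<theta>)) ^ k))"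
    proof (rule sum_mono)
      fix m
      have "N0 < 2 ^ k" using k less_exp[of k] by linarith
      then have "p (2 ^ k + m) \<le> a (2 ^ k + m) * (K * real (2 ^ k + m) powr (- \<theta>))" by (intro le) simp
      also have "\<dots> \<le> a (2 ^ k + m) * (K * real (2 ^ k) powr (- \<theta>))"
        using a K by (intro mult_left_mono powr_mono2') auto
      also have "real (2 ^ k) powr (- \<theta>) = (2 powr (- \<theta>)) ^ k"
        by (simp add: powr_realpow[symmetric] powr_powr mult.commute)
      finally show "p (2 ^ k + m) \<le> a (2 ^ k + m) * (K * (2 powr (- \<theta>)) ^ k)" .
    qed
    also have "\<dots> = (\<Sum>m<2 ^ k. a (2 ^ k + m)) * (K * (2 powr (- \<theta>)) ^ k)" by (rule sum_distrib_right[symmetric])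
    \<comment> \<open>Nonnegative terms are appended until the range consists of
      \<open>2 ^ k\<close> rows of length \<open>k + 1\<close>. The selected indices may thus leave
      the dyadic block, which is why \<open>gap_condition\<close> admits indices up to
      \<open>2 ^ (2 * k + 2)\<close>.\<close>
    also have "(\<Sum>m<2 ^ k. a (2 ^ k + m)) \<le> (\<Sum>m<2 ^ k * (k + 1). a (2 ^ k + m))"
      using a by (intro sum_mono2) auto
    also have "(\<Sum>m<2 ^ k * (k + 1). a (2 ^ k + m)) = (\<Sum>j<2 ^ k. \<Sum>m=j * (k + 1)..<j * (k + 1) + (k + 1). a (2 ^ k + m))"
      by (rule sum.nat_group[symmetric])
    also have "\<dots> = (\<Sum>j<2 ^ k. \<Sum>i<k + 1. a (2 ^ k + i + (k + 1) * j))"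
    proof (rule sum.cong[OF refl])
      fix j
      have shift: "(\<Sum>m=c..<c + d. f m) = (\<Sum>i<d. f (c + i))" for c d :: nat and f :: "nat \<Rightarrow> real"
        by (simp add: sum.atLeastLessThan_shift_0[of f c] lessThan_atLeast0 comp_def)
      show "(\<Sum>m=j * (k + 1)..<j * (k + 1) + (k + 1). a (2 ^ k + m)) = (\<Sum>i<k + 1. a (2 ^ k + i + (k + 1) * j))"
        unfolding shift by (intro sum.cong arg_cong[where f=a]) (auto simp: algebra_simps)
    qed
    also have "\<dots> = (\<Sum>i<k + 1. \<Sum>j<2 ^ k. a (2 ^ k + i + (k + 1) * j))" by (rule sum.swap)
    also have "\<dots> \<le> (\<Sum>i<k + 1. M)"
    proof (rule sum_mono)
      fix i assume "i \<in> {..<k + 1}"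
      with neg k show "(\<Sum>j<2 ^ k. a (2 ^ k + i + (k + 1) * j)) \<le> M" by (auto simp: not_less)
    qed
    also have "(\<Sum>i<k + 1. M) = real (k + 1) * M" by simp
    finally show "(\<Sum>m<2 ^ k. p (2 ^ k + m)) \<le> s k"
      using K by (simp add: s_def mult_ac mult_right_mono)
  qed
  with p(2) show False ..
qed

context borel_standard_process
begin

text \<open>
  Substitute for the second Borel--Cantelli lemma: up to the first occurrence of one of the events,
  the conditional probabilities must sum up to at most one.
\<close>

lemma union_lower_bound:
  fixes \<tau> :: "nat \<Rightarrow> ennreal" and \<rho> :: "nat \<Rightarrow> real"
  assumes \<tau>: "incseq \<tau>" and A: "\<And>i. Measurable.pred path_space (A i)"
    and G: "\<And>i. i < N \<Longrightarrow> {\<omega>\<in>\<Omega>. A i (path (\<tau> i) \<omega>)} \<in> sets (F (\<tau> (Suc i)))"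
    and a: "\<And>i y. i < N \<Longrightarrow> y \<in> ball x (\<rho> i) \<Longrightarrow> ennreal (a i) \<le> pr (Some y) (A i)" "\<And>i. 0 \<le> a i"
    and c: "\<And>i. i < N \<Longrightarrow> ennreal c \<le> emeasure (P z) {\<omega>\<in>\<Omega>. X (\<tau> i) \<omega> \<in> Some ` ball x (\<rho> i)}"
  shows "(\<Sum>i<N. a i) * (c - measure (P z) (\<Union>i<N. {\<omega>\<in>\<Omega>. A i (path (\<tau> i) \<omega>)})) \<le> 1"
proof -
  interpret prob_space "P z" by (rule prob_space_P)
  let ?G = "\<lambda>i. {\<omega>\<in>\<Omega>. A i (path (\<tau> i) \<omega>)}"
  let ?D = "\<lambda>i. {\<omega>\<in>\<Omega>. X (\<tau> i) \<omega> \<in> Some ` ball x (\<rho> i)}"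
  let ?B = "\<lambda>i. \<Omega> - (\<Union>j<i. ?G j)"
  let ?U = "\<Union>i<N. ?G i"
  have GP: "?G i \<in> sets (P z)" for i by (rule event_path[OF A])
  have UP: "?U \<in> sets (P z)" by (intro sets.finite_UN GP) auto
  have DF: "?D i \<in> sets (F (\<tau> i))" for i
    using measurable_sets[OF adapted ball_cem, of "\<tau> i" x "\<rho> i"]
    by (simp add: vimage_def Collect_conj_eq Int_commute space_F)
  have BF: "?B i \<in> sets (F (\<tau> i))" if i: "i \<le> N" for i
  proof -
    have "?G j \<in> sets (F (\<tau> i))" if "j < i" for j
      using G[of j] sets_F_mono[OF incseqD[OF \<tau>, of "Suc j" i]] that i by auto
    then show ?thesis using sets.top[of "F (\<tau> i)"] by (intro sets.Diff sets.finite_UN) (auto simp: space_F)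
  qed
  have DP: "?D i \<in> sets (P z)" for i using sets_F_P[OF DF] by auto
  have BP: "?B i \<in> sets (P z)" if "i < N" for i using sets_F_P[OF BF] that by auto
  have 1: "a i * measure (P z) (?B i \<inter> ?D i) \<le> measure (P z) (?B i \<inter> ?G i)" if i: "i < N" for i
  proof -
    have BD: "?B i \<inter> ?D i \<in> sets (F (\<tau> i))" by (intro sets.Int BF DF) (use i in simp)
    have "ennreal (a i) * emeasure (P z) (?B i \<inter> ?D i) = (\<integral>\<^sup>+\<omega>. ennreal (a i) * indicator (?B i \<inter> ?D i) \<omega> \<partial>P z)"
      by (rule nn_integral_cmult_indicator[symmetric, OF sets_F_P[OF BD]])
    also have "\<dots> \<le> (\<integral>\<^sup>+\<omega>. indicator (?B i \<inter> ?D i) \<omega> * pr (X (\<tau> i) \<omega>) (A i) \<partial>P z)"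
      using a(1)[OF i] by (intro nn_integral_mono) (auto split: split_indicator)
    also have "\<dots> = emeasure (P z) ((?B i \<inter> ?D i) \<inter> ?G i)" by (rule markov_event[OF BD A, symmetric])
    also have "\<dots> \<le> emeasure (P z) (?B i \<inter> ?G i)" by (intro emeasure_mono sets.Int BP GP) (use i in auto)
    finally show ?thesis using a(2) by (simp add: emeasure_eq_measure ennreal_mult'[symmetric])
  qed
  have 2: "c - measure (P z) ?U \<le> measure (P z) (?B i \<inter> ?D i)" if i: "i < N" for i
  proof -
    have "c \<le> measure (P z) (?D i)" using c[OF i] by (simp add: emeasure_eq_measure)
    also have "\<dots> \<le> measure (P z) ((?B i \<inter> ?D i) \<union> ?U)"
      using i by (intro finite_measure_mono sets.Un sets.Int BP DP UP) auto
    also have "\<dots> \<le> measure (P z) (?B i \<inter> ?D i) + measure (P z) ?U"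
      by (intro measure_Un_le sets.Int BP DP UP i)
    finally show ?thesis by simp
  qed
  have "(\<Sum>i<N. a i) * (c - measure (P z) ?U) = (\<Sum>i<N. a i * (c - measure (P z) ?U))" by (rule sum_distrib_right)
  also have "\<dots> \<le> (\<Sum>i<N. measure (P z) (?B i \<inter> ?G i))"
  proof (rule sum_mono)
    fix i assume "i \<in> {..<N}"
    then have i: "i < N" by simp
    have "a i * (c - measure (P z) ?U) \<le> a i * measure (P z) (?B i \<inter> ?D i)" using a(2) 2[OF i] by (intro mult_left_mono)
    also note 1[OF i]
    finally show "a i * (c - measure (P z) ?U) \<le> measure (P z) (?B i \<inter> ?G i)" .
  qed
  also have "\<dots> = measure (P z) (\<Union>i<N. ?B i \<inter> ?G i)"
  proof (rule finite_measure_finite_Union[symmetric])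
    show "disjoint_family_on (\<lambda>i. ?B i \<inter> ?G i) {..<N}"
      unfolding disjoint_family_on_def
    proof (intro ballI impI)
      fix i k :: nat assume "i \<noteq> k"
      then have "i < k \<or> k < i" by linarith
      then show "(?B i \<inter> ?G i) \<inter> (?B k \<inter> ?G k) = {}" by blast
    qed
  qed (use sets.Int[OF BP GP] in auto)
  also have "\<dots> \<le> 1" by simp
  finally show ?thesis .
qed

end

section \<open>Successive trials on sparse scales\<close>

context diffusive_process
begin

text \<open>Write \<open>t = \<Phi> v\<close>. The near-diagonal bound on
  \<open>ball x (v / \<eta>)\<close> has exactly this time and leads from \<open>z\<close> into
  \<open>ball x (\<eta> * v)\<close>, which lies in the target because \<open>t \<le> U0 r\<close>
  means \<open>v \<le> r / \<eta> ^ 3\<close>. The threshold \<open>t0\<close> does not depend on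
  \<open>r\<close>.\<close>

lemma hit_lower_bound:
  obtains t0 where "\<And>t r. t0 \<le> t \<Longrightarrow> 0 < r \<Longrightarrow> t \<le> U0 r \<Longrightarrow>
    ennreal c5 \<le> emeasure (P (Some z)) {\<omega>\<in>\<Omega>. X (ennreal t) \<omega> \<in> Some ` ball x (r / \<eta>\<^sup>2)}"
proof -
  \<comment> \<open>For \<open>v \<ge> a\<close> the radius \<open>\<eta> * v\<close> exceeds both
    the validity threshold at \<open>x\<close> and the distance from \<open>x\<close> to
    \<open>z\<close>.\<close>
  define a where "a = (R * dd x0 x powr \<upsilon> + dist x z + 1) / \<eta>"
  have Rd: "0 \<le> R * dd x0 x powr \<upsilon>" using R by simp
  then have a0: "0 < a" using eta by (simp add: a_def add_nonneg_pos)
  show thesis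
  proof (rule that[of "\<Phi> a"])
    fix t r assume t: "\<Phi> a \<le> t" "t \<le> U0 r" and r: "0 < r"
    obtain v where v: "a \<le> v" "\<Phi> v = t" using Phi_surj[OF a0 t(1)] by metis
    have v0: "0 < v" using v a0 by linarith
    have "R * dd x0 x powr \<upsilon> + dist x z + 1 \<le> \<eta> * v" using v(1) eta by (simp add: a_def field_simps)
    then have big: "R * dd x0 x powr \<upsilon> < \<eta> * v" "dist x z < \<eta> * v" using Rd zero_le_dist[of x z] by linarith+
    have "0 < r / \<eta>^3" using r eta by simp
    then have "v \<le> r / \<eta>^3" using t(2) v(2) Phi_le_iff[OF v0] unfolding U0_def by blast
    then have vr: "\<eta> * v \<le> r / \<eta>\<^sup>2" using eta r by (simp add: field_simps power2_eq_square power3_eq_cube)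
    have e: "\<eta>\<^sup>2 * (v / \<eta>) = \<eta> * v" "\<eta> * (v / \<eta>) = v" using eta by (auto simp: power2_eq_square)
    let ?E = "{\<omega>\<in>\<Omega>. X (ennreal t) \<omega> \<in> Some ` ball x (r / \<eta>\<^sup>2)}"
    show "ennreal c5 \<le> emeasure (P (Some z)) ?E"
    proof (rule ndl_ball_event[where r="v / \<eta>" and s="\<eta> * v" and x=x])
      show "R * dd x0 x powr \<upsilon> < \<eta> * v" by fact
      show "\<eta> * v \<le> \<eta>\<^sup>2 * (v / \<eta>)" unfolding e by simp
      have "\<eta> ^ 6 \<le> \<eta> ^ 2" using eta by (intro power_decreasing) auto
      then have "\<eta> ^ 6 * 1 \<le> \<eta> ^ 2 * l" using l eta by (intro mult_mono) auto
      then have "v * (\<eta> ^ 6 * 1) \<le> v * (\<eta> ^ 2 * l)" using v0 by (intro mult_left_mono) auto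
      then show "v / \<eta> \<le> \<eta> * v * (l / \<eta> ^ 6)" using eta by (simp add: field_simps power2_eq_square)
      show "z \<in> ball x (\<eta>\<^sup>2 * (v / \<eta>))" unfolding e using big by simp
      show "?E \<in> sets (P (Some z))" by (rule X_event[OF ball_cem])
      fix \<omega> assume "\<omega> \<in> \<Omega>" "X (ennreal (\<Phi> (\<eta> * (v / \<eta>)))) \<omega> \<in> Some ` ball x (\<eta> * v)"
      then show "\<omega> \<in> ?E" using vr unfolding e v(2) by auto
    qed
  qed
qed

text \<open>Over \<open>k + 1\<close> indices the time unit grows exponentially in \<open>k\<close>,
  whereas \<open>gg / U0\<close> at index \<open>n\<close> is of order \<open>ln n\<close>, hence at
  most linear in \<open>k\<close> for \<open>n \<le> 2 ^ (2 * k + 2)\<close>. The lower bound on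
  \<open>n\<close> only ensures that \<open>n\<close> is large.\<close>

lemma gap_condition:
  assumes q: "1 < q" and k: "0 < \<kappa>"
  shows "\<forall>\<^sub>F k in sequentially. \<forall>n. 2 ^ k \<le> n + k + 1 \<longrightarrow> n \<le> 2 ^ (2 * k + 2) \<longrightarrow>
     2 * \<kappa> * gg (q ^ n) \<le> U0 (q ^ (n + k + 1))"
proof -
  obtain m0 where m0: "1 \<le> m0" "\<And>n k. R < q ^ n \<Longrightarrow> 2 ^ k * U0 (q ^ n) \<le> U0 (q ^ (n + m0 * k))"
    using U0_growth[OF q] by blast
  obtain \<alpha> A r1 where al: "0 < \<alpha>" "\<alpha> \<le> A" "0 < r1" and gl: "\<And>r. r1 \<le> r \<Longrightarrow> \<alpha> * ll r * U0 r \<le> gg r"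
    and gu: "\<And>r. r1 \<le> r \<Longrightarrow> gg r \<le> A * ll r * U0 r" and l1: "\<And>r. r1 \<le> r \<Longrightarrow> 1 \<le> ll r"
    using gg_U0_bounds by blast
  obtain cq Cq where cq: "0 < cq" and lnphi: "\<forall>\<^sub>F n in sequentially. cq * real n \<le> ln (\<phi> (q ^ n)) \<and> ln (\<phi> (q ^ n)) \<le> Cq * real n"
    using ln_phi_bounds[OF q] by blast
  note qlim = filterlim_power_at_top[OF q]
  have "\<forall>\<^sub>F n in sequentially. max r1 (R + 1) \<le> q ^ n" by (rule eventually_ge_of_at_top[OF qlim])
  with lnphi eventually_ge_at_top[of 1]
  have "\<forall>\<^sub>F n in sequentially. cq * real n \<le> ln (\<phi> (q ^ n)) \<and> ln (\<phi> (q ^ n)) \<le> Cq * real n \<and> 1 \<le> n \<and> max r1 (R + 1) \<le> q ^ n"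
    by eventually_elim simp
  then obtain n1 where n1: "\<And>n. n1 \<le> n \<Longrightarrow> cq * real n \<le> ln (\<phi> (q ^ n)) \<and> ln (\<phi> (q ^ n)) \<le> Cq * real n \<and> 1 \<le> n \<and> max r1 (R + 1) \<le> q ^ n"
    by (auto simp: eventually_sequentially)
  have Cq: "0 < Cq"
  proof -
    have "0 < cq * real (max n1 1)" using cq by simp
    also have "\<dots> \<le> Cq * real (max n1 1)" using n1[of "max n1 1"] by linarith
    finally show ?thesis by (simp add: zero_less_mult_iff)
  qed
  define s where "s = ln 2 / real m0"
  have s: "0 < s" using m0(1) by (simp add: s_def)
  \<comment> \<open>The factor \<open>2 * \<kappa>\<close> of the claim, the constant
    \<open>A\<close> of \<open>gu\<close>, and another \<open>2\<close> for rounding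
    \<open>(k + 1) / m0\<close> down.\<close>
  define B where "B = 4 * \<kappa> * A"
  have lim: "(\<lambda>k. B * ((\<bar>ln Cq\<bar> + 2 * ln 2) * exp (- s * real k) + 2 * ln 2 * (real k * exp (- s * real k)))) \<longlonglongrightarrow> B * ((\<bar>ln Cq\<bar> + 2 * ln 2) * 0 + 2 * ln 2 * 0)"
  proof (intro tendsto_intros)
    show "(\<lambda>k. exp (- s * real k)) \<longlonglongrightarrow> 0" using s by real_asymp
    show "(\<lambda>k. real k * exp (- s * real k)) \<longlonglongrightarrow> 0" using s by real_asymp
  qed
  have e1: "\<forall>\<^sub>F k in sequentially. B * ((\<bar>ln Cq\<bar> + 2 * ln 2) * exp (- s * real k) + 2 * ln 2 * (real k * exp (- s * real k))) < 1"
    by (rule order_tendstoD(2)[OF lim]) simp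
  have "filterlim (\<lambda>k. (2::real) ^ k - real k - 1) at_top sequentially" by real_asymp
  then have e2: "\<forall>\<^sub>F k in sequentially. real n1 \<le> 2 ^ k - real k - 1" by (rule eventually_ge_of_at_top)
  show ?thesis
    using e1 e2
  proof eventually_elim
    case (elim k)
    show ?case
    proof (intro allI impI)
      fix n :: nat assume n: "2 ^ k \<le> n + k + 1" "n \<le> 2 ^ (2 * k + 2)"
      have "real (2 ^ k) \<le> real (n + k + 1)" using n(1) by (simp only: of_nat_le_iff)
      then have "real n1 \<le> real n" using elim(2) by simp
      then have nn: "n1 \<le> n" by simp
      note N = n1[OF nn]
      have q0: "0 < q ^ n" using q by simp
      have u: "0 < U0 (q ^ n)" by (rule U0_pos[OF q0])
      have n0: "0 < real n" using N by simp
      have "0 < ln (\<phi> (q ^ n))" using N cq n0 by (smt (verit) mult_pos_pos)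
      then have "ll (q ^ n) \<le> ln (Cq * real n)" unfolding ll_def using N by (intro ln_mono) auto
      also have "\<dots> = ln Cq + ln (real n)" using Cq n0 by (rule ln_mult_pos)
      also have "ln (real n) \<le> ln (real (2 ^ (2 * k + 2)))" using n(2) n0 by (intro ln_mono) (auto simp only: of_nat_le_iff of_nat_0_less_iff)
      also have "ln (real (2 ^ (2 * k + 2))) = real (2 * k + 2) * ln 2" by (simp only: of_nat_power of_nat_numeral ln_realpow zero_less_numeral)
      finally have lb: "ll (q ^ n) \<le> \<bar>ln Cq\<bar> + 2 * ln 2 + 2 * ln 2 * real k" by (simp add: algebra_simps)
      define i where "i = (k + 1) div m0"
      have i1: "real k / real m0 - 1 \<le> real i"
      proof -
        have "k + 1 < m0 * (i + 1)" using m0(1) unfolding i_def by (metis dividend_less_times_div add.commute mult.commute add_mult_distrib2 mult.right_neutral less_le_trans zero_less_one)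
        then have "real (k + 1) < real (m0 * (i + 1))" by (simp only: of_nat_less_iff)
        then have "real k < real m0 * (real i + 1)" by (simp add: algebra_simps)
        then show ?thesis using m0(1) by (simp add: field_simps)
      qed
      have "exp (s * real k) = 2 * exp (ln 2 * (real k / real m0 - 1))"
        by (simp add: s_def algebra_simps exp_diff)
      also have "\<dots> \<le> 2 * exp (ln 2 * real i)" using i1 by simp
      also have "exp (ln 2 * real i) = 2 ^ i" by (simp add: exp_of_nat2_mult)
      finally have ei: "exp (s * real k) \<le> 2 * 2 ^ i" .
      have "4 * \<kappa> * A * ll (q ^ n) \<le> B * (\<bar>ln Cq\<bar> + 2 * ln 2 + 2 * ln 2 * real k)"
        unfolding B_def using lb k al by (intro mult_left_mono) auto
      also have "\<dots> = B * ((\<bar>ln Cq\<bar> + 2 * ln 2) * exp (- s * real k) + 2 * ln 2 * (real k * exp (- s * real k))) * exp (s * real k)"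
        by (simp add: algebra_simps flip: exp_add)
      also have "\<dots> \<le> 1 * exp (s * real k)" using elim(1) by (intro mult_right_mono) auto
      also have "\<dots> \<le> 2 * 2 ^ i" using ei by simp
      finally have f: "2 * \<kappa> * (A * ll (q ^ n)) \<le> 2 ^ i" by (simp add: mult_ac)
      have "2 * \<kappa> * gg (q ^ n) \<le> 2 * \<kappa> * (A * ll (q ^ n) * U0 (q ^ n))"
        using gu[of "q ^ n"] N k by (intro mult_left_mono) auto
      also have "\<dots> = 2 * \<kappa> * (A * ll (q ^ n)) * U0 (q ^ n)" by simp
      also have "\<dots> \<le> 2 ^ i * U0 (q ^ n)" using f u by (intro mult_right_mono) auto
      also have "\<dots> \<le> U0 (q ^ (n + m0 * i))" using N by (intro m0) auto
      also have "\<dots> \<le> U0 (q ^ (n + k + 1))"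
      proof (rule U0_mono)
        have "m0 * i \<le> k + 1" unfolding i_def by simp
        then show "q ^ (n + m0 * i) \<le> q ^ (n + k + 1)" using q by (intro power_increasing) auto
      qed (use q in simp)
      finally show "2 * \<kappa> * gg (q ^ n) \<le> U0 (q ^ (n + k + 1))" .
    qed
  qed
qed

end

lemma divide_less_ennreal_real:
  assumes "0 < g" "0 \<le> c"
  shows "a / ennreal g < ennreal c \<longleftrightarrow> a < ennreal (c * g)"
  using assms divide_less_ennreal[of "ennreal g" a "ennreal c"] by (simp add: ennreal_mult)

lemma divide_le_ennreal_real:
  assumes "0 < g" "0 \<le> c" "a \<le> ennreal (c * g)"
  shows "a / ennreal g \<le> ennreal c"
proof -
  have "a / ennreal g \<le> ennreal (c * g) / ennreal g" by (rule divide_right_mono_ennreal[OF assms(3)])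
  also have "\<dots> = ennreal c" using assms by (simp add: divide_ennreal)
  finally show ?thesis .
qed

context diffusive_process
begin

lemma gg_at_top: "filterlim gg at_top at_top"
proof (rule filterlim_at_top_mono[OF phi_at_top])
  have "\<forall>\<^sub>F r in at_top. 0 \<le> \<phi> r" by (rule eventually_ge_of_at_top[OF phi_at_top])
  moreover have "\<forall>\<^sub>F r in at_top. 1 \<le> ll r" by (rule eventually_ge_of_at_top[OF ll_at_top])
  ultimately show "\<forall>\<^sub>F r in at_top. \<phi> r \<le> gg r"
    by eventually_elim (simp add: gg_def mult_le_cancel_left1)
qed

text \<open>Trials are run one after the other on sparse scales. Each finds the process in the right
  ball with probability at least \<open>c5\<close> and then has conditional success probability at
  least \<open>a\<close>. The resulting \<open>\<kappa>\<close> is twice that of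
  \<open>tail_comparison\<close>, because time is now counted from \<open>0\<close> and includes the
  waiting time before a trial.\<close>

lemma not_summable_imp_infinitely_often:
  assumes q: "1 < q" and lam: "0 < \<zeta>" "\<zeta> < \<xi>" and ns: "\<not> summable (tail x (Some z) \<xi> q)"
  shows "\<exists>\<kappa>>0. \<not> (AE \<omega> in P (Some z). \<forall>\<^sub>F n in sequentially.
    occ x (q ^ n) (ennreal (\<kappa> * gg (q ^ n))) (path 0 \<omega>) < ennreal (\<zeta> * gg (q ^ n)))"
proof -
  interpret prob_space "P (Some z)" by (rule prob_space_P)
  let ?M = "P (Some z)"
  note qlim = filterlim_power_at_top[OF q]
  obtain \<theta> where th: "0 < \<theta>" and cmp: "\<And>\<zeta> \<xi>. 0 < \<zeta> \<Longrightarrow> \<zeta> < \<xi> \<Longrightarrow> \<exists>\<kappa>\<ge>1. \<exists>K>0. \<forall>x z. \<forall>\<^sub>F n in sequentially. \<exists>a. 0 \<le> a \<and> a \<le> 1 \<and>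
       pr z (\<lambda>p. ennreal (\<xi> * gg (q ^ n)) < occ x (q ^ n) \<infinity> p) \<le> ennreal (a * (K * real n powr (- \<theta> * (\<xi> - \<zeta>)))) \<and>
       (\<forall>y\<in>ball x (q ^ n / \<eta>\<^sup>2). ennreal a \<le>
          pr (Some y) (\<lambda>p. ennreal (\<zeta> * gg (q ^ n)) \<le> occ x (q ^ n) (ennreal (\<kappa> * gg (q ^ n))) p))"
    using tail_comparison[OF q] by blast
  define t where "t = \<theta> * (\<xi> - \<zeta>)"
  have t: "0 < t" using th lam by (simp add: t_def)
  from cmp[OF lam] obtain \<kappa> K where k: "1 \<le> \<kappa>" and K: "0 < K" and "\<forall>x z. \<forall>\<^sub>F n in sequentially. \<exists>a. 0 \<le> a \<and> a \<le> 1 \<and>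
       pr z (\<lambda>p. ennreal (\<xi> * gg (q ^ n)) < occ x (q ^ n) \<infinity> p) \<le> ennreal (a * (K * real n powr (- \<theta> * (\<xi> - \<zeta>)))) \<and>
       (\<forall>y\<in>ball x (q ^ n / \<eta>\<^sup>2). ennreal a \<le>
          pr (Some y) (\<lambda>p. ennreal (\<zeta> * gg (q ^ n)) \<le> occ x (q ^ n) (ennreal (\<kappa> * gg (q ^ n))) p))"
    by (elim exE conjE) (rule that)
  from this(3)[THEN spec[of _ x], THEN spec[of _ "Some z"]] obtain N0 where
    "\<And>n. N0 \<le> n \<Longrightarrow> \<exists>a. 0 \<le> a \<and> a \<le> 1 \<and>
       pr (Some z) (\<lambda>p. ennreal (\<xi> * gg (q ^ n)) < occ x (q ^ n) \<infinity> p) \<le> ennreal (a * (K * real n powr (- \<theta> * (\<xi> - \<zeta>)))) \<and>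
       (\<forall>y\<in>ball x (q ^ n / \<eta>\<^sup>2). ennreal a \<le>
          pr (Some y) (\<lambda>p. ennreal (\<zeta> * gg (q ^ n)) \<le> occ x (q ^ n) (ennreal (\<kappa> * gg (q ^ n))) p))"
    unfolding eventually_sequentially by blast
  then obtain a' where a': "\<And>n. N0 \<le> n \<Longrightarrow> 0 \<le> a' n \<and>
       pr (Some z) (\<lambda>p. ennreal (\<xi> * gg (q ^ n)) < occ x (q ^ n) \<infinity> p) \<le> ennreal (a' n * (K * real n powr (- \<theta> * (\<xi> - \<zeta>)))) \<and>
       (\<forall>y\<in>ball x (q ^ n / \<eta>\<^sup>2). ennreal (a' n) \<le>
          pr (Some y) (\<lambda>p. ennreal (\<zeta> * gg (q ^ n)) \<le> occ x (q ^ n) (ennreal (\<kappa> * gg (q ^ n))) p))"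
    by metis
  define a where "a n = (if N0 \<le> n then a' n else 0)" for n
  have a0: "0 \<le> a n" for n using a'[of n] by (simp add: a_def)
  have ap: "tail x (Some z) \<xi> q n \<le> a n * (K * real n powr (- t))" if "N0 \<le> n" for n
  proof -
    have "ennreal (tail x (Some z) \<xi> q n) \<le> ennreal (a n * (K * real n powr (- t)))"
      using a'[OF that] that by (simp add: ennreal_tail a_def t_def)
    then show ?thesis using a0[of n] K by (subst (asm) ennreal_le_iff) auto
  qed
  have al: "ennreal (a n) \<le> pr (Some y) (\<lambda>p. ennreal (\<zeta> * gg (q ^ n)) \<le> occ x (q ^ n) (ennreal (\<kappa> * gg (q ^ n))) p)"
    if "N0 \<le> n" "y \<in> ball x (q ^ n / \<eta>\<^sup>2)" for n y
    using a'[OF that(1)] that by (simp add: a_def)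
  obtain \<alpha> A r1 where alph: "0 < \<alpha>" "\<alpha> \<le> A" "0 < r1" and gl: "\<And>r. r1 \<le> r \<Longrightarrow> \<alpha> * ll r * U0 r \<le> gg r"
    and l1: "\<And>r. r1 \<le> r \<Longrightarrow> 1 \<le> ll r"
    by (rule gg_U0_bounds) (rule that)
  obtain t0 where hit: "\<And>t r. t0 \<le> t \<Longrightarrow> 0 < r \<Longrightarrow> t \<le> U0 r \<Longrightarrow>
    ennreal c5 \<le> emeasure ?M {\<omega>\<in>\<Omega>. X (ennreal t) \<omega> \<in> Some ` ball x (r / \<eta>\<^sup>2)}"
    by (rule hit_lower_bound[where x=x and z=z]) (rule that)
  have "\<forall>\<^sub>F n in sequentially. max r1 1 \<le> q ^ n" by (rule eventually_ge_of_at_top[OF qlim])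
  moreover have "\<forall>\<^sub>F n in sequentially. 1 / \<alpha> \<le> ll (q ^ n)"
    by (rule eventually_ge_of_at_top[OF filterlim_compose[OF ll_at_top qlim]])
  moreover have "\<forall>\<^sub>F n in sequentially. max 1 t0 \<le> gg (q ^ n)"
    by (rule eventually_ge_of_at_top[OF filterlim_compose[OF gg_at_top qlim]])
  moreover have "\<forall>\<^sub>F n in sequentially. 2 \<le> \<phi> (q ^ n)"
    by (rule eventually_ge_of_at_top[OF filterlim_compose[OF phi_at_top qlim]])
  ultimately have "\<forall>\<^sub>F n in sequentially. max r1 1 \<le> q ^ n \<and> 1 / \<alpha> \<le> ll (q ^ n) \<and> max 1 t0 \<le> gg (q ^ n) \<and> 2 \<le> \<phi> (q ^ n)"
    by eventually_elim blast
  then obtain n2 where n2: "\<And>n. n2 \<le> n \<Longrightarrow> max r1 1 \<le> q ^ n \<and> 1 / \<alpha> \<le> ll (q ^ n) \<and> max 1 t0 \<le> gg (q ^ n) \<and> 2 \<le> \<phi> (q ^ n)"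
    unfolding eventually_sequentially by blast
  have ug: "U0 (q ^ n) \<le> gg (q ^ n)" if "n2 \<le> n" for n
  proof -
    have "1 \<le> \<alpha> * ll (q ^ n)" using n2[OF that] alph by (simp add: field_simps)
    then have "1 * U0 (q ^ n) \<le> \<alpha> * ll (q ^ n) * U0 (q ^ n)" using U0_pos[of "q ^ n"] q by (intro mult_right_mono) auto
    also have "\<dots> \<le> gg (q ^ n)" using n2[OF that] by (intro gl) simp
    finally show ?thesis by simp
  qed
  have gm: "gg (q ^ n) \<le> gg (q ^ n')" if "n2 \<le> n" "n \<le> n'" for n n'
  proof (rule gg_mono(1))
    show "q ^ n \<le> q ^ n'" using q that by (intro power_increasing) auto
    have "0 \<le> 1 / \<alpha>" using alph by simp
    then show "1 \<le> q ^ n" "1 < \<phi> (q ^ n)" "0 \<le> ll (q ^ n)" using n2[OF that(1)] by linarith+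
  qed
  define E where "E n = {\<omega>\<in>\<Omega>. ennreal (\<zeta> * gg (q ^ n)) \<le> occ x (q ^ n) (ennreal (2 * \<kappa> * gg (q ^ n))) (path 0 \<omega>)}" for n
  have E: "E n \<in> sets ?M" for n unfolding E_def
    by (rule event_path[where A="\<lambda>p. ennreal (\<zeta> * gg (q ^ n)) \<le> occ x (q ^ n) (ennreal (2 * \<kappa> * gg (q ^ n))) p"]) measurable
  \<comment> \<open>The bound does not depend on \<open>N\<close>, so it passes to the limsup event
    by continuity from above.\<close>
  have main: "c5 / 2 \<le> measure ?M (\<Union>n\<in>{N..}. E n)" for N
  proof -
    have k0: "0 < \<kappa>" using k by simp
    define m where "m = max N (max N0 n2)"
    have m: "N \<le> m" "N0 \<le> m" "n2 \<le> m" unfolding m_def by auto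
    have "filterlim (\<lambda>k. (2::real) ^ k - real k - 1) at_top sequentially" by real_asymp
    then have "\<forall>\<^sub>F k in sequentially. real m \<le> 2 ^ k - real k - 1" by (rule eventually_ge_of_at_top)
    with gap_condition[OF q k0]
    have "\<forall>\<^sub>F k in sequentially. (\<forall>n. 2 ^ k \<le> n + k + 1 \<longrightarrow> n \<le> 2 ^ (2 * k + 2) \<longrightarrow>
     2 * \<kappa> * gg (q ^ n) \<le> U0 (q ^ (n + k + 1))) \<and> real m \<le> 2 ^ k - real k - 1"
      by eventually_elim blast
    then obtain k1 where k1: "\<And>k n. k1 \<le> k \<Longrightarrow> 2 ^ k \<le> n + k + 1 \<Longrightarrow> n \<le> 2 ^ (2 * k + 2) \<Longrightarrow>
     2 * \<kappa> * gg (q ^ n) \<le> U0 (q ^ (n + k + 1))" "\<And>k. k1 \<le> k \<Longrightarrow> real m \<le> 2 ^ k - real k - 1"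
      unfolding eventually_sequentially by blast
    \<comment> \<open>Beyond this threshold for the sum of the success probabilities,
      \<open>union_lower_bound\<close> forces the union to have probability at least
      \<open>c5 / 2\<close>.\<close>
    have c50: "0 \<le> 2 / c5" using c5 by simp
    have "\<exists>k\<ge>k1. \<exists>i\<le>k. 2 / c5 < (\<Sum>j<2 ^ k. a (2 ^ k + i + (k + 1) * j))"
      by (rule ex_large_residue_class[where ?N0.0=N0, OF tail_nonneg ns a0 K t _ c50]) (rule ap)
    then
    obtain k i where ki: "k1 \<le> k" "i \<le> k" and big: "2 / c5 < (\<Sum>j<2 ^ k. a (2 ^ k + i + (k + 1) * j))"
      by (elim exE conjE) (rule that)
    have kk: "m + (k + 1) \<le> 2 ^ k"
    proof (subst of_nat_le_iff[symmetric, where 'a=real])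
      have "real m + (real k + 1) \<le> 2 ^ k" using k1(2)[OF ki(1)] by linarith
      then show "real (m + (k + 1)) \<le> real (2 ^ k)"
        by (simp only: of_nat_add of_nat_power of_nat_1 of_nat_numeral)
    qed
    \<comment> \<open>Shifted back by one gap: \<open>f (Suc j)\<close> is the member number
      \<open>j\<close> of the residue class, while \<open>f j\<close> is the preceding scale, whose
      time budget determines when trial \<open>j\<close> starts.\<close>
    define f where "f j = 2 ^ k + i + (k + 1) * j - (k + 1)" for j
    have fn: "f j + k + 1 = 2 ^ k + i + (k + 1) * j" for j using kk unfolding f_def mult_Suc_right by linarith
    have fS: "f (Suc j) = f j + k + 1" for j using kk unfolding f_def mult_Suc_right by linarith
    have "m \<le> f j" for j using kk unfolding f_def by linarith
    then have fN: "N \<le> f j" "N0 \<le> f j" "n2 \<le> f j" for j using m by (blast intro: order_trans)+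
    have f_le: "f j \<le> 2 ^ (2 * k + 2)" if "j < 2 ^ k" for j
    proof -
      have "f j \<le> 2 ^ k + k + (k + 1) * 2 ^ k" using mult_le_mono2[OF less_imp_le[OF that], of "k + 1"] ki(2) fn[of j] by linarith
      also have "\<dots> \<le> 2 ^ k * 2 ^ k + 2 ^ k * 2 ^ k + 2 ^ k * 2 ^ k"
      proof (intro add_mono mult_le_mono1)
        have e: "k + 1 \<le> 2 ^ k" by (simp add: Suc_le_eq less_exp)
        then show "k + 1 \<le> 2 ^ k" .
        show "(2::nat) ^ k \<le> 2 ^ k * 2 ^ k" by simp
        then show "k \<le> 2 ^ k * 2 ^ k" using e by linarith
      qed
      also have "\<dots> \<le> 2 ^ (2 * k + 2)" by (simp add: power_add mult_2)
      finally show ?thesis .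
    qed
    have gap: "2 * \<kappa> * gg (q ^ f j) \<le> U0 (q ^ f (Suc j))" if "j < 2 ^ k" for j
    proof -
      have "2 ^ k \<le> f j + k + 1" unfolding fn by simp
      from k1(1)[OF ki(1) this f_le[OF that]] show ?thesis by (simp only: fS)
    qed
    \<comment> \<open>Trial \<open>j\<close> starts at \<open>\<tau> j\<close>, takes time
      \<open>\<kappa> * gg\<close> on scale \<open>f (Suc j)\<close> and ends by
      \<open>\<tau> (Suc j)\<close>; half of the budget \<open>2 * \<kappa> * gg\<close> of that
      scale covers the start time.\<close>
    define \<tau> where "\<tau> j = ennreal (2 * \<kappa> * gg (q ^ f j))" for j
    let ?A = "\<lambda>j p. ennreal (\<zeta> * gg (q ^ f (Suc j))) \<le> occ x (q ^ f (Suc j)) (ennreal (\<kappa> * gg (q ^ f (Suc j)))) p"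
    let ?G = "\<lambda>j. {\<omega>\<in>\<Omega>. ?A j (path (\<tau> j) \<omega>)}"
    have gpos: "0 \<le> gg (q ^ f j)" for j using n2[OF fN(3)[of j]] by simp
    have step: "\<tau> j + ennreal (\<kappa> * gg (q ^ f (Suc j))) \<le> \<tau> (Suc j)" if "j < 2 ^ k" for j
    proof -
      have "2 * \<kappa> * gg (q ^ f j) \<le> 1 * gg (q ^ f (Suc j))" using gap[OF that] ug[OF fN(3)[of "Suc j"]] by simp
      also have "\<dots> \<le> \<kappa> * gg (q ^ f (Suc j))" using k gpos by (intro mult_right_mono)
      finally have s: "2 * \<kappa> * gg (q ^ f j) + \<kappa> * gg (q ^ f (Suc j)) \<le> 2 * \<kappa> * gg (q ^ f (Suc j))" by linarith
      have "\<tau> j + ennreal (\<kappa> * gg (q ^ f (Suc j))) = ennreal (2 * \<kappa> * gg (q ^ f j) + \<kappa> * gg (q ^ f (Suc j)))"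
        unfolding \<tau>_def using k gpos[of j] gpos[of "Suc j"] by (intro ennreal_plus[symmetric]) auto
      also have "\<dots> \<le> \<tau> (Suc j)" unfolding \<tau>_def by (rule ennreal_leI[OF s])
      finally show ?thesis .
    qed
    have inc: "incseq \<tau>"
    proof (rule incseq_SucI)
      fix j
      have "gg (q ^ f j) \<le> gg (q ^ f (Suc j))" using fN(3) by (intro gm) (auto simp: fS)
      then show "\<tau> j \<le> \<tau> (Suc j)" unfolding \<tau>_def using k by (intro ennreal_leI mult_left_mono) auto
    qed
    have mA: "Measurable.pred path_space (?A j)" for j by measurable
    have "(\<Sum>j<2 ^ k. a (f (Suc j))) * (c5 - measure ?M (\<Union>j<2 ^ k. ?G j)) \<le> 1"
    proof (rule union_lower_bound[OF inc mA, where x=x and \<rho>="\<lambda>j. q ^ f (Suc j) / \<eta>\<^sup>2"])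
      fix j :: nat assume j: "j < 2 ^ k"
      have "(\<lambda>\<omega>. occ x (q ^ f (Suc j)) (ennreal (\<kappa> * gg (q ^ f (Suc j)))) (path (\<tau> j) \<omega>)) \<in> borel_measurable (F (\<tau> (Suc j)))"
        by (rule measurable_F_mono[OF step[OF j] measurable_occ_path_F])
      then have "{\<omega>\<in>space (F (\<tau> (Suc j))). ?A j (path (\<tau> j) \<omega>)} \<in> sets (F (\<tau> (Suc j)))" by measurable
      then show "?G j \<in> sets (F (\<tau> (Suc j)))" by (simp add: space_F)
      show "ennreal (a (f (Suc j))) \<le> pr (Some y) (?A j)" if "y \<in> ball x (q ^ f (Suc j) / \<eta>\<^sup>2)" for y
        by (rule al[OF fN(2) that])
      have "t0 \<le> gg (q ^ f j)" using n2[OF fN(3)[of j]] by simp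
      also have "\<dots> \<le> 2 * \<kappa> * gg (q ^ f j)" using k gpos[of j] by (simp add: mult_le_cancel_right1)
      finally show "ennreal c5 \<le> emeasure ?M {\<omega>\<in>\<Omega>. X (\<tau> j) \<omega> \<in> Some ` ball x (q ^ f (Suc j) / \<eta>\<^sup>2)}"
        unfolding \<tau>_def using q gap[OF j] by (intro hit) auto
    qed (rule a0)
    moreover have "(\<Sum>j<2 ^ k. a (f (Suc j))) = (\<Sum>j<2 ^ k. a (2 ^ k + i + (k + 1) * j))"
      by (simp only: fS fn)
    ultimately have le: "(\<Sum>j<2 ^ k. a (2 ^ k + i + (k + 1) * j)) * (c5 - measure ?M (\<Union>j<2 ^ k. ?G j)) \<le> 1" by simp
    have "c5 / 2 \<le> measure ?M (\<Union>j<2 ^ k. ?G j)"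
    proof (rule ccontr)
      assume "\<not> ?thesis"
      then have c: "c5 / 2 < c5 - measure ?M (\<Union>j<2 ^ k. ?G j)" by simp
      have "1 = 2 / c5 * (c5 / 2)" using c5 by simp
      also have "\<dots> < (\<Sum>j<2 ^ k. a (2 ^ k + i + (k + 1) * j)) * (c5 - measure ?M (\<Union>j<2 ^ k. ?G j))"
        using c5 by (intro mult_strict_mono[OF big c] order.strict_trans[OF _ big, of 0]) simp_all
      finally show False using le by simp
    qed
    also have "\<dots> \<le> measure ?M (\<Union>n\<in>{N..}. E n)"
    proof (rule finite_measure_mono)
      show "(\<Union>n\<in>{N..}. E n) \<in> sets ?M" by (intro sets.countable_UN'' E) auto
      show "(\<Union>j<2 ^ k. ?G j) \<subseteq> (\<Union>n\<in>{N..}. E n)"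
      proof
        fix \<omega> assume "\<omega> \<in> (\<Union>j<2 ^ k. ?G j)"
        then obtain j where j: "j < 2 ^ k" and w: "\<omega> \<in> \<Omega>" and A: "?A j (path (\<tau> j) \<omega>)" by blast
        have nn: "0 \<le> 2 * \<kappa> * gg (q ^ f j)" using k gpos[of j] by simp
        have "occ x (q ^ f (Suc j)) (ennreal (\<kappa> * gg (q ^ f (Suc j)))) (path (\<tau> j) \<omega>)
           \<le> occ x (q ^ f (Suc j)) (\<tau> j + ennreal (\<kappa> * gg (q ^ f (Suc j)))) (path 0 \<omega>)"
          using occ_split[OF w nn, of x "q ^ f (Suc j)" "ennreal (\<kappa> * gg (q ^ f (Suc j)))" 0]
          unfolding \<tau>_def by simp
        also have "\<dots> \<le> occ x (q ^ f (Suc j)) (\<tau> (Suc j)) (path 0 \<omega>)" by (rule occ_mono[OF w step[OF j] order_refl])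
        finally have "\<omega> \<in> E (f (Suc j))" using A w unfolding E_def \<tau>_def by simp
        then show "\<omega> \<in> (\<Union>n\<in>{N..}. E n)" using fN(1) by blast
      qed
    qed
    finally show ?thesis .
  qed
  have "\<not> (AE \<omega> in ?M. \<forall>\<^sub>F n in sequentially.
    occ x (q ^ n) (ennreal (2 * \<kappa> * gg (q ^ n))) (path 0 \<omega>) < ennreal (\<zeta> * gg (q ^ n)))"
  proof
    assume ae: "AE \<omega> in ?M. \<forall>\<^sub>F n in sequentially.
      occ x (q ^ n) (ennreal (2 * \<kappa> * gg (q ^ n))) (path 0 \<omega>) < ennreal (\<zeta> * gg (q ^ n))"
    let ?H = "\<lambda>N. \<Union>n\<in>{N..}. E n"
    have H: "?H N \<in> sets ?M" for N by (intro sets.countable_UN'' E) auto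
    have "AE \<omega> in ?M. \<omega> \<notin> (\<Inter>N. ?H N)"
      using ae
    proof eventually_elim
      case (elim \<omega>)
      then obtain N where "\<And>n. N \<le> n \<Longrightarrow> occ x (q ^ n) (ennreal (2 * \<kappa> * gg (q ^ n))) (path 0 \<omega>) < ennreal (\<zeta> * gg (q ^ n))"
        unfolding eventually_sequentially by blast
      then have "\<omega> \<notin> ?H N" unfolding E_def by (auto simp: not_le)
      then show ?case by blast
    qed
    then have "measure ?M (\<Inter>N. ?H N) = 0"
      using H by (subst prob_eq_0) (auto intro: sets.countable_INT)
    moreover have "(\<lambda>N. measure ?M (?H N)) \<longlonglongrightarrow> measure ?M (\<Inter>N. ?H N)"
    proof (rule finite_Lim_measure_decseq)
      show "range ?H \<subseteq> sets ?M" using H by blast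
      show "decseq ?H" unfolding decseq_def by (intro allI impI UN_mono) auto
    qed
    ultimately have "c5 / 2 \<le> 0" using main by (intro LIMSEQ_le_const) auto
    with c5 show False by simp
  qed
  moreover have "0 < 2 * \<kappa>" using k by simp
  ultimately show ?thesis by blast
qed

text \<open>For \<open>q ^ (n - 1) \<le> r < q ^ n\<close> the larger ball bounds the occupation,
  and \<open>gg (q ^ n) \<le> gg (q * r)\<close> costs only the factor
  \<open>1 + \<epsilon>\<close>.\<close>

lemma ev_occ_le_continuous:
  assumes q: "1 < q" and \<zeta>: "0 \<le> \<zeta>" and quot: "\<forall>\<^sub>F r in at_top. gg (q * r) \<le> (1 + \<epsilon>) * gg r"
    and w: "\<omega> \<in> \<Omega>" and ev: "\<forall>\<^sub>F n in sequentially. occ x (q ^ n) \<infinity> (path 0 \<omega>) \<le> ennreal (\<zeta> * gg (q ^ n))"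
  shows "\<forall>\<^sub>F r in at_top. occ x r \<infinity> (path 0 \<omega>) \<le> ennreal (\<zeta> * (1 + \<epsilon>) * gg r)"
proof -
  note qlim = filterlim_power_at_top[OF q]
  obtain N where N: "\<And>n. N \<le> n \<Longrightarrow> occ x (q ^ n) \<infinity> (path 0 \<omega>) \<le> ennreal (\<zeta> * gg (q ^ n))"
    using ev unfolding eventually_sequentially by blast
  have "\<forall>\<^sub>F r in at_top. 2 \<le> \<phi> r" by (rule eventually_ge_of_at_top[OF phi_at_top])
  moreover have "\<forall>\<^sub>F r in at_top. 0 \<le> ll r" by (rule eventually_ge_of_at_top[OF ll_at_top])
  ultimately have "\<forall>\<^sub>F r in at_top. 2 \<le> \<phi> r \<and> 0 \<le> ll r" by eventually_elim simp
  then obtain r2 where r2: "\<And>r. r2 \<le> r \<Longrightarrow> 2 \<le> \<phi> r \<and> 0 \<le> ll r" unfolding eventually_at_top_linorder by blast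
  show ?thesis
    using quot eventually_ge_at_top[of "q ^ N"] eventually_ge_at_top[of "max 1 r2"]
  proof eventually_elim
    case (elim r)
    obtain m where m: "r < q ^ m" using real_arch_pow[OF q] by blast
    define n where "n = (LEAST m. r < q ^ m)"
    have n: "r < q ^ n" unfolding n_def using m by (rule LeastI)
    have "q ^ (n - 1) \<le> r"
    proof (cases n)
      case 0 then show ?thesis using n elim by simp
    next
      case (Suc i)
      have "\<not> r < q ^ i" using not_less_Least[of i "\<lambda>m. r < q ^ m"] Suc unfolding n_def by simp
      then show ?thesis using Suc by simp
    qed
    moreover have n1: "n \<noteq> 0" using n elim by (cases n) auto
    ultimately have nq: "q ^ n \<le> q * r" using q by (cases n) auto
    have "N \<le> n"
    proof (rule ccontr)
      assume "\<not> N \<le> n"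
      then have "q ^ n \<le> q ^ N" using q by (intro power_increasing) auto
      with n elim show False by simp
    qed
    have "occ x r \<infinity> (path 0 \<omega>) \<le> occ x (q ^ n) \<infinity> (path 0 \<omega>)" using n by (intro occ_mono[OF w]) auto
    also have "\<dots> \<le> ennreal (\<zeta> * gg (q ^ n))" by (rule N[OF \<open>N \<le> n\<close>])
    also have "\<dots> \<le> ennreal (\<zeta> * (1 + \<epsilon>) * gg r)"
    proof (rule ennreal_leI)
      have "r2 \<le> q ^ n" "1 \<le> q ^ n" using n elim by auto
      then have "gg (q ^ n) \<le> gg (q * r)" using nq r2[of "q ^ n"] by (intro gg_mono) auto
      also note elim(1)
      finally show "\<zeta> * gg (q ^ n) \<le> \<zeta> * (1 + \<epsilon>) * gg r" using \<zeta> by (simp add: mult.assoc mult_left_mono)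
    qed
    finally show ?case .
  qed
qed

section \<open>From geometric scales to the limsup\<close>

lemma eventually_gg_pos: "\<forall>\<^sub>F r in at_top. 0 < gg r"
proof -
  have "\<forall>\<^sub>F r in at_top. 1 \<le> gg r" by (rule eventually_ge_of_at_top[OF gg_at_top])
  then show ?thesis by eventually_elim simp
qed

lemma Limsup_occ_le:
  assumes "0 < \<kappa>" "0 \<le> c" and ev: "\<forall>\<^sub>F r in at_top. occ x r T' (path 0 \<omega>) \<le> ennreal (c * gg r)"
    and w: "\<omega> \<in> \<Omega>" and T: "\<And>r. ennreal (\<kappa> * gg r) \<le> T'"
  shows "Limsup at_top (\<lambda>r. occ x r (ennreal (\<kappa> * gg r)) (path 0 \<omega>) / ennreal (\<kappa> * gg r)) \<le> ennreal (c / \<kappa>)"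
proof (rule Limsup_bounded)
  show "\<forall>\<^sub>F r in at_top. occ x r (ennreal (\<kappa> * gg r)) (path 0 \<omega>) / ennreal (\<kappa> * gg r) \<le> ennreal (c / \<kappa>)"
    using ev eventually_gg_pos
  proof eventually_elim
    case (elim r)
    have "occ x r (ennreal (\<kappa> * gg r)) (path 0 \<omega>) \<le> ennreal (c / \<kappa> * (\<kappa> * gg r))"
      using occ_mono[OF w T order_refl, of x r r 0] elim(1) assms(1) by (auto intro: order_trans)
    then show ?case using elim assms by (intro divide_le_ennreal_real) auto
  qed
qed

text \<open>Boundedness of \<open>\<kappa> * f \<kappa>\<close> follows from
  \<open>summable_tail\<close> at some possibly large level. The sharp upper bound uses
  \<open>not_summable_imp_infinitely_often\<close> for levels just above the supremum, the lower
  bound only monotonicity of occupation in time.\<close>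

lemma occupation_limsup_limit:
  fixes f :: "real \<Rightarrow> real"
  assumes f_range: "\<And>\<kappa>. 0 < \<kappa> \<Longrightarrow> 0 < f \<kappa>"
    and f_limsup: "\<And>x \<kappa> z. 0 < \<kappa> \<Longrightarrow> AE \<omega> in P (Some z).
      Limsup at_top (\<lambda>r. occ x r (ennreal (\<kappa> * gg r)) (path 0 \<omega>) / ennreal (\<kappa> * gg r)) = ennreal (f \<kappa>)"
  shows "\<exists>\<kappa>1>0. ((\<lambda>\<kappa>. \<kappa> * f \<kappa>) \<longlongrightarrow> \<kappa>1) at_top \<and>
    (\<forall>x z. AE \<omega> in P (Some z). Limsup at_top (\<lambda>r. occ x r \<infinity> (path 0 \<omega>) / ennreal (gg r)) = ennreal \<kappa>1)"
proof -
  have lt: "AE \<omega> in P (Some z). \<forall>\<^sub>F r in at_top. occ x r (ennreal (\<kappa> * gg r)) (path 0 \<omega>) < ennreal (c * gg r)"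
    if k: "0 < \<kappa>" and c: "\<kappa> * f \<kappa> < c" for x z \<kappa> c
    using f_limsup[OF k, where x=x and z=z]
  proof eventually_elim
    case (elim \<omega>)
    have c0: "0 < c" using f_range[OF k] k c by (smt (verit) mult_pos_pos)
    have "ennreal (f \<kappa>) < ennreal (c / \<kappa>)" using f_range[OF k] k c by (intro ennreal_lessI) (auto simp: field_simps c0)
    then have "Limsup at_top (\<lambda>r. occ x r (ennreal (\<kappa> * gg r)) (path 0 \<omega>) / ennreal (\<kappa> * gg r)) < ennreal (c / \<kappa>)"
      using elim by simp
    from Limsup_lessD[OF this] eventually_gg_pos show ?case
    proof eventually_elim
      case (elim r)
      then have "occ x r (ennreal (\<kappa> * gg r)) (path 0 \<omega>) < ennreal (c / \<kappa> * (\<kappa> * gg r))"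
        using k c0 by (subst (asm) divide_less_ennreal_real) auto
      then show ?case using k by simp
    qed
  qed
  \<comment> \<open>Inequalities between values of \<open>f\<close> are deterministic, so it
    suffices to read them off at a single sample point at which the almost sure statements
    hold.\<close>
  have ae_ex: "\<exists>\<omega>\<in>\<Omega>. Q \<omega>" if "AE \<omega> in P (Some z). Q \<omega>" for Q z
  proof -
    interpret prob_space "P (Some z)" by (rule prob_space_P)
    have "AE \<omega> in P (Some z). \<omega> \<in> space (P (Some z)) \<and> Q \<omega>" using that AE_space by eventually_elim simp
    from eventually_happens[OF this] show ?thesis by (auto simp: trivial_limit_def ae_filter_eq_bot_iff emeasure_space_1[simplified])
  qed
  have mono: "\<kappa> * f \<kappa> \<le> \<kappa>' * f \<kappa>'" if k: "0 < \<kappa>" "\<kappa> \<le> \<kappa>'" for \<kappa> \<kappa>'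
  proof (rule dense_ge)
    fix c assume c: "\<kappa>' * f \<kappa>' < c"
    have k': "0 < \<kappa>'" using k by simp
    have c0: "0 < c" using f_range[OF k'] k' c by (smt (verit) mult_pos_pos)
    have "AE \<omega> in P (Some x0). (\<forall>\<^sub>F r in at_top. occ x0 r (ennreal (\<kappa>' * gg r)) (path 0 \<omega>) < ennreal (c * gg r)) \<and>
        Limsup at_top (\<lambda>r. occ x0 r (ennreal (\<kappa> * gg r)) (path 0 \<omega>) / ennreal (\<kappa> * gg r)) = ennreal (f \<kappa>)"
      using lt[OF k' c, where x=x0 and z=x0] f_limsup[OF k(1), where x=x0 and z=x0] by eventually_elim simp
    from ae_ex[OF this] obtain \<omega> where w: "\<omega> \<in> \<Omega>"
      and ev: "\<forall>\<^sub>F r in at_top. occ x0 r (ennreal (\<kappa>' * gg r)) (path 0 \<omega>) < ennreal (c * gg r)"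
      and L: "Limsup at_top (\<lambda>r. occ x0 r (ennreal (\<kappa> * gg r)) (path 0 \<omega>) / ennreal (\<kappa> * gg r)) = ennreal (f \<kappa>)"
      by blast
    have "ennreal (f \<kappa>) \<le> ennreal (c / \<kappa>)"
      unfolding L[symmetric]
    proof (rule Limsup_bounded)
      show "\<forall>\<^sub>F r in at_top. occ x0 r (ennreal (\<kappa> * gg r)) (path 0 \<omega>) / ennreal (\<kappa> * gg r) \<le> ennreal (c / \<kappa>)"
        using ev eventually_gg_pos
      proof eventually_elim
        case (elim r)
        have "ennreal (\<kappa> * gg r) \<le> ennreal (\<kappa>' * gg r)" using k elim by (intro ennreal_leI mult_right_mono) auto
        from occ_mono[OF w this order_refl, of x0 r 0] elim(1)
        have "occ x0 r (ennreal (\<kappa> * gg r)) (path 0 \<omega>) \<le> ennreal (c / \<kappa> * (\<kappa> * gg r))"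
          using k by (auto intro: order_trans less_imp_le)
        then show ?case using elim k c0 by (intro divide_le_ennreal_real) auto
      qed
    qed
    then have "f \<kappa> \<le> c / \<kappa>" using c0 k by (subst (asm) ennreal_le_iff) auto
    then show "\<kappa> * f \<kappa> \<le> c" using k by (simp add: field_simps)
  qed
  have Limsup_ge: "ennreal (\<kappa> * f \<kappa>) \<le> Limsup at_top (\<lambda>r. occ x r \<infinity> (path 0 \<omega>) / ennreal (gg r))"
    if k: "0 < \<kappa>" and w: "\<omega> \<in> \<Omega>"
      and L: "Limsup at_top (\<lambda>r. occ x r (ennreal (\<kappa> * gg r)) (path 0 \<omega>) / ennreal (\<kappa> * gg r)) = ennreal (f \<kappa>)" for \<kappa> x \<omega>
  proof (rule ccontr)
    assume "\<not> ?thesis"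
    then have "Limsup at_top (\<lambda>r. occ x r \<infinity> (path 0 \<omega>) / ennreal (gg r)) < ennreal (\<kappa> * f \<kappa>)" by simp
    then obtain s where s: "Limsup at_top (\<lambda>r. occ x r \<infinity> (path 0 \<omega>) / ennreal (gg r)) < s" "s < ennreal (\<kappa> * f \<kappa>)"
      using dense by blast
    then obtain c where c: "s = ennreal c" "0 \<le> c" by (cases s) auto
    have "\<forall>\<^sub>F r in at_top. occ x r \<infinity> (path 0 \<omega>) \<le> ennreal (c * gg r)"
      using Limsup_lessD[OF s(1)] eventually_gg_pos
    proof eventually_elim
      case (elim r)
      then show ?case unfolding c using c(2) by (subst (asm) divide_less_ennreal_real) auto
    qed
    from Limsup_occ_le[OF k c(2) this w] L have "ennreal (f \<kappa>) \<le> ennreal (c / \<kappa>)" by simp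
    then have "f \<kappa> \<le> c / \<kappa>" using c k by (subst (asm) ennreal_le_iff) auto
    then have "ennreal (\<kappa> * f \<kappa>) \<le> ennreal c" using k by (intro ennreal_leI) (simp add: field_simps)
    with s c show False by simp
  qed
  have bdd: "bdd_above ((\<lambda>\<kappa>. \<kappa> * f \<kappa>) ` {0<..})"
  proof -
    obtain q where q: "1 < q" "\<forall>\<^sub>F r in at_top. gg (q * r) \<le> (1 + 1) * gg r"
      using gg_quotient[OF zero_less_one] by blast
    obtain \<zeta> where z: "0 < \<zeta>" "\<And>x z. summable (tail x z \<zeta> q)" using summable_tail[OF q(1)] by blast
    have "\<kappa> * f \<kappa> \<le> \<zeta> * (1 + 1)" if k: "0 < \<kappa>" for \<kappa>
    proof -
      have "AE \<omega> in P (Some x0). (\<forall>\<^sub>F n in sequentially. occ x0 (q ^ n) \<infinity> (path 0 \<omega>) \<le> ennreal (\<zeta> * gg (q ^ n))) \<and>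
        Limsup at_top (\<lambda>r. occ x0 r (ennreal (\<kappa> * gg r)) (path 0 \<omega>) / ennreal (\<kappa> * gg r)) = ennreal (f \<kappa>)"
        using ev_occ_le[OF z(2)[of x0 "Some x0"]] f_limsup[OF k, where x=x0 and z=x0] by eventually_elim simp
      from ae_ex[OF this] obtain \<omega> where w: "\<omega> \<in> \<Omega>"
        and ev: "\<forall>\<^sub>F n in sequentially. occ x0 (q ^ n) \<infinity> (path 0 \<omega>) \<le> ennreal (\<zeta> * gg (q ^ n))"
        and L: "Limsup at_top (\<lambda>r. occ x0 r (ennreal (\<kappa> * gg r)) (path 0 \<omega>) / ennreal (\<kappa> * gg r)) = ennreal (f \<kappa>)"
        by blast
      have z0: "0 \<le> \<zeta> * (1 + 1)" using z by simp
      from ev_occ_le_continuous[OF q(1) less_imp_le[OF z(1)] q(2) w ev]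
      have "ennreal (f \<kappa>) \<le> ennreal (\<zeta> * (1 + 1) / \<kappa>)"
        unfolding L[symmetric] by (rule Limsup_occ_le[OF k z0 _ w]) simp
      then have "f \<kappa> \<le> \<zeta> * (1 + 1) / \<kappa>" using z k by (subst (asm) ennreal_le_iff) auto
      then show ?thesis using k by (simp add: field_simps)
    qed
    then show ?thesis by (intro bdd_aboveI2) auto
  qed
  define \<kappa>1 where "\<kappa>1 = (SUP \<kappa>\<in>{0<..}. \<kappa> * f \<kappa>)"
  have le: "\<kappa> * f \<kappa> \<le> \<kappa>1" if "0 < \<kappa>" for \<kappa>
    unfolding \<kappa>1_def using that by (intro cSUP_upper bdd) simp
  have pos: "0 < \<kappa>1" using le[of 1] f_range[of 1] by simp
  have lim: "((\<lambda>\<kappa>. \<kappa> * f \<kappa>) \<longlongrightarrow> \<kappa>1) at_top"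
  proof (rule order_tendstoI)
    fix a assume "a < \<kappa>1"
    then obtain k where k: "0 < k" "a < k * f k"
      unfolding \<kappa>1_def using less_cSUP_iff[OF _ bdd, of a] by auto
    show "\<forall>\<^sub>F \<kappa> in at_top. a < \<kappa> * f \<kappa>"
      using eventually_ge_at_top[of k] by eventually_elim (use k mono[OF k(1)] in \<open>auto intro: order_less_le_trans\<close>)
  next
    fix a assume a: "\<kappa>1 < a"
    show "\<forall>\<^sub>F \<kappa> in at_top. \<kappa> * f \<kappa> < a"
      using eventually_gt_at_top[of 0]
    proof eventually_elim
      case (elim \<kappa>)
      then show ?case using le[OF elim] a by linarith
    qed
  qed
  have upper: "AE \<omega> in P (Some z). Limsup at_top (\<lambda>r. occ x r \<infinity> (path 0 \<omega>) / ennreal (gg r)) \<le> ennreal ((\<kappa>1 + 2 * e) * (1 + e))"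
    if e: "0 < e" for x z e
  proof -
    obtain q where q: "1 < q" "\<forall>\<^sub>F r in at_top. gg (q * r) \<le> (1 + e) * gg r"
      using gg_quotient[OF e] by blast
    have "summable (tail x (Some z) (\<kappa>1 + 2 * e) q)"
    proof (rule ccontr)
      assume ns: "\<not> ?thesis"
      \<comment> \<open>Two levels above \<open>\<kappa>1\<close> are needed, since the comparison
        of tails requires a strict gap.\<close>
      have l: "0 < \<kappa>1 + e" "\<kappa>1 + e < \<kappa>1 + 2 * e" using pos e by auto
      from not_summable_imp_infinitely_often[OF q(1) l ns] obtain \<kappa> where k: "0 < \<kappa>"
        and n: "\<not> (AE \<omega> in P (Some z). \<forall>\<^sub>F n in sequentially.
          occ x (q ^ n) (ennreal (\<kappa> * gg (q ^ n))) (path 0 \<omega>) < ennreal ((\<kappa>1 + e) * gg (q ^ n)))" by blast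
      have "\<kappa> * f \<kappa> < \<kappa>1 + e" using le[OF k] e by simp
      from lt[OF k this, where x=x and z=z] have "AE \<omega> in P (Some z). \<forall>\<^sub>F n in sequentially.
          occ x (q ^ n) (ennreal (\<kappa> * gg (q ^ n))) (path 0 \<omega>) < ennreal ((\<kappa>1 + e) * gg (q ^ n))"
        by eventually_elim (rule eventually_compose_filterlim[OF _ filterlim_power_at_top[OF q(1)]])
      with n show False ..
    qed
    from ev_occ_le[OF this] AE_space show ?thesis
    proof eventually_elim
      case (elim \<omega>)
      have z0: "0 \<le> \<kappa>1 + 2 * e" using pos e by simp
      from elim have w: "\<omega> \<in> \<Omega>" by simp
      from ev_occ_le_continuous[OF q(1) z0 q(2) w elim(1)]
      have "\<forall>\<^sub>F r in at_top. occ x r \<infinity> (path 0 \<omega>) / ennreal (gg r) \<le> ennreal ((\<kappa>1 + 2 * e) * (1 + e))"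
        using eventually_gg_pos
      proof eventually_elim
        case (elim r)
        then show ?case using z0 e by (intro divide_le_ennreal_real) auto
      qed
      then show ?case by (rule Limsup_bounded)
    qed
  qed
  have "AE \<omega> in P (Some z). Limsup at_top (\<lambda>r. occ x r \<infinity> (path 0 \<omega>) / ennreal (gg r)) = ennreal \<kappa>1" for x z
  proof -
    \<comment> \<open>Countably many margins \<open>1 / real (Suc n)\<close> and times
      \<open>real (Suc n)\<close> suffice, so that one null set serves for all of them.\<close>
    have "AE \<omega> in P (Some z). \<forall>n::nat. Limsup at_top (\<lambda>r. occ x r \<infinity> (path 0 \<omega>) / ennreal (gg r))
        \<le> ennreal ((\<kappa>1 + 2 * (1 / real (Suc n))) * (1 + 1 / real (Suc n)))"
      unfolding AE_all_countable by (intro allI upper) simp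
    moreover have "AE \<omega> in P (Some z). \<forall>n::nat. Limsup at_top (\<lambda>r. occ x r (ennreal (real (Suc n) * gg r)) (path 0 \<omega>) / ennreal (real (Suc n) * gg r))
        = ennreal (f (real (Suc n)))"
      unfolding AE_all_countable by (intro allI f_limsup) simp
    ultimately show ?thesis using AE_space
    proof eventually_elim
      case (elim \<omega>)
      then have w: "\<omega> \<in> \<Omega>" by simp
      let ?L = "Limsup at_top (\<lambda>r. occ x r \<infinity> (path 0 \<omega>) / ennreal (gg r))"
      show "?L = ennreal \<kappa>1"
      proof (rule antisym)
        have "(\<lambda>n. (\<kappa>1 + 2 * (1 / real (Suc n))) * (1 + 1 / real (Suc n))) \<longlonglongrightarrow> (\<kappa>1 + 2 * 0) * (1 + 0)"
          by (intro tendsto_intros LIMSEQ_Suc[OF lim_1_over_n])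
        then have "(\<lambda>n. ennreal ((\<kappa>1 + 2 * (1 / real (Suc n))) * (1 + 1 / real (Suc n)))) \<longlonglongrightarrow> ennreal \<kappa>1"
          by (intro tendsto_ennrealI) simp
        then show "?L \<le> ennreal \<kappa>1" using elim(1) by (intro LIMSEQ_le_const) auto
        have "filterlim (\<lambda>n. real (Suc n)) at_top sequentially"
          by (rule filterlim_compose[OF filterlim_real_sequentially filterlim_Suc])
        then have "(\<lambda>n. real (Suc n) * f (real (Suc n))) \<longlonglongrightarrow> \<kappa>1" by (rule filterlim_compose[OF lim])
        then have "(\<lambda>n. ennreal (real (Suc n) * f (real (Suc n)))) \<longlonglongrightarrow> ennreal \<kappa>1" by (rule tendsto_ennrealI)
        moreover have "ennreal (real (Suc n) * f (real (Suc n))) \<le> ?L" for n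
          using elim(2) by (intro Limsup_ge[OF _ w]) auto
        ultimately show "ennreal \<kappa>1 \<le> ?L" by (intro LIMSEQ_le_const2) auto
      qed
    qed
  qed
  with pos lim show ?thesis by blast
qed

end

theorem theorem2p9:
  fixes \<mu> :: "'a::{metric_space, second_countable_topology} measure"
    and x0 :: 'a
    and \<Omega> :: "'w set"
    and F :: "ennreal \<Rightarrow> 'w measure"
    and X :: "ennreal \<Rightarrow> 'w \<Rightarrow> 'a option"
    and P :: "'a option \<Rightarrow> 'w measure"
    and J :: "'a \<Rightarrow> 'a option measure"
    and \<Phi> f :: "real \<Rightarrow> real"
    and R \<upsilon> d1 C_U \<beta>2 :: real
  assumes locally_compact: "locally_compact_space (euclidean :: 'a topology)"
    and radon: "radon_measure \<mu>" and support: "full_support \<mu>"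
    and process: "borel_standard_process \<Omega> F X P"
    and levy: "levy_system X P J"
    and Phi_pos: "\<forall>r>0. \<Phi> r > 0"
    and Phi_increasing: "strict_mono_on {0<..} \<Phi>"
    and Phi_continuous: "continuous_on {0<..} \<Phi>"
    and R: "R \<ge> 1" and upsilon: "0 < \<upsilon>" "\<upsilon> < 1"
    and VRD: "VRD \<mu> x0 R \<upsilon> d1"
    and ULS: "ULS R \<Phi>"
    and Tail: "Tail_le J x0 R \<Phi> \<upsilon>"
    and NDL: "NDL X P \<mu> x0 R \<Phi> \<upsilon>"
    and NDU: "NDU X P \<mu> x0 R \<Phi> \<upsilon>"
    and C_U: "C_U \<ge> 1" and beta2: "\<beta>2 < d1"
    and Phi_upper: "\<forall>r s. r \<ge> s \<and> s > R \<longrightarrow> \<Phi> r / \<Phi> s \<le> C_U * (r / s) powr \<beta>2"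
    and f_range: "\<forall>\<kappa>>0. 0 < f \<kappa> \<and> f \<kappa> \<le> 1"
    and f_limsup: "\<forall>x. \<forall>\<kappa>>0. \<forall>z. AE \<omega> in P (Some z).
      Limsup at_top (\<lambda>r. occupation_time X (ball x r)
                            (ennreal (\<kappa> * phi \<Phi> r * ln (ln (phi \<Phi> r)))) \<omega>
                          / ennreal (\<kappa> * phi \<Phi> r * ln (ln (phi \<Phi> r))))
        = ennreal (f \<kappa>)"
  shows "\<exists>\<kappa>1>0. ((\<lambda>\<kappa>. \<kappa> * f \<kappa>) \<longlongrightarrow> \<kappa>1) at_top \<and>
    (\<forall>x z. AE \<omega> in P (Some z).
      Limsup at_top (\<lambda>r. occupation_time X (ball x r) \<infinity> \<omega>
                          / ennreal (phi \<Phi> r * ln (ln (phi \<Phi> r))))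
        = ennreal \<kappa>1)"
proof -
  from radon have mu: "sets \<mu> = sets borel" by (simp add: radon_measure_def)
  from VRD have d1: "0 < d1" by (simp add: VRD_def)
  from VRD obtain d2 cm Cm where vrd_const: "0 < d2" "0 < cm" "0 < Cm"
    and *: "\<forall>x r s. r \<ge> s \<and> s > R * dd x0 x powr \<upsilon> \<longrightarrow>
      cm * (r / s) powr d1 \<le> vol \<mu> x r / vol \<mu> x s \<and> vol \<mu> x r / vol \<mu> x s \<le> Cm * (r / s) powr d2"
    unfolding VRD_def by (elim conjE exE) (rule that)
  note vrd = *[THEN spec, THEN spec, THEN spec, THEN mp, OF conjI]
  from ULS obtain l where l: "1 < l" and uls: "\<And>s. R < s \<Longrightarrow> 2 * \<Phi> (s / l) \<le> \<Phi> s"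
    unfolding ULS_def by blast
  from NDL obtain \<eta> cl where eta: "\<eta> \<in> {0<..<1}" and cl: "0 < cl"
    and *: "\<forall>x r. r > R * dd x0 x powr \<upsilon> \<longrightarrow> (\<exists>p. is_heat_kernel X P \<mu> (ball x r) p \<and>
      (\<forall>y\<in>ball x (\<eta>\<^sup>2 * r). \<forall>z\<in>ball x (\<eta>\<^sup>2 * r). p (\<Phi> (\<eta> * r)) y z \<ge> ennreal (cl / vol \<mu> x r)))"
    unfolding NDL_def by (elim conjE exE bexE) (rule that)
  note ndl = *[THEN spec, THEN spec, THEN mp]
  from NDU obtain p cu where p: "is_heat_kernel X P \<mu> UNIV p" and cu: "0 < cu"
    and *: "\<forall>x y t. t \<ge> \<Phi> (R * (max (dd x0 x) (dd x0 y)) powr \<upsilon>) \<longrightarrow>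
      p t x y \<le> ennreal (cu / min (vol \<mu> x (inv_into {0<..} \<Phi> t)) (vol \<mu> y (inv_into {0<..} \<Phi> t)))"
    unfolding NDU_def by (elim conjE exE) (rule that)
  note ndu = *[THEN spec, THEN spec, THEN spec, THEN mp]
  \<comment> \<open>\<open>beta2\<close> says nothing about the sign of \<open>\<beta>2\<close>.
    Enlarging the exponent keeps the bound because \<open>r / s \<ge> 1\<close>, and makes it
    positive, so that \<open>d1 / \<beta>\<close> is a return exponent larger than
    \<open>1\<close>.\<close>
  define \<beta> where "\<beta> = max \<beta>2 (d1 / 2)"
  have beta: "0 < \<beta>" "\<beta> < d1" using d1 beta2 by (auto simp: \<beta>_def)
  have Phi_upper': "\<Phi> r / \<Phi> s \<le> C_U * (r / s) powr \<beta>" if "s \<le> r" "R < s" for r s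
  proof -
    have "\<Phi> r / \<Phi> s \<le> C_U * (r / s) powr \<beta>2" using Phi_upper that by simp
    also have "\<dots> \<le> C_U * (r / s) powr \<beta>"
      using C_U R that by (intro mult_left_mono powr_mono) (auto simp: \<beta>_def)
    finally show ?thesis .
  qed
  interpret borel_standard_process \<Omega> F X P by (rule process)
  interpret diffusive_process \<Omega> F X P \<mu> x0 \<Phi> R \<upsilon> d1 d2 cm Cm l C_U \<beta> \<eta> cl cu p
  proof unfold_locales
    show "0 < r \<Longrightarrow> 0 < \<Phi> r" for r using Phi_pos by simp
    show "0 < \<eta>" "\<eta> < 1" using eta by auto
  qed (fact mu Phi_increasing Phi_continuous R upsilon d1 vrd_const vrd l uls beta C_U Phi_upper' cl ndl cu p ndu)+
  have gg_eq: "phi \<Phi> r * ln (ln (phi \<Phi> r)) = gg r" for r by (simp add: gg_def ll_def)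
  have occ_eq: "AE \<omega> in P (Some z). \<forall>r. occupation_time X (ball x r) (T r) \<omega> = occ x r (T r) (path 0 \<omega>)" for x z T
    using AE_space by eventually_elim (simp add: occupation_time_eq)
  have "AE \<omega> in P (Some z). Limsup at_top (\<lambda>r. occ x r (ennreal (\<kappa> * gg r)) (path 0 \<omega>) / ennreal (\<kappa> * gg r)) = ennreal (f \<kappa>)"
    if "0 < \<kappa>" for x \<kappa> z
  proof -
    from f_limsup that have "AE \<omega> in P (Some z).
      Limsup at_top (\<lambda>r. occupation_time X (ball x r) (ennreal (\<kappa> * gg r)) \<omega> / ennreal (\<kappa> * gg r)) = ennreal (f \<kappa>)"
      by (simp only: mult.assoc gg_eq)
    with occ_eq[where x=x and z=z and T="\<lambda>r. ennreal (\<kappa> * gg r)"] show ?thesis by eventually_elim simp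
  qed
  from occupation_limsup_limit[OF _ this] f_range obtain \<kappa>1 where "0 < \<kappa>1"
    and "((\<lambda>\<kappa>. \<kappa> * f \<kappa>) \<longlongrightarrow> \<kappa>1) at_top"
    and ae: "\<And>x z. AE \<omega> in P (Some z). Limsup at_top (\<lambda>r. occ x r \<infinity> (path 0 \<omega>) / ennreal (gg r)) = ennreal \<kappa>1"
    by blast
  moreover have "AE \<omega> in P (Some z). Limsup at_top (\<lambda>r. occupation_time X (ball x r) \<infinity> \<omega> / ennreal (gg r)) = ennreal \<kappa>1" for x z
    using ae[of x z] occ_eq[where x=x and z=z and T="\<lambda>_. \<infinity>"] by eventually_elim simp
  ultimately show ?thesis unfolding gg_eq by blast
qed

end
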